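(* Let $G$ be a group of type $FP_\infty$. Let $\{V_n,\phi_n\}_{n=1}^{\infty}$ be a consistent sequence of finite dimensional rational representations of $S_n$ compatible with $G$-actions. If the sequence $\{V_n,\phi_n\}_{n=1}^{\infty}$ is monotone and uniformly representation stable with stable range $n\geq N$, then for any integer $p\geq 0$ the sequence $\{H^p(G;V_n),\phi_n^*\}_{n=1}^{\infty}$ is monotone and uniformly representation stable with the same stable range $n\geq N$.
   Context: A group $G$ is of type $FP_\infty$ if $\mathbb{Z}$ has a resolution over $\mathbb{Z}G$ by finitely generated projective (equivalently free) modules. A consistent sequence is a sequence of rational $S_n$-representations $V_n$ with linear maps $\phi_n\colon V_n\to V_{n+1}$ equivariant with respect to the standard inclusion $S_n\hookrightarrow S_{n+1}$. It is compatible with $G$-actions if each $V_n$ is a $G$-module (over $\mathbb{Q}$), the maps $\phi_n$ are $G$-maps, and the $G$-action on $V_n$ commutes with the $S_n$-action. Then $H^p(G;V_n)$ is an $S_n$-representation via the action of $S_n$ on coefficients, and $\phi_n^*\colon H^p(G;V_n)\to H^p(G;V_{n+1})$ is the map induced by the coefficient map $\phi_n$. For a partition $\lambda=(\lambda_1\geq\cdots\geq\lambda_l)$ of $k\geq 0$ and $n\geq k+\lambda_1$, $V(\lambda)_n$ denotes the irreducible rational $S_n$-representation corresponding to the partition $(n-k,\lambda_1,\ldots,\lambda_l)$ of $n$ (and $V(\lambda)_n=0$, with multiplicity $0$, if $n<k+\lambda_1$). A consistent sequence of finite dimensional representations is uniformly representation stable with stable range $n\geq N$ if for all $n\geq N$: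 (I) $\phi_n$ is injective; (II) the $S_{n+1}$-span of $\phi_n(V_n)$ equals $V_{n+1}$; (III) for each partition $\lambda$, the multiplicity of $V(\lambda)_n$ in $V_n$ is constant for all $n\geq N$. A consistent sequence with $\phi_n$ injective for $n\ge N$ is monotone for $n\geq N$ if for each $n\geq N$ and each subrepresentation $W<V_n$ isomorphic to $V(\lambda)_n^{\oplus k}$, the $S_{n+1}$-span of $\phi_n(W)$ contains $V(\lambda)_{n+1}^{\oplus k}$ as a subrepresentation. "Monotone and uniformly representation stable with stable range $n\geq N$" means both properties hold with the same $N$. *)

theory Defs
  imports
    "HOL-Algebra.Sym_Groups"
    "HOL-Algebra.Algebraic_Closure_Type"
    "Jordan_Normal_Form.Missing_VectorSpace"
begin

section \<open>Left modules over a possibly noncommutative ring\<close>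

text \<open>The library locale \<^locale>\<open>Module.module\<close> requires a commutative ring; the axioms below
  are the same without commutativity.  Only the additive part and the scalar multiplication of the
  record type are meaningful for a module; the fields \<open>mult\<close> and \<open>one\<close> are junk.\<close>

locale left_module = R?: ring R + M?: abelian_group M
  for R :: "('a, 'c) ring_scheme" (structure) and M :: "('a, 'b, 'd) module_scheme" (structure) +
  assumes smult_closed:
      "\<lbrakk>a \<in> carrier R; x \<in> carrier M\<rbrakk> \<Longrightarrow> a \<odot>\<^bsub>M\<^esub> x \<in> carrier M"
    and smult_l_distr:
      "\<lbrakk>a \<in> carrier R; b \<in> carrier R; x \<in> carrier M\<rbrakk> \<Longrightarrow>
        (a \<oplus>\<^bsub>R\<^esub> b) \<odot>\<^bsub>M\<^esub> x = a \<odot>\<^bsub>M\<^esub> x \<oplus>\<^bsub>M\<^esub> b \<odot>\<^bsub>M\<^esub> x"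
    and smult_r_distr:
      "\<lbrakk>a \<in> carrier R; x \<in> carrier M; y \<in> carrier M\<rbrakk> \<Longrightarrow>
        a \<odot>\<^bsub>M\<^esub> (x \<oplus>\<^bsub>M\<^esub> y) = a \<odot>\<^bsub>M\<^esub> x \<oplus>\<^bsub>M\<^esub> a \<odot>\<^bsub>M\<^esub> y"
    and smult_assoc:
      "\<lbrakk>a \<in> carrier R; b \<in> carrier R; x \<in> carrier M\<rbrakk> \<Longrightarrow>
        (a \<otimes>\<^bsub>R\<^esub> b) \<odot>\<^bsub>M\<^esub> x = a \<odot>\<^bsub>M\<^esub> (b \<odot>\<^bsub>M\<^esub> x)"
    and smult_one: "x \<in> carrier M \<Longrightarrow> \<one>\<^bsub>R\<^esub> \<odot>\<^bsub>M\<^esub> x = x"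

definition regular_module :: "('a, 'c) ring_scheme \<Rightarrow> ('a, 'a) module" where
  "regular_module R = \<lparr>carrier = carrier R, mult = mult R, one = one R,
     zero = zero R, add = add R, module.smult = mult R\<rparr>"

text \<open>The external direct sum of \<open>k\<close> copies of \<open>M\<close>.\<close>

definition module_power :: "('a, 'b, 'd) module_scheme \<Rightarrow> nat \<Rightarrow> ('a, nat \<Rightarrow> 'b) module" where
  "module_power M k = \<lparr>carrier = {..<k} \<rightarrow>\<^sub>E carrier M, mult = undefined, one = undefined,
     zero = (\<lambda>i\<in>{..<k}. \<zero>\<^bsub>M\<^esub>),
     add = (\<lambda>u v. \<lambda>i\<in>{..<k}. u i \<oplus>\<^bsub>M\<^esub> v i),
     module.smult = (\<lambda>a v. \<lambda>i\<in>{..<k}. a \<odot>\<^bsub>M\<^esub> v i)\<rparr>"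

text \<open>A finitely generated projective module is a direct summand of a free module of finite rank:
  \<open>j\<close> is the inclusion and \<open>q\<close> the projection.\<close>

definition fg_projective :: "('a, 'c) ring_scheme \<Rightarrow> ('a, 'b, 'd) module_scheme \<Rightarrow> bool" where
  "fg_projective R P \<longleftrightarrow> left_module R P \<and>
     (\<exists>k. \<exists>j \<in> LinearCombinations.module_hom R P (module_power (regular_module R) k).
          \<exists>q \<in> LinearCombinations.module_hom R (module_power (regular_module R) k) P.
          \<forall>x\<in>carrier P. q (j x) = x)"


section \<open>Group rings and groups of type $FP_\infty$\<close>

definition group_ring :: "('g, 'm) monoid_scheme \<Rightarrow> ('g \<Rightarrow> 'k::comm_ring_1) ring" where
  "group_ring G = \<lparr>
     carrier = {a. finite {g. a g \<noteq> 0} \<and> {g. a g \<noteq> 0} \<subseteq> carrier G},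
     mult = (\<lambda>a b x. \<Sum>(g, h) \<in> {(g, h). a g \<noteq> 0 \<and> b h \<noteq> 0 \<and> g \<otimes>\<^bsub>G\<^esub> h = x}. a g * b h),
     one = (\<lambda>x. if x = \<one>\<^bsub>G\<^esub> then 1 else 0),
     zero = (\<lambda>x. 0),
     add = (\<lambda>a b x. a x + b x)\<rparr>"

text \<open>The trivial module \<open>\<int>\<close>: the group ring acts through the augmentation.\<close>

definition trivial_module :: "('g \<Rightarrow> int, int) module" where
  "trivial_module = \<lparr>carrier = UNIV, mult = (*), one = 1, zero = 0, add = (+),
     module.smult = (\<lambda>a z. (\<Sum>g | a g \<noteq> 0. a g) * z)\<rparr>"

text \<open>\<open>\<dots> \<rightarrow> P\<^sub>1 \<rightarrow> P\<^sub>0 \<rightarrow> \<int> \<rightarrow> 0\<close> is exact, with \<open>d i : P\<^sub>i\<^sub>+\<^sub>1 \<rightarrow> P\<^sub>i\<close>.  The carrier type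
  \<open>nat \<Rightarrow> 'g \<Rightarrow> int\<close> is no restriction: it contains the free modules of finite rank, hence
  an isomorphic copy of every finitely generated projective module.\<close>

definition type_FP_infinity :: "('g, 'm) monoid_scheme \<Rightarrow> bool" where
  "type_FP_infinity G \<longleftrightarrow>
     (\<exists>(P :: nat \<Rightarrow> ('g \<Rightarrow> int, nat \<Rightarrow> 'g \<Rightarrow> int) module) d \<epsilon>.
        (\<forall>i. fg_projective (group_ring G) (P i)) \<and>
        (\<forall>i. d i \<in> LinearCombinations.module_hom (group_ring G) (P (Suc i)) (P i)) \<and>
        \<epsilon> \<in> LinearCombinations.module_hom (group_ring G) (P 0) trivial_module \<and>
        \<epsilon> ` carrier (P 0) = UNIV \<and>
        {x \<in> carrier (P 0). \<epsilon> x = 0} = d 0 ` carrier (P 1) \<and>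
        (\<forall>i. {x \<in> carrier (P (Suc i)). d i x = \<zero>\<^bsub>P i\<^esub>} = d (Suc i) ` carrier (P (Suc (Suc i)))))"


section \<open>Rational representations\<close>

abbreviation rat_field :: "rat ring" where
  "rat_field \<equiv> ring_of_type_algebra"

definition finite_dim :: "(rat, 'v) module \<Rightarrow> bool" where
  "finite_dim V \<longleftrightarrow> vectorspace rat_field V \<and> vectorspace.fin_dim rat_field V"

definition rat_rep ::
  "('h, 'm) monoid_scheme \<Rightarrow> (rat, 'v) module \<Rightarrow> ('h \<Rightarrow> 'v \<Rightarrow> 'v) \<Rightarrow> bool" where
  "rat_rep H V \<rho> \<longleftrightarrow> group H \<and> vectorspace rat_field V \<and>
     (\<forall>h\<in>carrier H. \<rho> h \<in> LinearCombinations.module_hom rat_field V V) \<and>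
     (\<forall>v\<in>carrier V. \<rho> \<one>\<^bsub>H\<^esub> v = v) \<and>
     (\<forall>g\<in>carrier H. \<forall>h\<in>carrier H. \<forall>v\<in>carrier V. \<rho> (g \<otimes>\<^bsub>H\<^esub> h) v = \<rho> g (\<rho> h v))"

definition subrep ::
  "('h, 'm) monoid_scheme \<Rightarrow> (rat, 'v) module \<Rightarrow> ('h \<Rightarrow> 'v \<Rightarrow> 'v) \<Rightarrow> 'v set \<Rightarrow> bool" where
  "subrep H V \<rho> W \<longleftrightarrow> subspace rat_field W V \<and> (\<forall>h\<in>carrier H. \<forall>w\<in>W. \<rho> h w \<in> W)"

definition rep_span ::
  "('h, 'm) monoid_scheme \<Rightarrow> (rat, 'v) module \<Rightarrow> ('h \<Rightarrow> 'v \<Rightarrow> 'v) \<Rightarrow> 'v set \<Rightarrow> 'v set" where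
  "rep_span H V \<rho> A = \<Inter>{W. subrep H V \<rho> W \<and> A \<subseteq> W}"

definition rep_iso ::
  "('h, 'm) monoid_scheme \<Rightarrow> (rat, 'v) module \<Rightarrow> ('h \<Rightarrow> 'v \<Rightarrow> 'v) \<Rightarrow>
     (rat, 'w) module \<Rightarrow> ('h \<Rightarrow> 'w \<Rightarrow> 'w) \<Rightarrow> bool" where
  "rep_iso H V \<rho> W \<sigma> \<longleftrightarrow>
     (\<exists>f \<in> LinearCombinations.module_hom rat_field V W. bij_betw f (carrier V) (carrier W) \<and>
        (\<forall>h\<in>carrier H. \<forall>v\<in>carrier V. f (\<rho> h v) = \<sigma> h (f v)))"

definition irreducible_subrep ::
  "('h, 'm) monoid_scheme \<Rightarrow> (rat, 'v) module \<Rightarrow> ('h \<Rightarrow> 'v \<Rightarrow> 'v) \<Rightarrow> 'v set \<Rightarrow> bool" where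
  "irreducible_subrep H V \<rho> W \<longleftrightarrow> subrep H V \<rho> W \<and> W \<noteq> {\<zero>\<^bsub>V\<^esub>} \<and>
     (\<forall>U. subrep H V \<rho> U \<and> U \<subseteq> W \<longrightarrow> U = {\<zero>\<^bsub>V\<^esub>} \<or> U = W)"

text \<open>The action on \<open>module_power V k\<close>.\<close>

definition power_action :: "nat \<Rightarrow> ('h \<Rightarrow> 'v \<Rightarrow> 'v) \<Rightarrow> 'h \<Rightarrow> (nat \<Rightarrow> 'v) \<Rightarrow> (nat \<Rightarrow> 'v)" where
  "power_action k \<rho> h v = (\<lambda>i\<in>{..<k}. \<rho> h (v i))"

text \<open>\<open>V = W\<^sub>0 \<oplus> \<dots> \<oplus> W\<^sub>r\<^sub>-\<^sub>1\<close> as an internal direct sum of irreducible subrepresentations.\<close>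

definition irreducible_decomposition ::
  "('h, 'm) monoid_scheme \<Rightarrow> (rat, 'v) module \<Rightarrow> ('h \<Rightarrow> 'v \<Rightarrow> 'v) \<Rightarrow>
     nat \<Rightarrow> (nat \<Rightarrow> 'v set) \<Rightarrow> bool" where
  "irreducible_decomposition H V \<rho> r W \<longleftrightarrow>
     (\<forall>i<r. irreducible_subrep H V \<rho> (W i)) \<and>
     (\<forall>v\<in>carrier V. \<exists>!w. w \<in> (\<Pi>\<^sub>E i\<in>{..<r}. W i) \<and> v = (\<Oplus>\<^bsub>V\<^esub>i\<in>{..<r}. w i))"

text \<open>The multiplicity of the irreducible representation \<open>(L, \<sigma>)\<close> in the finite dimensional
  representation \<open>(V, \<rho>)\<close> of a finite group; it does not depend on the decomposition.\<close>

definition multiplicity_in ::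
  "('h, 'm) monoid_scheme \<Rightarrow> (rat, 'w) module \<Rightarrow> ('h \<Rightarrow> 'w \<Rightarrow> 'w) \<Rightarrow>
     (rat, 'v) module \<Rightarrow> ('h \<Rightarrow> 'v \<Rightarrow> 'v) \<Rightarrow> nat" where
  "multiplicity_in H L \<sigma> V \<rho> =
     (THE m. \<exists>r W. irreducible_decomposition H V \<rho> r W \<and>
        m = card {i. i < r \<and> rep_iso H (V\<lparr>carrier := W i\<rparr>) \<rho> L \<sigma>})"


section \<open>Irreducible representations of the symmetric groups\<close>

definition is_partition :: "nat list \<Rightarrow> bool" where
  "is_partition \<mu> \<longleftrightarrow> sorted_wrt (\<ge>) \<mu> \<and> (\<forall>m\<in>set \<mu>. m > 0)"

text \<open>The standard tableau of shape \<open>\<mu>\<close>, with the entries \<open>1, 2, \<dots>\<close> written row by row: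
  the row (counted from \<open>0\<close>) and the column (counted from \<open>1\<close>) of the entry \<open>i\<close>.\<close>

definition tableau_row :: "nat list \<Rightarrow> nat \<Rightarrow> nat" where
  "tableau_row \<mu> i = (LEAST r. i \<le> sum_list (take (Suc r) \<mu>))"

definition tableau_col :: "nat list \<Rightarrow> nat \<Rightarrow> nat" where
  "tableau_col \<mu> i = i - sum_list (take (tableau_row \<mu> i) \<mu>)"

definition row_stabilizer :: "nat list \<Rightarrow> (nat \<Rightarrow> nat) set" where
  "row_stabilizer \<mu> = {p \<in> carrier (sym_group (sum_list \<mu>)).
     \<forall>i\<in>{1..sum_list \<mu>}. tableau_row \<mu> (p i) = tableau_row \<mu> i}"

definition col_stabilizer :: "nat list \<Rightarrow> (nat \<Rightarrow> nat) set" where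
  "col_stabilizer \<mu> = {p \<in> carrier (sym_group (sum_list \<mu>)).
     \<forall>i\<in>{1..sum_list \<mu>}. tableau_col \<mu> (p i) = tableau_col \<mu> i}"

text \<open>The Young symmetrizer: the row symmetrizer times the signed column antisymmetrizer.\<close>

definition young_symmetrizer :: "nat list \<Rightarrow> (nat \<Rightarrow> nat) \<Rightarrow> rat" where
  "young_symmetrizer \<mu> =
     (\<lambda>p. if p \<in> row_stabilizer \<mu> then 1 else 0)
     \<otimes>\<^bsub>group_ring (sym_group (sum_list \<mu>))\<^esub>
     (\<lambda>p. if p \<in> col_stabilizer \<mu> then of_int (sign p) else 0)"

text \<open>The irreducible representation of \<open>S\<^sub>n\<close> corresponding to the partition \<open>\<mu>\<close> of \<open>n\<close>: the left
  ideal of \<open>\<rat>[S\<^sub>n]\<close> generated by the Young symmetrizer, on which \<open>S\<^sub>n\<close> acts by left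
  multiplication.  In this convention the partition \<open>(n)\<close> gives the trivial representation.\<close>

definition specht_module :: "nat list \<Rightarrow> (rat, (nat \<Rightarrow> nat) \<Rightarrow> rat) module" where
  "specht_module \<mu> = (let A = group_ring (sym_group (sum_list \<mu>)) in
     \<lparr>carrier = (\<lambda>a. a \<otimes>\<^bsub>A\<^esub> young_symmetrizer \<mu>) ` carrier A, mult = mult A, one = one A,
      zero = zero A, add = add A, module.smult = (\<lambda>c a p. c * a p)\<rparr>)"

definition specht_action ::
  "nat list \<Rightarrow> (nat \<Rightarrow> nat) \<Rightarrow> ((nat \<Rightarrow> nat) \<Rightarrow> rat) \<Rightarrow> ((nat \<Rightarrow> nat) \<Rightarrow> rat)" where
  "specht_action \<mu> s a =
     (\<lambda>p. if p = s then 1 else 0) \<otimes>\<^bsub>group_ring (sym_group (sum_list \<mu>))\<^esub> a"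

text \<open>For a partition \<open>\<lambda>\<close> of \<open>k\<close>, the partition \<open>(n - k, \<lambda>\<^sub>1, \<dots>, \<lambda>\<^sub>l)\<close> of \<open>n\<close>, which exists for
  \<open>n \<ge> k + \<lambda>\<^sub>1\<close> (where \<open>\<lambda>\<^sub>1 = 0\<close> for the empty partition).\<close>

definition padded :: "nat list \<Rightarrow> nat \<Rightarrow> nat list" where
  "padded \<mu> n = (n - sum_list \<mu>) # \<mu>"

definition padding_exists :: "nat list \<Rightarrow> nat \<Rightarrow> bool" where
  "padding_exists \<mu> n \<longleftrightarrow> n \<ge> sum_list \<mu> + (if \<mu> = [] then 0 else hd \<mu>)"

definition padded_multiplicity ::
  "nat list \<Rightarrow> nat \<Rightarrow> (rat, 'v) module \<Rightarrow> ((nat \<Rightarrow> nat) \<Rightarrow> 'v \<Rightarrow> 'v) \<Rightarrow> nat" where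
  "padded_multiplicity \<mu> n V \<rho> =
     (if padding_exists \<mu> n
      then multiplicity_in (sym_group n) (specht_module (padded \<mu> n)) (specht_action (padded \<mu> n)) V \<rho>
      else 0)"


section \<open>Representation stability\<close>

text \<open>A sequence is indexed by \<open>n \<ge> 1\<close>; its values at \<open>n = 0\<close> are irrelevant.  The standard inclusion
  \<open>S\<^sub>n \<subseteq> S\<^sub>n\<^sub>+\<^sub>1\<close> is an inclusion of sets of permutations of \<^typ>\<open>nat\<close>.\<close>

definition consistent_sequence ::
  "(nat \<Rightarrow> (rat, 'v) module) \<Rightarrow> (nat \<Rightarrow> (nat \<Rightarrow> nat) \<Rightarrow> 'v \<Rightarrow> 'v) \<Rightarrow> (nat \<Rightarrow> 'v \<Rightarrow> 'v) \<Rightarrow> bool" where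
  "consistent_sequence V \<rho> \<phi> \<longleftrightarrow>
     (\<forall>n\<ge>1. rat_rep (sym_group n) (V n) (\<rho> n) \<and>
        \<phi> n \<in> LinearCombinations.module_hom rat_field (V n) (V (Suc n)) \<and>
        (\<forall>s\<in>carrier (sym_group n). \<forall>v\<in>carrier (V n). \<phi> n (\<rho> n s v) = \<rho> (Suc n) s (\<phi> n v)))"

definition compatible_action ::
  "('g, 'm) monoid_scheme \<Rightarrow> (nat \<Rightarrow> (rat, 'v) module) \<Rightarrow> (nat \<Rightarrow> (nat \<Rightarrow> nat) \<Rightarrow> 'v \<Rightarrow> 'v) \<Rightarrow>
     (nat \<Rightarrow> 'v \<Rightarrow> 'v) \<Rightarrow> (nat \<Rightarrow> 'g \<Rightarrow> 'v \<Rightarrow> 'v) \<Rightarrow> bool" where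
  "compatible_action G V \<rho> \<phi> \<gamma> \<longleftrightarrow>
     (\<forall>n\<ge>1. rat_rep G (V n) (\<gamma> n) \<and>
        (\<forall>g\<in>carrier G. \<forall>v\<in>carrier (V n). \<phi> n (\<gamma> n g v) = \<gamma> (Suc n) g (\<phi> n v)) \<and>
        (\<forall>g\<in>carrier G. \<forall>s\<in>carrier (sym_group n). \<forall>v\<in>carrier (V n).
           \<gamma> n g (\<rho> n s v) = \<rho> n s (\<gamma> n g v)))"

definition uniformly_stable ::
  "nat \<Rightarrow> (nat \<Rightarrow> (rat, 'v) module) \<Rightarrow> (nat \<Rightarrow> (nat \<Rightarrow> nat) \<Rightarrow> 'v \<Rightarrow> 'v) \<Rightarrow>
     (nat \<Rightarrow> 'v \<Rightarrow> 'v) \<Rightarrow> bool" where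
  "uniformly_stable N V \<rho> \<phi> \<longleftrightarrow>
     consistent_sequence V \<rho> \<phi> \<and> (\<forall>n\<ge>1. finite_dim (V n)) \<and>
     (\<forall>n\<ge>max 1 N.
        inj_on (\<phi> n) (carrier (V n)) \<and>
        rep_span (sym_group (Suc n)) (V (Suc n)) (\<rho> (Suc n)) (\<phi> n ` carrier (V n))
          = carrier (V (Suc n))) \<and>
     (\<forall>\<mu>. is_partition \<mu> \<longrightarrow>
        (\<forall>m\<ge>max 1 N. \<forall>n\<ge>max 1 N.
           padded_multiplicity \<mu> m (V m) (\<rho> m) = padded_multiplicity \<mu> n (V n) (\<rho> n)))"

definition monotone_sequence ::
  "nat \<Rightarrow> (nat \<Rightarrow> (rat, 'v) module) \<Rightarrow> (nat \<Rightarrow> (nat \<Rightarrow> nat) \<Rightarrow> 'v \<Rightarrow> 'v) \<Rightarrow>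
     (nat \<Rightarrow> 'v \<Rightarrow> 'v) \<Rightarrow> bool" where
  "monotone_sequence N V \<rho> \<phi> \<longleftrightarrow>
     consistent_sequence V \<rho> \<phi> \<and>
     (\<forall>n\<ge>max 1 N. inj_on (\<phi> n) (carrier (V n)) \<and>
        (\<forall>\<mu> k W. is_partition \<mu> \<and> padding_exists \<mu> n \<and> subrep (sym_group n) (V n) (\<rho> n) W \<and>
           rep_iso (sym_group n) ((V n)\<lparr>carrier := W\<rparr>) (\<rho> n)
             (module_power (specht_module (padded \<mu> n)) k)
             (power_action k (specht_action (padded \<mu> n))) \<longrightarrow>
           (\<exists>U. subrep (sym_group (Suc n)) (V (Suc n)) (\<rho> (Suc n)) U \<and>
              U \<subseteq> rep_span (sym_group (Suc n)) (V (Suc n)) (\<rho> (Suc n)) (\<phi> n ` W) \<and>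
              rep_iso (sym_group (Suc n)) ((V (Suc n))\<lparr>carrier := U\<rparr>) (\<rho> (Suc n))
                (module_power (specht_module (padded \<mu> (Suc n))) k)
                (power_action k (specht_action (padded \<mu> (Suc n)))))))"


section \<open>Group cohomology\<close>

text \<open>The cohomology of \<open>Hom\<^sub>G(F, V)\<close> for the standard resolution \<open>F\<close>: the module \<open>F\<^sub>p\<close> is free
  abelian on the \<open>(p+1)\<close>-tuples of elements of \<open>G\<close>, with \<open>G\<close> acting diagonally by left
  multiplication, so a cochain is an equivariant function on tuples (represented as lists).\<close>

definition tuples :: "('g, 'm) monoid_scheme \<Rightarrow> nat \<Rightarrow> 'g list set" where
  "tuples G p = {gs. set gs \<subseteq> carrier G \<and> length gs = Suc p}"

definition cochains ::
  "('g, 'm) monoid_scheme \<Rightarrow> (rat, 'v) module \<Rightarrow> ('g \<Rightarrow> 'v \<Rightarrow> 'v) \<Rightarrow> nat \<Rightarrow>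
     (rat, 'g list \<Rightarrow> 'v) module" where
  "cochains G V \<gamma> p = \<lparr>
     carrier = {f \<in> tuples G p \<rightarrow>\<^sub>E carrier V.
       \<forall>g\<in>carrier G. \<forall>gs\<in>tuples G p. f (map (\<lambda>x. g \<otimes>\<^bsub>G\<^esub> x) gs) = \<gamma> g (f gs)},
     mult = undefined, one = undefined,
     zero = (\<lambda>gs\<in>tuples G p. \<zero>\<^bsub>V\<^esub>),
     add = (\<lambda>f f'. \<lambda>gs\<in>tuples G p. f gs \<oplus>\<^bsub>V\<^esub> f' gs),
     module.smult = (\<lambda>c f. \<lambda>gs\<in>tuples G p. c \<odot>\<^bsub>V\<^esub> f gs)\<rparr>"

text \<open>\<open>(\<delta> f)(g\<^sub>0, \<dots>, g\<^sub>p\<^sub>+\<^sub>1) = \<Sum>\<^sub>i (-1)\<^sup>i f(g\<^sub>0, \<dots>, \<bar>g\<^sub>i\<bar>, \<dots>, g\<^sub>p\<^sub>+\<^sub>1)\<close>, where the entry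
  between bars is omitted.\<close>

definition coboundary ::
  "('g, 'm) monoid_scheme \<Rightarrow> (rat, 'v) module \<Rightarrow> nat \<Rightarrow> ('g list \<Rightarrow> 'v) \<Rightarrow> ('g list \<Rightarrow> 'v)" where
  "coboundary G V p f = (\<lambda>gs\<in>tuples G (Suc p).
     \<Oplus>\<^bsub>V\<^esub>i\<in>{..Suc p}. (let v = f (take i gs @ drop (Suc i) gs) in if even i then v else \<ominus>\<^bsub>V\<^esub> v))"

definition cocycles ::
  "('g, 'm) monoid_scheme \<Rightarrow> (rat, 'v) module \<Rightarrow> ('g \<Rightarrow> 'v \<Rightarrow> 'v) \<Rightarrow> nat \<Rightarrow> ('g list \<Rightarrow> 'v) set" where
  "cocycles G V \<gamma> p =
     {f \<in> carrier (cochains G V \<gamma> p). coboundary G V p f = \<zero>\<^bsub>cochains G V \<gamma> (Suc p)\<^esub>}"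

fun coboundaries ::
  "('g, 'm) monoid_scheme \<Rightarrow> (rat, 'v) module \<Rightarrow> ('g \<Rightarrow> 'v \<Rightarrow> 'v) \<Rightarrow> nat \<Rightarrow> ('g list \<Rightarrow> 'v) set" where
  "coboundaries G V \<gamma> 0 = {\<zero>\<^bsub>cochains G V \<gamma> 0\<^esub>}"
| "coboundaries G V \<gamma> (Suc p) = coboundary G V p ` carrier (cochains G V \<gamma> p)"

text \<open>\<open>H\<^sup>p(G; V)\<close>, whose elements are the cosets of the coboundaries in the cocycles.\<close>

definition cohomology ::
  "('g, 'm) monoid_scheme \<Rightarrow> (rat, 'v) module \<Rightarrow> ('g \<Rightarrow> 'v \<Rightarrow> 'v) \<Rightarrow> nat \<Rightarrow>
     (rat, ('g list \<Rightarrow> 'v) set) module" where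
  "cohomology G V \<gamma> p = (let C = cochains G V \<gamma> p; B = coboundaries G V \<gamma> p in
     \<lparr>carrier = (\<lambda>f. B +>\<^bsub>C\<^esub> f) ` cocycles G V \<gamma> p, mult = undefined, one = undefined,
      zero = B,
      add = (\<lambda>c d. c <+>\<^bsub>C\<^esub> d),
      module.smult = (\<lambda>a c. \<Union>f\<in>c. B +>\<^bsub>C\<^esub> (a \<odot>\<^bsub>C\<^esub> f))\<rparr>)"

text \<open>The map \<open>H\<^sup>p(G; V) \<rightarrow> H\<^sup>p(G; W)\<close> induced by a coefficient map \<open>\<eta> : V \<rightarrow> W\<close>, sending the class
  of \<open>f\<close> to the class of \<open>\<eta> \<circ> f\<close>; the action on the target \<open>W\<close> is \<open>\<gamma>\<close>.\<close>

definition cohomology_map ::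
  "('g, 'm) monoid_scheme \<Rightarrow> (rat, 'w) module \<Rightarrow> ('g \<Rightarrow> 'w \<Rightarrow> 'w) \<Rightarrow> nat \<Rightarrow> ('v \<Rightarrow> 'w) \<Rightarrow>
     ('g list \<Rightarrow> 'v) set \<Rightarrow> ('g list \<Rightarrow> 'w) set" where
  "cohomology_map G W \<gamma> p \<eta> c =
     (\<Union>f\<in>c. coboundaries G W \<gamma> p +>\<^bsub>cochains G W \<gamma> p\<^esub> (\<lambda>gs\<in>tuples G p. \<eta> (f gs)))"

end

theory Submission
  imports Defs "HOL-Library.Function_Algebras" "HOL-Library.Poly_Mapping"
begin

text \<open>Let \<open>c\<^sub>n\<close> be the Young symmetrizer of \<open>\<lambda>[n]\<close>.  The space \<open>c\<^sub>n V\<^sub>n\<close> has the multiplicity of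
  \<open>V(\<lambda>)\<^sub>n\<close> as its dimension, and \<open>c\<^sub>n\<^sub>+\<^sub>1 \<rat>[S\<^sub>n\<^sub>+\<^sub>1] c\<^sub>n\<close> is, up to scalars, reached by a single element
  \<open>\<theta>\<close>.  Hence monotone uniform stability says exactly that \<open>v \<mapsto> \<theta> \<phi>\<^sub>n v\<close> is a bijection from
  \<open>c\<^sub>n V\<^sub>n\<close> onto \<open>c\<^sub>n\<^sub>+\<^sub>1 V\<^sub>n\<^sub>+\<^sub>1\<close>, and that \<open>V(\<lambda>)\<^sub>n\<^sub>+\<^sub>1\<close> does not occur in
  \<open>V\<^sub>n\<^sub>+\<^sub>1\<close> if \<open>\<lambda>[n]\<close> does not exist.  The bijection and its inverse are restrictions of \<open>G\<close>-maps, so they persist on cohomology, where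
  \<open>\<rat>[S\<^sub>n]\<close> acts through the coefficients.  Finite dimensionality of the cohomology follows by
  comparing the standard resolution with one by finitely generated projective modules.\<close>

section \<open>Permutation actions, tableaux and Young symmetrizers\<close>

text \<open>The direction from the bijections back to stability needs every nonzero rational
  representation of a symmetric group to be moved by some Young symmetrizer: the kernel of
  \<open>\<phi> n\<close>, and a complement of the span of its image, are accessible only through
  such operators. Characters and splitting fields are avoided by positivity. Representations carry
  invariant positive definite forms for which row and column symmetrizers are self-adjoint, and a
  largest set of letters fixing a nonzero vector supplies the first row of a suitable tableau.
  Positivity also shows that a Young symmetrizer has nonzero square, without computing the scalar.
  The element \<open>theta\<close> exists because row symmetrizer times anything times column
  symmetrizer is a multiple of the Young symmetrizer, and the column symmetrizer survives the
  passage from \<open>n\<close> to \<open>n + 1\<close> up to relabelling. Cohomology has no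
  coordinates before it is known to be finite dimensional, so the bijections are transported on
  cocycles; type FP enters through finitely many generators in each degree, whose values determine a
  cocycle up to a coboundary.\<close>

definition scl :: "rat \<Rightarrow> ('i \<Rightarrow> rat) \<Rightarrow> 'i \<Rightarrow> rat" (infixr "*q" 75) where
  "c *q f = (\<lambda>x. c * f x)"

lemma scl_apply [simp]: "(c *q f) x = c * f x"
  by (simp add: scl_def)

text \<open>Functions into the rationals form a type on which spans, bases and dimensions are
  available; abstract representations are carried over to it by coordinates. The index type stays
  arbitrary because coordinate vectors and group algebra elements both have to fit.\<close>

global_interpretation fv: vector_space scl
  by unfold_locales (auto simp: scl_def fun_eq_iff algebra_simps)

abbreviation lin :: "(('i \<Rightarrow> rat) \<Rightarrow> 'j \<Rightarrow> rat) \<Rightarrow> bool" where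
  "lin \<equiv> Vector_Spaces.linear scl scl"

lemma linI:
  assumes "\<And>x y. f (x + y) = f x + f y" "\<And>c x. f (c *q x) = c *q f x"
  shows "lin f"
  unfolding Vector_Spaces.linear_iff
  using assms by (auto intro: fv.vector_space_axioms)

lemma lin_add: "lin f \<Longrightarrow> f (x + y) = f x + f y"
  by (simp add: Vector_Spaces.linear_iff)

lemma lin_scl: "lin f \<Longrightarrow> f (c *q x) = c *q f x"
  by (simp add: Vector_Spaces.linear_iff)

lemma lin_zero: "lin f \<Longrightarrow> f 0 = 0"
  using lin_scl[of f 0 0] by simp

lemma lin_sum: "lin f \<Longrightarrow> f (\<Sum>i\<in>I. g i) = (\<Sum>i\<in>I. f (g i))"
  by (induction I rule: infinite_finite_induct) (simp_all add: lin_zero[of f] lin_add[of f])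

lemma lin_diff: "lin f \<Longrightarrow> f (x - y) = f x - f y"
  using lin_add[of f "x - y" y] by simp

lemma lin_neg: "lin f \<Longrightarrow> f (- x) = - f x"
  using lin_diff[of f 0 x] lin_zero[of f] by simp

lemma sum_fun_apply: "(\<Sum>i\<in>I. f i) x = (\<Sum>i\<in>I. f i x)"
  by (induction I rule: infinite_finite_induct) auto

section \<open>Group algebras of permutations and their actions\<close>

abbreviation perms :: "nat set \<Rightarrow> (nat \<Rightarrow> nat) set" where
  "perms T \<equiv> {p. p permutes T}"

text \<open>No unit law is imposed: for a representation transported by coordinates the identity
  acts as a projection onto the coordinate vectors, so \<open>\<rho> id x = x\<close> can be
  expected only on a subspace (assumption \<open>unit\<close> of \<open>inner_rep\<close>).\<close>

locale perm_rep =
  fixes T :: "nat set" and \<rho> :: "(nat \<Rightarrow> nat) \<Rightarrow> ('i \<Rightarrow> rat) \<Rightarrow> ('i \<Rightarrow> rat)"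
  assumes fin: "finite T"
    and lin: "p \<in> perms T \<Longrightarrow> lin (\<rho> p)"
    and mult: "p \<in> perms T \<Longrightarrow> q \<in> perms T \<Longrightarrow> \<rho> (p \<circ> q) x = \<rho> p (\<rho> q x)"

definition act :: "nat set \<Rightarrow> ((nat \<Rightarrow> nat) \<Rightarrow> ('i \<Rightarrow> rat) \<Rightarrow> ('i \<Rightarrow> rat)) \<Rightarrow>
    ((nat \<Rightarrow> nat) \<Rightarrow> rat) \<Rightarrow> ('i \<Rightarrow> rat) \<Rightarrow> ('i \<Rightarrow> rat)" where
  "act T \<rho> a x = (\<Sum>p\<in>perms T. a p *q \<rho> p x)"

text \<open>Left translation in the group algebra: \<open>delta q\<close> goes to
  \<open>delta (p \<circ> q)\<close>. Since \<open>conv\<close> is the action belonging to this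
  representation, associativity of the product is an instance of \<open>act_conv\<close>.\<close>

definition left_reg :: "(nat \<Rightarrow> nat) \<Rightarrow> ((nat \<Rightarrow> nat) \<Rightarrow> rat) \<Rightarrow> ((nat \<Rightarrow> nat) \<Rightarrow> rat)" where
  "left_reg p b = (\<lambda>x. b (inv' p \<circ> x))"

text \<open>Only the support is restricted, and a permutation of a subset is a permutation of the
  larger set, so \<open>alg S\<close> is contained in \<open>alg T\<close> for
  \<open>S \<subseteq> T\<close>. Symmetrizers of stage \<open>n\<close> thus live at stage
  \<open>n + 1\<close> without an embedding map.\<close>

definition alg :: "nat set \<Rightarrow> ((nat \<Rightarrow> nat) \<Rightarrow> rat) set" where
  "alg T = {a. \<forall>p. p \<notin> perms T \<longrightarrow> a p = 0}"

definition delta :: "'p \<Rightarrow> 'p \<Rightarrow> rat" where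
  "delta p = (\<lambda>x. if x = p then 1 else 0)"

abbreviation conv :: "nat set \<Rightarrow> ((nat \<Rightarrow> nat) \<Rightarrow> rat) \<Rightarrow> ((nat \<Rightarrow> nat) \<Rightarrow> rat) \<Rightarrow> ((nat \<Rightarrow> nat) \<Rightarrow> rat)" where
  "conv T \<equiv> act T left_reg"

lemma perms_comp: "p \<in> perms T \<Longrightarrow> q \<in> perms T \<Longrightarrow> p \<circ> q \<in> perms T"
  by (simp add: permutes_compose)

lemma perms_inv: "p \<in> perms T \<Longrightarrow> inv' p \<in> perms T"
  by (simp add: permutes_inv)

lemma perms_mono: "S \<subseteq> T \<Longrightarrow> p \<in> perms S \<Longrightarrow> p \<in> perms T"
  by (simp add: permutes_subset)

lemma left_reg_comp:
  assumes "p \<in> perms T" "q \<in> perms T"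
  shows "left_reg (p \<circ> q) b = left_reg p (left_reg q b)"
proof -
  have e: "inv' (p \<circ> q) = inv' q \<circ> inv' p"
    using assms by (intro o_inv_distrib) (auto intro: permutes_bij)
  show ?thesis unfolding left_reg_def e comp_assoc ..
qed

lemma left_reg_rep: "finite T \<Longrightarrow> perm_rep T left_reg"
  by unfold_locales (auto simp: left_reg_comp intro!: linI, auto simp: left_reg_def fun_eq_iff)

lemma left_reg_delta:
  assumes "p \<in> perms T"
  shows "left_reg p (delta q) = delta (p \<circ> q)"
proof -
  have "inv' p \<circ> x = q \<longleftrightarrow> x = p \<circ> q" for x
    using permutes_inv_o[of p T] assms by (metis comp_assoc id_comp mem_Collect_eq)
  then show ?thesis by (auto simp: left_reg_def delta_def fun_eq_iff)
qed

lemma left_reg_alg: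
  assumes "p \<in> perms T" "b \<in> alg T" shows "left_reg p b \<in> alg T"
proof -
  have "x \<in> perms T" if "inv' p \<circ> x \<in> perms T" for x
  proof -
    have "p \<circ> (inv' p \<circ> x) \<in> perms T" using assms(1) that by (rule perms_comp)
    then show ?thesis using permutes_inv_o(1)[of p T] assms(1) by (simp add: comp_assoc[symmetric])
  qed
  then show ?thesis using assms by (auto simp: alg_def left_reg_def)
qed

lemma alg_add: "a \<in> alg T \<Longrightarrow> b \<in> alg T \<Longrightarrow> a + b \<in> alg T"
  and alg_scl: "a \<in> alg T \<Longrightarrow> c *q a \<in> alg T"
  and alg_zero: "0 \<in> alg T"
  and alg_delta: "p \<in> perms T \<Longrightarrow> delta p \<in> alg T"
  by (auto simp: alg_def delta_def)

lemma alg_sum: "(\<And>i. i \<in> I \<Longrightarrow> f i \<in> alg T) \<Longrightarrow> (\<Sum>i\<in>I. f i) \<in> alg T"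
  by (induction I rule: infinite_finite_induct) (auto simp: alg_add alg_zero)

lemma conv_alg: "b \<in> alg T \<Longrightarrow> conv T a b \<in> alg T"
  unfolding act_def by (intro alg_sum alg_scl left_reg_alg)

context perm_rep
begin

lemma finp: "finite (perms T)"
  using fin by (simp add: finite_permutations)

lemma lin_act: "Vector_Spaces.linear scl scl (act T \<rho> a)"
  by (rule linI) (simp_all add: act_def lin_add[OF lin] lin_scl[OF lin] fv.scale_right_distrib
      sum.distrib fv.scale_sum_right mult.commute)

lemma act_add_left: "act T \<rho> (a + b) x = act T \<rho> a x + act T \<rho> b x"
  by (simp add: act_def fv.scale_left_distrib sum.distrib)

lemma act_scl_left: "act T \<rho> (c *q a) x = c *q act T \<rho> a x"
  by (simp add: act_def fv.scale_sum_right)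

lemma act_zero_left: "act T \<rho> 0 x = 0"
  by (simp add: act_def)

lemma act_sum_left: "act T \<rho> (\<Sum>i\<in>I. f i) x = (\<Sum>i\<in>I. act T \<rho> (f i) x)"
  by (induction I rule: infinite_finite_induct) (simp_all only: sum.infinite sum.empty sum.insert act_add_left act_zero_left simp_thms)

lemma act_delta: "p \<in> perms T \<Longrightarrow> act T \<rho> (delta p) x = \<rho> p x"
proof -
  assume p: "p \<in> perms T"
  have "act T \<rho> (delta p) x = (\<Sum>q\<in>perms T. if q = p then \<rho> q x else 0)"
    unfolding act_def by (rule sum.cong) (auto simp: delta_def)
  also have "\<dots> = \<rho> p x" using p finp by simp
  finally show ?thesis .
qed

lemma act_left_reg:
  assumes "p \<in> perms T"
  shows "act T \<rho> (left_reg p b) x = \<rho> p (act T \<rho> b x)"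
proof -
  have "act T \<rho> (left_reg p b) x = (\<Sum>q\<in>perms T. left_reg p b (p \<circ> q) *q \<rho> (p \<circ> q) x)"
    unfolding act_def
    using assms permutes_inv_o[of p T]
    by (intro sum.reindex_bij_witness[of _ "\<lambda>q. p \<circ> q" "\<lambda>q. inv' p \<circ> q"])
       (auto simp: permutes_compose permutes_inv comp_assoc[symmetric])
  also have "\<dots> = (\<Sum>q\<in>perms T. b q *q \<rho> p (\<rho> q x))"
    using assms permutes_inv_o[of p T]
    by (intro sum.cong) (auto simp: left_reg_def comp_assoc[symmetric] mult)
  also have "\<dots> = \<rho> p (act T \<rho> b x)"
    using assms by (simp add: act_def lin_sum[OF lin] lin_scl[OF lin])
  finally show ?thesis .
qed

lemma act_conv: "act T \<rho> (conv T a b) x = act T \<rho> a (act T \<rho> b x)"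
proof -
  have "act T \<rho> (conv T a b) x = (\<Sum>p\<in>perms T. a p *q act T \<rho> (left_reg p b) x)"
    unfolding act_def[of T left_reg] by (simp add: act_sum_left act_scl_left)
  also have "\<dots> = act T \<rho> a (act T \<rho> b x)"
    by (subst (2) act_def) (simp add: act_left_reg)
  finally show ?thesis .
qed

end

lemma conv_delta_id: "finite T \<Longrightarrow> a \<in> alg T \<Longrightarrow> conv T a (delta id) = a"
proof -
  assume f: "finite T" and a: "a \<in> alg T"
  have "conv T a (delta id) = (\<Sum>p\<in>perms T. a p *q delta p)"
    unfolding act_def by (rule sum.cong) (auto simp: left_reg_delta[where T=T])
  also have "\<dots> = a"
  proof
    fix x
    have "(\<Sum>p\<in>perms T. a p *q delta p) x = (\<Sum>p\<in>perms T. if p = x then a p else 0)"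
      unfolding sum_fun_apply by (rule sum.cong) (auto simp: delta_def)
    also have "\<dots> = a x" using f a by (auto simp: alg_def finite_permutations)
    finally show "(\<Sum>p\<in>perms T. a p *q delta p) x = a x" .
  qed
  finally show ?thesis .
qed

section \<open>Tableaux, row and column groups, and the collapse of products\<close>

definition boxes :: "nat list \<Rightarrow> (nat \<times> nat) set" where
  "boxes \<mu> = {(i, j). i < length \<mu> \<and> 1 \<le> j \<and> j \<le> \<mu> ! i}"

text \<open>The labelling \<open>t\<close> may be any function. A constant one puts all letters into
  one row, so that the facts on row symmetrizers cover the sum over all permutations as
  well.\<close>

definition row_group :: "nat set \<Rightarrow> (nat \<Rightarrow> nat \<times> nat) \<Rightarrow> (nat \<Rightarrow> nat) set" where
  "row_group T t = {p \<in> perms T. \<forall>y\<in>T. fst (t (p y)) = fst (t y)}"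

definition col_group :: "nat set \<Rightarrow> (nat \<Rightarrow> nat \<times> nat) \<Rightarrow> (nat \<Rightarrow> nat) set" where
  "col_group T t = {p \<in> perms T. \<forall>y\<in>T. snd (t (p y)) = snd (t y)}"

definition row_sym :: "nat set \<Rightarrow> (nat \<Rightarrow> nat \<times> nat) \<Rightarrow> (nat \<Rightarrow> nat) \<Rightarrow> rat" where
  "row_sym T t = (\<lambda>p. if p \<in> row_group T t then 1 else 0)"

definition col_sym :: "nat set \<Rightarrow> (nat \<Rightarrow> nat \<times> nat) \<Rightarrow> (nat \<Rightarrow> nat) \<Rightarrow> rat" where
  "col_sym T t = (\<lambda>p. if p \<in> col_group T t then of_int (sign p) else 0)"

abbreviation young :: "nat set \<Rightarrow> (nat \<Rightarrow> nat \<times> nat) \<Rightarrow> (nat \<Rightarrow> nat) \<Rightarrow> rat" where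
  "young T t \<equiv> conv T (row_sym T t) (col_sym T t)"

lemma row_sym_alg: "row_sym T t \<in> alg T" and col_sym_alg: "col_sym T t \<in> alg T"
  by (auto simp: row_sym_def col_sym_def alg_def row_group_def col_group_def)

lemma row_group_comp: "p \<in> row_group T t \<Longrightarrow> q \<in> row_group T t \<Longrightarrow> p \<circ> q \<in> row_group T t"
  by (auto simp: row_group_def permutes_compose permutes_in_image)

lemma col_group_comp: "p \<in> col_group T t \<Longrightarrow> q \<in> col_group T t \<Longrightarrow> p \<circ> q \<in> col_group T t"
  by (auto simp: col_group_def permutes_compose permutes_in_image)

lemma row_group_inv: assumes "p \<in> row_group T t" shows "inv' p \<in> row_group T t"
proof -
  have p: "p permutes T" using assms by (simp add: row_group_def)
  have "fst (t (inv' p y)) = fst (t y)" if "y \<in> T" for y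
    using assms that permutes_in_image[OF permutes_inv[OF p], of y] permutes_inverses(1)[OF p, of y]
    unfolding row_group_def by (metis (mono_tags, lifting) mem_Collect_eq)
  then show ?thesis using p by (simp add: row_group_def permutes_inv)
qed

lemma col_group_inv: assumes "p \<in> col_group T t" shows "inv' p \<in> col_group T t"
proof -
  have p: "p permutes T" using assms by (simp add: col_group_def)
  have "snd (t (inv' p y)) = snd (t y)" if "y \<in> T" for y
    using assms that permutes_in_image[OF permutes_inv[OF p], of y] permutes_inverses(1)[OF p, of y]
    unfolding col_group_def by (metis (mono_tags, lifting) mem_Collect_eq)
  then show ?thesis using p by (simp add: col_group_def permutes_inv)
qed

lemma sign_perms: 
  assumes "finite T" "p \<in> perms T" "q \<in> perms T"
  shows "sign (p \<circ> q) = sign p * sign q"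
  using assms by (auto intro!: sign_compose permutation_permutes[THEN iffD2])

context perm_rep
begin

lemma act_row_sym: "act T \<rho> (row_sym T t) x = (\<Sum>p\<in>row_group T t. \<rho> p x)"
  unfolding act_def row_sym_def
  by (rule sum.mono_neutral_cong_right) (auto simp: finp row_group_def)

lemma act_col_sym: "act T \<rho> (col_sym T t) x = (\<Sum>p\<in>col_group T t. of_int (sign p) *q \<rho> p x)"
  unfolding act_def col_sym_def
  by (rule sum.mono_neutral_cong_right) (auto simp: finp col_group_def)

lemma row_sym_right:
  assumes p: "p \<in> row_group T t"
  shows "act T \<rho> (row_sym T t) (\<rho> p x) = act T \<rho> (row_sym T t) x"
proof -
  have pp: "p \<in> perms T" using p by (simp add: row_group_def)
  have "(\<Sum>q\<in>row_group T t. \<rho> q (\<rho> p x)) = (\<Sum>q\<in>row_group T t. \<rho> (q \<circ> p) x)"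
    using pp by (intro sum.cong) (auto simp: mult row_group_def)
  also have "\<dots> = (\<Sum>q\<in>row_group T t. \<rho> q x)"
    using p pp permutes_inv_o[of p T]
    by (intro sum.reindex_bij_witness[of _ "\<lambda>q. q \<circ> inv' p" "\<lambda>q. q \<circ> p"])
       (auto simp: row_group_comp row_group_inv comp_assoc)
  finally show ?thesis by (simp add: act_row_sym)
qed

lemma row_sym_left:
  assumes p: "p \<in> row_group T t"
  shows "\<rho> p (act T \<rho> (row_sym T t) x) = act T \<rho> (row_sym T t) x"
proof -
  have pp: "p \<in> perms T" using p by (simp add: row_group_def)
  have "\<rho> p (\<Sum>q\<in>row_group T t. \<rho> q x) = (\<Sum>q\<in>row_group T t. \<rho> (p \<circ> q) x)"
    using pp by (subst lin_sum[OF lin]) (auto simp: mult row_group_def intro!: sum.cong)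
  also have "\<dots> = (\<Sum>q\<in>row_group T t. \<rho> q x)"
    using p pp permutes_inv_o[of p T]
    by (intro sum.reindex_bij_witness[of _ "\<lambda>q. inv' p \<circ> q" "\<lambda>q. p \<circ> q"])
       (auto simp: row_group_comp row_group_inv comp_assoc[symmetric])
  finally show ?thesis by (simp add: act_row_sym)
qed

lemma col_sym_left:
  assumes p: "p \<in> col_group T t"
  shows "\<rho> p (act T \<rho> (col_sym T t) x) = of_int (sign p) *q act T \<rho> (col_sym T t) x"
proof -
  have pp: "p \<in> perms T" using p by (simp add: col_group_def)
  have s: "sign (p \<circ> q) = sign p * sign q" if "q \<in> col_group T t" for q
    using sign_perms[OF fin pp] that by (auto simp: col_group_def)
  have ss: "sign p * (sign p * z) = z" for z by (simp add: sign_def)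
  have ss': "(of_int (sign p) :: rat) * (of_int (sign p) * z) = z" for z by (simp add: sign_def)
  have "\<rho> p (\<Sum>q\<in>col_group T t. of_int (sign q) *q \<rho> q x)
      = (\<Sum>q\<in>col_group T t. of_int (sign q) *q \<rho> (p \<circ> q) x)"
    using pp by (subst lin_sum[OF lin]) (auto simp: mult col_group_def lin_scl[OF lin] intro!: sum.cong)
  also have "\<dots> = (\<Sum>q\<in>col_group T t. of_int (sign p) *q of_int (sign (p \<circ> q)) *q \<rho> (p \<circ> q) x)"
    by (rule sum.cong) (auto simp: s ss')
  also have "\<dots> = (\<Sum>q\<in>col_group T t. of_int (sign p) *q of_int (sign q) *q \<rho> q x)"
    using p pp permutes_inv_o[of p T]
    by (intro sum.reindex_bij_witness[of _ "\<lambda>q. inv' p \<circ> q" "\<lambda>q. p \<circ> q"])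
       (auto simp: col_group_comp col_group_inv comp_assoc[symmetric])
  finally show ?thesis unfolding act_col_sym by (simp add: fv.scale_sum_right del: fv.scale_scale)
qed

end

text \<open>The equality case of the column comparison below. Among \<open>h + 1\<close> naturals
  the maximum is at least \<open>h\<close>, so the others keep the bound for \<open>h\<close>, form
  \<open>{..<h}\<close> by induction, and leave only \<open>h\<close> for the maximum.\<close>

lemma sum_ge_initial:
  fixes A :: "nat set"
  assumes "finite A" "card A = h" "sum id A \<le> sum id {..<h}"
  shows "A = {..<h}"
  using assms
proof (induction h arbitrary: A)
  case 0 then show ?case by simp
next
  case (Suc h)
  have ne: "A \<noteq> {}" using Suc.prems(2) by auto
  define m where "m = Max A"
  have mA: "m \<in> A" using ne Suc.prems(1) by (simp add: m_def)
  have "A \<subseteq> {..m}" using Suc.prems(1) by (auto simp: m_def)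
  then have "card A \<le> Suc m" using card_mono[of "{..m}" A] by simp
  then have mh: "h \<le> m" using Suc.prems by simp
  have "sum id A = m + sum id (A - {m})" using sum.remove[OF Suc.prems(1) mA, of id] by simp
  then have s: "m + sum id (A - {m}) \<le> h + sum id {..<h}" using Suc.prems(3) by (simp add: lessThan_Suc)
  have "A - {m} = {..<h}"
    using Suc.prems s mh mA by (intro Suc.IH) auto
  then have "m \<le> h" using s by simp
  then have "m = h" using mh by simp
  moreover have "A = insert m (A - {m})" using mA by blast
  ultimately show ?case using \<open>A - {m} = {..<h}\<close> by (metis lessThan_Suc)
qed

lemma sum_initial_le:
  fixes A :: "nat set"
  assumes "finite A"
  shows "sum id {..<card A} \<le> sum id A"
proof (rule ccontr)
  assume "\<not> ?thesis"
  then have "sum id A \<le> sum id {..<card A}" by simp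
  from sum_ge_initial[OF assms refl this] \<open>\<not> ?thesis\<close> show False by simp
qed

definition tableau :: "nat list \<Rightarrow> nat set \<Rightarrow> (nat \<Rightarrow> nat \<times> nat) \<Rightarrow> bool" where
  "tableau \<mu> T t \<longleftrightarrow> is_partition \<mu> \<and> bij_betw t T (boxes \<mu>)"

lemma partition_nth_antimono:
  "is_partition \<mu> \<Longrightarrow> i \<le> j \<Longrightarrow> j < length \<mu> \<Longrightarrow> \<mu> ! j \<le> \<mu> ! i"
  by (cases "i = j") (auto simp: is_partition_def sorted_wrt_iff_nth_less)

text \<open>Rows of a partition shape get shorter, so columns have no gaps; the row indices
  occurring in a column therefore have the least sum possible for its length.\<close>

lemma tableau_column:
  assumes "tableau \<mu> T t"
  shows "\<exists>h. (fst \<circ> t) ` {y \<in> T. snd (t y) = j} = {..<h}"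
    and "inj_on (fst \<circ> t) {y \<in> T. snd (t y) = j}"
proof -
  have b: "bij_betw t T (boxes \<mu>)" and p: "is_partition \<mu>" using assms by (auto simp: tableau_def)
  have im: "(fst \<circ> t) ` {y \<in> T. snd (t y) = j} = {i. (i, j) \<in> boxes \<mu>}"
  proof safe
    fix y assume "y \<in> T" "j = snd (t y)"
    then show "((fst \<circ> t) y, snd (t y)) \<in> boxes \<mu>" using b by (auto simp: bij_betw_def)
  next
    fix i assume "(i, j) \<in> boxes \<mu>"
    then obtain y where "y \<in> T" "t y = (i, j)" using b by (force simp: bij_betw_def)
    then show "i \<in> (fst \<circ> t) ` {y \<in> T. snd (t y) = j}" by (auto intro!: rev_image_eqI[of y])
  qed
  define I where "I = {i. (i, j) \<in> boxes \<mu>}"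
  have I: "i' \<in> I" if "i \<in> I" "i' \<le> i" for i i'
    using that partition_nth_antimono[OF p, of i' i] by (auto simp: I_def boxes_def)
  have "finite I" by (rule finite_subset[of _ "{..<length \<mu>}"]) (auto simp: I_def boxes_def)
  then have "\<exists>h. I = {..<h}"
  proof (cases "I = {}")
    case False
    then have m: "Max I \<in> I" using \<open>finite I\<close> by simp
    have "I = {..<Suc (Max I)}"
    proof (intro equalityI subsetI)
      fix i assume "i \<in> I" then show "i \<in> {..<Suc (Max I)}"
        using Max_ge[OF \<open>finite I\<close>, of i] by simp
    next
      fix i assume "i \<in> {..<Suc (Max I)}" then show "i \<in> I" using I[OF m, of i] by simp
    qed
    then show ?thesis ..
  qed auto
  then show "\<exists>h. (fst \<circ> t) ` {y \<in> T. snd (t y) = j} = {..<h}" using im I_def by simp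
  show "inj_on (fst \<circ> t) {y \<in> T. snd (t y) = j}"
    using b by (auto simp: bij_betw_def inj_on_def prod_eq_iff)
qed

text \<open>Comparing, column by column, the sum of the row indices with its minimum shows that the
  shape cannot change when the columns are permuted by a \<open>\<sigma>\<close> without repeated boxes.\<close>

lemma tableau_dichotomy:
  assumes T: "finite T" and t: "tableau \<mu> T t" and s: "\<sigma> \<in> perms T"
    and distinct: "\<And>y z. \<lbrakk>y \<in> T; z \<in> T; fst (t y) = fst (t z); snd (t (inv' \<sigma> y)) = snd (t (inv' \<sigma> z))\<rbrakk> \<Longrightarrow> y = z"
  shows "\<exists>p\<in>row_group T t. \<exists>q\<in>col_group T t. \<sigma> = p \<circ> q"
proof -
  have sp: "\<sigma> permutes T" using s by simp
  define k where "k = (\<lambda>y. snd (t y))"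
  define k' where "k' = (\<lambda>y. snd (t (inv' \<sigma> y)))"
  define r where "r = (\<lambda>y. fst (t y))"
  define C where "C = (\<lambda>j. {y \<in> T. k y = j})"
  define C' where "C' = (\<lambda>j. {y \<in> T. k' y = j})"
  have injT: "inj_on t T" and imT: "t ` T = boxes \<mu>" using t by (auto simp: tableau_def bij_betw_def)
  have C'im: "C' j = \<sigma> ` C j" for j
    using permutes_inverses[OF sp] permutes_in_image[OF sp] permutes_in_image[OF permutes_inv[OF sp]]
    by (auto simp: C'_def C_def k'_def k_def image_iff) metis
  have cardC': "card (C' j) = card (C j)" for j
    unfolding C'im by (rule card_image) (meson inj_on_subset permutes_inj[OF sp] subset_UNIV)
  have finC: "finite (C j)" "finite (C' j)" for j using T by (auto simp: C_def C'_def)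
  have injr: "inj_on r (C j)" for j
    using tableau_column(2)[OF t, of j] by (simp add: r_def C_def k_def comp_def)
  have injr': "inj_on r (C' j)" for j
  proof (rule inj_onI)
    fix y z assume "y \<in> C' j" "z \<in> C' j" "r y = r z"
    then show "y = z" using distinct[of y z] by (simp add: C'_def r_def k'_def)
  qed
  have rC: "r ` C j = {..<card (C j)}" for j
  proof -
    obtain h where h: "r ` C j = {..<h}"
      using tableau_column(1)[OF t, of j] by (auto simp: r_def C_def k_def comp_def)
    then have "h = card (C j)" using card_image[OF injr, of j] by simp
    then show ?thesis using h by simp
  qed
  define J where "J = k ` T"
  have J': "k' ` T = J"
    using permutes_image[OF permutes_inv[OF sp]] unfolding J_def k'_def k_def
    by (metis (no_types, lifting) image_cong image_image)
  have finJ: "finite J" using T by (simp add: J_def)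
  have sumC: "(\<Sum>j\<in>J. \<Sum>y\<in>C j. r y) = (\<Sum>y\<in>T. r y)"
    unfolding C_def J_def by (rule sum.image_gen[OF T, symmetric])
  have sumC': "(\<Sum>j\<in>J. \<Sum>y\<in>C' j. r y) = (\<Sum>y\<in>T. r y)"
    unfolding C'_def J'[symmetric] by (rule sum.image_gen[OF T, symmetric])
  have s1: "(\<Sum>y\<in>C j. r y) = sum id {..<card (C j)}" for j
    using sum.reindex[OF injr, of id j] rC[of j] by (simp add: comp_def)
  have s2: "(\<Sum>y\<in>C' j. r y) = sum id (r ` C' j)" for j
    using sum.reindex[OF injr', of id j] by (simp add: comp_def)
  have le: "(\<Sum>y\<in>C j. r y) \<le> (\<Sum>y\<in>C' j. r y)" for j
    unfolding s1 s2 using sum_initial_le[of "r ` C' j"] finC cardC' card_image[OF injr', of j] by simp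
  have eq: "(\<Sum>y\<in>C j. r y) = (\<Sum>y\<in>C' j. r y)" if "j \<in> J" for j
  proof (rule ccontr)
    assume "\<not> ?thesis"
    then have "(\<Sum>y\<in>C j. r y) < (\<Sum>y\<in>C' j. r y)" using le[of j] by simp
    then have "(\<Sum>j\<in>J. \<Sum>y\<in>C j. r y) < (\<Sum>j\<in>J. \<Sum>y\<in>C' j. r y)"
      using that finJ le by (intro sum_strict_mono_ex1) auto
    then show False using sumC sumC' by simp
  qed
  have rC': "r ` C' j = r ` C j" if "j \<in> J" for j
    unfolding rC
    using eq[OF that] s1 s2 finC cardC' card_image[OF injr', of j]
    by (intro sum_ge_initial) auto
  \<comment> \<open>\<open>u\<close> moves a letter within its row to the column that it occupies
    after translation by \<open>\<sigma>\<close>; the equality \<open>rC'\<close> guarantees that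
    this box exists. Then \<open>u\<close> is a row permutation, \<open>u \<circ> \<sigma>\<close> a
    column permutation, and \<open>\<sigma>\<close> factors accordingly.\<close>
  define u where "u = (\<lambda>y. if y \<in> T then the_inv_into T t (r y, k' y) else y)"
  have inb: "(r y, k' y) \<in> t ` T" if "y \<in> T" for y
  proof -
    have "k' y \<in> J" "y \<in> C' (k' y)" using that J' by (auto simp: C'_def)
    then have "r y \<in> r ` C (k' y)" using rC' by blast
    then obtain z where z: "z \<in> T" "k z = k' y" "r z = r y" by (auto simp: C_def)
    then have "t z = (r y, k' y)" by (simp add: r_def k_def prod_eq_iff)
    then show ?thesis using z by (metis imageI)
  qed
  have tu: "t (u y) = (r y, k' y)" if "y \<in> T" for y
    using that f_the_inv_into_f[OF injT inb] by (simp add: u_def)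
  have uT: "u y \<in> T" if "y \<in> T" for y
    using that the_inv_into_into[OF injT inb] by (simp add: u_def)
  have "inj_on u T"
  proof (rule inj_onI)
    fix y z assume yz: "y \<in> T" "z \<in> T" "u y = u z"
    then have "r y = r z" "k' y = k' z" using tu[of y] tu[of z] by auto
    then show "y = z" using distinct[of y z] yz by (simp add: r_def k'_def)
  qed
  then have "bij_betw u T T"
    using endo_inj_surj[OF T _ \<open>inj_on u T\<close>] uT by (simp add: bij_betw_def image_subset_iff)
  then have up: "u permutes T" by (rule bij_imp_permutes) (simp add: u_def)
  have urow: "u \<in> row_group T t" using up tu by (simp add: row_group_def r_def)
  have "u \<circ> \<sigma> \<in> col_group T t"
  proof -
    have "snd (t (u (\<sigma> y))) = snd (t y)" if "y \<in> T" for y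
      using tu[of "\<sigma> y"] that permutes_in_image[OF sp] permutes_inverses(2)[OF sp]
      by (simp add: k'_def)
    then show ?thesis using permutes_compose[OF sp up] by (simp add: col_group_def)
  qed
  moreover have "\<sigma> = inv' u \<circ> (u \<circ> \<sigma>)"
    using permutes_inv_o(2)[OF up] by (simp add: comp_assoc[symmetric])
  ultimately show ?thesis using row_group_inv[OF urow] by blast
qed

lemma inv_perms_o: "p \<in> perms T \<Longrightarrow> inv' p \<circ> p = id" "p \<in> perms T \<Longrightarrow> p \<circ> inv' p = id"
  using permutes_inv_o[of p T] by auto

lemma transpose_conj:
  assumes "\<sigma> permutes T"
  shows "\<sigma> \<circ> Transposition.transpose (inv' \<sigma> y) (inv' \<sigma> z) = Transposition.transpose y z \<circ> \<sigma>"
  using permutes_inverses[OF assms]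
  by (auto simp: fun_eq_iff Transposition.transpose_def)

text \<open>Either \<open>\<sigma>\<close> is a row permutation times a column permutation and both
  factors are absorbed, or two letters share a row of \<open>t\<close> and a column of its translate
  by \<open>\<sigma>\<close>. In the second case their transposition is absorbed on the left, while
  its conjugate is a column permutation of sign -1, so the product equals its own negative.\<close>

lemma young_collapse_perm:
  assumes T: "finite T" and t: "tableau \<mu> T t" and s: "\<sigma> \<in> perms T"
  shows "\<exists>c. conv T (row_sym T t) (left_reg \<sigma> (col_sym T t)) = c *q young T t"
proof -
  interpret L: perm_rep T left_reg by (rule left_reg_rep[OF T])
  have colid: "conv T (col_sym T t) (delta id) = col_sym T t"
    by (rule conv_delta_id[OF T col_sym_alg])
  have sp: "\<sigma> permutes T" using s by simp
  show ?thesis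
  proof (cases "\<forall>y\<in>T. \<forall>z\<in>T. fst (t y) = fst (t z) \<longrightarrow> snd (t (inv' \<sigma> y)) = snd (t (inv' \<sigma> z)) \<longrightarrow> y = z")
    case True
    then obtain p q where pq: "p \<in> row_group T t" "q \<in> col_group T t" "\<sigma> = p \<circ> q"
      using tableau_dichotomy[OF T t s] by blast
    have pp: "p \<in> perms T" "q \<in> perms T" using pq by (auto simp: row_group_def col_group_def)
    have "left_reg q (col_sym T t) = of_int (sign q) *q col_sym T t"
      using L.col_sym_left[OF pq(2), of "delta id"] colid by simp
    then have "left_reg \<sigma> (col_sym T t) = left_reg p (of_int (sign q) *q col_sym T t)"
      unfolding pq(3) left_reg_comp[OF pp] by simp
    also have "\<dots> = of_int (sign q) *q left_reg p (col_sym T t)"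
      using L.lin[OF pp(1)] by (rule lin_scl)
    finally have "conv T (row_sym T t) (left_reg \<sigma> (col_sym T t))
        = of_int (sign q) *q conv T (row_sym T t) (left_reg p (col_sym T t))"
      by (simp only: lin_scl[OF L.lin_act])
    also have "\<dots> = of_int (sign q) *q young T t"
      by (simp only: L.row_sym_right[OF pq(1)])
    finally show ?thesis ..
  next
    case False
    then obtain y z where yz: "y \<in> T" "z \<in> T" "fst (t y) = fst (t z)"
      "snd (t (inv' \<sigma> y)) = snd (t (inv' \<sigma> z))" "y \<noteq> z" by blast
    define \<tau> where "\<tau> = Transposition.transpose y z"
    define \<tau>' where "\<tau>' = Transposition.transpose (inv' \<sigma> y) (inv' \<sigma> z)"
    have iT: "inv' \<sigma> y \<in> T" "inv' \<sigma> z \<in> T" using yz permutes_in_image[OF permutes_inv[OF sp]] by auto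
    have ine: "inv' \<sigma> y \<noteq> inv' \<sigma> z" using yz(5) permutes_inverses(1)[OF sp] by metis
    have \<tau>: "\<tau> \<in> row_group T t"
      using yz by (auto simp: \<tau>_def row_group_def permutes_swap_id Transposition.transpose_def)
    have \<tau>': "\<tau>' \<in> col_group T t"
      using yz iT by (auto simp: \<tau>'_def col_group_def permutes_swap_id Transposition.transpose_def)
    have pp: "\<tau> \<in> perms T" "\<tau>' \<in> perms T" using \<tau> \<tau>' by (auto simp: row_group_def col_group_def)
    have sg: "sign \<tau>' = -1" using ine by (simp add: \<tau>'_def sign_swap_id)
    have c: "\<sigma> \<circ> \<tau>' = \<tau> \<circ> \<sigma>" unfolding \<tau>_def \<tau>'_def by (rule transpose_conj[OF sp])
    let ?a = "row_sym T t" and ?b = "col_sym T t"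
    have b: "left_reg \<tau>' ?b = - ?b"
      using L.col_sym_left[OF \<tau>', of "delta id"] colid sg by (simp add: scl_def fun_eq_iff)
    have "conv T ?a (left_reg \<sigma> ?b) = conv T ?a (left_reg (\<tau> \<circ> \<sigma>) ?b)"
      using L.row_sym_right[OF \<tau>, of "left_reg \<sigma> ?b"] left_reg_comp[OF pp(1) s, of ?b] by simp
    also have "\<dots> = conv T ?a (left_reg \<sigma> (left_reg \<tau>' ?b))"
      using left_reg_comp[OF s pp(2), of ?b] c by simp
    also have "\<dots> = - conv T ?a (left_reg \<sigma> ?b)"
      by (simp only: b lin_neg[OF L.lin[OF s]] lin_neg[OF L.lin_act])
    finally have "conv T ?a (left_reg \<sigma> ?b) x = 0" for x
      by (metis fun_Compl_def minus_zero neg_equal_zero uminus_apply)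
    then have "conv T ?a (left_reg \<sigma> ?b) = 0 *q young T t" by (auto simp: fun_eq_iff)
    then show ?thesis ..
  qed
qed

text \<open>Linear extension of the previous lemma. All one-dimensionality statements below,
  including the one behind \<open>theta\<close>, come from here.\<close>

lemma young_collapse:
  assumes T: "finite T" and t: "tableau \<mu> T t"
  shows "\<exists>c. conv T (row_sym T t) (conv T x (col_sym T t)) = c *q young T t"
proof -
  interpret L: perm_rep T left_reg by (rule left_reg_rep[OF T])
  obtain f where f: "\<And>\<sigma>. \<sigma> \<in> perms T \<Longrightarrow>
      conv T (row_sym T t) (left_reg \<sigma> (col_sym T t)) = f \<sigma> *q young T t"
    using young_collapse_perm[OF T t] by metis
  have "conv T (row_sym T t) (conv T x (col_sym T t))
      = (\<Sum>\<sigma>\<in>perms T. x \<sigma> *q conv T (row_sym T t) (left_reg \<sigma> (col_sym T t)))"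
    by (subst (2) act_def) (simp only: lin_sum[OF L.lin_act] lin_scl[OF L.lin_act])
  also have "\<dots> = (\<Sum>\<sigma>\<in>perms T. (x \<sigma> * f \<sigma>) *q young T t)"
    by (rule sum.cong) (auto simp: f)
  also have "\<dots> = (\<Sum>\<sigma>\<in>perms T. x \<sigma> * f \<sigma>) *q young T t"
    by (simp add: fv.scale_sum_left)
  finally show ?thesis ..
qed

lemma sum_const_fun: "(\<Sum>i\<in>I. v) = of_nat (card I) *q v"
proof
  fix x
  have "(\<Sum>i\<in>I. v) x = (\<Sum>i\<in>I. v x)" by (rule sum_fun_apply)
  also have "\<dots> = of_nat (card I) * v x" by simp
  finally show "(\<Sum>i\<in>I. v) x = (of_nat (card I) *q v) x" by (simp only: scl_apply)
qed

lemma perm_rep_subset: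
  assumes "perm_rep T \<rho>" "A \<subseteq> T"
  shows "perm_rep A \<rho>"
proof -
  interpret perm_rep T \<rho> by fact
  show ?thesis
    using fin assms(2) perms_mono[OF assms(2)] lin mult
    by (intro perm_rep.intro) (auto intro: finite_subset)
qed

section \<open>Invariant inner products and highest weight vectors\<close>

definition sym_sum :: "((nat \<Rightarrow> nat) \<Rightarrow> ('i \<Rightarrow> rat) \<Rightarrow> ('i \<Rightarrow> rat)) \<Rightarrow> nat set \<Rightarrow> ('i \<Rightarrow> rat) \<Rightarrow> ('i \<Rightarrow> rat)" where
  "sym_sum \<rho> A v = (\<Sum>p\<in>perms A. \<rho> p v)"

lemma sym_sum_row_sym:
  assumes "perm_rep A \<rho>"
  shows "sym_sum \<rho> A v = act A \<rho> (row_sym A (\<lambda>_. (0, 0))) v"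
  by (simp add: perm_rep.act_row_sym[OF assms] sym_sum_def row_group_def)

lemma sym_sum_left:
  assumes "perm_rep A \<rho>" "p \<in> perms A"
  shows "\<rho> p (sym_sum \<rho> A v) = sym_sum \<rho> A v"
  using perm_rep.row_sym_left[OF assms(1), of p "\<lambda>_. (0,0)" v] assms
  by (simp add: sym_sum_row_sym row_group_def)

lemma sym_sum_right:
  assumes "perm_rep A \<rho>" "p \<in> perms A"
  shows "sym_sum \<rho> A (\<rho> p v) = sym_sum \<rho> A v"
  using perm_rep.row_sym_right[OF assms(1), of p "\<lambda>_. (0,0)" v] assms
  by (simp add: sym_sum_row_sym row_group_def)

lemma lin_sym_sum: "perm_rep A \<rho> \<Longrightarrow> lin (sym_sum \<rho> A)"
  using perm_rep.lin_act[of A \<rho> "row_sym A (\<lambda>_. (0, 0))"] sym_sum_row_sym[of A \<rho>]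
  by presburger

text \<open>Bilinearity and invariance are asked on the whole type, positivity only on
  \<open>E\<close>: the forms used later involve finitely many coordinates and may vanish on other
  functions. Positivity takes the place of arguments over an algebraically closed field.\<close>

locale inner_rep = perm_rep T \<rho> for T and \<rho> :: "(nat \<Rightarrow> nat) \<Rightarrow> ('i \<Rightarrow> rat) \<Rightarrow> ('i \<Rightarrow> rat)" +
  fixes ip :: "('i \<Rightarrow> rat) \<Rightarrow> ('i \<Rightarrow> rat) \<Rightarrow> rat" and E :: "('i \<Rightarrow> rat) set"
  assumes ip_add: "ip (x + y) z = ip x z + ip y z"
    and ip_scl: "ip (c *q x) z = c * ip x z"
    and ip_sym: "ip x y = ip y x"
    and ip_inv: "p \<in> perms T \<Longrightarrow> ip (\<rho> p x) (\<rho> p y) = ip x y"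
    and ip_pos: "x \<in> E \<Longrightarrow> x \<noteq> 0 \<Longrightarrow> ip x x > 0"
    and sub: "fv.subspace E"
    and stable: "p \<in> perms T \<Longrightarrow> x \<in> E \<Longrightarrow> \<rho> p x \<in> E"
    and unit: "x \<in> E \<Longrightarrow> \<rho> id x = x"
begin

lemma ip_zero: "ip 0 z = 0"
  using ip_scl[of 0 0 z] by simp

lemma ip_sum: "ip (\<Sum>i\<in>I. f i) z = (\<Sum>i\<in>I. ip (f i) z)"
proof (induction I rule: infinite_finite_induct)
  case (insert i I)
  then show ?case by (simp only: sum.insert ip_add not_False_eq_True)
qed (simp_all only: sum.infinite sum.empty ip_zero not_False_eq_True)

lemma ip_pos': "x \<in> E \<Longrightarrow> ip x x \<ge> 0"
  using ip_pos[of x] ip_zero by (cases "x = 0") (auto intro: less_imp_le)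

lemma ip_eq_0: "x \<in> E \<Longrightarrow> ip x x = 0 \<Longrightarrow> x = 0"
  using ip_pos[of x] by force

lemma unit_inv:
  assumes "p \<in> perms T" "x \<in> E"
  shows "\<rho> p (\<rho> (inv' p) x) = x" "\<rho> (inv' p) (\<rho> p x) = x"
  using mult[OF assms(1) perms_inv[OF assms(1)], of x] mult[OF perms_inv[OF assms(1)] assms(1), of x]
    inv_perms_o[OF assms(1)] unit[OF assms(2)] by simp_all

lemma ip_adj:
  assumes "p \<in> perms T" "y \<in> E"
  shows "ip (\<rho> p x) y = ip x (\<rho> (inv' p) y)"
  using ip_inv[OF assms(1), of x "\<rho> (inv' p) y"] unit_inv[OF assms] by simp

lemma stable_act: "x \<in> E \<Longrightarrow> act T \<rho> a x \<in> E"
  unfolding act_def by (intro fv.subspace_sum[OF sub] fv.subspace_scale[OF sub] stable) auto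

text \<open>Group elements are isometries, so the adjoint of each is its inverse, and inversion
  permutes the row group.\<close>

lemma row_sym_adj:
  assumes "y \<in> E"
  shows "ip (act T \<rho> (row_sym T t) x) y = ip x (act T \<rho> (row_sym T t) y)"
proof -
  have "ip (act T \<rho> (row_sym T t) x) y = (\<Sum>p\<in>row_group T t. ip x (\<rho> (inv' p) y))"
    unfolding act_row_sym ip_sum using ip_adj assms by (intro sum.cong) (auto simp: row_group_def)
  also have "\<dots> = (\<Sum>p\<in>row_group T t. ip x (\<rho> p y))"
    by (rule sum.reindex_bij_witness[of _ "inv'" "inv'"])
       (auto simp: row_group_inv, auto simp: row_group_def permutes_inv_inv)
  also have "\<dots> = ip x (act T \<rho> (row_sym T t) y)"
    unfolding act_row_sym ip_sym[of x] ip_sum ..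
  finally show ?thesis .
qed

lemma col_sym_adj:
  assumes "y \<in> E"
  shows "ip (act T \<rho> (col_sym T t) x) y = ip x (act T \<rho> (col_sym T t) y)"
proof -
  have "ip (act T \<rho> (col_sym T t) x) y = (\<Sum>p\<in>col_group T t. of_int (sign p) * ip x (\<rho> (inv' p) y))"
    unfolding act_col_sym ip_sum ip_scl using ip_adj assms by (intro sum.cong) (auto simp: col_group_def)
  also have "\<dots> = (\<Sum>p\<in>col_group T t. of_int (sign p) * ip x (\<rho> p y))"
    using fin
    by (intro sum.reindex_bij_witness[of _ "inv'" "inv'"])
       (auto simp: col_group_inv, auto simp: col_group_def permutes_inv_inv
          intro!: sign_inverse permutation_permutes[THEN iffD2])
  also have "\<dots> = ip x (act T \<rho> (col_sym T t) y)"
    unfolding act_col_sym ip_sym[of x] ip_sum ip_scl ..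
  finally show ?thesis .
qed

lemma row_sym_sq:
  "act T \<rho> (row_sym T t) (act T \<rho> (row_sym T t) x) = of_nat (card (row_group T t)) *q act T \<rho> (row_sym T t) x"
  by (subst act_row_sym) (simp add: row_sym_left sum_const_fun del: sum_constant)

lemma col_sym_sq:
  "act T \<rho> (col_sym T t) (act T \<rho> (col_sym T t) x) = of_nat (card (col_group T t)) *q act T \<rho> (col_sym T t) x"
proof -
  have "of_int (sign p) *q \<rho> p (act T \<rho> (col_sym T t) x) = act T \<rho> (col_sym T t) x" if "p \<in> col_group T t" for p
    by (simp add: col_sym_left[OF that] sign_def fun_eq_iff)
  then show ?thesis by (subst act_col_sym) (simp add: sum_const_fun del: sum_constant)
qed

lemma group_card: "of_nat (card (row_group T t)) \<noteq> (0::rat)" "of_nat (card (col_group T t)) \<noteq> (0::rat)"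
proof -
  have "finite (row_group T t)" "finite (col_group T t)"
    by (rule finite_subset[OF _ finp]; auto simp: row_group_def col_group_def)+
  moreover have "id \<in> row_group T t" "id \<in> col_group T t"
    by (auto simp: row_group_def col_group_def permutes_id)
  ultimately show "of_nat (card (row_group T t)) \<noteq> (0::rat)" "of_nat (card (col_group T t)) \<noteq> (0::rat)"
    by auto
qed

text \<open>Let \<open>a\<close> and \<open>b\<close> be the two symmetrizers, self-adjoint and
  idempotent up to nonzero scalars, with \<open>x\<close> in the image of \<open>a\<close>. Up to
  nonzero factors \<open>ip (b x) (b x)\<close> equals \<open>ip x (b x)\<close>, then
  \<open>ip (a x) (b x)\<close>, then \<open>ip x (a (b x))\<close>, which is zero.\<close>

lemma row_col_zero:
  assumes x: "x \<in> E" and z: "act T \<rho> (row_sym T t) (act T \<rho> (col_sym T t) x) = 0"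
    and y: "x = act T \<rho> (row_sym T t) y"
  shows "act T \<rho> (col_sym T t) x = 0"
proof -
  let ?a = "act T \<rho> (row_sym T t)" and ?b = "act T \<rho> (col_sym T t)"
  let ?r = "of_nat (card (row_group T t)) :: rat" and ?c = "of_nat (card (col_group T t)) :: rat"
  have bx: "?b x \<in> E" using x by (rule stable_act)
  have ax: "?a x = ?r *q x" using y row_sym_sq by simp
  have "ip (?b x) (?b x) = ip x (?b (?b x))" by (rule col_sym_adj[OF bx])
  also have "\<dots> = ?c * ip x (?b x)" by (simp only: col_sym_sq ip_sym[of x] ip_scl)
  finally have 1: "ip (?b x) (?b x) = ?c * ip x (?b x)" .
  have "?r * ip x (?b x) = ip (?a x) (?b x)" by (simp only: ax ip_scl)
  also have "\<dots> = ip x (?a (?b x))" by (rule row_sym_adj[OF bx])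
  also have "\<dots> = 0" by (simp only: z ip_sym[of x] ip_zero)
  finally have "ip x (?b x) = 0" using group_card(1)[of t] by simp
  then show ?thesis using 1 ip_eq_0[OF bx] by simp
qed

lemma col_row_zero:
  assumes x: "x \<in> E" and z: "act T \<rho> (col_sym T t) (act T \<rho> (row_sym T t) x) = 0"
    and y: "x = act T \<rho> (col_sym T t) y"
  shows "act T \<rho> (row_sym T t) x = 0"
proof -
  let ?a = "act T \<rho> (row_sym T t)" and ?b = "act T \<rho> (col_sym T t)"
  let ?r = "of_nat (card (row_group T t)) :: rat" and ?c = "of_nat (card (col_group T t)) :: rat"
  have bx: "?a x \<in> E" using x by (rule stable_act)
  have ax: "?b x = ?c *q x" using y col_sym_sq by simp
  have "ip (?a x) (?a x) = ip x (?a (?a x))" by (rule row_sym_adj[OF bx])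
  also have "\<dots> = ?r * ip x (?a x)" by (simp only: row_sym_sq ip_sym[of x] ip_scl)
  finally have 1: "ip (?a x) (?a x) = ?r * ip x (?a x)" .
  have "?c * ip x (?a x) = ip (?b x) (?a x)" by (simp only: ax ip_scl)
  also have "\<dots> = ip x (?b (?a x))" by (rule col_sym_adj[OF bx])
  also have "\<dots> = 0" by (simp only: z ip_sym[of x] ip_zero)
  finally have "ip x (?a x) = 0" using group_card(2)[of t] by simp
  then show ?thesis using 1 ip_eq_0[OF bx] by simp
qed

definition invariants :: "nat set \<Rightarrow> ('i \<Rightarrow> rat) set" where
  "invariants A = {w \<in> E. \<forall>g\<in>perms A. \<rho> g w = w}"

lemma sym_sum_stable: "A \<subseteq> T \<Longrightarrow> x \<in> E \<Longrightarrow> sym_sum \<rho> A x \<in> E"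
  unfolding sym_sum_def by (intro fv.subspace_sum[OF sub] stable) (auto intro: perms_mono[simplified])

lemma sym_sum_invariant:
  assumes "v \<in> invariants A" "finite A"
  shows "sym_sum \<rho> A v = of_nat (fact (card A)) *q v"
proof -
  have "sym_sum \<rho> A v = (\<Sum>p\<in>perms A. v)"
    unfolding sym_sum_def using assms by (intro sum.cong) (auto simp: invariants_def)
  then show ?thesis by (simp only: sum_const_fun card_permutations[OF refl assms(2)])
qed

lemma perms_transpose: "x \<in> T \<Longrightarrow> y \<in> T \<Longrightarrow> Transposition.transpose x y \<in> perms T"
  by (simp add: permutes_swap_id)

lemma invariants_commute:
  assumes "g \<in> perms (T - A)" "w \<in> invariants A" "A \<subseteq> T"
  shows "\<rho> g w \<in> invariants A"
proof -
  have gT: "g \<in> perms T" using perms_mono[of "T - A" T] assms(1) by blast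
  have "\<rho> h (\<rho> g w) = \<rho> g w" if h: "h \<in> perms A" for h
  proof -
    have hT: "h \<in> perms T" using perms_mono[OF assms(3)] h by blast
    have "h \<circ> g = g \<circ> h"
    proof
      fix z
      show "(h \<circ> g) z = (g \<circ> h) z"
        using h assms(1) permutes_in_image[of g "T - A" z] permutes_in_image[of h A z]
        by (cases "z \<in> A"; cases "z \<in> T - A") (auto simp: permutes_def)
    qed
    then have "\<rho> h (\<rho> g w) = \<rho> g (\<rho> h w)" using mult[OF hT gT, of w] mult[OF gT hT, of w] by simp
    then show ?thesis using assms(2) h by (simp add: invariants_def)
  qed
  then show ?thesis using stable[OF gT] assms(2) by (simp add: invariants_def)
qed

text \<open>Symmetrizing \<open>w\<close> over \<open>insert y A\<close> gives an invariant of too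
  large a set, hence zero. The cosets of \<open>perms A\<close> are represented by the
  transpositions of \<open>y\<close> with the letters of \<open>insert y A\<close>, and the one with
  \<open>y\<close> itself contributes \<open>w\<close>. This is the analogue of a raising operator
  killing a highest weight vector.\<close>

lemma highest_weight:
  assumes max: "\<And>Y w. Y \<subseteq> T \<Longrightarrow> card Y = Suc (card A) \<Longrightarrow> w \<in> invariants Y \<Longrightarrow> w = 0"
    and A: "A \<subseteq> T" and w: "w \<in> invariants A" and y: "y \<in> T" "y \<notin> A"
  shows "(\<Sum>x\<in>A. \<rho> (Transposition.transpose x y) w) = - w"
proof -
  have fA: "finite A" using A fin by (rule finite_subset)
  have wE: "w \<in> E" using w by (simp add: invariants_def)
  have YT: "insert y A \<subseteq> T" using A y by simp
  note Y = perm_rep_subset[OF perm_rep_axioms YT]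
  define S where "S = sym_sum \<rho> (insert y A) w"
  have "S \<in> invariants (insert y A)"
    unfolding S_def invariants_def using sym_sum_stable[OF YT wE] sym_sum_left[OF Y] by simp
  then have S0: "S = 0" using max[OF YT, of S] fA y by simp
  have tr: "Transposition.transpose y b \<in> perms T" if "b \<in> insert y A" for b
    using that YT by (intro perms_transpose) auto
  have "S = (\<Sum>b\<in>insert y A. \<Sum>q\<in>perms A. \<rho> (Transposition.transpose y b \<circ> q) w)"
    unfolding S_def sym_sum_def by (rule sum_over_permutations_insert[OF fA y(2)])
  also have "\<dots> = (\<Sum>b\<in>insert y A. \<Sum>q\<in>perms A. \<rho> (Transposition.transpose y b) w)"
  proof (intro sum.cong refl)
    fix b q assume b: "b \<in> insert y A" and q: "q \<in> perms A"
    have "q \<in> perms T" using q perms_mono[OF A] by blast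
    then have "\<rho> (Transposition.transpose y b \<circ> q) w = \<rho> (Transposition.transpose y b) (\<rho> q w)"
      by (rule mult[OF tr[OF b]])
    then show "\<rho> (Transposition.transpose y b \<circ> q) w = \<rho> (Transposition.transpose y b) w"
      using w q by (simp add: invariants_def)
  qed
  also have "\<dots> = of_nat (fact (card A)) *q (\<Sum>b\<in>insert y A. \<rho> (Transposition.transpose y b) w)"
    by (simp only: sum_const_fun card_permutations[OF refl fA] fv.scale_sum_right)
  finally have "(\<Sum>b\<in>insert y A. \<rho> (Transposition.transpose y b) w) = 0"
    using S0 by (metis fv.scale_eq_0_iff fact_nonzero of_nat_eq_0_iff)
  moreover have "\<rho> (Transposition.transpose y y) w = w" using unit[OF wE] by simp
  ultimately have "w + (\<Sum>b\<in>A. \<rho> (Transposition.transpose y b) w) = 0"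
    by (simp only: sum.insert[OF fA y(2)])
  then show ?thesis unfolding transpose_commute[of y] by (metis add_eq_0_iff)
qed

end

section \<open>Matchings between a row and the remaining letters\<close>

abbreviation tr :: "nat \<Rightarrow> nat \<Rightarrow> nat \<Rightarrow> nat" where "tr \<equiv> Transposition.transpose"

text \<open>Products of disjoint transpositions, each exchanging a letter of \<open>A\<close> with a
  letter of \<open>Y\<close>, with all of \<open>Y\<close> used. When each column contains at most
  one letter of \<open>A\<close>, a column permutation has this form up to a permutation of the
  letters outside \<open>A\<close>.\<close>

definition matching :: "nat set \<Rightarrow> nat set \<Rightarrow> (nat \<Rightarrow> nat) \<Rightarrow> bool" where
  "matching A Y m \<longleftrightarrow> finite Y \<and> A \<inter> Y = {} \<and> (\<forall>z. m (m z) = z) \<and> (\<forall>z. z \<notin> A \<union> Y \<longrightarrow> m z = z) \<and>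
     (\<forall>y\<in>Y. m y \<in> A) \<and> (\<forall>x\<in>A. m x = x \<or> m x \<in> Y)"

lemma matching_permutes: assumes "matching A Y m" shows "m permutes A \<union> Y"
  unfolding permutes_def
proof (intro conjI allI impI)
  show "\<And>x. x \<notin> A \<union> Y \<Longrightarrow> m x = x" using assms by (simp add: matching_def)
  show "\<exists>!x. m x = y" for y using assms unfolding matching_def by metis
qed

lemma matching_remove:
  assumes m: "matching A Y m" and y: "y \<in> Y"
  shows "matching A (Y - {y}) (m \<circ> tr (m y) y)"
    and "(m \<circ> tr (m y) y) (m y) = m y"
    and "m = (m \<circ> tr (m y) y) \<circ> tr (m y) y"
proof -
  have inv: "m (m z) = z" for z using m by (simp add: matching_def)
  have my: "m y \<in> A" "y \<notin> A" using m y by (auto simp: matching_def)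
  have e: "(m \<circ> tr (m y) y) z = (if z = y \<or> z = m y then z else m z)" for z
    using inv by (auto simp: Transposition.transpose_def)
  show "(m \<circ> tr (m y) y) (m y) = m y" by (simp add: e)
  show "m = (m \<circ> tr (m y) y) \<circ> tr (m y) y" by (simp add: comp_assoc)
  have ne: "m z \<noteq> y" "m z \<noteq> m y" if "z \<noteq> y" "z \<noteq> m y" for z using that inv by metis+
  show "matching A (Y - {y}) (m \<circ> tr (m y) y)"
    using m ne my unfolding matching_def e by auto
qed

lemma matching_insert:
  assumes m: "matching A Y m" and x: "x \<in> A" "m x = x" and y: "y \<notin> A" "y \<notin> Y"
  shows "matching A (insert y Y) (m \<circ> tr x y)"
proof -
  have inv: "m (m z) = z" for z using m by (simp add: matching_def)
  have my: "m y = y" using m y by (simp add: matching_def)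
  have e: "(m \<circ> tr x y) z = (if z = x then y else if z = y then x else m z)" for z
    using x my by (auto simp: Transposition.transpose_def)
  have ne: "m z \<noteq> x" "m z \<noteq> y" if "z \<noteq> x" "z \<noteq> y" for z using that inv x my by metis+
  show ?thesis using m ne x y unfolding matching_def e by auto
qed

lemma matching_empty: "matching A {} m \<Longrightarrow> m = id"
  by (rule ext, rename_tac z, case_tac "z \<in> A") (auto simp: matching_def)

lemma matching_sign:
  "matching A Y m \<Longrightarrow> finite A \<Longrightarrow> sign m = (-1) ^ card Y"
proof (induction "card Y" arbitrary: Y m)
  case 0
  then have "Y = {}" by (simp add: matching_def)
  then have "m = id" using 0 matching_empty by blast
  then show ?case using \<open>Y = {}\<close> by (simp add: sign_id)
next
  case (Suc n)
  then obtain y where y: "y \<in> Y" by fastforce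
  note r = matching_remove[OF Suc.prems(1) y]
  have fY: "finite Y" using Suc.prems by (simp add: matching_def)
  have c: "card (Y - {y}) = n" using Suc.hyps(2) y fY by simp
  have "m y \<noteq> y" using Suc.prems(1) y by (auto simp: matching_def)
  then have s: "sign (tr (m y) y) = -1" by (simp add: sign_swap_id)
  have "permutation (m \<circ> tr (m y) y)"
    unfolding permutation_permutes
    using matching_permutes[OF r(1)] fY Suc.prems(2) by (intro exI[of _ "A \<union> (Y - {y})"]) simp
  then have "sign m = sign (m \<circ> tr (m y) y) * sign (tr (m y) y)"
    by (subst r(3), intro sign_compose permutation_swap_id)
  then show ?case using Suc.hyps(1)[OF c[symmetric] r(1) Suc.prems(2)] s c Suc.hyps(2)[symmetric] by simp
qed

lemma matching_fixed_card:
  assumes m: "matching A Y m" and A: "finite A"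
  shows "card {x \<in> A. m x = x} + card Y = card A" and "bij_betw m {x \<in> A. m x \<noteq> x} Y"
proof -
  show b: "bij_betw m {x \<in> A. m x \<noteq> x} Y"
    by (rule bij_betw_byWitness[of _ m]) (use m in \<open>auto simp: matching_def\<close>)
  have "A = {x \<in> A. m x = x} \<union> {x \<in> A. m x \<noteq> x}" by auto
  then have "card A = card {x \<in> A. m x = x} + card {x \<in> A. m x \<noteq> x}"
    using A by (metis (no_types, lifting) card_Un_disjoint disjoint_iff finite_Un mem_Collect_eq)
  then show "card {x \<in> A. m x = x} + card Y = card A"
    using bij_betw_same_card[OF b] by simp
qed

context inner_rep
begin

lemma tr_perms_diff: "A \<subseteq> T \<Longrightarrow> y \<in> T - A \<Longrightarrow> z \<in> T - A \<Longrightarrow> tr y z \<in> perms (T - A)"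
  by (simp add: permutes_swap_id)

text \<open>The permutations of \<open>insert y Y\<close> are sorted by the image of
  \<open>y\<close>, which puts a transposition on the left. Conjugation moves it to the right, at
  the price of replacing \<open>perms Y\<close> by the permutations of
  \<open>insert y Y - {z}\<close>.\<close>

lemma sym_sum_insert:
  assumes Y: "Y \<subseteq> T" "y \<in> T" "y \<notin> Y"
  shows "sym_sum \<rho> (insert y Y) v
    = sym_sum \<rho> Y v + (\<Sum>z\<in>Y. sym_sum \<rho> (insert y Y - {z}) (\<rho> (tr z y) v))"
proof -
  have fY: "finite Y" using Y fin finite_subset by blast
  have conj: "tr y b \<circ> q \<circ> tr y b \<in> perms (insert y Y - {b})" if b: "b \<in> Y" and q: "q \<in> perms Y" for b q
  proof -
    have 1: "(tr y b \<circ> q \<circ> tr y b) permutes insert y Y"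
      using b q by (intro permutes_compose permutes_swap_id) (auto intro: permutes_subset)
    have 2: "(tr y b \<circ> q \<circ> tr y b) b = b"
      using q Y(3) by (simp add: permutes_def)
    have "(tr y b \<circ> q \<circ> tr y b) permutes (insert y Y - {b})"
    proof (rule permutes_superset[OF 1])
      fix x assume "x \<in> insert y Y - (insert y Y - {b})"
      then have "x = b" by blast
      then show "(tr y b \<circ> q \<circ> tr y b) x = x" using 2 by (simp only:)
    qed
    then show ?thesis by (simp only: mem_Collect_eq)
  qed
  have conj': "tr y b \<circ> q \<circ> tr y b \<in> perms Y" if b: "b \<in> Y" and q: "q \<in> perms (insert y Y - {b})" for b q
  proof -
    have 1: "(tr y b \<circ> q \<circ> tr y b) permutes insert y Y"
      using b q by (intro permutes_compose permutes_swap_id) (auto intro: permutes_subset)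
    have 2: "(tr y b \<circ> q \<circ> tr y b) y = y"
      using q b by (simp add: permutes_def)
    have "(tr y b \<circ> q \<circ> tr y b) permutes Y"
    proof (rule permutes_superset[OF 1])
      fix x assume "x \<in> insert y Y - Y"
      then have "x = y" by blast
      then show "(tr y b \<circ> q \<circ> tr y b) x = x" using 2 by (simp only:)
    qed
    then show ?thesis by (simp only: mem_Collect_eq)
  qed
  have inv: "tr y b \<circ> (tr y b \<circ> q \<circ> tr y b) \<circ> tr y b = q" for b q
    by (simp add: fun_eq_iff)
  have "sym_sum \<rho> (insert y Y) v = (\<Sum>b\<in>insert y Y. \<Sum>q\<in>perms Y. \<rho> (tr y b \<circ> q) v)"
    unfolding sym_sum_def by (rule sum_over_permutations_insert[OF fY Y(3)])
  also have "\<dots> = (\<Sum>q\<in>perms Y. \<rho> (tr y y \<circ> q) v) + (\<Sum>b\<in>Y. \<Sum>q\<in>perms Y. \<rho> (tr y b \<circ> q) v)"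
    by (rule sum.insert[OF fY Y(3)])
  also have "(\<Sum>q\<in>perms Y. \<rho> (tr y y \<circ> q) v) = sym_sum \<rho> Y v"
    by (simp add: sym_sum_def)
  also have "(\<Sum>b\<in>Y. \<Sum>q\<in>perms Y. \<rho> (tr y b \<circ> q) v)
      = (\<Sum>b\<in>Y. sym_sum \<rho> (insert y Y - {b}) (\<rho> (tr b y) v))"
  proof (rule sum.cong[OF refl])
    fix b assume b: "b \<in> Y"
    have trT: "tr y b \<in> perms T" using b Y by (intro perms_transpose) auto
    have "(\<Sum>q\<in>perms Y. \<rho> (tr y b \<circ> q) v) = (\<Sum>q\<in>perms (insert y Y - {b}). \<rho> (q \<circ> tr y b) v)"
    proof (rule sum.reindex_bij_witness[of _ "\<lambda>q. tr y b \<circ> q \<circ> tr y b" "\<lambda>q. tr y b \<circ> q \<circ> tr y b"])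
      fix q assume q: "q \<in> perms Y"
      have "tr y b \<circ> q \<circ> tr y b \<circ> tr y b = tr y b \<circ> q" by (simp add: comp_assoc)
      then show "\<rho> (tr y b \<circ> q \<circ> tr y b \<circ> tr y b) v = \<rho> (tr y b \<circ> q) v" by (rule arg_cong)
    qed (use conj[OF b] conj'[OF b] inv in blast)+
    also have "\<dots> = sym_sum \<rho> (insert y Y - {b}) (\<rho> (tr b y) v)"
      unfolding sym_sum_def transpose_commute[of b y]
      by (rule sum.cong[OF refl], rule mult[OF _ trT]) (use Y perms_mono[of "insert y Y - {b}" T] in blast)
    finally show "(\<Sum>q\<in>perms Y. \<rho> (tr y b \<circ> q) v) = sym_sum \<rho> (insert y Y - {b}) (\<rho> (tr b y) v)" .
  qed
  finally show ?thesis .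
qed

text \<open>Induction on \<open>card Y\<close>: take the pair \<open>x0\<close>, \<open>y\<close>
  off \<open>m\<close> and apply \<open>highest_weight\<close> at \<open>y\<close> to the shorter
  matching \<open>m0\<close>. Among the products \<open>m0 \<circ> tr x y\<close>, those with
  \<open>x\<close> fixed by \<open>m0\<close> all give the wanted vector after symmetrization; the
  others fall under the induction hypothesis, and \<open>sym_sum_insert\<close> collects them into
  \<open>sym_sum \<rho> Y v\<close>.\<close>

lemma matching_sum:
  assumes max: "\<And>Y w. Y \<subseteq> T \<Longrightarrow> card Y = Suc (card A) \<Longrightarrow> w \<in> invariants Y \<Longrightarrow> w = 0"
    and A: "A \<subseteq> T"
  shows "matching A Y m \<Longrightarrow> Y \<subseteq> T - A \<Longrightarrow> v \<in> invariants A \<Longrightarrow>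
    sym_sum \<rho> A (\<rho> m v) = ((- 1) ^ card Y * of_nat (fact (card A - card Y))) *q sym_sum \<rho> Y v"
proof (induction "card Y" arbitrary: Y m v)
  case 0
  then have Y: "Y = {}" by (simp add: matching_def)
  then have m: "m = id" using 0(2) matching_empty by blast
  have vE: "v \<in> E" using 0 by (simp add: invariants_def)
  have "sym_sum \<rho> A (\<rho> m v) = of_nat (fact (card A)) *q v"
    unfolding m unit[OF vE] by (rule sym_sum_invariant[OF 0(4) finite_subset[OF A fin]])
  moreover have "sym_sum \<rho> Y v = v" using unit[OF vE] by (simp add: Y sym_sum_def)
  ultimately show ?case by (simp only: Y card.empty power_0 mult_1 diff_zero)
next
  case (Suc t)
  note m = Suc.prems(1) and Y = Suc.prems(2) and v = Suc.prems(3)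
  have fA: "finite A" and fY: "finite Y" using A fin finite_subset m by (auto simp: matching_def)
  have vE: "v \<in> E" using v by (simp add: invariants_def)
  have rA: "perm_rep A \<rho>" by (rule perm_rep_subset[OF perm_rep_axioms A])
  obtain y where y: "y \<in> Y" using Suc.hyps(2) by fastforce
  have yT: "y \<in> T" "y \<notin> A" using y Y by auto
  define x0 where "x0 = m y"
  define m0 where "m0 = m \<circ> tr x0 y"
  define Y0 where "Y0 = Y - {y}"
  note r = matching_remove[OF m y, folded x0_def, folded m0_def Y0_def]
  have x0: "x0 \<in> A" using m y by (auto simp: matching_def x0_def)
  have cY0: "card Y0 = t" using y fY Suc.hyps(2) by (simp add: Y0_def)
  have Y0: "Y0 \<subseteq> T - A" "y \<notin> Y0" "insert y Y0 = Y" using Y y by (auto simp: Y0_def)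
  define Af where "Af = {x \<in> A. m0 x = x}"
  define Am where "Am = {x \<in> A. m0 x \<noteq> x}"
  have cAf: "card Af + t = card A" and bij: "bij_betw m0 Am Y0"
    using matching_fixed_card[OF r(1) fA] by (auto simp: Af_def Am_def cY0)
  have m0T: "m0 \<in> perms T"
    using matching_permutes[OF r(1)] permutes_subset[of m0 "A \<union> Y0" T] A Y0 by auto
  have mT: "m \<in> perms T"
    using matching_permutes[OF m] permutes_subset[of m "A \<union> Y" T] A Y by auto
  have trT: "tr x y \<in> perms T" if "x \<in> A" for x using that A yT by (intro perms_transpose) auto
  have trA: "tr x x' \<in> perms A" if "x \<in> A" "x' \<in> A" for x x' using that by (simp add: permutes_swap_id)
  let ?D = "sym_sum \<rho> A (\<rho> m v)"
  \<comment> \<open>Conjugation by \<open>tr x x0\<close> turns \<open>m\<close> into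
    \<open>m0 \<circ> tr x y\<close>. This transposition lies in \<open>perms A\<close>, so it fixes
    \<open>v\<close> on the right and is absorbed by the symmetrization on the left.\<close>
  have fixed: "sym_sum \<rho> A (\<rho> (m0 \<circ> tr x y) v) = ?D" if x: "x \<in> Af" for x
  proof -
    have xA: "x \<in> A" "m0 x = x" using x by (auto simp: Af_def)
    let ?s = "tr x x0"
    have sA: "?s \<in> perms A" by (rule trA[OF xA(1) x0])
    have sT: "?s \<in> perms T" using sA perms_mono[OF A] by blast
    have inj: "m0 z = m0 z' \<longleftrightarrow> z = z'" for z z' using m0T permutes_inj[of m0 T] by (auto dest: injD)
    have "m0 \<circ> ?s = ?s \<circ> m0"
      using xA(2) r(2) inj by (auto simp: fun_eq_iff Transposition.transpose_def)
    moreover have "?s \<circ> tr x0 y \<circ> ?s = tr x y"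
      using xA(1) x0 yT(2) by (auto simp: fun_eq_iff Transposition.transpose_def)
    ultimately have "m0 \<circ> tr x y = ?s \<circ> (m \<circ> ?s)"
      unfolding r(3) by (metis comp_assoc)
    then have "\<rho> (m0 \<circ> tr x y) v = \<rho> ?s (\<rho> m (\<rho> ?s v))"
      using mult[OF sT perms_comp[OF mT sT], of v] mult[OF mT sT, of v] by simp
    also have "\<rho> ?s v = v" using v sA by (simp add: invariants_def)
    finally show ?thesis by (simp only: sym_sum_right[OF rA sA])
  qed
  let ?c = "(- 1) ^ t * of_nat (fact (card A - t)) :: rat"
  \<comment> \<open>If \<open>m0\<close> pairs \<open>x\<close> with \<open>?z\<close>, pair
    \<open>x\<close> with \<open>y\<close> instead: the result is a matching onto
    \<open>Y - {?z}\<close>, preceded by \<open>tr ?z y\<close>. The latter moves letters outside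
    \<open>A\<close> only, so it preserves the invariance of \<open>v\<close> under
    \<open>perms A\<close>.\<close>
  have moved: "sym_sum \<rho> A (\<rho> (m0 \<circ> tr x y) v) = ?c *q sym_sum \<rho> (Y - {m0 x}) (\<rho> (tr (m0 x) y) v)"
    if x: "x \<in> Am" for x
  proof -
    let ?z = "m0 x"
    have xA: "x \<in> A" using x by (simp add: Am_def)
    have z: "?z \<in> Y0" using bij x by (auto simp: bij_betw_def)
    then have zY: "?z \<in> Y" "?z \<noteq> y" "?z \<in> T - A" using Y0 by auto
    have mz: "m0 ?z = x" using r(1) by (simp add: matching_def)
    note r' = matching_remove[OF r(1) z, unfolded mz]
    define m1 where "m1 = m0 \<circ> tr x ?z"
    have m1: "matching A (Y0 - {?z}) m1" "m1 x = x" using r' by (auto simp: m1_def)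
    have "matching A (insert y (Y0 - {?z})) (m1 \<circ> tr x y)"
      by (rule matching_insert[OF m1(1) xA m1(2)]) (use yT Y0 in auto)
    moreover have Yz: "insert y (Y0 - {?z}) = Y - {?z}" using zY Y0 by auto
    ultimately have m2: "matching A (Y - {?z}) (m1 \<circ> tr x y)" by simp
    have trz: "tr ?z y \<in> perms (T - A)" using zY yT A by (intro tr_perms_diff) auto
    have trzT: "tr ?z y \<in> perms T" using trz perms_mono[of "T - A" T] by blast
    have "tr x ?z \<circ> tr x y \<circ> tr ?z y = tr x y"
      using zY(2,3) xA yT(2) by (auto simp: fun_eq_iff Transposition.transpose_def)
    then have "m0 \<circ> tr x y = (m1 \<circ> tr x y) \<circ> tr ?z y"
      unfolding m1_def by (metis comp_assoc)
    moreover have "m1 \<circ> tr x y \<in> perms T"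
      using matching_permutes[OF m2] permutes_subset[of "m1 \<circ> tr x y" "A \<union> (Y - {?z})" T] A Y by auto
    ultimately have "\<rho> (m0 \<circ> tr x y) v = \<rho> (m1 \<circ> tr x y) (\<rho> (tr ?z y) v)"
      using mult[of "m1 \<circ> tr x y" "tr ?z y" v] trzT by simp
    moreover have "t = card (Y - {?z})" using zY fY Suc.hyps(2) by simp
    ultimately show ?thesis
      using Suc.hyps(1)[OF _ m2 _ invariants_commute[OF trz v A]] Y by auto
  qed
  have "(\<Sum>x\<in>A. sym_sum \<rho> A (\<rho> (m0 \<circ> tr x y) v)) = sym_sum \<rho> A (\<rho> m0 (\<Sum>x\<in>A. \<rho> (tr x y) v))"
    unfolding lin_sum[OF lin[OF m0T]] lin_sum[OF lin_sym_sum[OF rA]]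
    by (rule sum.cong[OF refl]) (simp only: mult[OF m0T trT])
  also have "\<dots> = - sym_sum \<rho> A (\<rho> m0 v)"
    by (simp only: highest_weight[OF max A v yT] lin_neg[OF lin[OF m0T]] lin_neg[OF lin_sym_sum[OF rA]])
  also have "sym_sum \<rho> A (\<rho> m0 v) = ?c *q sym_sum \<rho> Y0 v"
    using Suc.hyps(1)[OF cY0[symmetric] r(1) Y0(1) v] cY0 by simp
  finally have total: "(\<Sum>x\<in>A. sym_sum \<rho> A (\<rho> (m0 \<circ> tr x y) v)) = - (?c *q sym_sum \<rho> Y0 v)" .
  have "(\<Sum>x\<in>A. sym_sum \<rho> A (\<rho> (m0 \<circ> tr x y) v))
      = (\<Sum>x\<in>Af. sym_sum \<rho> A (\<rho> (m0 \<circ> tr x y) v)) + (\<Sum>x\<in>Am. sym_sum \<rho> A (\<rho> (m0 \<circ> tr x y) v))"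
    using fA by (subst sum.union_disjoint[symmetric]) (auto simp: Af_def Am_def intro!: sum.cong)
  also have "(\<Sum>x\<in>Af. sym_sum \<rho> A (\<rho> (m0 \<circ> tr x y) v)) = of_nat (card Af) *q ?D"
    unfolding sum_const_fun[symmetric] by (rule sum.cong[OF refl fixed])
  also have "(\<Sum>x\<in>Am. sym_sum \<rho> A (\<rho> (m0 \<circ> tr x y) v))
      = (\<Sum>x\<in>Am. ?c *q sym_sum \<rho> (Y - {m0 x}) (\<rho> (tr (m0 x) y) v))"
    by (rule sum.cong[OF refl moved])
  also have "\<dots> = (\<Sum>z\<in>Y0. ?c *q sym_sum \<rho> (Y - {z}) (\<rho> (tr z y) v))"
    by (rule sum.reindex_bij_betw[OF bij])
  also have "\<dots> = ?c *q (\<Sum>z\<in>Y0. sym_sum \<rho> (Y - {z}) (\<rho> (tr z y) v))"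
    by (rule fv.scale_sum_right[symmetric])
  finally have "of_nat (card Af) *q ?D + ?c *q (\<Sum>z\<in>Y0. sym_sum \<rho> (Y - {z}) (\<rho> (tr z y) v)) + ?c *q sym_sum \<rho> Y0 v = 0"
    by (intro eq_neg_iff_add_eq_0[THEN iffD1] trans[OF sym total])
  moreover have "sym_sum \<rho> Y v = sym_sum \<rho> Y0 v + (\<Sum>z\<in>Y0. sym_sum \<rho> (Y - {z}) (\<rho> (tr z y) v))"
    using sym_sum_insert[of Y0 y v] Y0 yT by auto
  ultimately have key: "of_nat (card Af) *q ?D + ?c *q sym_sum \<rho> Y v = 0"
    by (simp only: fv.scale_right_distrib add.assoc add.commute add.left_commute)
  have x0f: "x0 \<in> Af" using x0 r(2) by (simp add: Af_def)
  have "finite Af" using fA by (simp add: Af_def)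
  then have pos: "card Af > 0" using x0f by (auto simp: card_gt_0_iff)
  then obtain k where k: "card Af = Suc k" by (cases "card Af") auto
  \<comment> \<open>With \<open>card Af = Suc k\<close> the factorial of \<open>card A - t\<close>
    splits off exactly the factor by which the relation \<open>key\<close> has to be
    divided.\<close>
  have At: "card A - t = Suc k" "card A - card Y = k" using cAf k Suc.hyps(2) by auto
  show ?case
  proof
    fix z
    have "of_nat (card Af) * ?D z + ?c * sym_sum \<rho> Y v z = 0"
      using fun_cong[OF key, of z] by simp
    then have "of_nat (Suc k) * ?D z + (-1) ^ t * (of_nat (Suc k) * of_nat (fact k)) * sym_sum \<rho> Y v z = 0"
      by (simp only: k At fact_Suc of_nat_mult of_nat_id)
    then have "of_nat (Suc k) * (?D z + (-1) ^ t * of_nat (fact k) * sym_sum \<rho> Y v z) = (0::rat)"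
      by (simp only: distrib_left mult.assoc mult.left_commute)
    then have "?D z + (-1) ^ t * of_nat (fact k) * sym_sum \<rho> Y v z = (0::rat)"
      by (simp del: of_nat_Suc)
    then show "?D z = (((- 1) ^ card Y * of_nat (fact (card A - card Y))) *q sym_sum \<rho> Y v) z"
      unfolding scl_apply At(2) unfolding Suc.hyps(2)[symmetric] by (simp add: eq_neg_iff_add_eq_0)
  qed
qed

end

lemma (in perm_rep) col_sym_right:
  assumes p: "p \<in> col_group T t"
  shows "act T \<rho> (col_sym T t) (\<rho> p x) = of_int (sign p) *q act T \<rho> (col_sym T t) x"
proof -
  have pp: "p \<in> perms T" using p by (simp add: col_group_def)
  have s: "sign (q \<circ> p) = sign p * sign q" if "q \<in> col_group T t" for q
    using sign_perms[OF fin _ pp, of q] that by (simp add: col_group_def mult.commute)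
  have ss': "(of_int (sign p) :: rat) * (of_int (sign p) * z) = z" for z by (simp add: sign_def)
  have "(\<Sum>q\<in>col_group T t. of_int (sign q) *q \<rho> q (\<rho> p x))
      = (\<Sum>q\<in>col_group T t. of_int (sign p) *q of_int (sign (q \<circ> p)) *q \<rho> (q \<circ> p) x)"
    using pp by (intro sum.cong) (auto simp: mult col_group_def s ss')
  also have "\<dots> = (\<Sum>q\<in>col_group T t. of_int (sign p) *q of_int (sign q) *q \<rho> q x)"
    using p pp permutes_inv_o[of p T]
    by (intro sum.reindex_bij_witness[of _ "\<lambda>q. q \<circ> inv' p" "\<lambda>q. q \<circ> p"])
       (auto simp: col_group_comp col_group_inv comp_assoc)
  finally show ?thesis unfolding act_col_sym by (simp add: fv.scale_sum_right del: fv.scale_scale)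
qed

lemma permutes_split:
  assumes p: "p permutes T" and A: "A \<subseteq> T" "finite T" and pA: "\<And>x. x \<in> A \<Longrightarrow> p x \<in> A"
  obtains p1 p2 where "p1 permutes A" "p2 permutes (T - A)" "p = p2 \<circ> p1"
    "\<And>x. x \<in> T - A \<Longrightarrow> p2 x = p x"
proof -
  have fA: "finite A" using A finite_subset by blast
  have inj: "inj p" using p by (rule permutes_inj)
  then have im: "p ` A = A" using endo_inj_surj[OF fA, of p] pA by (simp add: image_subset_iff inj_on_subset)
  have out: "p x \<notin> A" if "x \<notin> A" for x
    using that im inj by (metis imageE injD)
  define p1 where "p1 = (\<lambda>x. if x \<in> A then p x else x)"
  define p2 where "p2 = (\<lambda>x. if x \<in> A then x else p x)"
  have e: "p = p2 \<circ> p1" using pA by (auto simp: p1_def p2_def)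
  have p1: "p1 permutes A"
  proof (rule bij_imp_permutes)
    show "bij_betw p1 A A"
      using inj im by (auto simp: bij_betw_def p1_def inj_on_def)
  qed (simp add: p1_def)
  have "p2 = p \<circ> inv' p1"
    unfolding e using permutes_inv_o(1)[OF p1] by (simp add: comp_assoc)
  then have "p2 permutes T"
    using permutes_compose[OF permutes_subset[OF permutes_inv[OF p1] A(1)] p] by simp
  then have p2: "p2 permutes (T - A)"
    by (rule permutes_superset) (auto simp: p2_def)
  show thesis by (rule that[OF p1 p2 e]) (simp add: p2_def)
qed

lemma inner_rep_restrict:
  assumes "inner_rep T \<rho> ip E" and S: "S \<subseteq> T" and F: "F \<subseteq> E" "fv.subspace F"
    and st: "\<And>p x. p \<in> perms S \<Longrightarrow> x \<in> F \<Longrightarrow> \<rho> p x \<in> F"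
  shows "inner_rep S \<rho> ip F"
proof -
  interpret inner_rep T \<rho> ip E by fact
  note pS = perms_mono[OF S]
  show ?thesis
  proof (rule inner_rep.intro)
    show "perm_rep S \<rho>" by (rule perm_rep_subset[OF perm_rep_axioms S])
    show "inner_rep_axioms S \<rho> ip F"
      using pS F st
      by (intro inner_rep_axioms.intro ip_add ip_scl ip_sym ip_inv ip_pos unit) auto
  qed
qed

context inner_rep
begin

lemma sym_sum_adj:
  assumes "Y \<subseteq> T" "y \<in> E" shows "ip (sym_sum \<rho> Y x) y = ip x (sym_sum \<rho> Y y)"
proof -
  have i: "inner_rep Y \<rho> ip E"
    using stable sub perms_mono[OF assms(1)] by (intro inner_rep_restrict[OF inner_rep_axioms assms(1)]) auto
  show ?thesis
    unfolding sym_sum_row_sym[OF inner_rep.axioms(1)[OF i]] by (rule inner_rep.row_sym_adj[OF i assms(2)])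
qed

text \<open>Up to a positive factor the symmetrization is an orthogonal projection, so its quadratic
  form is the squared length of the projected vector.\<close>

lemma sym_sum_pos:
  assumes "Y \<subseteq> T" "v \<in> E" shows "ip v (sym_sum \<rho> Y v) \<ge> 0"
proof -
  have i: "inner_rep Y \<rho> ip E"
    using stable sub perms_mono[OF assms(1)] by (intro inner_rep_restrict[OF inner_rep_axioms assms(1)]) auto
  let ?r = "of_nat (card (row_group Y (\<lambda>_. (0,0)))) :: rat"
  have sE: "sym_sum \<rho> Y v \<in> E" by (rule sym_sum_stable[OF assms])
  have "ip (sym_sum \<rho> Y v) (sym_sum \<rho> Y v) = ip v (sym_sum \<rho> Y (sym_sum \<rho> Y v))"
    by (rule sym_sum_adj[OF assms(1) sE])
  also have "sym_sum \<rho> Y (sym_sum \<rho> Y v) = ?r *q sym_sum \<rho> Y v"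
    unfolding sym_sum_row_sym[OF inner_rep.axioms(1)[OF i]] by (rule inner_rep.row_sym_sq[OF i])
  also have "ip v (?r *q sym_sum \<rho> Y v) = ?r * ip v (sym_sum \<rho> Y v)"
    by (simp only: ip_sym[of v] ip_scl)
  finally have "?r * ip v (sym_sum \<rho> Y v) \<ge> 0" using ip_pos'[OF sE] by simp
  moreover have "?r > 0" using inner_rep.group_card(1)[OF i, of "\<lambda>_. (0,0)"] by simp
  ultimately show ?thesis by (simp add: zero_le_mult_iff)
qed

lemma ip_right: "ip x (c *q y) = c * ip x y" "ip x (\<Sum>i\<in>I. f i) = (\<Sum>i\<in>I. ip x (f i))"
  by (simp_all only: ip_sym[of x] ip_scl ip_sum)

lemma invariants_subspace: "A \<subseteq> T \<Longrightarrow> fv.subspace (invariants A)"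
  unfolding invariants_def fv.subspace_def
  using fv.subspace_0[OF sub] fv.subspace_add[OF sub] fv.subspace_scale[OF sub]
    lin_zero[OF lin] lin_add[OF lin] lin_scl[OF lin] perms_mono[of A T] by auto

text \<open>\<open>A\<close> is placed as a new row over the tableau \<open>t'\<close> of the other
  letters. Let \<open>v\<close> be the nonzero vector made by the small column symmetrizer; the
  large one sends \<open>v\<close> to a nonzero multiple of its value at \<open>u\<close>. Pairing
  that value with \<open>v\<close> gives the sum of \<open>sign q * ip v (\<rho> q v)\<close>, in
  which every term is nonnegative by \<open>matching_sum\<close> and \<open>sym_sum_pos\<close>, and
  \<open>q = id\<close> contributes \<open>ip v v > 0\<close>. Hence nothing cancels.\<close>

lemma add_row_nonzero:
  assumes max: "\<And>Y w. Y \<subseteq> T \<Longrightarrow> card Y = Suc (card A) \<Longrightarrow> w \<in> invariants Y \<Longrightarrow> w = 0"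
    and A: "A \<subseteq> T" and u: "u \<in> invariants A"
    and injA: "inj_on (\<lambda>x. snd (t x)) A"
    and tt': "\<And>y. y \<in> T - A \<Longrightarrow> snd (t y) = snd (t' y)"
    and v: "act (T - A) \<rho> (col_sym (T - A) t') u \<noteq> 0"
  shows "act T \<rho> (col_sym T t) u \<noteq> 0"
proof -
  define S where "S = T - A"
  have ST: "S \<subseteq> T" by (auto simp: S_def)
  have fA: "finite A" using A fin finite_subset by blast
  have iS: "inner_rep S \<rho> ip (invariants A)"
  proof (rule inner_rep_restrict[OF inner_rep_axioms ST])
    show "fv.subspace (invariants A)" by (rule invariants_subspace[OF A])
    show "invariants A \<subseteq> E" by (auto simp: invariants_def)
    show "\<rho> p x \<in> invariants A" if "p \<in> perms S" "x \<in> invariants A" for p x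
      by (rule invariants_commute[OF that(1)[unfolded S_def] that(2) A])
  qed
  define v where "v = act S \<rho> (col_sym S t') u"
  have v0: "v \<noteq> 0" using v by (simp add: v_def S_def)
  have vF: "v \<in> invariants A" unfolding v_def by (rule inner_rep.stable_act[OF iS u])
  have vE: "v \<in> E" using vF by (simp add: invariants_def)
  have uE: "u \<in> E" using u by (simp add: invariants_def)
  let ?b = "act T \<rho> (col_sym T t)"
  have sub_col: "q \<in> col_group T t" if "q \<in> col_group S t'" for q
  proof -
    have q: "q permutes S" using that by (simp add: col_group_def)
    have "snd (t (q y)) = snd (t y)" if y: "y \<in> T" for y
    proof (cases "y \<in> S")
      case True
      then have "q y \<in> S" using permutes_in_image[OF q] by simp
      then show ?thesis using \<open>q \<in> col_group S t'\<close> True tt' by (simp add: col_group_def S_def)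
    next
      case False then show ?thesis using q by (simp add: permutes_def)
    qed
    then show ?thesis using permutes_subset[OF q ST] by (simp add: col_group_def)
  qed
  have bv: "?b v = of_nat (card (col_group S t')) *q ?b u"
  proof -
    have "?b v = (\<Sum>q\<in>col_group S t'. of_int (sign q) *q ?b (\<rho> q u))"
      unfolding v_def perm_rep.act_col_sym[OF inner_rep.axioms(1)[OF iS]]
      by (simp only: lin_sum[OF lin_act] lin_scl[OF lin_act])
    also have "\<dots> = (\<Sum>q\<in>col_group S t'. ?b u)"
    proof (rule sum.cong[OF refl])
      fix q assume q: "q \<in> col_group S t'"
      show "of_int (sign q) *q ?b (\<rho> q u) = ?b u"
        unfolding col_sym_right[OF sub_col[OF q]] by (simp add: sign_def fun_eq_iff)
    qed
    finally show ?thesis by (simp only: sum_const_fun)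
  qed
  have nonneg: "of_int (sign q) * ip v (\<rho> q v) \<ge> 0" if q: "q \<in> col_group T t" for q
  proof -
    have qp: "q permutes T" and qc: "\<And>y. y \<in> T \<Longrightarrow> snd (t (q y)) = snd (t y)"
      using q by (auto simp: col_group_def)
    have qc': "\<And>y. y \<in> T \<Longrightarrow> snd (t (inv' q y)) = snd (t y)"
      using col_group_inv[OF q] by (auto simp: col_group_def)
    note qi = permutes_inverses[OF qp]
    have qT: "q y \<in> T \<longleftrightarrow> y \<in> T" "inv' q y \<in> T \<longleftrightarrow> y \<in> T" for y
      using permutes_in_image[OF qp] permutes_in_image[OF permutes_inv[OF qp]] by auto
    have fixA: "q x = x" if "x \<in> A" "q x \<in> A" for x
      using that injA qc[of x] A by (auto dest: inj_onD)
    \<comment> \<open>\<open>Y\<close> consists of the letters that \<open>q\<close> brings out of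
      \<open>A\<close>, and \<open>m\<close> exchanges them with their origins. A letter that
      \<open>q\<close> keeps in \<open>A\<close> is fixed, because the letters of \<open>A\<close>
      lie in different columns. The remaining factor \<open>m \<circ> q\<close> fixes
      \<open>A\<close> pointwise and is a column permutation of \<open>t'\<close>.\<close>
    define Y where "Y = {y \<in> S. inv' q y \<in> A}"
    define m where "m = (\<lambda>z. if z \<in> A then q z else if inv' q z \<in> A then inv' q z else z)"
    have fY: "finite Y" using fin by (simp add: Y_def S_def)
    have mm: "m (m z) = z" for z
    proof (cases "z \<in> A \<and> q z \<in> A")
      case True
      then have "m z = z" using fixA[of z] by (simp add: m_def)
      then show ?thesis by simp
    next
      case False
      then show ?thesis using qi by (auto simp: m_def)
    qed
    have mat: "matching A Y m"
      unfolding matching_def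
    proof (intro conjI ballI allI impI)
      show "m z = z" if "z \<notin> A \<union> Y" for z
        using that A qT(2)[of z] by (auto simp: m_def Y_def S_def)
      show "m x = x \<or> m x \<in> Y" if "x \<in> A" for x
        using that A fixA[of x] qT(1)[of x] qi by (auto simp: m_def Y_def S_def)
      show "m y \<in> A" if "y \<in> Y" for y using that by (auto simp: m_def Y_def S_def)
    qed (use fY mm in \<open>auto simp: Y_def S_def\<close>)
    have YS: "Y \<subseteq> T - A" by (auto simp: Y_def S_def)
    have mT: "m permutes T"
      by (rule permutes_subset[OF matching_permutes[OF mat]]) (use A YS in blast)
    have mc: "snd (t (m z)) = snd (t z)" if "z \<in> T" for z
      using that qc qc' by (auto simp: m_def)
    define q' where "q' = m \<circ> q"
    have q'T: "q' permutes T" unfolding q'_def by (rule permutes_compose[OF qp mT])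
    have q'A: "q' x = x" if "x \<in> A" for x
      using that fixA[of x] qi by (auto simp: q'_def m_def)
    have q'S: "q' permutes S"
      unfolding S_def by (rule permutes_superset[OF q'T]) (auto simp: q'A)
    have q'c: "q' \<in> col_group S t'"
    proof -
      have "snd (t' (q' y)) = snd (t' y)" if y: "y \<in> S" for y
      proof -
        have "q' y \<in> S" using permutes_in_image[OF q'S] y by simp
        moreover have "snd (t (q' y)) = snd (t y)"
          using mc[of "q y"] qc[of y] qT y by (simp add: q'_def S_def)
        ultimately show ?thesis using tt' y by (simp add: S_def)
      qed
      then show ?thesis using q'S by (simp add: col_group_def)
    qed
    have e: "q = m \<circ> q'" using mm by (simp add: q'_def fun_eq_iff)
    have mp: "m \<in> perms T" "q' \<in> perms T" using mT q'T by auto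
    have "sign q = sign m * sign q'" unfolding e by (rule sign_perms[OF fin mp])
    then have sq: "sign q = (-1) ^ card Y * sign q'" using matching_sign[OF mat fA] by simp
    have "\<rho> q v = \<rho> m (\<rho> q' v)" unfolding e by (rule mult[OF mp])
    also have "\<rho> q' v = of_int (sign q') *q v"
      unfolding v_def by (rule perm_rep.col_sym_left[OF inner_rep.axioms(1)[OF iS] q'c])
    finally have qv: "\<rho> q v = of_int (sign q') *q \<rho> m v"
      by (simp only: lin_scl[OF lin[OF mp(1)]])
    have lA: "lin (sym_sum \<rho> A)" by (rule lin_sym_sum[OF perm_rep_subset[OF perm_rep_axioms A]])
    have qvE: "\<rho> q v \<in> E" using stable[of q] qp vE by simp
    have "of_nat (fact (card A)) * ip v (\<rho> q v) = ip (sym_sum \<rho> A v) (\<rho> q v)"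
      by (simp only: sym_sum_invariant[OF vF fA] ip_scl)
    also have "\<dots> = ip v (sym_sum \<rho> A (\<rho> q v))" by (rule sym_sum_adj[OF A qvE])
    also have "\<dots> = of_int (sign q') * ((- 1) ^ card Y * of_nat (fact (card A - card Y))) * ip v (sym_sum \<rho> Y v)"
      by (simp only: qv lin_scl[OF lA] matching_sum[OF max A mat YS vF] ip_right mult.assoc)
    finally have "of_nat (fact (card A)) * (of_int (sign q) * ip v (\<rho> q v))
        = (of_int (sign q) * of_int (sign q') * (- 1) ^ card Y) * of_nat (fact (card A - card Y)) * ip v (sym_sum \<rho> Y v)"
      by (simp add: mult_ac)
    \<comment> \<open>The sign in \<open>matching_sum\<close> is that of the matching, so all signs
      cancel and a nonnegative quantity is left.\<close>
    also have "of_int (sign q) * of_int (sign q') * (- 1) ^ card Y = (1 :: rat)"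
      unfolding sq by (simp add: sign_def power_mult_distrib[symmetric])
    finally have "of_nat (fact (card A)) * (of_int (sign q) * ip v (\<rho> q v)) \<ge> 0"
      using mult_nonneg_nonneg[OF _ sym_sum_pos[OF _ vE, of Y], of "of_nat (fact (card A - card Y))"] YS
      by (simp add: subset_iff)
    moreover have "(of_nat (fact (card A)) :: rat) > 0" by simp
    ultimately show ?thesis by (metis mult_le_cancel_left_pos mult_zero_right)
  qed
  have fC: "finite (col_group T t)" by (rule finite_subset[OF _ finp]) (auto simp: col_group_def)
  have "0 < ip v v" by (rule ip_pos[OF vE v0])
  also have "ip v v = of_int (sign (id :: nat \<Rightarrow> nat)) * ip v (\<rho> id v)" using unit[OF vE] by (simp add: sign_id)
  also have "\<dots> \<le> (\<Sum>q\<in>col_group T t. of_int (sign q) * ip v (\<rho> q v))"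
  proof (rule member_le_sum[where f = "\<lambda>q. of_int (sign q) * ip v (\<rho> q v)", OF _ _ fC])
    show "id \<in> col_group T t" using permutes_id[of T] by (simp add: col_group_def)
  qed (use nonneg in blast)
  also have "\<dots> = ip v (?b v)" by (simp only: act_col_sym ip_right)
  finally have "?b v \<noteq> 0" using ip_zero ip_sym by (metis less_irrefl)
  then show ?thesis unfolding bv by (metis fv.scale_zero_right)
qed

end

section \<open>Detection of every nonzero representation by a Young symmetrizer\<close>

lemma boxes_Cons: "boxes (h # \<nu>) = {0} \<times> {1..h} \<union> (\<lambda>(i, j). (Suc i, j)) ` boxes \<nu>"
proof (intro equalityI subsetI)
  fix b assume b: "b \<in> boxes (h # \<nu>)"
  then obtain i j where ij: "b = (i, j)" "i < Suc (length \<nu>)" "1 \<le> j" "j \<le> (h # \<nu>) ! i"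
    by (auto simp: boxes_def)
  show "b \<in> {0} \<times> {1..h} \<union> (\<lambda>(i, j). (Suc i, j)) ` boxes \<nu>"
  proof (cases i)
    case 0 then show ?thesis using ij by simp
  next
    case (Suc i')
    then have "(i', j) \<in> boxes \<nu>" using ij by (simp add: boxes_def)
    then show ?thesis using ij Suc by force
  qed
next
  fix b assume "b \<in> {0} \<times> {1..h} \<union> (\<lambda>(i, j). (Suc i, j)) ` boxes \<nu>"
  then show "b \<in> boxes (h # \<nu>)" by (auto simp: boxes_def)
qed

text \<open>The first row of the tableau is a largest set of letters with an invariant vector, which
  makes every vector invariant under it behave like a highest weight vector.\<close>

lemma exists_col_row_nonzero:
  assumes "inner_rep T \<rho> ip E" "e \<in> E" "e \<noteq> 0"
  shows "\<exists>\<mu> t w. tableau \<mu> T t \<and> sum_list \<mu> = card T \<and> w \<in> E \<and>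
    act T \<rho> (col_sym T t) (act T \<rho> (row_sym T t) w) \<noteq> 0"
  using assms
proof (induction "card T" arbitrary: T E e rule: less_induct)
  case less
  interpret inner_rep T \<rho> ip E by fact
  show ?case
  proof (cases "T = {}")
    case True
    have p: "perms T = {id}" by (simp add: True permutes_empty)
    have "tableau [] T (\<lambda>_. (0, 0))" by (simp add: tableau_def is_partition_def boxes_def True bij_betw_def)
    moreover have "act T \<rho> (col_sym T (\<lambda>_. (0, 0))) (act T \<rho> (row_sym T (\<lambda>_. (0, 0))) e) = e"
      using unit[OF less.prems(2)] unfolding act_def p
      by (simp add: row_sym_def col_sym_def row_group_def col_group_def permutes_id sign_id)
    ultimately show ?thesis using less.prems True by (metis card.empty sum_list.Nil)
  next
    case False
    define Q where "Q = (\<lambda>A. A \<subseteq> T \<and> (\<exists>w\<in>invariants A. w \<noteq> 0))"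
    obtain x where x: "x \<in> T" using False by blast
    have "e \<in> invariants {x}"
      using less.prems(2) unit by (auto simp: invariants_def permutes_sing)
    then have Qx: "Q {x}" using x less.prems(3) by (auto simp: Q_def)
    have "\<exists>A. Q A \<and> (\<forall>B. Q B \<longrightarrow> card B \<le> card A)"
      by (rule ex_has_greatest_nat[where P = Q and f = card and b = "Suc (card T)" and k = "{x}"])
         (use Qx in \<open>auto simp: Q_def less_Suc_eq_le intro: card_mono[OF fin]\<close>)
    then obtain A where QA: "Q A" and Amax: "\<And>B. Q B \<Longrightarrow> card B \<le> card A" by blast
    have A: "A \<subseteq> T" using QA by (simp add: Q_def)
    obtain w0 where w0: "w0 \<in> invariants A" "w0 \<noteq> 0" using QA by (auto simp: Q_def)
    have fA: "finite A" using A fin finite_subset by blast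
    define h where "h = card A"
    have h1: "h \<ge> 1" using Amax[OF Qx] by (simp add: h_def)
    define S where "S = T - A"
    have ST: "S \<subseteq> T" by (auto simp: S_def)
    have cS: "card S + h = card T" using A fin fA card_mono[OF fin A] by (simp add: S_def h_def card_Diff_subset)
    \<comment> \<open>The invariants of \<open>A\<close> are a representation of the permutations of
      the other letters. The induction continues there, with fewer letters and a smaller
      space.\<close>
    have iS: "inner_rep S \<rho> ip (invariants A)"
    proof (rule inner_rep_restrict[OF inner_rep_axioms ST])
      show "fv.subspace (invariants A)" by (rule invariants_subspace[OF A])
      show "invariants A \<subseteq> E" by (auto simp: invariants_def)
      show "\<rho> p x \<in> invariants A" if "p \<in> perms S" "x \<in> invariants A" for p x
        by (rule invariants_commute[OF that(1)[unfolded S_def] that(2) A])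
    qed
    have "card S < card T" using cS h1 by simp
    from less.hyps[OF this iS w0] obtain \<nu> t' w where
      t': "tableau \<nu> S t'" and \<nu>: "sum_list \<nu> = card S" and w: "w \<in> invariants A"
      and nz: "act S \<rho> (col_sym S t') (act S \<rho> (row_sym S t') w) \<noteq> 0" by blast
    define u where "u = act S \<rho> (row_sym S t') w"
    have rS: "perm_rep S \<rho>" by (rule inner_rep.axioms(1)[OF iS])
    have u: "u \<in> invariants A" unfolding u_def by (rule inner_rep.stable_act[OF iS w])
    have uE: "u \<in> E" using u by (simp add: invariants_def)
    have u0: "u \<noteq> 0" using nz lin_zero[OF perm_rep.lin_act[OF rS]] unfolding u_def by metis
    have u_row: "\<rho> p u = u" if "p \<in> row_group S t'" for p
      unfolding u_def by (rule perm_rep.row_sym_left[OF rS that])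
    have bt': "bij_betw t' S (boxes \<nu>)" and p\<nu>: "is_partition \<nu>" using t' by (auto simp: tableau_def)
    \<comment> \<open>The permutations of the first row of \<open>t'\<close> also fix the nonzero
      vector \<open>u\<close>, so this row is no longer than the largest set \<open>A\<close>; hence
      the new row may stand on top.\<close>
    have hd_le: "is_partition (h # \<nu>)"
    proof (cases \<nu>)
      case Nil then show ?thesis using h1 by (simp add: is_partition_def)
    next
      case (Cons a \<nu>')
      define R where "R = {y \<in> S. fst (t' y) = 0}"
      have im: "t' ` R = {0 :: nat} \<times> {1..a}"
      proof (intro equalityI subsetI)
        fix b assume "b \<in> t' ` R"
        then obtain y where y: "y \<in> S" "fst (t' y) = 0" "b = t' y" by (auto simp: R_def)
        then have "b \<in> boxes \<nu>" "fst b = 0" using bt' by (auto simp: bij_betw_def)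
        then show "b \<in> {0} \<times> {1..a}" using Cons by (auto simp: boxes_def)
      next
        fix b assume b: "b \<in> {0 :: nat} \<times> {1..a}"
        then have "b \<in> boxes \<nu>" using Cons by (auto simp: boxes_def)
        then obtain y where "y \<in> S" "b = t' y" using bt' by (auto simp: bij_betw_def)
        then show "b \<in> t' ` R" using b by (auto simp: R_def)
      qed
      have "inj_on t' R" using bt' by (auto simp: bij_betw_def R_def inj_on_def)
      then have cR: "card R = a" using card_image[of t' R] im by (simp add: card_cartesian_product)
      have "\<rho> g u = u" if g: "g \<in> perms R" for g
      proof (rule u_row)
        have gp: "g permutes R" using g by simp
        have "fst (t' (g y)) = fst (t' y)" for y
          using permutes_in_image[OF gp, of y] permutes_not_in[OF gp, of y] by (cases "y \<in> R") (auto simp: R_def)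
        moreover have "g permutes S" using permutes_subset[OF gp] by (simp add: R_def)
        ultimately show "g \<in> row_group S t'" by (simp add: row_group_def)
      qed
      then have "u \<in> invariants R" using uE by (simp add: invariants_def)
      moreover have "R \<subseteq> T" using ST by (auto simp: R_def)
      ultimately have "Q R" using u0 by (auto simp: Q_def)
      then have "a \<le> h" using Amax[of R] cR by (simp add: h_def)
      then show ?thesis using p\<nu> h1 Cons by (auto simp: is_partition_def)
    qed
    have "\<exists>f. bij_betw f A {1..h}"
      by (rule finite_same_card_bij[OF fA]) (simp_all add: h_def)
    then obtain f where f: "bij_betw f A {1..h}" by blast
    define t where "t = (\<lambda>y. if y \<in> A then (0, f y) else (Suc (fst (t' y)), snd (t' y)))"
    have bA: "bij_betw t A ({0} \<times> {1..h})"
      using f by (auto simp: bij_betw_def t_def inj_on_def image_def)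
    have bS: "bij_betw t S ((\<lambda>(i, j). (Suc i, j)) ` boxes \<nu>)"
    proof -
      have "bij_betw ((\<lambda>(i, j). (Suc i, j)) \<circ> t') S ((\<lambda>(i, j). (Suc i, j)) ` boxes \<nu>)"
        by (rule bij_betw_trans[OF bt']) (auto simp: bij_betw_def inj_on_def)
      then show ?thesis
        by (rule bij_betw_cong[THEN iffD1, rotated]) (auto simp: t_def S_def split_beta)
    qed
    have TS: "T = A \<union> S" using A by (auto simp: S_def)
    have "bij_betw t T (boxes (h # \<nu>))"
      unfolding TS boxes_Cons by (rule bij_betw_combine[OF bA bS]) auto
    then have tab: "tableau (h # \<nu>) T t" using hd_le by (simp add: tableau_def)
    have sum: "sum_list (h # \<nu>) = card T" using cS \<nu> by simp
    have max: "v = 0" if "Y \<subseteq> T" "card Y = Suc (card A)" "v \<in> invariants Y" for Y v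
      using Amax[of Y] that by (auto simp: Q_def)
    have bu: "act T \<rho> (col_sym T t) u \<noteq> 0"
    proof (rule add_row_nonzero[OF max A u])
      show "inj_on (\<lambda>x. snd (t x)) A" using f by (auto simp: bij_betw_def t_def inj_on_def)
      show "snd (t y) = snd (t' y)" if "y \<in> T - A" for y using that by (simp add: t_def)
      show "act (T - A) \<rho> (col_sym (T - A) t') u \<noteq> 0" using nz by (simp add: u_def S_def)
    qed
    \<comment> \<open>A row permutation of the stacked tableau is a permutation of \<open>A\<close>
      followed by a row permutation of \<open>t'\<close>, and both fix \<open>u\<close>.\<close>
    have "act T \<rho> (row_sym T t) u = of_nat (card (row_group T t)) *q u"
      unfolding act_row_sym sum_const_fun[symmetric]
    proof (rule sum.cong[OF refl])
      fix p assume p: "p \<in> row_group T t"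
      have pT: "p permutes T" and pr: "\<And>y. y \<in> T \<Longrightarrow> fst (t (p y)) = fst (t y)"
        using p by (auto simp: row_group_def)
      have pA: "p x \<in> A" if "x \<in> A" for x
        using pr[of x] that A by (auto simp: t_def split: if_splits)
      obtain p1 p2 where pp: "p1 permutes A" "p2 permutes (T - A)" "p = p2 \<circ> p1"
        "\<And>x. x \<in> T - A \<Longrightarrow> p2 x = p x"
        using permutes_split[OF pT A fin pA] by blast
      have "fst (t' (p2 y)) = fst (t' y)" if y: "y \<in> S" for y
      proof -
        have "p2 y \<in> S" using permutes_in_image[OF pp(2)] y by (simp add: S_def)
        then show ?thesis using pr[of y] pp(4)[of y] y by (simp add: t_def S_def)
      qed
      then have r2: "p2 \<in> row_group S t'" using pp(2) by (simp add: row_group_def S_def)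
      have pT12: "p2 \<in> perms T" "p1 \<in> perms T"
        using pp permutes_subset[OF pp(2)] permutes_subset[OF pp(1) A] by auto
      have "\<rho> p u = \<rho> p2 (\<rho> p1 u)" unfolding pp(3) by (rule mult[OF pT12])
      also have "\<rho> p1 u = u" using u pp(1) by (simp add: invariants_def)
      finally show "\<rho> p u = u" using u_row[OF r2] by simp
    qed
    then have "act T \<rho> (col_sym T t) (act T \<rho> (row_sym T t) u)
        = of_nat (card (row_group T t)) *q act T \<rho> (col_sym T t) u"
      by (simp only: lin_scl[OF lin_act])
    then have "act T \<rho> (col_sym T t) (act T \<rho> (row_sym T t) u) \<noteq> 0"
      using bu group_card(1)[of t] by (metis fv.scale_eq_0_iff)
    then show ?thesis using tab sum uE by blast
  qed
qed

text \<open>The vector found before has the row symmetrizer applied first, whereas in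
  \<open>young\<close> it comes last. Applying it once more cannot give zero, by
  \<open>row_col_zero\<close>.\<close>

lemma exists_young_nonzero:
  assumes "inner_rep T \<rho> ip E" "e \<in> E" "e \<noteq> 0"
  shows "\<exists>\<mu> t w. tableau \<mu> T t \<and> sum_list \<mu> = card T \<and> w \<in> E \<and> act T \<rho> (young T t) w \<noteq> 0"
proof -
  interpret inner_rep T \<rho> ip E by fact
  obtain \<mu> t w where t: "tableau \<mu> T t" "sum_list \<mu> = card T" and w: "w \<in> E"
    and nz: "act T \<rho> (col_sym T t) (act T \<rho> (row_sym T t) w) \<noteq> 0"
    using exists_col_row_nonzero[OF assms] by blast
  have "act T \<rho> (young T t) (act T \<rho> (row_sym T t) w) \<noteq> 0"
    using row_col_zero[OF stable_act[OF w] _ refl] nz unfolding act_conv by blast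
  then show ?thesis using t stable_act[OF w] by blast
qed

section \<open>Left ideals generated by Young symmetrizers\<close>

lemma left_reg_id: "left_reg id x = x"
  by (simp add: left_reg_def)

lemma left_reg_inner_rep:
  assumes "finite T"
  shows "inner_rep T left_reg (\<lambda>x y. \<Sum>p\<in>perms T. x p * y p) (alg T)"
proof (intro inner_rep.intro left_reg_rep[OF assms] inner_rep_axioms.intro)
  fix p x y assume p: "p \<in> perms T"
  show "(\<Sum>q\<in>perms T. left_reg p x q * left_reg p y q) = (\<Sum>q\<in>perms T. x q * y q)"
    using p by (intro sum.reindex_bij_witness[of _ "\<lambda>q. p \<circ> q" "\<lambda>q. inv' p \<circ> q"])
      (auto simp: left_reg_def permutes_compose permutes_inv comp_assoc[symmetric] permutes_inv_o)
next
  fix x assume x: "x \<in> alg T" "x \<noteq> 0"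
  then obtain p where p: "x p \<noteq> 0" by (auto simp: fun_eq_iff)
  then have "p \<in> perms T" using x(1) by (auto simp: alg_def)
  then have "x p * x p \<le> (\<Sum>q\<in>perms T. x q * x q)"
    using assms by (intro member_le_sum) (auto intro: finite_permutations)
  moreover have "x p * x p > 0" using p by (metis mult_neg_neg mult_pos_pos linorder_neqE)
  ultimately show "0 < (\<Sum>p\<in>perms T. x p * x p)" by simp
next
  show "fv.subspace (alg T)" unfolding fv.subspace_def by (auto intro: alg_add alg_scl alg_zero)
qed (auto simp: sum.distrib sum_distrib_left algebra_simps left_reg_alg left_reg_id)

text \<open>Inversion of permutations gives the anti-involution \<open>st\<close>, and the
  coefficient at \<open>id\<close> of \<open>st z\<close> times \<open>z\<close> is the sum of
  squares of \<open>z\<close>. So \<open>z\<close>, the product of \<open>st x\<close> and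
  \<open>x\<close>, is nonzero; it is fixed by \<open>st\<close>, hence its square is nonzero for
  the same reason.\<close>

lemma exists_square_nonzero:
  assumes T: "finite T" and x: "x \<in> alg T" "x \<noteq> 0"
  shows "\<exists>y\<in>alg T. conv T (conv T y x) (conv T y x) \<noteq> 0"
proof -
  define st where "st = (\<lambda>(x :: (nat \<Rightarrow> nat) \<Rightarrow> rat) p. if p \<in> perms T then x (inv' p) else 0)"
  have at_id: "conv T (st z) z' id = (\<Sum>p\<in>perms T. z (inv' p) * z' (inv' p))" for z z'
    by (auto simp: act_def sum_fun_apply left_reg_def st_def intro!: sum.cong)
  have sq: "conv T (st z) z id \<noteq> 0" if "z \<in> alg T" "z \<noteq> 0" for z
  proof -
    have "conv T (st z) z id = (\<Sum>p\<in>perms T. z p * z p)"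
      unfolding at_id
      by (rule sum.reindex_bij_witness[of _ "inv'" "inv'"]) (auto simp: permutes_inv permutes_inv_inv)
    then show ?thesis using inner_rep.ip_pos[OF left_reg_inner_rep[OF T] that] by simp
  qed
  define z where "z = conv T (st x) x"
  have z: "z \<in> alg T" unfolding z_def using x(1) by (rule conv_alg)
  have "z id \<noteq> 0" unfolding z_def by (rule sq[OF x])
  then have z0: "z \<noteq> 0" by auto
  have "st z = z"
  proof
    fix q
    show "st z q = z q"
    proof (cases "q \<in> perms T")
      case True
      then have qp: "q permutes T" by simp
      have "z (inv' q) = (\<Sum>p\<in>perms T. x (inv' p) * x (inv' p \<circ> inv' q))"
        by (simp add: z_def act_def sum_fun_apply left_reg_def st_def)
      also have "\<dots> = (\<Sum>p\<in>perms T. x (inv' p) * x (inv' p \<circ> q))"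
      proof (rule sum.reindex_bij_witness[of _ "\<lambda>p. inv' q \<circ> p" "\<lambda>p. q \<circ> p"])
        fix p assume p: "p \<in> perms T"
        have pp: "p permutes T" using p by simp
        show "inv' q \<circ> (q \<circ> p) = p" "q \<circ> (inv' q \<circ> p) = p"
          using inv_perms_o[OF True] by (simp_all only: comp_assoc[symmetric] id_comp)
        show "q \<circ> p \<in> perms T" "inv' q \<circ> p \<in> perms T"
          using perms_comp[OF True p] perms_comp[OF perms_inv[OF True] p] by auto
        have i: "inv' (q \<circ> p) = inv' p \<circ> inv' q"
          using permutes_bij[OF qp] permutes_bij[OF pp] by (rule o_inv_distrib)
        have "inv' p \<circ> inv' q \<circ> q = inv' p"
          using inv_perms_o(1)[OF True] by (simp only: comp_assoc comp_id)
        then show "x (inv' (q \<circ> p)) * x (inv' (q \<circ> p) \<circ> q) = x (inv' p) * x (inv' p \<circ> inv' q)"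
          unfolding i by (simp only: mult.commute)
      qed
      also have "\<dots> = z q" by (simp add: z_def act_def sum_fun_apply left_reg_def st_def)
      finally show ?thesis using True by (simp add: st_def)
    next
      case False then show ?thesis using z by (auto simp: st_def alg_def)
    qed
  qed
  then have "conv T z z id \<noteq> 0" using sq[OF z z0] by simp
  then have "conv T z z \<noteq> 0" by auto
  moreover have "st x \<in> alg T" by (auto simp: st_def alg_def)
  ultimately show ?thesis unfolding z_def by blast
qed

lemma conv_assoc: "finite T \<Longrightarrow> conv T (conv T a b) x = conv T a (conv T b x)"
  by (rule perm_rep.act_conv[OF left_reg_rep])

lemma conv_delta_left: "finite T \<Longrightarrow> conv T (delta id) x = x"
  using perm_rep.act_delta[OF left_reg_rep, of T id x] by (simp add: permutes_id left_reg_id)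

lemma young_alg: "young T t \<in> alg T"
  by (rule conv_alg[OF col_sym_alg])

text \<open>Writing the Young symmetrizer as \<open>a b\<close>, the product is
  \<open>a (b x a) b\<close>, to which \<open>young_collapse\<close> applies.\<close>

lemma young_sandwich:
  assumes T: "finite T" and t: "tableau \<mu> T t"
  shows "\<exists>q. conv T (young T t) (conv T x (young T t)) = q *q young T t"
proof -
  have "conv T (young T t) (conv T x (young T t))
     = conv T (row_sym T t) (conv T (conv T (col_sym T t) (conv T x (row_sym T t))) (col_sym T t))"
    by (simp only: conv_assoc[OF T])
  then show ?thesis using young_collapse[OF T t] by metis
qed

text \<open>The coefficient at \<open>id\<close> is 1: a permutation preserving both rows and
  columns fixes every box, so the two groups meet in the identity.\<close>

lemma young_nonzero:
  assumes T: "finite T" and t: "tableau \<mu> T t"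
  shows "young T t \<noteq> 0"
proof -
  interpret L: perm_rep T left_reg by (rule left_reg_rep[OF T])
  have inj: "inj_on t T" using t by (simp add: tableau_def bij_betw_def)
  have fR: "finite (row_group T t)" by (rule finite_subset[OF _ L.finp]) (auto simp: row_group_def)
  have idR: "id \<in> row_group T t" using permutes_id[of T] by (simp add: row_group_def)
  have one: "col_sym T t (inv' p \<circ> id) = (if p = id then 1 else 0)" if p: "p \<in> row_group T t" for p
  proof (cases "p = id")
    case True
    have "id \<in> col_group T t" using permutes_id[of T] by (simp add: col_group_def)
    then show ?thesis by (simp only: True inv_id comp_id col_sym_def if_True sign_id of_int_1 simp_thms)
  next
    case False
    have "inv' p \<notin> col_group T t"
    proof
      assume c: "inv' p \<in> col_group T t"
      have pp: "p permutes T" using p by (simp add: row_group_def)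
      have r: "inv' p \<in> row_group T t" by (rule row_group_inv[OF p])
      have "inv' p y = y" for y
      proof (cases "y \<in> T")
        case True
        then have "t (inv' p y) = t y" using r c by (auto simp: row_group_def col_group_def prod_eq_iff)
        then show ?thesis using True inj permutes_in_image[OF permutes_inv[OF pp]] by (auto dest: inj_onD)
      next
        case False then show ?thesis using permutes_not_in[OF permutes_inv[OF pp]] by simp
      qed
      then have "inv' p = id" by (simp add: fun_eq_iff)
      then have "p = id" using permutes_inv_inv[OF pp] by (metis inv_id)
      then show False using False by simp
    qed
    then show ?thesis using False by (simp only: comp_id col_sym_def if_False)
  qed
  have "young T t id = (\<Sum>p\<in>row_group T t. col_sym T t (inv' p \<circ> id))"
    unfolding L.act_row_sym by (simp only: sum_fun_apply left_reg_def)
  also have "\<dots> = (\<Sum>p\<in>row_group T t. if p = id then 1 else 0)"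
    by (rule sum.cong[OF refl one])
  also have "\<dots> = 1" using fR idR by simp
  finally show ?thesis by auto
qed

text \<open>The scalar is known classically as the group order divided by a dimension, but only its
  nonvanishing matters. If \<open>a b a b\<close> were zero, \<open>row_col_zero\<close> would give
  \<open>b a b = 0\<close> and \<open>col_row_zero\<close> would give
  \<open>a b = 0\<close>.\<close>

lemma young_quasi_idempotent:
  assumes T: "finite T" and t: "tableau \<mu> T t"
  shows "\<exists>q. q \<noteq> 0 \<and> conv T (young T t) (young T t) = q *q young T t"
proof -
  interpret L: inner_rep T left_reg "\<lambda>x y. \<Sum>p\<in>perms T. x p * y p" "alg T"
    by (rule left_reg_inner_rep[OF T])
  obtain q where q: "conv T (young T t) (conv T (delta id) (young T t)) = q *q young T t"
    using young_sandwich[OF T t] by blast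
  have qq: "conv T (young T t) (young T t) = q *q young T t"
    using q by (simp only: conv_delta_left[OF T])
  have "q \<noteq> 0"
  proof
    assume "q = 0"
    then have z: "conv T (row_sym T t) (conv T (col_sym T t) (young T t)) = 0"
      using qq by (simp only: conv_assoc[OF T] fv.scale_zero_left)
    have "conv T (col_sym T t) (young T t) = 0"
      by (rule L.row_col_zero[OF young_alg z refl])
    then have "young T t = 0"
      by (rule L.col_row_zero[OF col_sym_alg _ conv_delta_id[OF T col_sym_alg, symmetric]])
    then show False using young_nonzero[OF T t] by simp
  qed
  then show ?thesis using qq by blast
qed

text \<open>The left ideal of \<open>k\<close> contains an element \<open>y k\<close> with nonzero
  square; written out with \<open>k = a c\<close>, that square has \<open>c y k\<close> as a
  factor.\<close>

lemma left_ideal_nonzero: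
  assumes T: "finite T" and k: "k = conv T a c" "k \<noteq> 0" and c: "c \<in> alg T"
  shows "\<exists>y\<in>alg T. conv T c (conv T y k) \<noteq> 0"
proof -
  have kA: "k \<in> alg T" unfolding k(1) by (rule conv_alg[OF c])
  obtain y where y: "y \<in> alg T" "conv T (conv T y k) (conv T y k) \<noteq> 0"
    using exists_square_nonzero[OF T kA k(2)] by blast
  have kz: "conv T k z = conv T a (conv T c z)" for z
    by (simp only: k(1) conv_assoc[OF T])
  have "conv T (conv T y k) (conv T y k) = conv T y (conv T a (conv T c (conv T y k)))"
    using kz[of "conv T y k"] by (simp only: conv_assoc[OF T])
  then have "conv T c (conv T y k) \<noteq> 0"
    using y(2) lin_zero[OF perm_rep.lin_act[OF left_reg_rep[OF T]]] by metis
  then show ?thesis using y(1) by blast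
qed

lemma group_conj:
  assumes s: "\<sigma> \<in> perms T" and st: "\<And>y. y \<in> T \<Longrightarrow> t y = s (\<sigma> y)"
  shows "p \<in> row_group T t \<Longrightarrow> \<sigma> \<circ> p \<circ> inv' \<sigma> \<in> row_group T s"
    and "p \<in> col_group T t \<Longrightarrow> \<sigma> \<circ> p \<circ> inv' \<sigma> \<in> col_group T s"
proof -
  have sp: "\<sigma> permutes T" using s by simp
  note i = permutes_inverses[OF sp]
  note m = permutes_in_image[OF sp] permutes_in_image[OF permutes_inv[OF sp]]
  have e: "s (\<sigma> (p (inv' \<sigma> y))) = t (p (inv' \<sigma> y))" "s y = t (inv' \<sigma> y)" "inv' \<sigma> y \<in> T"
    if "p permutes T" "y \<in> T" for p y
    using st i m permutes_in_image[OF that(1)] that(2) by auto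
  show "\<sigma> \<circ> p \<circ> inv' \<sigma> \<in> row_group T s" if p: "p \<in> row_group T t"
  proof -
    have pp: "p permutes T" using p by (simp add: row_group_def)
    have "\<sigma> \<circ> p \<circ> inv' \<sigma> \<in> perms T" using perms_comp[OF perms_comp[OF s] perms_inv[OF s]] pp by blast
    moreover have "fst (s ((\<sigma> \<circ> p \<circ> inv' \<sigma>) y)) = fst (s y)" if y: "y \<in> T" for y
      unfolding comp_def e[OF pp y] using p e(3)[OF pp y] by (simp add: row_group_def)
    ultimately show ?thesis by (simp only: row_group_def) blast
  qed
  show "\<sigma> \<circ> p \<circ> inv' \<sigma> \<in> col_group T s" if p: "p \<in> col_group T t"
  proof -
    have pp: "p permutes T" using p by (simp add: col_group_def)
    have "\<sigma> \<circ> p \<circ> inv' \<sigma> \<in> perms T" using perms_comp[OF perms_comp[OF s] perms_inv[OF s]] pp by blast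
    moreover have "snd (s ((\<sigma> \<circ> p \<circ> inv' \<sigma>) y)) = snd (s y)" if y: "y \<in> T" for y
      unfolding comp_def e[OF pp y] using p e(3)[OF pp y] by (simp add: col_group_def)
    ultimately show ?thesis by (simp only: col_group_def) blast
  qed
qed

context perm_rep
begin

lemma young_conj:
  assumes s: "\<sigma> \<in> perms T" and st: "\<And>y. y \<in> T \<Longrightarrow> t y = s (\<sigma> y)"
  shows "\<rho> \<sigma> (act T \<rho> (row_sym T t) x) = act T \<rho> (row_sym T s) (\<rho> \<sigma> x)"
    and "\<rho> \<sigma> (act T \<rho> (col_sym T t) x) = act T \<rho> (col_sym T s) (\<rho> \<sigma> x)"
    and "\<rho> \<sigma> (act T \<rho> (young T t) x) = act T \<rho> (young T s) (\<rho> \<sigma> x)"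
proof -
  have sp: "\<sigma> permutes T" using s by simp
  have ts: "s y = t (inv' \<sigma> y)" if "y \<in> T" for y
    using st permutes_inverses[OF sp] permutes_in_image[OF permutes_inv[OF sp]] that by auto
  note c1 = group_conj[where t = t and s = s, OF s st]
  note c2 = group_conj[where t = s and s = t, OF perms_inv[OF s] ts, unfolded permutes_inv_inv[OF sp]]
  have w: "inv' \<sigma> \<circ> (\<sigma> \<circ> p \<circ> inv' \<sigma>) \<circ> \<sigma> = p" "\<sigma> \<circ> (inv' \<sigma> \<circ> p \<circ> \<sigma>) \<circ> inv' \<sigma> = p" for p
    using permutes_inverses[OF sp] by (simp_all add: fun_eq_iff)
  have e: "\<sigma> \<circ> p \<circ> inv' \<sigma> \<circ> \<sigma> = \<sigma> \<circ> p" for p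
    using permutes_inverses[OF sp] by (simp add: fun_eq_iff)
  have m: "\<rho> \<sigma> (\<rho> p x) = \<rho> (\<sigma> \<circ> p \<circ> inv' \<sigma>) (\<rho> \<sigma> x)" if "p \<in> perms T" for p x
    using mult[OF s that, of x] mult[OF perms_comp[OF perms_comp[OF s that] perms_inv[OF s]] s, of x]
    by (simp only: e)
  have rp: "p \<in> perms T" if "p \<in> row_group T t \<or> p \<in> col_group T t" for p
    using that by (auto simp: row_group_def col_group_def)
  have row: "\<rho> \<sigma> (act T \<rho> (row_sym T t) x) = act T \<rho> (row_sym T s) (\<rho> \<sigma> x)" for x
    unfolding act_row_sym lin_sum[OF lin[OF s]]
    by (rule sum.reindex_bij_witness[of _ "\<lambda>p. inv' \<sigma> \<circ> p \<circ> \<sigma>" "\<lambda>p. \<sigma> \<circ> p \<circ> inv' \<sigma>"])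
       (use c1(1) c2(1) w m rp in \<open>simp_all only: simp_thms\<close>)
  have sg: "sign (\<sigma> \<circ> p \<circ> inv' \<sigma>) = sign p" if "p \<in> perms T" for p
    using sign_perms[OF fin perms_comp[OF s that] perms_inv[OF s]] sign_perms[OF fin s that]
      sign_perms[OF fin perms_inv[OF s] s] inv_perms_o(1)[OF s] sign_id
    by (simp add: mult.left_commute mult.commute)
  have col: "\<rho> \<sigma> (act T \<rho> (col_sym T t) x) = act T \<rho> (col_sym T s) (\<rho> \<sigma> x)" for x
    unfolding act_col_sym lin_sum[OF lin[OF s]] lin_scl[OF lin[OF s]]
    by (rule sum.reindex_bij_witness[of _ "\<lambda>p. inv' \<sigma> \<circ> p \<circ> \<sigma>" "\<lambda>p. \<sigma> \<circ> p \<circ> inv' \<sigma>"])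
       (use c1(2) c2(2) w m rp sg in \<open>simp_all only: simp_thms\<close>)
  show "\<rho> \<sigma> (act T \<rho> (row_sym T t) x) = act T \<rho> (row_sym T s) (\<rho> \<sigma> x)" by (rule row)
  show "\<rho> \<sigma> (act T \<rho> (col_sym T t) x) = act T \<rho> (col_sym T s) (\<rho> \<sigma> x)" by (rule col)
  show "\<rho> \<sigma> (act T \<rho> (young T t) x) = act T \<rho> (young T s) (\<rho> \<sigma> x)"
    by (simp only: act_conv row col)
qed

end

lemma tableau_relabel:
  assumes T: "finite T" and t: "tableau \<mu> T t" and s: "tableau \<mu> T s"
  shows "\<exists>\<sigma>\<in>perms T. \<forall>y\<in>T. t y = s (\<sigma> y)"
proof -
  have bt: "bij_betw t T (boxes \<mu>)" and bs: "bij_betw s T (boxes \<mu>)" using t s by (auto simp: tableau_def)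
  define \<sigma> where "\<sigma> = (\<lambda>y. if y \<in> T then the_inv_into T s (t y) else y)"
  have "bij_betw (the_inv_into T s \<circ> t) T T"
    by (rule bij_betw_trans[OF bt bij_betw_the_inv_into[OF bs]])
  then have "bij_betw \<sigma> T T"
    by (rule bij_betw_cong[THEN iffD1, rotated]) (simp add: \<sigma>_def)
  then have "\<sigma> permutes T" by (rule bij_imp_permutes) (simp add: \<sigma>_def)
  moreover have "t y = s (\<sigma> y)" if "y \<in> T" for y
  proof -
    have "t y \<in> s ` T" using that bt bs by (auto simp: bij_betw_def)
    then show ?thesis
      using that f_the_inv_into_f[OF bij_betw_imp_inj_on[OF bs]] by (simp add: \<sigma>_def)
  qed
  ultimately show ?thesis by blast
qed


text \<open>This identification lets the symmetrizer of \<open>{1..n}\<close> be multiplied with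
  that of \<open>{1..Suc n}\<close> inside one algebra.\<close>

lemma act_mono:
  assumes "finite T" "S \<subseteq> T" "a \<in> alg S"
  shows "act T \<rho> a x = act S \<rho> a x"
  unfolding act_def
  by (rule sum.mono_neutral_right)
     (use assms perms_mono[OF assms(2)] in \<open>auto simp: finite_permutations alg_def\<close>)

section \<open>Standard tableaux and padded partitions\<close>

definition std :: "nat list \<Rightarrow> nat \<Rightarrow> nat \<times> nat" where
  "std \<mu> i = (tableau_row \<mu> i, tableau_col \<mu> i)"

lemma tableau_row_eq:
  assumes "r < length \<mu>" "sum_list (take r \<mu>) < i" "i \<le> sum_list (take (Suc r) \<mu>)"
  shows "tableau_row \<mu> i = r"
  unfolding tableau_row_def
proof (rule Least_equality)
  fix r' assume r': "i \<le> sum_list (take (Suc r') \<mu>)"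
  show "r \<le> r'"
  proof (rule ccontr)
    assume "\<not> r \<le> r'"
    then have "take (Suc r') \<mu> = take (Suc r') (take r \<mu>)" by (simp add: min_def)
    then have "sum_list (take (Suc r') \<mu>) \<le> sum_list (take r \<mu>)"
      by (metis append_take_drop_id le_add1 sum_list_append)
    then show False using r' assms by simp
  qed
qed fact

lemma tableau_row_exists:
  fixes \<mu> :: "nat list"
  assumes "1 \<le> i" "i \<le> sum_list \<mu>"
  shows "\<exists>r<length \<mu>. sum_list (take r \<mu>) < i \<and> i \<le> sum_list (take (Suc r) \<mu>)"
  using assms
proof (induction \<mu> arbitrary: i)
  case (Cons a \<mu>)
  show ?case
  proof (cases "i \<le> a")
    case True then show ?thesis using Cons.prems by (intro exI[of _ 0]) simp
  next
    case False
    then obtain r where "r < length \<mu>" "sum_list (take r \<mu>) < i - a" "i - a \<le> sum_list (take (Suc r) \<mu>)"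
      using Cons.IH[of "i - a"] Cons.prems False by force
    then show ?thesis using False by (intro exI[of _ "Suc r"]) auto
  qed
qed simp

lemma std_tableau:
  assumes "is_partition \<mu>"
  shows "tableau \<mu> {1..sum_list \<mu>} (std \<mu>)"
proof -
  have sp: "\<exists>r<length \<mu>. sum_list (take r \<mu>) < i \<and> i \<le> sum_list (take r \<mu>) + \<mu> ! r \<and>
      std \<mu> i = (r, i - sum_list (take r \<mu>))" if i: "i \<in> {1..sum_list \<mu>}" for i
  proof -
    obtain r where r: "r < length \<mu>" "sum_list (take r \<mu>) < i" "i \<le> sum_list (take (Suc r) \<mu>)"
      using tableau_row_exists[of i \<mu>] i by auto
    then have "tableau_row \<mu> i = r" by (rule tableau_row_eq)
    then show ?thesis
      using r by (intro exI[of _ r]) (simp add: std_def tableau_col_def take_Suc_conv_app_nth)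
  qed
  have "inj_on (std \<mu>) {1..sum_list \<mu>}"
  proof (rule inj_onI)
    fix i i' assume "i \<in> {1..sum_list \<mu>}" "i' \<in> {1..sum_list \<mu>}" "std \<mu> i = std \<mu> i'"
    then show "i = i'" using sp[of i] sp[of i'] by auto
  qed
  moreover have "std \<mu> ` {1..sum_list \<mu>} = boxes \<mu>"
  proof (intro equalityI subsetI)
    fix b assume "b \<in> std \<mu> ` {1..sum_list \<mu>}"
    then obtain i where i: "i \<in> {1..sum_list \<mu>}" "b = std \<mu> i" by blast
    show "b \<in> boxes \<mu>" using sp[OF i(1)] i(2) by (auto simp: boxes_def)
  next
    fix b assume "b \<in> boxes \<mu>"
    then obtain r j where b: "b = (r, j)" "r < length \<mu>" "1 \<le> j" "j \<le> \<mu> ! r" by (auto simp: boxes_def)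
    define i where "i = sum_list (take r \<mu>) + j"
    have i2: "sum_list (take r \<mu>) < i" "i \<le> sum_list (take (Suc r) \<mu>)"
      using b by (auto simp: i_def take_Suc_conv_app_nth)
    have "sum_list (take (Suc r) \<mu>) \<le> sum_list \<mu>"
      by (metis append_take_drop_id le_add1 sum_list_append)
    then have "i \<in> {1..sum_list \<mu>}" using i2 by simp
    moreover have "std \<mu> i = b"
      using tableau_row_eq[OF b(2) i2] b(1) by (simp add: std_def tableau_col_def i_def)
    ultimately show "b \<in> std \<mu> ` {1..sum_list \<mu>}" by blast
  qed
  ultimately show ?thesis using assms by (simp add: tableau_def bij_betw_def)
qed

lemma padded_facts:
  assumes "is_partition \<mu>" "padding_exists \<mu> n" "n \<ge> 1"
  shows "is_partition (padded \<mu> n)" "sum_list (padded \<mu> n) = n"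
proof -
  show "sum_list (padded \<mu> n) = n" using assms by (simp add: padded_def padding_exists_def)
  have "hd \<mu> \<le> n - sum_list \<mu>" if "\<mu> \<noteq> []" using that assms(2) by (simp add: padding_exists_def)
  then show "is_partition (padded \<mu> n)"
    using assms by (cases \<mu>) (auto simp: is_partition_def padded_def)
qed

definition cy :: "nat list \<Rightarrow> nat \<Rightarrow> (nat \<Rightarrow> nat) \<Rightarrow> rat" where
  "cy \<mu> n = young {1..n} (std (padded \<mu> n))"

lemma cy_tableau:
  assumes "is_partition \<mu>" "padding_exists \<mu> n" "n \<ge> 1"
  shows "tableau (padded \<mu> n) {1..n} (std (padded \<mu> n))"
  using std_tableau[OF padded_facts(1)[OF assms]] padded_facts(2)[OF assms] by simp

lemma cy_alg: "cy \<mu> n \<in> alg {1..n}"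
  unfolding cy_def by (rule young_alg)

lemma cy_sandwich:
  assumes "is_partition \<mu>" "padding_exists \<mu> n" "n \<ge> 1"
  shows "\<exists>q. conv {1..n} (cy \<mu> n) (conv {1..n} x (cy \<mu> n)) = q *q cy \<mu> n"
  unfolding cy_def by (rule young_sandwich[OF _ cy_tableau[OF assms]]) simp

lemma cy_square:
  assumes "is_partition \<mu>" "padding_exists \<mu> n" "n \<ge> 1"
  shows "\<exists>q. q \<noteq> 0 \<and> conv {1..n} (cy \<mu> n) (cy \<mu> n) = q *q cy \<mu> n"
  unfolding cy_def by (rule young_quasi_idempotent[OF _ cy_tableau[OF assms]]) simp

text \<open>Tableaux of equal shape differ by a relabelling, which conjugates the symmetrizers, so
  the tableau found may be replaced by the standard one. Its shape is \<open>padded \<nu> n\<close>,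
  where \<open>\<nu>\<close> drops the first part.\<close>

lemma cy_complete:
  assumes i: "inner_rep {1..n} \<rho> ip E" and e: "e \<in> E" "e \<noteq> 0" and n: "n \<ge> 1"
  shows "\<exists>\<mu> w. is_partition \<mu> \<and> padding_exists \<mu> n \<and> w \<in> E \<and> act {1..n} \<rho> (cy \<mu> n) w \<noteq> 0"
proof -
  interpret inner_rep "{1..n}" \<rho> ip E by fact
  obtain \<mu> t w where t: "tableau \<mu> {1..n} t" and s: "sum_list \<mu> = card {1..n}" and w: "w \<in> E"
    and nz: "act {1..n} \<rho> (young {1..n} t) w \<noteq> 0"
    using exists_young_nonzero[OF i e] by blast
  have p: "is_partition \<mu>" using t by (simp add: tableau_def)
  have "\<mu> \<noteq> []" using s n by auto
  then obtain a \<nu> where \<mu>: "\<mu> = a # \<nu>" by (cases \<mu>) auto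
  have pad: "padded \<nu> n = \<mu>" using s \<mu> by (simp add: padded_def)
  have p\<nu>: "is_partition \<nu>" using p \<mu> by (simp add: is_partition_def)
  have ex: "padding_exists \<nu> n" using p s \<mu> by (cases \<nu>) (auto simp: is_partition_def padding_exists_def)
  note std = cy_tableau[OF p\<nu> ex n, unfolded pad]
  obtain \<sigma> where \<sigma>: "\<sigma> \<in> perms {1..n}" "\<forall>y\<in>{1..n}. t y = std \<mu> (\<sigma> y)"
    using tableau_relabel[OF fin t std] by blast
  have "\<rho> \<sigma> (act {1..n} \<rho> (young {1..n} t) w) = act {1..n} \<rho> (cy \<nu> n) (\<rho> \<sigma> w)"
    unfolding cy_def pad by (rule young_conj(3)[OF \<sigma>(1)]) (use \<sigma>(2) in blast)
  moreover have "\<rho> \<sigma> (act {1..n} \<rho> (young {1..n} t) w) \<noteq> 0"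
    using unit_inv(2)[OF \<sigma>(1) stable_act[OF w, of "young {1..n} t"]] nz
      lin_zero[OF lin[OF perms_inv[OF \<sigma>(1)]]] by metis
  ultimately have "act {1..n} \<rho> (cy \<nu> n) (\<rho> \<sigma> w) \<noteq> 0" by metis
  then show ?thesis using p\<nu> ex stable[OF \<sigma>(1) w] by blast
qed

text \<open>Appending the letter \<open>n + 1\<close> to the first row does not change the column group, because
  the new box is alone in its column.\<close>

lemma cy_theta:
  assumes "is_partition \<mu>" "padding_exists \<mu> n" "n \<ge> 1"
  shows "\<exists>\<sigma>\<in>perms {1..Suc n}. \<forall>x. \<exists>q.
    conv {1..Suc n} (cy \<mu> (Suc n)) (conv {1..Suc n} x (cy \<mu> n))
      = q *q conv {1..Suc n} (cy \<mu> (Suc n)) (delta \<sigma>)"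
proof -
  let ?S = "{1..n}" and ?T = "{1..Suc n}"
  have T: "finite ?T" and ST: "?S \<subseteq> ?T" by auto
  interpret L: perm_rep ?T left_reg by (rule left_reg_rep[OF T])
  have ex': "padding_exists \<mu> (Suc n)" using assms(2) by (simp add: padding_exists_def)
  define s where "s = std (padded \<mu> n)"
  \<comment> \<open>The standard tableau of \<open>padded \<mu> (Suc n)\<close> is filled row by row
    and in general does not extend that of \<open>padded \<mu> n\<close>. The tableau
    \<open>t\<close> does, with \<open>Suc n\<close> at the end of the first row;
    \<open>\<sigma>\<close> below relabels it to the standard one.\<close>
  define t where "t = (\<lambda>y. if y = Suc n then (0, Suc n - sum_list \<mu>) else s y)"
  have n\<mu>: "sum_list \<mu> \<le> n" using assms(2) by (simp add: padding_exists_def)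
  have bs: "bij_betw s ?S (boxes (padded \<mu> n))"
    using cy_tableau[OF assms] by (simp add: tableau_def s_def)
  have bx: "boxes (padded \<mu> (Suc n)) = boxes (padded \<mu> n) \<union> {(0, Suc n - sum_list \<mu>)}"
    using n\<mu> unfolding padded_def boxes_Cons by (auto simp: Suc_diff_le le_Suc_eq)
  have TS: "?T = ?S \<union> {Suc n}" by auto
  have "bij_betw t ?T (boxes (padded \<mu> (Suc n)))"
    unfolding TS bx
  proof (rule bij_betw_combine)
    show "bij_betw t ?S (boxes (padded \<mu> n))"
      by (rule bij_betw_cong[THEN iffD1, OF _ bs]) (simp add: t_def)
    show "bij_betw t {Suc n} {(0, Suc n - sum_list \<mu>)}" by (simp add: bij_betw_def t_def)
    show "boxes (padded \<mu> n) \<inter> {(0, Suc n - sum_list \<mu>)} = {}"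
      using n\<mu> by (auto simp: padded_def boxes_def)
  qed
  then have tab: "tableau (padded \<mu> (Suc n)) ?T t"
    using padded_facts(1)[OF assms(1) ex'] by (simp add: tableau_def)
  have col_small: "snd (s y) < Suc n - sum_list \<mu>" if "y \<in> ?S" for y
  proof -
    have "s y \<in> boxes (padded \<mu> n)" using bs that by (auto simp: bij_betw_def)
    then obtain i j where ij: "s y = (i, j)" "i < length (padded \<mu> n)" "j \<le> padded \<mu> n ! i"
      by (auto simp: boxes_def)
    have "padded \<mu> n ! i \<le> padded \<mu> n ! 0"
      using partition_nth_antimono[OF padded_facts(1)[OF assms], of 0 i] ij(2) by simp
    then show ?thesis using ij n\<mu> by (simp add: padded_def)
  qed
  have "col_group ?T t = col_group ?S s"
  proof (intro equalityI subsetI)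
    fix p assume p: "p \<in> col_group ?T t"
    have pp: "p permutes ?T" using p by (simp add: col_group_def)
    have fx: "p (Suc n) = Suc n"
    proof (rule ccontr)
      assume ne: "p (Suc n) \<noteq> Suc n"
      have "p (Suc n) \<in> ?T" using permutes_in_image[OF pp, of "Suc n"] by simp
      then have "p (Suc n) \<in> ?S" using ne by auto
      then have "snd (t (p (Suc n))) < snd (t (Suc n))" using col_small ne by (simp add: t_def)
      then show False using p by (simp add: col_group_def)
    qed
    have pS: "p permutes ?S"
      by (rule permutes_superset[OF pp]) (use fx in \<open>auto simp: le_Suc_eq\<close>)
    have "snd (s (p y)) = snd (s y)" if y: "y \<in> ?S" for y
    proof -
      have "snd (t (p y)) = snd (t y)" using p y by (simp add: col_group_def)
      moreover have "p y \<in> ?S" using permutes_in_image[OF pS] y by blast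
      ultimately show ?thesis using y by (auto simp: t_def split: if_splits)
    qed
    then show "p \<in> col_group ?S s" using pS by (simp add: col_group_def)
  next
    fix p assume p: "p \<in> col_group ?S s"
    have pp: "p permutes ?S" using p by (simp add: col_group_def)
    have "snd (t (p y)) = snd (t y)" if y: "y \<in> ?T" for y
    proof (cases "y = Suc n")
      case True
      then show ?thesis using permutes_not_in[OF pp, of "Suc n"] by simp
    next
      case False
      then have yS: "y \<in> ?S" using y by auto
      then have "p y \<in> ?S" using permutes_in_image[OF pp] by blast
      then have "p y \<noteq> Suc n" by auto
      then show ?thesis using p yS False by (simp add: t_def col_group_def)
    qed
    then show "p \<in> col_group ?T t" using permutes_subset[OF pp ST] by (simp add: col_group_def)
  qed
  then have cols: "col_sym ?T t = col_sym ?S s" by (simp add: col_sym_def fun_eq_iff)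
  \<comment> \<open>With a common column symmetrizer, any product ending in
    \<open>cy \<mu> n\<close> ends in the column symmetrizer of \<open>t\<close>, so the collapse
    for the larger tableau \<open>t\<close> applies.\<close>
  have cn: "cy \<mu> n = conv ?T (row_sym ?S s) (col_sym ?T t)"
    unfolding cy_def s_def[symmetric] cols by (rule act_mono[OF T ST row_sym_alg, symmetric])
  obtain \<sigma> where \<sigma>: "\<sigma> \<in> perms ?T" "\<forall>y\<in>?T. t y = std (padded \<mu> (Suc n)) (\<sigma> y)"
    using tableau_relabel[OF T tab cy_tableau[OF assms(1) ex']] by auto
  have cj: "left_reg \<sigma> (conv ?T (young ?T t) z) = conv ?T (cy \<mu> (Suc n)) (left_reg \<sigma> z)" for z
    unfolding cy_def by (rule L.young_conj(3)[OF \<sigma>(1)]) (use \<sigma>(2) in blast)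
  have "\<exists>q. conv ?T (cy \<mu> (Suc n)) (conv ?T x (cy \<mu> n)) = q *q conv ?T (cy \<mu> (Suc n)) (delta \<sigma>)" for x
  proof -
    define w where "w = conv ?T (conv ?T (delta (inv' \<sigma>)) x) (row_sym ?S s)"
    have "left_reg \<sigma> (conv ?T (delta (inv' \<sigma>)) z) = z" for z
      using L.act_delta[OF perms_inv[OF \<sigma>(1)], of z] left_reg_comp[OF \<sigma>(1) perms_inv[OF \<sigma>(1)], of z]
        inv_perms_o(2)[OF \<sigma>(1)] left_reg_id by metis
    then have "conv ?T x (cy \<mu> n) = left_reg \<sigma> (conv ?T w (col_sym ?T t))"
      unfolding cn w_def by (simp only: conv_assoc[OF T])
    then have e: "conv ?T (cy \<mu> (Suc n)) (conv ?T x (cy \<mu> n))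
        = left_reg \<sigma> (conv ?T (young ?T t) (conv ?T w (col_sym ?T t)))"
      by (simp only: cj)
    have "conv ?T (young ?T t) (conv ?T w (col_sym ?T t))
        = conv ?T (row_sym ?T t) (conv ?T (conv ?T (col_sym ?T t) w) (col_sym ?T t))"
      by (simp only: conv_assoc[OF T])
    then obtain q where "conv ?T (young ?T t) (conv ?T w (col_sym ?T t)) = q *q young ?T t"
      using young_collapse[OF T tab] by metis
    then have "conv ?T (cy \<mu> (Suc n)) (conv ?T x (cy \<mu> n)) = q *q left_reg \<sigma> (young ?T t)"
      unfolding e by (simp only: lin_scl[OF L.lin[OF \<sigma>(1)]])
    also have "left_reg \<sigma> (young ?T t) = conv ?T (cy \<mu> (Suc n)) (delta \<sigma>)"
      using cj[of "delta id"] left_reg_delta[OF \<sigma>(1), of id] conv_delta_id[OF T young_alg, of t]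
      by (simp only: comp_id)
    finally show ?thesis by (rule exI[of _ q])
  qed
  then show ?thesis using \<sigma>(1) by blast
qed

section \<open>Rational vector spaces with coordinates\<close>

lemma rat_field_simps [simp]:
  "carrier rat_field = UNIV" "x \<otimes>\<^bsub>rat_field\<^esub> y = x * y" "\<one>\<^bsub>rat_field\<^esub> = 1"
  "\<zero>\<^bsub>rat_field\<^esub> = 0" "x \<oplus>\<^bsub>rat_field\<^esub> y = x + y"
  by (simp_all add: ring_of_type_algebra_def)

abbreviation hom :: "(rat, 'v) module \<Rightarrow> (rat, 'w) module \<Rightarrow> ('v \<Rightarrow> 'w) set" where
  "hom V W \<equiv> LinearCombinations.module_hom rat_field V W"

lemma homI:
  assumes "\<And>v. v \<in> carrier V \<Longrightarrow> f v \<in> carrier W"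
    "\<And>v w. v \<in> carrier V \<Longrightarrow> w \<in> carrier V \<Longrightarrow> f (v \<oplus>\<^bsub>V\<^esub> w) = f v \<oplus>\<^bsub>W\<^esub> f w"
    "\<And>c v. v \<in> carrier V \<Longrightarrow> f (c \<odot>\<^bsub>V\<^esub> v) = c \<odot>\<^bsub>W\<^esub> f v"
  shows "f \<in> hom V W"
  using assms by (auto simp: LinearCombinations.module_hom_def)

lemma homD:
  assumes "f \<in> hom V W"
  shows "v \<in> carrier V \<Longrightarrow> f v \<in> carrier W"
    "v \<in> carrier V \<Longrightarrow> w \<in> carrier V \<Longrightarrow> f (v \<oplus>\<^bsub>V\<^esub> w) = f v \<oplus>\<^bsub>W\<^esub> f w"
    "v \<in> carrier V \<Longrightarrow> f (c \<odot>\<^bsub>V\<^esub> v) = c \<odot>\<^bsub>W\<^esub> f v"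
  using assms by (auto simp: LinearCombinations.module_hom_def)

lemma vs_facts:
  assumes "vectorspace rat_field V"
  shows "v \<in> carrier V \<Longrightarrow> 0 \<odot>\<^bsub>V\<^esub> v = \<zero>\<^bsub>V\<^esub>" "v \<in> carrier V \<Longrightarrow> 1 \<odot>\<^bsub>V\<^esub> v = v"
    "v \<in> carrier V \<Longrightarrow> c \<odot>\<^bsub>V\<^esub> v \<in> carrier V" "\<zero>\<^bsub>V\<^esub> \<in> carrier V" "c \<odot>\<^bsub>V\<^esub> \<zero>\<^bsub>V\<^esub> = \<zero>\<^bsub>V\<^esub>"
    "v \<in> carrier V \<Longrightarrow> (-1) \<odot>\<^bsub>V\<^esub> v = \<ominus>\<^bsub>V\<^esub> v" "abelian_group V"
    "v \<in> carrier V \<Longrightarrow> w \<in> carrier V \<Longrightarrow> v \<oplus>\<^bsub>V\<^esub> w \<in> carrier V"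
    "v \<in> carrier V \<Longrightarrow> w \<in> carrier V \<Longrightarrow> c \<odot>\<^bsub>V\<^esub> (v \<oplus>\<^bsub>V\<^esub> w) = c \<odot>\<^bsub>V\<^esub> v \<oplus>\<^bsub>V\<^esub> c \<odot>\<^bsub>V\<^esub> w"
    "v \<in> carrier V \<Longrightarrow> (c + d) \<odot>\<^bsub>V\<^esub> v = c \<odot>\<^bsub>V\<^esub> v \<oplus>\<^bsub>V\<^esub> d \<odot>\<^bsub>V\<^esub> v"
    "v \<in> carrier V \<Longrightarrow> (c * d) \<odot>\<^bsub>V\<^esub> v = c \<odot>\<^bsub>V\<^esub> (d \<odot>\<^bsub>V\<^esub> v)"
    "v \<in> carrier V \<Longrightarrow> c \<odot>\<^bsub>V\<^esub> v = \<zero>\<^bsub>V\<^esub> \<Longrightarrow> c = 0 \<or> v = \<zero>\<^bsub>V\<^esub>"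
proof -
  interpret vectorspace rat_field V by fact
  note l = smult_l_distr[simplified] and r = smult_r_distr[simplified] and a = smult_assoc1[simplified]
  show z: "0 \<odot>\<^bsub>V\<^esub> v = \<zero>\<^bsub>V\<^esub>" if "v \<in> carrier V" for v using smult_l_null[OF that] by simp
  show o: "1 \<odot>\<^bsub>V\<^esub> v = v" if "v \<in> carrier V" for v using smult_one[OF that] by simp
  show cl: "c \<odot>\<^bsub>V\<^esub> v \<in> carrier V" if "v \<in> carrier V" for c v using smult_closed[of c v] that by simp
  show "\<zero>\<^bsub>V\<^esub> \<in> carrier V" by simp
  show zr: "c \<odot>\<^bsub>V\<^esub> \<zero>\<^bsub>V\<^esub> = \<zero>\<^bsub>V\<^esub>" for c using smult_r_null[of c] by simp
  show "(-1) \<odot>\<^bsub>V\<^esub> v = \<ominus>\<^bsub>V\<^esub> v" if "v \<in> carrier V" for v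
    using l[of v "-1" 1] z[OF that] o[OF that] cl[OF that, of "-1"] that
    by (metis add.left_inverse minus_equality)
  show "abelian_group V" ..
  show "v \<oplus>\<^bsub>V\<^esub> w \<in> carrier V" if "v \<in> carrier V" "w \<in> carrier V" for v w using that by simp
  show "c \<odot>\<^bsub>V\<^esub> (v \<oplus>\<^bsub>V\<^esub> w) = c \<odot>\<^bsub>V\<^esub> v \<oplus>\<^bsub>V\<^esub> c \<odot>\<^bsub>V\<^esub> w" if "v \<in> carrier V" "w \<in> carrier V" for c v w
    using r[OF that] .
  show "(c + d) \<odot>\<^bsub>V\<^esub> v = c \<odot>\<^bsub>V\<^esub> v \<oplus>\<^bsub>V\<^esub> d \<odot>\<^bsub>V\<^esub> v" if "v \<in> carrier V" for c d v
    using l[OF that] .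
  show aa: "(c * d) \<odot>\<^bsub>V\<^esub> v = c \<odot>\<^bsub>V\<^esub> (d \<odot>\<^bsub>V\<^esub> v)" if "v \<in> carrier V" for c d v
    using a[OF that] .
  show "c = 0 \<or> v = \<zero>\<^bsub>V\<^esub>" if v: "v \<in> carrier V" and e: "c \<odot>\<^bsub>V\<^esub> v = \<zero>\<^bsub>V\<^esub>" for c v
  proof (rule ccontr)
    assume n: "\<not> ?thesis"
    then have "v = (1 / c * c) \<odot>\<^bsub>V\<^esub> v" using o[OF v] by simp
    also have "\<dots> = \<zero>\<^bsub>V\<^esub>" unfolding aa[OF v] e zr ..
    finally show False using n by simp
  qed
qed

lemma subrep_iff:
  "subrep H V \<rho> W \<longleftrightarrow> vectorspace rat_field V \<and> W \<subseteq> carrier V \<and> \<zero>\<^bsub>V\<^esub> \<in> W \<and>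
    (\<forall>v\<in>W. \<forall>w\<in>W. v \<oplus>\<^bsub>V\<^esub> w \<in> W) \<and> (\<forall>c. \<forall>v\<in>W. c \<odot>\<^bsub>V\<^esub> v \<in> W) \<and> (\<forall>h\<in>carrier H. \<forall>w\<in>W. \<rho> h w \<in> W)"
  by (auto simp: subrep_def subspace_def submodule_def vectorspace_def)

lemma subrep_vectorspace:
  assumes "subrep H V \<rho> W" shows "vectorspace rat_field (V\<lparr>carrier := W\<rparr>)"
  using assms vectorspace.subspace_is_vs by (auto simp: subrep_def subspace_def)

lemma hom_zero:
  assumes "vectorspace rat_field V" "vectorspace rat_field W" "F \<in> hom V W"
  shows "F \<zero>\<^bsub>V\<^esub> = \<zero>\<^bsub>W\<^esub>"
proof -
  have "F (0 \<odot>\<^bsub>V\<^esub> \<zero>\<^bsub>V\<^esub>) = 0 \<odot>\<^bsub>W\<^esub> F \<zero>\<^bsub>V\<^esub>" by (rule homD(3)[OF assms(3) vs_facts(4)[OF assms(1)]])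
  then show ?thesis using vs_facts(1,4)[OF assms(1)] vs_facts(1)[OF assms(2)] homD(1)[OF assms(3)] by simp
qed

lemma hom_finsum:
  assumes V: "vectorspace rat_field V" and W: "vectorspace rat_field W" and F: "F \<in> hom V W"
    and f: "f \<in> I \<rightarrow> carrier V"
  shows "F (finsum V f I) = finsum W (\<lambda>i. F (f i)) I"
proof -
  interpret V: vectorspace rat_field V by fact
  interpret W: vectorspace rat_field W by fact
  show ?thesis using f
  proof (induction I rule: infinite_finite_induct)
    case (infinite A) then show ?case by (simp add: V.finsum_infinite W.finsum_infinite hom_zero[OF V W F])
  next
    case empty then show ?case by (simp add: hom_zero[OF V W F])
  next
    case (insert x S)
    have "F (finsum V f (insert x S)) = F (f x \<oplus>\<^bsub>V\<^esub> finsum V f S)"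
      using insert by (subst V.finsum_insert) (auto simp: Pi_iff)
    also have "\<dots> = F (f x) \<oplus>\<^bsub>W\<^esub> F (finsum V f S)"
      using insert by (intro homD(2)[OF F]) (auto simp: Pi_iff)
    also have "\<dots> = finsum W (\<lambda>i. F (f i)) (insert x S)"
      using insert homD(1)[OF F] by (subst W.finsum_insert) (auto simp: Pi_iff)
    finally show ?case .
  qed
qed

definition funs :: "(rat, 'i \<Rightarrow> rat) module" where
  "funs = \<lparr>carrier = UNIV, mult = undefined, one = undefined, zero = 0, add = (+), module.smult = scl\<rparr>"

lemma funs_simps [simp]:
  "carrier funs = UNIV" "\<zero>\<^bsub>funs\<^esub> = 0" "x \<oplus>\<^bsub>funs\<^esub> y = x + y" "c \<odot>\<^bsub>funs\<^esub> x = c *q x"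
  by (simp_all add: funs_def)

lemma vectorspaceI:
  assumes "\<And>v w. v \<in> carrier V \<Longrightarrow> w \<in> carrier V \<Longrightarrow> v \<oplus>\<^bsub>V\<^esub> w \<in> carrier V"
    and "\<zero>\<^bsub>V\<^esub> \<in> carrier V"
    and "\<And>u v w. u \<in> carrier V \<Longrightarrow> v \<in> carrier V \<Longrightarrow> w \<in> carrier V \<Longrightarrow> u \<oplus>\<^bsub>V\<^esub> v \<oplus>\<^bsub>V\<^esub> w = u \<oplus>\<^bsub>V\<^esub> (v \<oplus>\<^bsub>V\<^esub> w)"
    and "\<And>v w. v \<in> carrier V \<Longrightarrow> w \<in> carrier V \<Longrightarrow> v \<oplus>\<^bsub>V\<^esub> w = w \<oplus>\<^bsub>V\<^esub> v"
    and "\<And>v. v \<in> carrier V \<Longrightarrow> \<zero>\<^bsub>V\<^esub> \<oplus>\<^bsub>V\<^esub> v = v"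
    and "\<And>v. v \<in> carrier V \<Longrightarrow> \<exists>w\<in>carrier V. w \<oplus>\<^bsub>V\<^esub> v = \<zero>\<^bsub>V\<^esub>"
    and "\<And>c v. v \<in> carrier V \<Longrightarrow> c \<odot>\<^bsub>V\<^esub> v \<in> carrier V"
    and "\<And>c d v. v \<in> carrier V \<Longrightarrow> (c + d) \<odot>\<^bsub>V\<^esub> v = c \<odot>\<^bsub>V\<^esub> v \<oplus>\<^bsub>V\<^esub> d \<odot>\<^bsub>V\<^esub> v"
    and "\<And>c v w. v \<in> carrier V \<Longrightarrow> w \<in> carrier V \<Longrightarrow> c \<odot>\<^bsub>V\<^esub> (v \<oplus>\<^bsub>V\<^esub> w) = c \<odot>\<^bsub>V\<^esub> v \<oplus>\<^bsub>V\<^esub> c \<odot>\<^bsub>V\<^esub> w"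
    and "\<And>c d v. v \<in> carrier V \<Longrightarrow> (c * d) \<odot>\<^bsub>V\<^esub> v = c \<odot>\<^bsub>V\<^esub> (d \<odot>\<^bsub>V\<^esub> v)"
    and "\<And>v. v \<in> carrier V \<Longrightarrow> 1 \<odot>\<^bsub>V\<^esub> v = v"
  shows "vectorspace rat_field V"
proof -
  have "abelian_group V" by (rule abelian_groupI) (use assms in auto)
  moreover have "field rat_field" ..
  moreover have "cring rat_field" ..
  ultimately show ?thesis
    unfolding vectorspace_def Module.module_def module_axioms_def using assms by simp
qed

lemma funs_vs: "vectorspace rat_field funs"
proof (rule vectorspaceI)
  show "\<exists>w\<in>carrier funs. w \<oplus>\<^bsub>funs\<^esub> v = \<zero>\<^bsub>funs\<^esub>" for v :: "'a \<Rightarrow> rat"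
    by (rule bexI[of _ "- v"]) simp_all
qed (auto simp: fun_eq_iff algebra_simps)

lemma finsum_funs: "finsum funs f I = (\<Sum>i\<in>I. f i)"
proof -
  interpret vectorspace rat_field funs by (rule funs_vs)
  show ?thesis
  proof (induction I rule: infinite_finite_induct)
    case (insert x F)
    have "finsum funs f (insert x F) = f x \<oplus>\<^bsub>funs\<^esub> finsum funs f F"
      using insert by (subst finsum_insert) auto
    then show ?case using insert by (simp only: funs_simps sum.insert not_False_eq_True)
  qed (auto simp: finsum_infinite)
qed

text \<open>\<open>crd\<close> embeds \<open>V\<close> into the functions vanishing from
  \<open>d\<close> on. \<open>vec\<close> is a left inverse defined and linear on all functions; the
  other composite is only a projection onto the coordinate vectors of \<open>V\<close>.\<close>

locale coords = vectorspace rat_field V for V :: "(rat, 'v) module" +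
  fixes crd :: "'v \<Rightarrow> nat \<Rightarrow> rat" and vec :: "(nat \<Rightarrow> rat) \<Rightarrow> 'v" and d :: nat
  assumes crd: "crd \<in> hom V funs" and vec: "vec \<in> hom funs V"
    and vec_crd: "v \<in> carrier V \<Longrightarrow> vec (crd v) = v"
    and bound: "v \<in> carrier V \<Longrightarrow> i \<ge> d \<Longrightarrow> crd v i = 0"
begin

lemma V_vs: "vectorspace rat_field V" ..

lemma crd_add: "v \<in> carrier V \<Longrightarrow> w \<in> carrier V \<Longrightarrow> crd (v \<oplus>\<^bsub>V\<^esub> w) = crd v + crd w"
  and crd_scl: "v \<in> carrier V \<Longrightarrow> crd (c \<odot>\<^bsub>V\<^esub> v) = c *q crd v"
  and vec_closed: "vec x \<in> carrier V"
  and vec_add: "vec (x + y) = vec x \<oplus>\<^bsub>V\<^esub> vec y"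
  and vec_scl: "vec (c *q x) = c \<odot>\<^bsub>V\<^esub> vec x"
  using homD[OF crd] homD[OF vec] by simp_all

lemma crd_zero: "crd \<zero>\<^bsub>V\<^esub> = 0"
  using hom_zero[OF V_vs funs_vs crd] by simp

lemma crd_inj: "v \<in> carrier V \<Longrightarrow> w \<in> carrier V \<Longrightarrow> crd v = crd w \<Longrightarrow> v = w"
  by (metis vec_crd)

lemma crd_finsum: "f \<in> I \<rightarrow> carrier V \<Longrightarrow> crd (finsum V f I) = (\<Sum>i\<in>I. crd (f i))"
  using hom_finsum[OF V_vs funs_vs crd] by (simp add: finsum_funs)

lemma crd_subspace:
  assumes W: "W \<subseteq> carrier V" "\<zero>\<^bsub>V\<^esub> \<in> W" "\<And>v w. v \<in> W \<Longrightarrow> w \<in> W \<Longrightarrow> v \<oplus>\<^bsub>V\<^esub> w \<in> W" "\<And>c v. v \<in> W \<Longrightarrow> c \<odot>\<^bsub>V\<^esub> v \<in> W"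
  shows "fv.subspace (crd ` W)"
  unfolding fv.subspace_def
proof (intro conjI ballI allI)
  show "0 \<in> crd ` W" using crd_zero W(2) by (metis imageI)
  fix x assume "x \<in> crd ` W"
  then obtain v where v: "v \<in> W" "x = crd v" by blast
  show "c *q x \<in> crd ` W" for c using v W crd_scl[of v c] by (metis imageI subsetD)
  fix y assume "y \<in> crd ` W"
  then obtain w where w: "w \<in> W" "y = crd w" by blast
  show "x + y \<in> crd ` W" using v w W crd_add[of v w] by (metis imageI subsetD)
qed

end

lemma coords_exist:
  assumes "finite_dim V"
  shows "\<exists>crd vec d. coords V crd vec d"
proof -
  interpret vectorspace rat_field V using assms by (simp add: finite_dim_def)
  obtain B where fB: "finite B" and B: "basis B"
    using assms finite_basis_exists by (auto simp: finite_dim_def)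
  have BV: "B \<subseteq> carrier V" using B by (simp add: basis_def)
  have ex1: "\<And>v. v \<in> carrier V \<Longrightarrow> \<exists>! a. a \<in> B \<rightarrow>\<^sub>E UNIV \<and> lincomb a B = v"
    using basis_criterion[OF fB BV] B by simp
  define D where "D = card B"
  obtain b where b: "bij_betw b {..<D} B" using ex_bij_betw_nat_finite[OF fB] by (auto simp: D_def atLeast0LessThan)
  have bV: "b i \<in> carrier V" if "i < D" for i using b BV that by (auto simp: bij_betw_def)
  define vec where "vec = (\<lambda>x :: nat \<Rightarrow> rat. \<Oplus>\<^bsub>V\<^esub>i\<in>{..<D}. x i \<odot>\<^bsub>V\<^esub> b i)"
  have trm: "(\<lambda>i. x i \<odot>\<^bsub>V\<^esub> b i) \<in> {..<D} \<rightarrow> carrier V" for x using bV vs_facts(3)[OF vectorspace_axioms] by auto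
  have vec: "vec \<in> hom funs V"
  proof (rule homI)
    show "vec x \<in> carrier V" for x unfolding vec_def by (rule finsum_closed[OF trm])
    show "vec (x \<oplus>\<^bsub>funs\<^esub> y) = vec x \<oplus>\<^bsub>V\<^esub> vec y" for x y
      unfolding vec_def
      by (subst finsum_addf[symmetric, OF trm trm], rule finsum_cong')
         (use bV vs_facts(3,8,10)[OF vectorspace_axioms] in auto)
    show "vec (c \<odot>\<^bsub>funs\<^esub> x) = c \<odot>\<^bsub>V\<^esub> vec x" for c x
      unfolding vec_def
      by (subst finsum_smult_ldistr[OF _ _ trm], simp, simp, rule finsum_cong')
         (use bV vs_facts(3,11)[OF vectorspace_axioms] in auto)
  qed
  have lc: "vec x = lincomb (\<lambda>v\<in>B. x (the_inv_into {..<D} b v)) B" for x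
  proof -
    have "lincomb (\<lambda>v\<in>B. x (the_inv_into {..<D} b v)) (b ` {..<D})
        = finsum V (\<lambda>i. (\<lambda>v\<in>B. x (the_inv_into {..<D} b v)) (b i) \<odot>\<^bsub>V\<^esub> b i) {..<D}"
      unfolding lincomb_def
      by (rule finsum_reindex) (use b BV vs_facts(3)[OF vectorspace_axioms] in \<open>auto simp: bij_betw_def\<close>)
    also have "\<dots> = vec x"
      unfolding vec_def
      by (rule finsum_cong'[OF refl trm])
         (use b in \<open>auto simp: bij_betw_def the_inv_into_f_f\<close>)
    finally show ?thesis using b by (simp add: bij_betw_def)
  qed
  have sur: "\<exists>x. (\<forall>i\<ge>D. x i = 0) \<and> vec x = v" if v: "v \<in> carrier V" for v
  proof -
    obtain a where a: "a \<in> B \<rightarrow>\<^sub>E UNIV" "lincomb a B = v" using ex1[OF v] by blast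
    define x where "x = (\<lambda>i. if i < D then a (b i) else 0)"
    have "(\<lambda>v\<in>B. x (the_inv_into {..<D} b v)) = a"
    proof
      fix v show "(\<lambda>v\<in>B. x (the_inv_into {..<D} b v)) v = a v"
      proof (cases "v \<in> B")
        case True
        then have "v \<in> b ` {..<D}" using b by (simp add: bij_betw_def)
        then show ?thesis
          using True b f_the_inv_into_f[of b "{..<D}" v] the_inv_into_into[of b "{..<D}" v "{..<D}"]
          by (auto simp: x_def bij_betw_def)
      next
        case False then show ?thesis using a(1) by (auto simp: PiE_def extensional_def)
      qed
    qed
    then have "vec x = v" using lc[of x] a(2) by simp
    then show ?thesis by (intro exI[of _ x]) (simp add: x_def)
  qed
  have uni: "x = y" if x: "\<forall>i\<ge>D. x i = 0" and y: "\<forall>i\<ge>D. y i = 0" and e: "vec x = vec y" for x y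
  proof
    fix i
    have "(\<lambda>v\<in>B. x (the_inv_into {..<D} b v)) = (\<lambda>v\<in>B. y (the_inv_into {..<D} b v))"
      using ex1[OF homD(1)[OF vec, of x]] lc[of x] lc[of y] e by (metis (no_types, lifting) funs_simps(1) UNIV_I restrict_PiE_iff)
    then have "(\<lambda>v\<in>B. x (the_inv_into {..<D} b v)) (b i) = (\<lambda>v\<in>B. y (the_inv_into {..<D} b v)) (b i)" by simp
    then show "x i = y i"
      using x y b by (cases "i < D") (auto simp: bij_betw_def the_inv_into_f_f)
  qed
  \<comment> \<open>Vanishing from \<open>D\<close> on makes the choice unique (\<open>uni\<close>),
    and linearity follows from uniqueness.\<close>
  define crd where "crd = (\<lambda>v. SOME x. (\<forall>i\<ge>D. x i = 0) \<and> vec x = v)"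
  have c: "(\<forall>i\<ge>D. crd v i = 0) \<and> vec (crd v) = v" if "v \<in> carrier V" for v
    unfolding crd_def by (rule someI_ex[OF sur[OF that]])
  have "crd \<in> hom V funs"
  proof (rule homI)
    show "crd (v \<oplus>\<^bsub>V\<^esub> w) = crd v \<oplus>\<^bsub>funs\<^esub> crd w" if "v \<in> carrier V" "w \<in> carrier V" for v w
    proof (rule uni)
      show "vec (crd (v \<oplus>\<^bsub>V\<^esub> w)) = vec (crd v \<oplus>\<^bsub>funs\<^esub> crd w)"
        using homD(2)[OF vec, of "crd v" "crd w"] c that by simp
    qed (use c that in auto)
    show "crd (k \<odot>\<^bsub>V\<^esub> v) = k \<odot>\<^bsub>funs\<^esub> crd v" if "v \<in> carrier V" for k v
    proof (rule uni)
      show "vec (crd (k \<odot>\<^bsub>V\<^esub> v)) = vec (k \<odot>\<^bsub>funs\<^esub> crd v)"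
        using homD(3)[OF vec, of "crd v" k] c that vs_facts(3)[OF vectorspace_axioms that] by simp
    qed (use c that vs_facts(3)[OF vectorspace_axioms that] in auto)
  qed simp
  then have "coords V crd vec D"
    using vec c by (intro coords.intro vectorspace_axioms coords_axioms.intro) auto
  then show ?thesis by blast
qed

section \<open>Multiplicities of irreducible representations\<close>

lemma sym_group_simps [simp]:
  "carrier (sym_group n) = perms {1..n}" "p \<otimes>\<^bsub>sym_group n\<^esub> q = p \<circ> q" "\<one>\<^bsub>sym_group n\<^esub> = id"
  by (simp_all add: sym_group_def)

lemma rat_repD:
  assumes "rat_rep H V \<rho>"
  shows "vectorspace rat_field V"
    and "g \<in> carrier H \<Longrightarrow> \<rho> g \<in> hom V V"
    and "g \<in> carrier H \<Longrightarrow> v \<in> carrier V \<Longrightarrow> \<rho> g v \<in> carrier V"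
    and "v \<in> carrier V \<Longrightarrow> \<rho> \<one>\<^bsub>H\<^esub> v = v"
    and "g \<in> carrier H \<Longrightarrow> h \<in> carrier H \<Longrightarrow> v \<in> carrier V \<Longrightarrow> \<rho> (g \<otimes>\<^bsub>H\<^esub> h) v = \<rho> g (\<rho> h v)"
  using assms homD(1) by (fastforce simp: rat_rep_def)+

definition rep_act :: "nat \<Rightarrow> (rat, 'v) module \<Rightarrow> ((nat \<Rightarrow> nat) \<Rightarrow> 'v \<Rightarrow> 'v) \<Rightarrow>
    ((nat \<Rightarrow> nat) \<Rightarrow> rat) \<Rightarrow> 'v \<Rightarrow> 'v" where
  "rep_act n V \<rho> a v = (\<Oplus>\<^bsub>V\<^esub>g\<in>perms {1..n}. a g \<odot>\<^bsub>V\<^esub> \<rho> g v)"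

text \<open>Compatibility is asked only on the orbit of one vector and between two possibly
  different actions. The lemma therefore serves equivariant maps, the maps \<open>\<phi> n\<close>
  and the operators of \<open>G\<close> alike.\<close>

lemma hom_rep_act:
  assumes V: "vectorspace rat_field V" and W: "vectorspace rat_field W" and F: "F \<in> hom V W"
    and cl: "\<And>g. g \<in> perms {1..n} \<Longrightarrow> \<rho> g v \<in> carrier V"
    and eq: "\<And>g. g \<in> perms {1..n} \<Longrightarrow> F (\<rho> g v) = \<sigma> g (F v)"
  shows "F (rep_act n V \<rho> a v) = rep_act n W \<sigma> a (F v)"
proof -
  interpret W: vectorspace rat_field W by fact
  have "F (rep_act n V \<rho> a v) = (\<Oplus>\<^bsub>W\<^esub>g\<in>perms {1..n}. F (a g \<odot>\<^bsub>V\<^esub> \<rho> g v))"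
    unfolding rep_act_def by (rule hom_finsum[OF V W F]) (use vs_facts(3)[OF V] cl in auto)
  also have "\<dots> = rep_act n W \<sigma> a (F v)"
    unfolding rep_act_def
    by (rule W.finsum_cong') (use homD[OF F] cl eq vs_facts(3)[OF W] in \<open>auto simp flip: eq\<close>)
  finally show ?thesis .
qed

lemma dim_psubset:
  assumes A: "fv.subspace A" and B: "fv.subspace B" and AB: "A \<subset> B" and F: "finite F" "B \<subseteq> fv.span F"
  shows "fv.dim A < fv.dim B"
proof -
  obtain BA where BA: "BA \<subseteq> A" "fv.independent BA" "A \<subseteq> fv.span BA"
    using fv.maximal_independent_subset by blast
  obtain BB where BB: "BA \<subseteq> BB" "BB \<subseteq> B" "fv.independent BB" "B \<subseteq> fv.span BB"
    using fv.maximal_independent_subset_extend[of BA B] BA AB by blast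
  have fB: "finite BB" using fv.independent_span_bound[OF F(1) BB(3)] BB(2) F(2) by blast
  have "BA \<noteq> BB"
  proof
    assume "BA = BB"
    then have "B \<subseteq> A" using BB(4) fv.span_minimal[OF BA(1) A] by simp
    then show False using AB by blast
  qed
  then have "card BA < card BB" using psubset_card_mono[OF fB] BB(1) by blast
  then show ?thesis
    using fv.basis_card_eq_dim[OF BA(1,3,2)] fv.basis_card_eq_dim[OF BB(2,4,3)] by simp
qed

lemma vs_group_facts:
  assumes V_vs: "vectorspace rat_field V"
  shows "v \<in> carrier V \<Longrightarrow> w \<in> carrier V \<Longrightarrow> \<ominus>\<^bsub>V\<^esub> v \<oplus>\<^bsub>V\<^esub> (v \<oplus>\<^bsub>V\<^esub> w) = w"
    and "v \<in> carrier V \<Longrightarrow> w \<in> carrier V \<Longrightarrow> v \<oplus>\<^bsub>V\<^esub> (\<ominus>\<^bsub>V\<^esub> v \<oplus>\<^bsub>V\<^esub> w) = w"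
    and "v \<in> carrier V \<Longrightarrow> w \<in> carrier V \<Longrightarrow> \<ominus>\<^bsub>V\<^esub> v \<oplus>\<^bsub>V\<^esub> w = \<zero>\<^bsub>V\<^esub> \<Longrightarrow> v = w"
    and "v \<in> carrier V \<Longrightarrow> w \<in> carrier V \<Longrightarrow> v \<oplus>\<^bsub>V\<^esub> \<ominus>\<^bsub>V\<^esub> w = \<zero>\<^bsub>V\<^esub> \<Longrightarrow> v = w"
    and "u \<in> carrier V \<Longrightarrow> v \<in> carrier V \<Longrightarrow> w \<in> carrier V \<Longrightarrow> u \<oplus>\<^bsub>V\<^esub> v \<oplus>\<^bsub>V\<^esub> w = u \<oplus>\<^bsub>V\<^esub> (v \<oplus>\<^bsub>V\<^esub> w)"
    and "v \<in> carrier V \<Longrightarrow> v \<oplus>\<^bsub>V\<^esub> \<ominus>\<^bsub>V\<^esub> v = \<zero>\<^bsub>V\<^esub>"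
    and "v \<in> carrier V \<Longrightarrow> v \<oplus>\<^bsub>V\<^esub> \<zero>\<^bsub>V\<^esub> = v"
    and "v \<in> carrier V \<Longrightarrow> \<ominus>\<^bsub>V\<^esub> v \<in> carrier V"
proof -
  interpret V: abelian_group V by (rule vs_facts(7)[OF V_vs])
  show "v \<in> carrier V \<Longrightarrow> w \<in> carrier V \<Longrightarrow> \<ominus>\<^bsub>V\<^esub> v \<oplus>\<^bsub>V\<^esub> (v \<oplus>\<^bsub>V\<^esub> w) = w" for v w
    by (simp add: V.a_assoc[symmetric] V.l_neg)
  show 2: "v \<in> carrier V \<Longrightarrow> w \<in> carrier V \<Longrightarrow> v \<oplus>\<^bsub>V\<^esub> (\<ominus>\<^bsub>V\<^esub> v \<oplus>\<^bsub>V\<^esub> w) = w" for v w by (simp add: V.a_assoc[symmetric] V.r_neg)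
  show "v \<in> carrier V \<Longrightarrow> w \<in> carrier V \<Longrightarrow> \<ominus>\<^bsub>V\<^esub> v \<oplus>\<^bsub>V\<^esub> w = \<zero>\<^bsub>V\<^esub> \<Longrightarrow> v = w" for v w
    using 2[of v w] by simp
  show "v \<in> carrier V \<Longrightarrow> w \<in> carrier V \<Longrightarrow> v \<oplus>\<^bsub>V\<^esub> \<ominus>\<^bsub>V\<^esub> w = \<zero>\<^bsub>V\<^esub> \<Longrightarrow> v = w" for v w
    using 2[of w v] V.a_comm[of v "\<ominus>\<^bsub>V\<^esub> w"] by simp
qed (use V_vs vs_facts(7) abelian_group.r_neg abelian_monoid.a_assoc abelian_monoid.r_zero
   abelian_group.a_inv_closed abelian_group.axioms(1) in metis)+

locale sym_rep = coords V crd vec d for V :: "(rat, 'v) module" and crd vec d +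
  fixes n :: nat and \<rho> :: "(nat \<Rightarrow> nat) \<Rightarrow> 'v \<Rightarrow> 'v"
  assumes rr: "rat_rep (sym_group n) V \<rho>"
begin

lemmas vneg1 = vs_group_facts(1)[OF V_vs] and vneg2 = vs_group_facts(2)[OF V_vs]
  and vneg_eq = vs_group_facts(3)[OF V_vs] and vneg_eq' = vs_group_facts(4)[OF V_vs]
  and vassoc = vs_group_facts(5)[OF V_vs] and vrneg = vs_group_facts(6)[OF V_vs]
  and vrzero = vs_group_facts(7)[OF V_vs] and vncl = vs_group_facts(8)[OF V_vs]

abbreviation P where "P \<equiv> perms {1..n}"
abbreviation ra where "ra \<equiv> rep_act n V \<rho>"

definition mat where "mat g x = crd (\<rho> g (vec x))"

lemma rho_hom: "g \<in> P \<Longrightarrow> \<rho> g \<in> hom V V"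
  and rho_closed: "g \<in> P \<Longrightarrow> v \<in> carrier V \<Longrightarrow> \<rho> g v \<in> carrier V"
  and rho_one: "v \<in> carrier V \<Longrightarrow> \<rho> id v = v"
  and rho_mult: "g \<in> P \<Longrightarrow> h \<in> P \<Longrightarrow> v \<in> carrier V \<Longrightarrow> \<rho> (g \<circ> h) v = \<rho> g (\<rho> h v)"
  using rat_repD[OF rr] by simp_all

lemma mat_rep: "perm_rep {1..n} mat"
proof (rule perm_rep.intro)
  fix p assume p: "p \<in> P"
  show "lin (mat p)"
    unfolding mat_def
    by (rule linI) (simp_all only: vec_add vec_scl homD(2,3)[OF rho_hom[OF p]] vec_closed crd_add crd_scl rho_closed[OF p])
  fix q x assume q: "q \<in> P"
  show "mat (p \<circ> q) x = mat p (mat q x)"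
    unfolding mat_def by (simp only: rho_mult[OF p q vec_closed] vec_crd[OF rho_closed[OF q vec_closed]])
qed simp

lemma crd_rho: "g \<in> P \<Longrightarrow> v \<in> carrier V \<Longrightarrow> crd (\<rho> g v) = mat g (crd v)"
  by (simp add: mat_def vec_crd)

lemma crd_act: "v \<in> carrier V \<Longrightarrow> crd (ra a v) = act {1..n} mat a (crd v)"
proof -
  assume v: "v \<in> carrier V"
  have "crd (ra a v) = (\<Sum>g\<in>P. crd (a g \<odot>\<^bsub>V\<^esub> \<rho> g v))"
    unfolding rep_act_def using rho_closed[OF _ v] vs_facts(3)[OF V_vs] by (intro crd_finsum) auto
  also have "\<dots> = act {1..n} mat a (crd v)"
    unfolding act_def by (rule sum.cong) (auto simp: crd_scl rho_closed v crd_rho)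
  finally show ?thesis .
qed

lemma act_closed: "v \<in> carrier V \<Longrightarrow> ra a v \<in> carrier V"
  unfolding rep_act_def using rho_closed vs_facts(3)[OF V_vs] by (intro finsum_closed) auto

lemma act_right_hom: "ra a \<in> hom V V"
proof (rule homI)
  interpret M: perm_rep "{1..n}" mat by (rule mat_rep)
  show "ra a (v \<oplus>\<^bsub>V\<^esub> w) = ra a v \<oplus>\<^bsub>V\<^esub> ra a w" if "v \<in> carrier V" "w \<in> carrier V" for v w
    by (rule crd_inj) (use that in \<open>simp_all only: a_closed act_closed crd_act crd_add lin_add[OF M.lin_act]\<close>)
  show "ra a (c \<odot>\<^bsub>V\<^esub> v) = c \<odot>\<^bsub>V\<^esub> ra a v" if "v \<in> carrier V" for c v
    by (rule crd_inj) (use that in \<open>simp_all only: vs_facts(3)[OF V_vs] act_closed crd_act crd_scl lin_scl[OF M.lin_act]\<close>)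
qed (rule act_closed)

lemma act_left_add: "v \<in> carrier V \<Longrightarrow> ra (a + b) v = ra a v \<oplus>\<^bsub>V\<^esub> ra b v"
  by (rule crd_inj) (simp_all only: a_closed act_closed crd_act crd_add perm_rep.act_add_left[OF mat_rep])

lemma act_left_scl: "v \<in> carrier V \<Longrightarrow> ra (c *q a) v = c \<odot>\<^bsub>V\<^esub> ra a v"
  by (rule crd_inj) (simp_all only: vs_facts(3)[OF V_vs] act_closed crd_act crd_scl perm_rep.act_scl_left[OF mat_rep])

lemma ra_conv: "v \<in> carrier V \<Longrightarrow> ra (conv {1..n} a b) v = ra a (ra b v)"
  by (rule crd_inj) (simp_all only: act_closed crd_act perm_rep.act_conv[OF mat_rep])

lemma ra_delta: "v \<in> carrier V \<Longrightarrow> g \<in> P \<Longrightarrow> ra (delta g) v = \<rho> g v"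
  by (rule crd_inj) (simp_all only: rho_closed act_closed crd_act perm_rep.act_delta[OF mat_rep] crd_rho)

lemma act_zero_right: "ra a \<zero>\<^bsub>V\<^esub> = \<zero>\<^bsub>V\<^esub>"
  by (rule hom_zero[OF V_vs V_vs act_right_hom])

abbreviation sr where "sr \<equiv> subrep (sym_group n) V \<rho>"

lemma srD:
  assumes "sr W"
  shows "W \<subseteq> carrier V" "\<zero>\<^bsub>V\<^esub> \<in> W" "v \<in> W \<Longrightarrow> w \<in> W \<Longrightarrow> v \<oplus>\<^bsub>V\<^esub> w \<in> W" "v \<in> W \<Longrightarrow> c \<odot>\<^bsub>V\<^esub> v \<in> W"
    "g \<in> P \<Longrightarrow> v \<in> W \<Longrightarrow> \<rho> g v \<in> W"
  using assms by (auto simp: subrep_iff)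

lemma srI:
  assumes "W \<subseteq> carrier V" "\<zero>\<^bsub>V\<^esub> \<in> W" "\<And>v w. v \<in> W \<Longrightarrow> w \<in> W \<Longrightarrow> v \<oplus>\<^bsub>V\<^esub> w \<in> W" "\<And>c v. v \<in> W \<Longrightarrow> c \<odot>\<^bsub>V\<^esub> v \<in> W"
    "\<And>g v. g \<in> P \<Longrightarrow> v \<in> W \<Longrightarrow> \<rho> g v \<in> W"
  shows "sr W"
  using assms V_vs by (auto simp: subrep_iff)

lemma sr_carrier: "sr (carrier V)"
  by (rule srI) (use rho_closed vs_facts(3)[OF V_vs] in auto)

lemma sr_neg: "sr W \<Longrightarrow> v \<in> W \<Longrightarrow> \<ominus>\<^bsub>V\<^esub> v \<in> W"
  using srD(4)[of W v "-1"] srD(1)[of W] vs_facts(6)[OF V_vs, of v] by auto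

lemma sr_finsum:
  assumes "sr W" "f \<in> I \<rightarrow> W" shows "finsum V f I \<in> W"
  using assms(2)
proof (induction I rule: infinite_finite_induct)
  case (insert x F)
  then show ?case using srD(1,3)[OF assms(1)] by (subst finsum_insert) (auto simp: Pi_iff)
qed (use srD[OF assms(1)] in \<open>auto simp: finsum_infinite\<close>)

lemma sr_act: "sr W \<Longrightarrow> w \<in> W \<Longrightarrow> ra a w \<in> W"
  unfolding rep_act_def by (rule sr_finsum, assumption, rule funcsetI, rule srD(4), assumption, rule srD(5))

lemma crd_sr: "sr W \<Longrightarrow> fv.subspace (crd ` W)"
  by (rule crd_subspace) (auto dest: srD)

lemma crd_bounded: "W \<subseteq> carrier V \<Longrightarrow> crd ` W \<subseteq> fv.span ((\<lambda>i. delta i) ` {..<d})"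
proof safe
  fix v assume "W \<subseteq> carrier V" "v \<in> W"
  then have b: "\<And>i. i \<ge> d \<Longrightarrow> crd v i = 0" using bound by blast
  have "crd v = (\<Sum>i<d. crd v i *q delta i)"
  proof
    fix j
    have "(\<Sum>i<d. crd v i *q delta i) j = (\<Sum>i<d. if i = j then crd v i else 0)"
      unfolding sum_fun_apply by (rule sum.cong) (auto simp: delta_def)
    also have "\<dots> = crd v j" using b[of j] by (cases "j < d") auto
    finally show "crd v j = (\<Sum>i<d. crd v i *q delta i) j" ..
  qed
  also have "\<dots> \<in> fv.span ((\<lambda>i. delta i) ` {..<d})"
    by (intro fv.span_sum fv.span_scale fv.span_base) auto
  finally show "crd v \<in> fv.span ((\<lambda>i. delta i) ` {..<d})" .
qed

definition gd where "gd W = fv.dim (crd ` W)"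

lemma gd_less:
  assumes "sr U" "sr W" "U \<subset> W" shows "gd U < gd W"
  unfolding gd_def
proof (rule dim_psubset[OF crd_sr[OF assms(1)] crd_sr[OF assms(2)] _ _ crd_bounded])
  obtain w where w: "w \<in> W" "w \<notin> U" using assms(3) by blast
  have "crd w \<notin> crd ` U"
  proof
    assume "crd w \<in> crd ` U"
    then obtain u where "u \<in> U" "crd w = crd u" by blast
    then have "w = u" using crd_inj[of w u] w srD(1)[OF assms(1)] srD(1)[OF assms(2)] by blast
    then show False using w \<open>u \<in> U\<close> by simp
  qed
  then show "crd ` U \<subset> crd ` W" using w assms(3) by blast
qed (use srD(1)[OF assms(2)] in auto)

text \<open>The standard form of the first \<open>d\<close> coordinates, summed over the group. On
  coordinate vectors the term of the identity is already positive, and the other terms are sums of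
  squares.\<close>

lemma inner_exists:
  assumes W: "sr W"
  shows "\<exists>ip. inner_rep {1..n} mat ip (crd ` W)"
proof -
  interpret M: perm_rep "{1..n}" mat by (rule mat_rep)
  define ip where "ip = (\<lambda>x y. \<Sum>g\<in>P. \<Sum>i<d. mat g x i * mat g y i)"
  have one: "mat id (crd v) = crd v" if "v \<in> W" for v
    using that srD(1)[OF W] by (simp add: mat_def vec_crd rho_one subset_iff)
  have "inner_rep {1..n} mat ip (crd ` W)"
  proof (intro inner_rep.intro mat_rep inner_rep_axioms.intro)
    show "ip (x + y) z = ip x z + ip y z" for x y z
      by (simp add: ip_def lin_add[OF M.lin] distrib_right sum.distrib)
    show "ip (c *q x) z = c * ip x z" for c x z
      by (simp add: ip_def lin_scl[OF M.lin] sum_distrib_left mult.assoc)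
    show "ip x y = ip y x" for x y by (simp add: ip_def mult.commute)
    show "ip (mat p x) (mat p y) = ip x y" if p: "p \<in> P" for p x y
      unfolding ip_def
    proof (rule sum.reindex_bij_witness[of _ "\<lambda>g. g \<circ> inv' p" "\<lambda>g. g \<circ> p"])
      show "(\<Sum>i<d. mat (g \<circ> p) x i * mat (g \<circ> p) y i) = (\<Sum>i<d. mat g (mat p x) i * mat g (mat p y) i)"
        if "g \<in> P" for g by (simp only: M.mult[OF that p])
    qed (use inv_perms_o[OF p] perms_comp[OF _ p] perms_comp[OF _ perms_inv[OF p]] in \<open>simp_all only: comp_assoc comp_id\<close>)
    show "0 < ip x x" if x: "x \<in> crd ` W" "x \<noteq> 0" for x
    proof -
      obtain v where v: "v \<in> W" "x = crd v" using x by blast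
      obtain i where i: "x i \<noteq> 0" using x(2) by (auto simp: fun_eq_iff)
      have id: "i < d" using bound[of v i] v i srD(1)[OF W] by (meson not_less subsetD)
      have "0 < x i * x i" using i by (metis mult_neg_neg mult_pos_pos linorder_neqE)
      also have "\<dots> \<le> (\<Sum>i<d. x i * x i)" using id by (intro member_le_sum) auto
      also have "\<dots> = (\<Sum>i<d. mat id x i * mat id x i)" using one v by simp
      also have "\<dots> \<le> ip x x"
        unfolding ip_def
        by (rule member_le_sum[where f = "\<lambda>g. \<Sum>i<d. mat g x i * mat g x i"])
           (use M.finp permutes_id in \<open>auto intro: sum_nonneg\<close>)
      finally show ?thesis .
    qed
    show "fv.subspace (crd ` W)" by (rule crd_sr[OF W])
    show "mat p x \<in> crd ` W" if p: "p \<in> P" and x: "x \<in> crd ` W" for p x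
    proof -
      obtain v where v: "v \<in> W" "x = crd v" using x by blast
      then have "mat p x = crd (\<rho> p v)" using crd_rho[OF p, of v] srD(1)[OF W] by auto
      then show ?thesis using srD(5)[OF W p v(1)] by simp
    qed
    show "mat id x = x" if "x \<in> crd ` W" for x using that one by blast
  qed
  then show ?thesis by blast
qed

lemma complete:
  assumes W: "sr W" "W \<noteq> {\<zero>\<^bsub>V\<^esub>}" and n: "n \<ge> 1"
  shows "\<exists>\<mu> w. is_partition \<mu> \<and> padding_exists \<mu> n \<and> w \<in> W \<and> ra (cy \<mu> n) w \<noteq> \<zero>\<^bsub>V\<^esub>"
proof -
  obtain ip where ip: "inner_rep {1..n} mat ip (crd ` W)" using inner_exists[OF W(1)] by blast
  obtain e where e: "e \<in> W" "e \<noteq> \<zero>\<^bsub>V\<^esub>" using W srD(2)[OF W(1)] by blast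
  have eV: "e \<in> carrier V" using e srD(1)[OF W(1)] by blast
  have "crd e \<noteq> 0" using crd_inj[OF eV, of "\<zero>\<^bsub>V\<^esub>"] crd_zero e(2) by auto
  then obtain \<mu> x where \<mu>: "is_partition \<mu>" "padding_exists \<mu> n" "x \<in> crd ` W" "act {1..n} mat (cy \<mu> n) x \<noteq> 0"
    using cy_complete[OF ip _ _ n, of "crd e"] e(1) by blast
  then obtain w where w: "w \<in> W" "x = crd w" by blast
  have wV: "w \<in> carrier V" using w srD(1)[OF W(1)] by blast
  have "crd (ra (cy \<mu> n) w) \<noteq> 0" using \<mu>(4) w crd_act[OF wV] by simp
  then have "ra (cy \<mu> n) w \<noteq> \<zero>\<^bsub>V\<^esub>" using crd_zero by auto
  then show ?thesis using \<mu> w by blast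
qed

text \<open>A linear projection onto the coordinates of \<open>W\<close>, averaged over the group,
  becomes equivariant and remains the identity there; its kernel is the complement.\<close>

lemma maschke:
  assumes W: "sr W"
  shows "\<exists>C. sr C \<and> W \<inter> C = {\<zero>\<^bsub>V\<^esub>} \<and> (\<forall>v\<in>carrier V. \<exists>w\<in>W. \<exists>c\<in>C. v = w \<oplus>\<^bsub>V\<^esub> c)"
proof -
  interpret M: perm_rep "{1..n}" mat by (rule mat_rep)
  interpret pr: vector_space_pair "scl :: rat \<Rightarrow> (nat \<Rightarrow> rat) \<Rightarrow> _" "scl :: rat \<Rightarrow> (nat \<Rightarrow> rat) \<Rightarrow> _" ..
  have WV: "\<And>w. w \<in> W \<Longrightarrow> w \<in> carrier V" using srD(1)[OF W] by blast
  have "lin (\<lambda>x. x)" by (rule linI) auto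
  then obtain q where q: "range q \<subseteq> crd ` W" "lin q" "\<And>x. x \<in> crd ` W \<Longrightarrow> q x = x"
    using pr.linear_exists_left_inverse_on[of "\<lambda>x. x" "crd ` W"] crd_sr[OF W] by auto
  have matW: "mat g x \<in> crd ` W" if "g \<in> P" "x \<in> crd ` W" for g x
    using that srD(5)[OF W] WV crd_rho by (auto simp: image_iff) (metis)
  define N where "N = (of_nat (card P) :: rat)"
  have "id \<in> P" using permutes_id by simp
  then have N: "N \<noteq> 0" unfolding N_def using M.finp by (metis card_eq_0_iff empty_iff of_nat_eq_0_iff)
  define pi where "pi = (\<lambda>x. (1 / N) *q (\<Sum>g\<in>P. mat g (q (mat (inv' g) x))))"
  have lpi: "lin pi"
    by (rule linI)
       (simp_all only: pi_def lin_add[OF M.lin] lin_scl[OF M.lin] lin_add[OF q(2)] lin_scl[OF q(2)]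
         perms_inv sum.distrib fv.scale_right_distrib fv.scale_sum_right[symmetric] fv.scale_left_commute cong: sum.cong)
  have piW: "pi x \<in> crd ` W" for x
    unfolding pi_def
    by (intro fv.subspace_scale[OF crd_sr[OF W]] fv.subspace_sum[OF crd_sr[OF W]] matW) (use q in auto)
  have mm: "mat g (mat (inv' g) (crd v)) = crd v" if "g \<in> P" "v \<in> carrier V" for g v
  proof -
    have "mat g (mat (inv' g) (crd v)) = mat (g \<circ> inv' g) (crd v)"
      by (rule M.mult[OF that(1) perms_inv[OF that(1)], symmetric])
    also have "\<dots> = mat id (crd v)" by (simp only: inv_perms_o(2)[OF that(1)])
    also have "\<dots> = crd v" using that(2) by (simp add: mat_def vec_crd rho_one)
    finally show ?thesis .
  qed
  have pi_fix: "pi x = x" if x: "x \<in> crd ` W" for x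
  proof -
    obtain v where v: "v \<in> W" "x = crd v" using x by blast
    have "mat g (q (mat (inv' g) x)) = x" if "g \<in> P" for g
      using q(3)[OF matW[OF perms_inv[OF that] x]] mm[OF that WV[OF v(1)]] v(2) by simp
    then have "(\<Sum>g\<in>P. mat g (q (mat (inv' g) x))) = (\<Sum>g\<in>P. x)" by (rule sum.cong[OF refl])
    also have "\<dots> = N *q x" unfolding N_def by (rule sum_const_fun)
    finally show ?thesis using N by (simp only: pi_def fv.scale_scale) simp
  qed
  have pi_equiv: "pi (mat h x) = mat h (pi x)" if h: "h \<in> P" for h x
  proof -
    have "(\<Sum>g\<in>P. mat g (q (mat (inv' g) (mat h x)))) = (\<Sum>g\<in>P. mat h (mat g (q (mat (inv' g) x))))"
    proof (rule sum.reindex_bij_witness[of _ "\<lambda>g. h \<circ> g" "\<lambda>g. inv' h \<circ> g"])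
      fix g assume g: "g \<in> P"
      have hg: "inv' h \<circ> g \<in> P" using perms_comp[OF perms_inv[OF h] g] .
      have i: "inv' (inv' h \<circ> g) = inv' g \<circ> h"
        using o_inv_distrib[of "inv' h" g] permutes_bij[of g "{1..n}"] permutes_bij[OF permutes_inv[of h "{1..n}"]] g h
          permutes_inv_inv[of h "{1..n}"] by simp
      show "mat h (mat (inv' h \<circ> g) (q (mat (inv' (inv' h \<circ> g)) x))) = mat g (q (mat (inv' g) (mat h x)))"
        unfolding i M.mult[OF perms_inv[OF g] h] M.mult[OF h hg, symmetric] comp_assoc[symmetric] inv_perms_o(2)[OF h] id_comp ..
    qed (use h perms_comp perms_inv[OF h] inv_perms_o[OF h] in \<open>simp_all only: comp_assoc[symmetric] id_comp\<close>)
    then show ?thesis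
      unfolding pi_def lin_scl[OF M.lin[OF h]] lin_sum[OF M.lin[OF h]] by simp
  qed
  define C where "C = {v \<in> carrier V. pi (crd v) = 0}"
  have "sr C"
  proof (rule srI)
    show "\<rho> g v \<in> C" if "g \<in> P" "v \<in> C" for g v
      using that rho_closed pi_equiv[OF that(1), of "crd v"] lin_zero[OF M.lin] by (simp add: C_def crd_rho)
  qed (auto simp: C_def crd_zero lin_zero[OF lpi] crd_add lin_add[OF lpi] crd_scl lin_scl[OF lpi] vs_facts(3)[OF V_vs])
  moreover have "W \<inter> C = {\<zero>\<^bsub>V\<^esub>}"
  proof -
    have "v = \<zero>\<^bsub>V\<^esub>" if "v \<in> W" "v \<in> C" for v
      using that pi_fix[of "crd v"] crd_inj[OF WV[OF that(1)], of "\<zero>\<^bsub>V\<^esub>"] crd_zero by (simp add: C_def)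
    then show ?thesis using srD(2)[OF W] srD(2)[OF \<open>sr C\<close>] by blast
  qed
  moreover have "\<exists>w\<in>W. \<exists>c\<in>C. v = w \<oplus>\<^bsub>V\<^esub> c" if v: "v \<in> carrier V" for v
  proof -
    obtain w where w: "w \<in> W" "pi (crd v) = crd w" using piW[of "crd v"] by blast
    have wV: "w \<in> carrier V" using WV w by blast
    define c where "c = \<ominus>\<^bsub>V\<^esub> w \<oplus>\<^bsub>V\<^esub> v"
    have cV: "c \<in> carrier V" using v wV by (simp add: c_def vncl)
    have e: "v = w \<oplus>\<^bsub>V\<^esub> c" using v wV by (simp add: c_def vneg2)
    then have "crd v = crd w + crd c" using crd_add[OF wV cV] by simp
    then have "pi (crd v) = crd w + pi (crd c)" using lin_add[OF lpi] pi_fix w(1) by simp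
    then have "pi (crd c) = 0" using w(2) by simp
    then show ?thesis using w(1) cV e by (auto simp: C_def)
  qed
  ultimately show ?thesis by blast
qed

lemma sr_Int: "sr A \<Longrightarrow> sr B \<Longrightarrow> sr (A \<inter> B)"
  by (auto simp: subrep_iff)

text \<open>\<open>multiplicity_in\<close> is a definite description over decompositions, so one has
  to exist. A nonzero subrepresentation of least dimension is irreducible and splits off; the part
  of \<open>U\<close> in the complement has smaller dimension.\<close>

lemma decomposition_exists:
  "sr U \<Longrightarrow> \<exists>(r :: nat) W. (\<forall>i<r. irreducible_subrep (sym_group n) V \<rho> (W i) \<and> W i \<subseteq> U) \<and>
     (\<forall>v\<in>U. \<exists>!w. w \<in> (\<Pi>\<^sub>E i\<in>{..<r}. W i) \<and> v = (\<Oplus>\<^bsub>V\<^esub>i\<in>{..<r}. w i))"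
proof (induction "gd U" arbitrary: U rule: less_induct)
  case less
  show ?case
  proof (cases "U = {\<zero>\<^bsub>V\<^esub>}")
    case True
    define W0 :: "nat \<Rightarrow> 'v set" where "W0 = (\<lambda>_. {})"
    have W0: "(\<forall>i<0. irreducible_subrep (sym_group n) V \<rho> (W0 i) \<and> W0 i \<subseteq> U) \<and>
      (\<forall>v\<in>U. \<exists>!w. w \<in> (\<Pi>\<^sub>E i\<in>{..<0}. W0 i) \<and> v = (\<Oplus>\<^bsub>V\<^esub>i\<in>{..<0}. w i))"
      by (simp add: True)
    show ?thesis by (rule exI, rule exI, rule W0)
  next
    case False
    define Q where "Q = (\<lambda>W. sr W \<and> W \<subseteq> U \<and> W \<noteq> {\<zero>\<^bsub>V\<^esub>})"
    have "Q U" using False less.prems by (simp add: Q_def)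
    then obtain W where W: "Q W" and Wmin: "\<And>B. Q B \<Longrightarrow> gd W \<le> gd B"
      using ex_has_least_nat[of Q U gd] by blast
    have sW: "sr W" "W \<subseteq> U" "W \<noteq> {\<zero>\<^bsub>V\<^esub>}" using W by (auto simp: Q_def)
    have irr: "irreducible_subrep (sym_group n) V \<rho> W"
      unfolding irreducible_subrep_def
    proof (intro conjI allI impI)
      fix B assume B: "sr B \<and> B \<subseteq> W"
      show "B = {\<zero>\<^bsub>V\<^esub>} \<or> B = W"
      proof (rule ccontr)
        assume n: "\<not> ?thesis"
        then have "gd B < gd W" using gd_less[of B W] B sW by blast
        then show False using Wmin[of B] n B sW by (auto simp: Q_def)
      qed
    qed (use sW in auto)
    obtain C where C: "sr C" "W \<inter> C = {\<zero>\<^bsub>V\<^esub>}" "\<forall>v\<in>carrier V. \<exists>w\<in>W. \<exists>c\<in>C. v = w \<oplus>\<^bsub>V\<^esub> c"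
      using maschke[OF sW(1)] by blast
    define U' where "U' = U \<inter> C"
    have sU': "sr U'" unfolding U'_def by (rule sr_Int[OF less.prems C(1)])
    have UV: "\<And>u. u \<in> U \<Longrightarrow> u \<in> carrier V" using srD(1)[OF less.prems] by blast
    have "U' \<noteq> U"
    proof
      assume "U' = U"
      then have "W \<subseteq> W \<inter> C" using sW(2) by (auto simp: U'_def)
      then show False using C(2) sW(3) srD(2)[OF sW(1)] by blast
    qed
    then have "gd U' < gd U" using gd_less[OF sU' less.prems] by (auto simp: U'_def)
    from less.hyps[OF this sU'] obtain r :: nat and W' where
      ih: "(\<forall>i<r. irreducible_subrep (sym_group n) V \<rho> (W' i) \<and> W' i \<subseteq> U') \<and>
        (\<forall>v\<in>U'. \<exists>!w. w \<in> (\<Pi>\<^sub>E i\<in>{..<r}. W' i) \<and> v = (\<Oplus>\<^bsub>V\<^esub>i\<in>{..<r}. w i))"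
      by (elim exE)
    have W': "irreducible_subrep (sym_group n) V \<rho> (W' i) \<and> W' i \<subseteq> U'" if "i < r" for i
      using conjunct1[OF ih] that by (elim allE impE)
    have uni: "\<exists>!w. w \<in> (\<Pi>\<^sub>E i\<in>{..<r}. W' i) \<and> v = (\<Oplus>\<^bsub>V\<^esub>i\<in>{..<r}. w i)" if "v \<in> U'" for v
      by (rule bspec[OF conjunct2[OF ih] that])
    define WW where "WW = (\<lambda>i. if i < r then W' i else W)"
    have split_sum: "(\<Oplus>\<^bsub>V\<^esub>i\<in>{..<Suc r}. w i) = w r \<oplus>\<^bsub>V\<^esub> (\<Oplus>\<^bsub>V\<^esub>i\<in>{..<r}. w i)"
      if "w \<in> (\<Pi>\<^sub>E i\<in>{..<Suc r}. WW i)" for w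
    proof -
      have "w i \<in> carrier V" if i: "i < Suc r" for i
      proof -
        have "w i \<in> WW i" using \<open>w \<in> _\<close> i by (auto simp: PiE_iff)
        moreover have "WW i \<subseteq> U" using W'[of i] sW by (simp add: WW_def U'_def)
        ultimately show ?thesis using UV by blast
      qed
      then show ?thesis unfolding lessThan_Suc by (subst finsum_insert) auto
    qed
    have restr: "restrict w {..<r} \<in> (\<Pi>\<^sub>E i\<in>{..<r}. W' i)" "w r \<in> W"
      "(\<Oplus>\<^bsub>V\<^esub>i\<in>{..<r}. restrict w {..<r} i) = (\<Oplus>\<^bsub>V\<^esub>i\<in>{..<r}. w i)" "(\<Oplus>\<^bsub>V\<^esub>i\<in>{..<r}. w i) \<in> U'"
      if "w \<in> (\<Pi>\<^sub>E i\<in>{..<Suc r}. WW i)" for w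
    proof -
      have a: "w i \<in> W' i" if "i < r" for i 
      proof -
        have "w i \<in> WW i" using \<open>w \<in> _\<close> that by (auto simp: PiE_iff)
        then show ?thesis using that by (simp add: WW_def)
      qed
      then have b: "w i \<in> U'" if "i < r" for i using W'[OF that] that by blast
      show "restrict w {..<r} \<in> (\<Pi>\<^sub>E i\<in>{..<r}. W' i)" using a by auto
      have "w r \<in> WW r" using that by (simp add: PiE_iff)
      then show "w r \<in> W" by (simp add: WW_def)
      show "(\<Oplus>\<^bsub>V\<^esub>i\<in>{..<r}. restrict w {..<r} i) = (\<Oplus>\<^bsub>V\<^esub>i\<in>{..<r}. w i)"
        using b srD(1)[OF sU'] by (intro finsum_cong') auto
      show "(\<Oplus>\<^bsub>V\<^esub>i\<in>{..<r}. w i) \<in> U'" using b by (intro sr_finsum[OF sU']) auto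
    qed
    have A: "\<exists>!w. w \<in> (\<Pi>\<^sub>E i\<in>{..<Suc r}. WW i) \<and> v = (\<Oplus>\<^bsub>V\<^esub>i\<in>{..<Suc r}. w i)" if v: "v \<in> U" for v
    proof -
      obtain w0 c where wc: "w0 \<in> W" "c \<in> C" "v = w0 \<oplus>\<^bsub>V\<^esub> c" using C(3) UV[OF v] by blast
      have w0V: "w0 \<in> carrier V" "w0 \<in> U" and cV: "c \<in> carrier V"
        using wc sW UV srD(1)[OF C(1)] by auto
      have "c = \<ominus>\<^bsub>V\<^esub> w0 \<oplus>\<^bsub>V\<^esub> v" using wc(3) w0V cV by (simp add: vneg1)
      then have "c \<in> U" using srD(3)[OF less.prems sr_neg[OF less.prems w0V(2)] v] by simp
      then have cU: "c \<in> U'" using wc by (simp add: U'_def)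
      obtain w where w: "w \<in> (\<Pi>\<^sub>E i\<in>{..<r}. W' i)" "c = (\<Oplus>\<^bsub>V\<^esub>i\<in>{..<r}. w i)" using uni[OF cU] by blast
      define w' where "w' = w(r := w0)"
      have w'WW: "w' \<in> (\<Pi>\<^sub>E i\<in>{..<Suc r}. WW i)"
        using w(1) wc(1) by (auto simp: w'_def WW_def PiE_iff extensional_def less_Suc_eq)
      have rw': "restrict w' {..<r} = w"
        using w(1) by (auto simp: w'_def PiE_iff extensional_def fun_eq_iff)
      have "(\<Oplus>\<^bsub>V\<^esub>i\<in>{..<r}. w' i) = c" using restr(3)[OF w'WW] rw' w(2) by simp
      then have vw': "v = (\<Oplus>\<^bsub>V\<^esub>i\<in>{..<Suc r}. w' i)"
        using split_sum[OF w'WW] wc(3) by (simp add: w'_def)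
      show ?thesis
      proof (rule ex1I[of _ w'])
        show "w' \<in> (\<Pi>\<^sub>E i\<in>{..<Suc r}. WW i) \<and> v = (\<Oplus>\<^bsub>V\<^esub>i\<in>{..<Suc r}. w' i)" using w'WW vw' by blast
        fix u assume u: "u \<in> (\<Pi>\<^sub>E i\<in>{..<Suc r}. WW i) \<and> v = (\<Oplus>\<^bsub>V\<^esub>i\<in>{..<Suc r}. u i)"
        \<comment> \<open>Two expressions of \<open>v\<close> differ by an element of
          \<open>W\<close> that also lies in \<open>C\<close>, hence by zero; uniqueness within
          \<open>U'\<close> settles the remaining components.\<close>
        define s where "s = (\<Oplus>\<^bsub>V\<^esub>i\<in>{..<r}. u i)"
        have su: "s \<in> U'" "u r \<in> W" "v = u r \<oplus>\<^bsub>V\<^esub> s" using u restr[of u] split_sum[of u] by (auto simp: s_def)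
        have uV: "u r \<in> carrier V" "s \<in> carrier V" "s \<in> C" using su sW UV srD(1)[OF sU'] by (auto simp: U'_def)
        have "\<ominus>\<^bsub>V\<^esub> u r \<oplus>\<^bsub>V\<^esub> w0 = s \<oplus>\<^bsub>V\<^esub> \<ominus>\<^bsub>V\<^esub> c"
        proof -
          have "\<ominus>\<^bsub>V\<^esub> u r \<oplus>\<^bsub>V\<^esub> (w0 \<oplus>\<^bsub>V\<^esub> c) = s" using su(3) wc(3) uV by (simp add: vneg1)
          then have "(\<ominus>\<^bsub>V\<^esub> u r \<oplus>\<^bsub>V\<^esub> w0) \<oplus>\<^bsub>V\<^esub> c = s" using uV w0V cV by (simp add: vassoc vncl)
          then have "s \<oplus>\<^bsub>V\<^esub> \<ominus>\<^bsub>V\<^esub> c = (\<ominus>\<^bsub>V\<^esub> u r \<oplus>\<^bsub>V\<^esub> w0) \<oplus>\<^bsub>V\<^esub> c \<oplus>\<^bsub>V\<^esub> \<ominus>\<^bsub>V\<^esub> c" by simp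
          also have "\<dots> = \<ominus>\<^bsub>V\<^esub> u r \<oplus>\<^bsub>V\<^esub> w0" using uV w0V cV by (simp add: vassoc vncl vrneg vrzero)
          finally show ?thesis ..
        qed
        moreover have "\<ominus>\<^bsub>V\<^esub> u r \<oplus>\<^bsub>V\<^esub> w0 \<in> W" using srD(3)[OF sW(1) sr_neg[OF sW(1) su(2)] wc(1)] .
        moreover have "s \<oplus>\<^bsub>V\<^esub> \<ominus>\<^bsub>V\<^esub> c \<in> C" using srD(3)[OF C(1) uV(3) sr_neg[OF C(1) wc(2)]] .
        ultimately have z: "\<ominus>\<^bsub>V\<^esub> u r \<oplus>\<^bsub>V\<^esub> w0 = \<zero>\<^bsub>V\<^esub>" "s \<oplus>\<^bsub>V\<^esub> \<ominus>\<^bsub>V\<^esub> c = \<zero>\<^bsub>V\<^esub>" using C(2) by auto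
        have ur: "u r = w0" using z(1) uV w0V vneg_eq by blast
        have "s = c" using z(2) uV cV vneg_eq' by blast
        then have "restrict u {..<r} = w"
          using uni[OF cU] restr(1,3)[of u] u w by (metis s_def)
        then have "u i = w i" if "i < r" for i using that by (metis lessThan_iff restrict_apply')
        then have "u i = w' i" for i
          using u w'WW ur by (cases "i < r"; cases "i = r") (auto simp: w'_def PiE_iff extensional_def)
        then show "u = w'" by (simp add: fun_eq_iff)
      qed
    qed
    have B: "irreducible_subrep (sym_group n) V \<rho> (WW i) \<and> WW i \<subseteq> U" if "i < Suc r" for i
      using W'[of i] irr sW(2) by (auto simp: WW_def U'_def)
    show ?thesis
      by (rule exI[of _ "Suc r"], rule exI[of _ WW], rule conjI,
          (intro allI impI, rule B, assumption), (rule ballI, rule A, assumption))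
  qed
qed

end

section \<open>Specht modules as left ideals\<close>

lemma group_ring_carrier: "carrier (group_ring (sym_group n) :: ((nat \<Rightarrow> nat) \<Rightarrow> rat) ring) = alg {1..n}"
proof (intro equalityI subsetI)
  fix a :: "(nat \<Rightarrow> nat) \<Rightarrow> rat" assume "a \<in> carrier (group_ring (sym_group n))"
  then show "a \<in> alg {1..n}" by (auto simp: group_ring_def alg_def)
next
  fix a :: "(nat \<Rightarrow> nat) \<Rightarrow> rat" assume a: "a \<in> alg {1..n}"
  then have "{g. a g \<noteq> 0} \<subseteq> perms {1..n}" by (auto simp: alg_def)
  then show "a \<in> carrier (group_ring (sym_group n))"
    using finite_subset[OF _ finite_permutations[of "{1..n}"]] by (simp add: group_ring_def)
qed

text \<open>A pair of permutations with product \<open>x\<close> is determined by its first member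
  \<open>g\<close>, the second being \<open>inv' g \<circ> x\<close>; this turns the sum over pairs
  into the convolution.\<close>

lemma group_ring_mult:
  assumes a: "a \<in> alg {1..n}" and b: "b \<in> alg {1..n}"
  shows "a \<otimes>\<^bsub>group_ring (sym_group n)\<^esub> b = conv {1..n} a b"
proof
  fix x
  let ?P = "perms {1..n}"
  have "(a \<otimes>\<^bsub>group_ring (sym_group n)\<^esub> b) x
      = (\<Sum>(g, h)\<in>{(g, h). a g \<noteq> 0 \<and> b h \<noteq> 0 \<and> g \<circ> h = x}. a g * b h)"
    by (simp add: group_ring_def)
  also have "\<dots> = (\<Sum>p\<in>{p \<in> ?P. a p \<noteq> 0 \<and> b (inv' p \<circ> x) \<noteq> 0}. a p * b (inv' p \<circ> x))"
  proof (rule sum.reindex_bij_witness[of _ "\<lambda>p. (p, inv' p \<circ> x)" fst])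
    fix gh assume gh: "gh \<in> {(g, h). a g \<noteq> 0 \<and> b h \<noteq> 0 \<and> g \<circ> h = x}"
    obtain g h where e: "gh = (g, h)" by (cases gh)
    have gP: "g \<in> ?P" using gh a e by (auto simp: alg_def)
    have h: "inv' g \<circ> x = h" using gh e inv_perms_o(1)[OF gP] by (auto simp only: mem_Collect_eq prod.case comp_assoc[symmetric] id_comp)
    show "(fst gh, inv' (fst gh) \<circ> x) = gh" by (simp only: e fst_conv h)
    show "fst gh \<in> {p \<in> ?P. a p \<noteq> 0 \<and> b (inv' p \<circ> x) \<noteq> 0}" using gh gP h e by (simp only: fst_conv mem_Collect_eq prod.case simp_thms)
    show "a (fst gh) * b (inv' (fst gh) \<circ> x) = (case gh of (g, h) \<Rightarrow> a g * b h)"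
      by (simp only: e fst_conv h prod.case)
  next
    fix p assume p: "p \<in> {p \<in> ?P. a p \<noteq> 0 \<and> b (inv' p \<circ> x) \<noteq> 0}"
    then have "p \<circ> (inv' p \<circ> x) = x" using inv_perms_o(2)[of p "{1..n}"] by (simp only: mem_Collect_eq comp_assoc[symmetric] id_comp)
    then show "(p, inv' p \<circ> x) \<in> {(g, h). a g \<noteq> 0 \<and> b h \<noteq> 0 \<and> g \<circ> h = x}"
      using p by (simp only: mem_Collect_eq prod.case simp_thms)
  qed simp
  also have "\<dots> = (\<Sum>p\<in>?P. a p * b (inv' p \<circ> x))"
    by (rule sum.mono_neutral_left) (auto simp: finite_permutations)
  also have "\<dots> = conv {1..n} a b x"
    by (simp add: act_def sum_fun_apply left_reg_def)
  finally show "(a \<otimes>\<^bsub>group_ring (sym_group n)\<^esub> b) x = conv {1..n} a b x" .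
qed

lemma independent_family:
  assumes fin: "finite I" and z: "\<And>\<alpha>. (\<Sum>i\<in>I. \<alpha> i *q b i) = 0 \<Longrightarrow> \<forall>i\<in>I. \<alpha> i = 0"
  shows "inj_on b I" "fv.independent (b ` I)"
proof -
  show inj: "inj_on b I"
  proof (rule inj_onI, rule ccontr)
    fix i j assume ij: "i \<in> I" "j \<in> I" "b i = b j" "i \<noteq> j"
    define \<alpha> :: "_ \<Rightarrow> rat" where "\<alpha> = (\<lambda>l. if l = i then 1 else if l = j then -1 else 0)"
    have "(\<Sum>l\<in>I. \<alpha> l *q b l) = \<alpha> i *q b i + (\<alpha> j *q b j + (\<Sum>l\<in>I - {i} - {j}. \<alpha> l *q b l))"
      using sum.remove[OF fin ij(1), of "\<lambda>l. \<alpha> l *q b l"] sum.remove[of "I - {i}" j "\<lambda>l. \<alpha> l *q b l"] fin ij by simp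
    also have "(\<Sum>l\<in>I - {i} - {j}. \<alpha> l *q b l) = 0"
      by (rule sum.neutral) (auto simp: \<alpha>_def)
    also have "\<alpha> i *q b i + (\<alpha> j *q b j + 0) = 0" using ij by (simp add: \<alpha>_def fun_eq_iff)
    finally have "\<alpha> i = 0" using z[of \<alpha>] ij by blast
    then show False by (simp add: \<alpha>_def)
  qed
  show "fv.independent (b ` I)"
  proof (rule fv.independent_if_scalars_zero)
    fix f x assume s: "(\<Sum>x\<in>b ` I. f x *q x) = 0" and x: "x \<in> b ` I"
    have "(\<Sum>i\<in>I. f (b i) *q b i) = 0" using s by (simp add: sum.reindex[OF inj])
    then show "f x = 0" using z[of "\<lambda>i. f (b i)"] x by blast
  qed (use fin in simp)
qed

text \<open>\<open>rep_iso\<close> does not ask its arguments to be representations, so the closure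
  properties needed to invert the map are assumed for the source.\<close>

lemma rep_iso_sym:
  assumes i: "rep_iso H M \<sigma> V \<rho>"
    and cl: "\<And>v w. v \<in> carrier M \<Longrightarrow> w \<in> carrier M \<Longrightarrow> v \<oplus>\<^bsub>M\<^esub> w \<in> carrier M"
      "\<And>c v. v \<in> carrier M \<Longrightarrow> c \<odot>\<^bsub>M\<^esub> v \<in> carrier M"
      "\<And>h v. h \<in> carrier H \<Longrightarrow> v \<in> carrier M \<Longrightarrow> \<sigma> h v \<in> carrier M"
  shows "rep_iso H V \<rho> M \<sigma>"
proof -
  obtain f where f: "f \<in> hom M V" "bij_betw f (carrier M) (carrier V)"
    "\<And>h v. h \<in> carrier H \<Longrightarrow> v \<in> carrier M \<Longrightarrow> f (\<sigma> h v) = \<rho> h (f v)"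
    using i by (auto simp: rep_iso_def)
  define g where "g = the_inv_into (carrier M) f"
  have inj: "inj_on f (carrier M)" using f(2) by (simp add: bij_betw_def)
  have fg: "f (g v) = v" "g v \<in> carrier M" if "v \<in> carrier V" for v
  proof -
    have "v \<in> f ` carrier M" using f(2) that by (simp add: bij_betw_def)
    then show "f (g v) = v" "g v \<in> carrier M"
      unfolding g_def using f_the_inv_into_f[OF inj] the_inv_into_into[OF inj _ order_refl] by auto
  qed
  have gf: "g (f m) = m" if "m \<in> carrier M" for m unfolding g_def by (rule the_inv_into_f_f[OF inj that])
  have "g \<in> hom V M"
  proof (rule homI)
    show "g (v \<oplus>\<^bsub>V\<^esub> w) = g v \<oplus>\<^bsub>M\<^esub> g w" if "v \<in> carrier V" "w \<in> carrier V" for v w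
      using gf[OF cl(1)[OF fg(2)[OF that(1)] fg(2)[OF that(2)]]] homD(2)[OF f(1) fg(2)[OF that(1)] fg(2)[OF that(2)]] fg(1) that
      by simp
    show "g (c \<odot>\<^bsub>V\<^esub> v) = c \<odot>\<^bsub>M\<^esub> g v" if "v \<in> carrier V" for c v
      using gf[OF cl(2)[OF fg(2)[OF that], of c]] homD(3)[OF f(1) fg(2)[OF that], of c] fg(1) that by simp
  qed (rule fg(2))
  moreover have "bij_betw g (carrier V) (carrier M)"
    unfolding g_def by (rule bij_betw_the_inv_into[OF f(2)])
  moreover have "g (\<rho> h v) = \<sigma> h (g v)" if "h \<in> carrier H" "v \<in> carrier V" for h v
    using gf[OF cl(3)[OF that(1) fg(2)[OF that(2)]]] f(3)[OF that(1) fg(2)[OF that(2)]] fg(1)[OF that(2)] by simp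
  ultimately show ?thesis unfolding rep_iso_def by blast
qed

locale specht =
  fixes \<mu> :: "nat list" and n :: nat
  assumes part: "is_partition \<mu>" and pad: "padding_exists \<mu> n" and n1: "n \<ge> 1"
begin

abbreviation T where "T \<equiv> {1..n}"
abbreviation c where "c \<equiv> cy \<mu> n"
abbreviation Sp where "Sp \<equiv> specht_module (padded \<mu> n)"
abbreviation sa where "sa \<equiv> specht_action (padded \<mu> n)"

text \<open>Then \<open>(1 / kap) *q c\<close> is an idempotent, and \<open>c\<close> acts on its
  own image as the scalar \<open>kap\<close>.\<close>

definition kap where "kap = (SOME q. q \<noteq> 0 \<and> conv T c c = q *q c)"

lemma kap: "kap \<noteq> 0" "conv T c c = kap *q c"
  using someI_ex[OF cy_square[OF part pad n1]] by (auto simp: kap_def)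

lemma young_symmetrizer_eq: "young_symmetrizer (padded \<mu> n) = c"
proof -
  have s: "sum_list (padded \<mu> n) = n" by (rule padded_facts(2)[OF part pad n1])
  have "(\<lambda>p. if p \<in> row_stabilizer (padded \<mu> n) then 1 else 0) = row_sym T (std (padded \<mu> n))"
    by (simp add: row_sym_def row_stabilizer_def row_group_def s std_def)
  moreover have "(\<lambda>p. if p \<in> col_stabilizer (padded \<mu> n) then of_int (sign p) else 0) = col_sym T (std (padded \<mu> n))"
    by (simp add: col_sym_def col_stabilizer_def col_group_def s std_def)
  ultimately show ?thesis
    unfolding young_symmetrizer_def s cy_def using group_ring_mult[OF row_sym_alg col_sym_alg] by simp
qed

lemma c0: "c \<noteq> 0"
  unfolding cy_def by (rule young_nonzero[OF _ cy_tableau[OF part pad n1]]) simp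

lemma Sp_simps [simp]:
  "carrier Sp = (\<lambda>a. conv T a c) ` alg T" "\<zero>\<^bsub>Sp\<^esub> = 0" "x \<oplus>\<^bsub>Sp\<^esub> y = x + y" "q \<odot>\<^bsub>Sp\<^esub> x = q *q x"
proof -
  have s: "sum_list (padded \<mu> n) = n" by (rule padded_facts(2)[OF part pad n1])
  show "carrier Sp = (\<lambda>a. conv T a c) ` alg T"
    unfolding specht_module_def Let_def s young_symmetrizer_eq
    by (simp add: group_ring_carrier group_ring_mult[OF _ cy_alg] cong: image_cong_simp)
  show "\<zero>\<^bsub>Sp\<^esub> = 0" "x \<oplus>\<^bsub>Sp\<^esub> y = x + y" "q \<odot>\<^bsub>Sp\<^esub> x = q *q x"
    by (simp_all add: specht_module_def Let_def group_ring_def fun_eq_iff)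
qed

lemma Sp_alg: "x \<in> carrier Sp \<Longrightarrow> x \<in> alg T"
  using conv_alg[OF cy_alg[of \<mu> n]] by auto

lemma Sp_conv: "x \<in> carrier Sp \<Longrightarrow> a \<in> alg T \<Longrightarrow> conv T a x \<in> carrier Sp"
  using conv_assoc[of T a _ c] conv_alg[of _ T a] by (auto simp: image_iff; metis)

lemma c_Sp: "c \<in> carrier Sp"
  using conv_delta_left[of T c] alg_delta[of id T] permutes_id[of T] by (auto simp: image_iff; metis)

text \<open>As \<open>x\<close> is a product ending in \<open>c\<close>, this is the sandwich
  property. The symmetrizer cuts the Specht module down to the line through \<open>c\<close>, which
  is why one vector per copy is enough to count multiplicities.\<close>

lemma Sp_sandwich: "x \<in> carrier Sp \<Longrightarrow> \<exists>q. conv T c (conv T y x) = q *q c"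
  using cy_sandwich[OF part pad n1] conv_assoc[of T y _ c] by (auto) (metis finite_atLeastAtMost)

lemma sa_eq: "g \<in> perms T \<Longrightarrow> x \<in> carrier Sp \<Longrightarrow> sa g x = conv T (delta g) x"
proof -
  assume g: "g \<in> perms T" and x: "x \<in> carrier Sp"
  have s: "sum_list (padded \<mu> n) = n" by (rule padded_facts(2)[OF part pad n1])
  show ?thesis
    unfolding specht_action_def s delta_def[symmetric] by (rule group_ring_mult[OF alg_delta[OF g] Sp_alg[OF x]])
qed

lemma sa_closed: "g \<in> perms T \<Longrightarrow> x \<in> carrier Sp \<Longrightarrow> sa g x \<in> carrier Sp"
  using sa_eq Sp_conv alg_delta by metis

lemma Sp_closed: "x \<in> carrier Sp \<Longrightarrow> y \<in> carrier Sp \<Longrightarrow> x + y \<in> carrier Sp"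
  "x \<in> carrier Sp \<Longrightarrow> q *q x \<in> carrier Sp" "0 \<in> carrier Sp"
proof -
  interpret L: perm_rep T left_reg by (rule left_reg_rep) simp
  show "x + y \<in> carrier Sp" if "x \<in> carrier Sp" "y \<in> carrier Sp"
    using that L.act_add_left alg_add by (auto simp: image_iff; metis)
  show "q *q x \<in> carrier Sp" if "x \<in> carrier Sp"
    using that L.act_scl_left alg_scl by (auto simp: image_iff; metis)
  show "0 \<in> carrier Sp" using L.act_zero_left alg_zero by (auto simp: image_iff; metis)
qed

lemma Sp_vs: "vectorspace rat_field Sp"
proof (rule vectorspaceI)
  show "\<exists>w\<in>carrier Sp. w \<oplus>\<^bsub>Sp\<^esub> v = \<zero>\<^bsub>Sp\<^esub>" if "v \<in> carrier Sp" for v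
    using Sp_closed(2)[OF that, of "-1"] by (intro bexI[of _ "(-1) *q v"]) (auto simp: fun_eq_iff)
qed (use Sp_closed in \<open>auto simp del: Sp_simps(1) simp: fun_eq_iff algebra_simps\<close>)

lemma Sp_rep_act:
  assumes x: "x \<in> carrier Sp" shows "rep_act n Sp sa a x = conv T a x"
proof -
  have i: "(\<lambda>x. x) \<in> hom Sp funs" by (rule homI) auto
  have "rep_act n Sp sa a x = finsum funs (\<lambda>g. a g \<odot>\<^bsub>Sp\<^esub> sa g x) (perms T)"
    unfolding rep_act_def
    by (rule hom_finsum[OF Sp_vs funs_vs i]) (use sa_closed[OF _ x] Sp_closed(2) in auto)
  also have "\<dots> = (\<Sum>g\<in>perms T. a g *q left_reg g x)"
    unfolding finsum_funs
  proof (rule sum.cong[OF refl])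
    fix g assume g: "g \<in> perms T"
    have "sa g x = left_reg g x"
      using sa_eq[OF g x] perm_rep.act_delta[OF left_reg_rep[OF finite_atLeastAtMost] g, of x] by metis
    then show "a g \<odot>\<^bsub>Sp\<^esub> sa g x = a g *q left_reg g x" by (simp only: Sp_simps)
  qed
  finally show ?thesis by (simp only: act_def)
qed

lemma Sp_hom:
  assumes W: "vectorspace rat_field W" and F: "F \<in> hom Sp W"
    and eq: "\<And>g x. g \<in> perms T \<Longrightarrow> x \<in> carrier Sp \<Longrightarrow> F (sa g x) = \<rho> g (F x)" and x: "x \<in> carrier Sp"
  shows "F (conv T a x) = rep_act n W \<rho> a (F x)"
proof -
  have "F (rep_act n Sp sa a x) = rep_act n W \<rho> a (F x)"
    by (rule hom_rep_act[OF Sp_vs W F]) (use sa_closed[OF _ x] eq[OF _ x] in blast)+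
  then show ?thesis by (simp only: Sp_rep_act[OF x])
qed

text \<open>Irreducibility in operator form: any nonzero element leads back to the generator
  \<open>c\<close>. The product is nonzero by \<open>left_ideal_nonzero\<close> and a multiple of
  \<open>c\<close> by the sandwich property.\<close>

lemma Sp_left_ideal:
  assumes "x \<in> carrier Sp" "x \<noteq> 0"
  shows "\<exists>y\<in>alg T. \<exists>q. q \<noteq> 0 \<and> conv T c (conv T y x) = q *q c"
proof -
  obtain a where "x = conv T a c" using assms(1) by auto
  then obtain y where y: "y \<in> alg T" "conv T c (conv T y x) \<noteq> 0"
    using left_ideal_nonzero[of T x a c] cy_alg assms(2) by auto
  obtain q where q: "conv T c (conv T y x) = q *q c" using Sp_sandwich[OF assms(1)] by blast
  have "q \<noteq> 0" using q y(2) by auto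
  then show ?thesis using y(1) q by blast
qed

end

section \<open>Copies of a Specht module inside a representation\<close>

locale stage = sym_rep V crd vec d n \<rho> + specht \<mu> n for V crd vec d n \<rho> \<mu>
begin

text \<open>This is the image of \<open>c\<close> (\<open>eig_eq\<close>), written as an eigenspace
  so that it is visibly a subspace and every \<open>v\<close> in it is \<open>c\<close> applied to
  \<open>v\<close> divided by \<open>kap\<close>. Its dimension turns out to be the multiplicity of
  the Specht module.\<close>

definition eig where "eig = {v \<in> carrier V. ra c v = kap \<odot>\<^bsub>V\<^esub> v}"

lemma eig_image: "v \<in> carrier V \<Longrightarrow> ra c v \<in> eig"
  using ra_conv[of v c c] act_left_scl[of v kap c] kap(2) act_closed by (simp add: eig_def)

lemma eig_carrier: "v \<in> eig \<Longrightarrow> v \<in> carrier V" by (simp add: eig_def)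

lemma eig_self: "v \<in> eig \<Longrightarrow> ra c ((1 / kap) \<odot>\<^bsub>V\<^esub> v) = v"
  using homD(3)[OF act_right_hom, of v c "1 / kap"] vs_facts(11)[OF V_vs, of v "1 / kap" kap] vs_facts(2)[OF V_vs, of v] kap(1)
  by (simp add: eig_def)

lemma eig_eq: "eig = ra c ` carrier V"
  using eig_image eig_self vs_facts(3)[OF V_vs] eig_carrier by (metis (no_types, lifting) image_eqI image_subsetI subsetI subset_antisym)

lemma eig_subspace: "fv.subspace (crd ` eig)"
proof (rule crd_subspace)
  show "eig \<subseteq> carrier V" using eig_carrier by blast
  show "\<zero>\<^bsub>V\<^esub> \<in> eig" using act_zero_right vs_facts(4,5)[OF V_vs] by (simp add: eig_def)
  show "v \<oplus>\<^bsub>V\<^esub> w \<in> eig" if "v \<in> eig" "w \<in> eig" for v w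
    using that homD(2)[OF act_right_hom] vs_facts(9)[OF V_vs] by (simp add: eig_def)
  show "q \<odot>\<^bsub>V\<^esub> v \<in> eig" if "v \<in> eig" for q v
    using that homD(3)[OF act_right_hom] vs_facts(3)[OF V_vs] vs_facts(11)[OF V_vs, of v kap q] vs_facts(11)[OF V_vs, of v q kap]
    by (simp add: eig_def mult.commute)
qed

text \<open>Applying \<open>c\<close> after some \<open>y\<close> turns each \<open>z l\<close> into
  a multiple of \<open>c\<close>, and so turns the given relation into a linear one between the
  vectors \<open>u l\<close>. The element \<open>y\<close> is chosen to make the coefficient at
  \<open>j\<close> nonzero.\<close>

lemma independent_orbit:
  assumes u: "\<And>l. l < k \<Longrightarrow> u l \<in> eig"
    and ind: "\<And>\<alpha>. (\<Oplus>\<^bsub>V\<^esub>l\<in>{..<k}. \<alpha> l \<odot>\<^bsub>V\<^esub> u l) = \<zero>\<^bsub>V\<^esub> \<Longrightarrow> \<forall>l<k. \<alpha> l = 0"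
    and z: "\<And>l. l < k \<Longrightarrow> z l \<in> carrier Sp" and s: "(\<Oplus>\<^bsub>V\<^esub>l\<in>{..<k}. ra (z l) (u l)) = \<zero>\<^bsub>V\<^esub>"
    and j: "j < k"
  shows "z j = 0"
proof (rule ccontr)
  assume "z j \<noteq> 0"
  then obtain y q where y: "y \<in> alg T" "q \<noteq> 0" "conv T c (conv T y (z j)) = q *q c"
    using Sp_left_ideal[OF z[OF j]] by blast
  have uV: "u l \<in> carrier V" if "l < k" for l using u[OF that] by (rule eig_carrier)
  have "\<forall>l. \<exists>q. l < k \<longrightarrow> conv T c (conv T y (z l)) = q *q c"
    using Sp_sandwich[OF z] by blast
  from choice[OF this] obtain qs where "\<forall>l. l < k \<longrightarrow> conv T c (conv T y (z l)) = qs l *q c"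
    by (elim exE)
  then have qs: "conv T c (conv T y (z l)) = qs l *q c" if "l < k" for l using that by simp
  have "\<zero>\<^bsub>V\<^esub> = ra c (ra y (\<Oplus>\<^bsub>V\<^esub>l\<in>{..<k}. ra (z l) (u l)))" by (simp only: s act_zero_right)
  also have "\<dots> = (\<Oplus>\<^bsub>V\<^esub>l\<in>{..<k}. ra c (ra y (ra (z l) (u l))))"
    using uV act_closed by (subst hom_finsum[OF V_vs V_vs act_right_hom], force)+ simp
  also have "\<dots> = (\<Oplus>\<^bsub>V\<^esub>l\<in>{..<k}. (qs l * kap) \<odot>\<^bsub>V\<^esub> u l)"
  proof (rule finsum_cong'[OF refl])
    show "(\<lambda>l. (qs l * kap) \<odot>\<^bsub>V\<^esub> u l) \<in> {..<k} \<rightarrow> carrier V" using uV vs_facts(3)[OF V_vs] by auto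
    fix l assume "l \<in> {..<k}"
    then have l: "l < k" by simp
    have "ra c (ra y (ra (z l) (u l))) = ra (conv T c (conv T y (z l))) (u l)"
      using uV[OF l] act_closed by (simp only: ra_conv)
    also have "\<dots> = (qs l * kap) \<odot>\<^bsub>V\<^esub> u l"
    proof -
      have "ra c (u l) = kap \<odot>\<^bsub>V\<^esub> u l" using u[OF l] by (simp add: eig_def)
      then show ?thesis by (simp only: qs[OF l] act_left_scl[OF uV[OF l]] vs_facts(11)[OF V_vs uV[OF l]])
    qed
    finally show "ra c (ra y (ra (z l) (u l))) = (qs l * kap) \<odot>\<^bsub>V\<^esub> u l" .
  qed
  finally have zz: "\<zero>\<^bsub>V\<^esub> = (\<Oplus>\<^bsub>V\<^esub>l\<in>{..<k}. (qs l * kap) \<odot>\<^bsub>V\<^esub> u l)" .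
  have "\<forall>l<k. qs l * kap = 0" by (rule ind[OF zz[symmetric]])
  then have "qs j * kap = 0" using j by simp
  then have "qs j = 0" using kap(1) by simp
  then have "q *q c = 0" using y(3) qs[OF j] by simp
  then show False using y(2) c0 fv.scale_eq_0_iff by blast
qed

lemma power_simps [simp]:
  "carrier (module_power M k) = {..<k} \<rightarrow>\<^sub>E carrier M" "x \<oplus>\<^bsub>module_power M k\<^esub> y = (\<lambda>i\<in>{..<k}. x i \<oplus>\<^bsub>M\<^esub> y i)"
  "a \<odot>\<^bsub>module_power M k\<^esub> x = (\<lambda>i\<in>{..<k}. a \<odot>\<^bsub>M\<^esub> x i)"
  by (simp_all add: module_power_def)

lemma ra_left_hom: "v \<in> carrier V \<Longrightarrow> (\<lambda>x. ra x v) \<in> hom Sp V"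
  by (rule homI) (simp_all add: act_closed act_left_add act_left_scl)

text \<open>The map sends a tuple \<open>x\<close> to the sum of \<open>x l\<close> applied to
  \<open>u l\<close>; it is injective by \<open>independent_orbit\<close>. Minimality of
  \<open>U\<close> places this copy inside any subrepresentation that contains the vectors.\<close>

lemma orbit_iso:
  assumes u: "\<And>l. l < k \<Longrightarrow> u l \<in> eig"
    and ind: "\<And>\<alpha>. (\<Oplus>\<^bsub>V\<^esub>l\<in>{..<k}. \<alpha> l \<odot>\<^bsub>V\<^esub> u l) = \<zero>\<^bsub>V\<^esub> \<Longrightarrow> \<forall>l<k. \<alpha> l = 0"
  shows "\<exists>U. sr U \<and> rep_iso (sym_group n) (V\<lparr>carrier := U\<rparr>) \<rho> (module_power Sp k) (power_action k sa) \<and>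
    (\<forall>W. sr W \<longrightarrow> (\<forall>l<k. u l \<in> W) \<longrightarrow> U \<subseteq> W)"
proof -
  let ?M = "module_power Sp k"
  define g where "g = (\<lambda>x. \<Oplus>\<^bsub>V\<^esub>l\<in>{..<k}. ra (x l) (u l))"
  define U where "U = g ` carrier ?M"
  have uV: "u l \<in> carrier V" if "l < k" for l using u[OF that] by (rule eig_carrier)
  have tm: "(\<lambda>l. ra (x l) (u l)) \<in> {..<k} \<rightarrow> carrier V" for x using uV act_closed by auto
  have g: "g \<in> hom ?M V"
  proof (rule homI)
    show "g x \<in> carrier V" for x unfolding g_def by (rule finsum_closed[OF tm])
    show "g (x \<oplus>\<^bsub>?M\<^esub> y) = g x \<oplus>\<^bsub>V\<^esub> g y" for x y
      unfolding g_def
      by (subst finsum_addf[symmetric, OF tm tm], rule finsum_cong'[OF refl])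
         (use uV act_closed in \<open>auto simp: act_left_add\<close>)
    show "g (q \<odot>\<^bsub>?M\<^esub> x) = q \<odot>\<^bsub>V\<^esub> g x" for q x
      unfolding g_def
      by (subst finsum_smult_ldistr[OF _ _ tm], simp, simp, rule finsum_cong'[OF refl])
         (use uV act_closed vs_facts(3)[OF V_vs] in \<open>auto simp: act_left_scl\<close>)
  qed
  have xS: "x l \<in> carrier Sp" if "x \<in> carrier ?M" "l < k" for x l
    using that by (auto simp: PiE_iff simp del: Sp_simps)
  have geq: "g (power_action k sa h x) = \<rho> h (g x)" if h: "h \<in> P" and x: "x \<in> carrier ?M" for h x
  proof -
    have "\<rho> h (g x) = (\<Oplus>\<^bsub>V\<^esub>l\<in>{..<k}. \<rho> h (ra (x l) (u l)))"
      unfolding g_def by (rule hom_finsum[OF V_vs V_vs rho_hom[OF h] tm])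
    also have "\<dots> = g (power_action k sa h x)"
      unfolding g_def
    proof (rule finsum_cong'[OF refl tm])
      fix l assume "l \<in> {..<k}"
      then have l: "l < k" by simp
      have "power_action k sa h x l = conv T (delta h) (x l)"
        using l by (simp add: power_action_def sa_eq[OF h xS[OF x l]])
      then show "\<rho> h (ra (x l) (u l)) = ra (power_action k sa h x l) (u l)"
        by (simp only: ra_conv[OF uV[OF l]] ra_delta[OF act_closed[OF uV[OF l]] h])
    qed
    finally show ?thesis ..
  qed
  have Mcl: "\<And>x y. x \<in> carrier ?M \<Longrightarrow> y \<in> carrier ?M \<Longrightarrow> x \<oplus>\<^bsub>?M\<^esub> y \<in> carrier ?M"
    "\<And>x q. x \<in> carrier ?M \<Longrightarrow> q \<odot>\<^bsub>?M\<^esub> x \<in> carrier ?M"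
    "\<And>h x. h \<in> P \<Longrightarrow> x \<in> carrier ?M \<Longrightarrow> power_action k sa h x \<in> carrier ?M"
    using xS Sp_closed sa_closed by (auto simp: power_action_def restrict_PiE_iff simp del: Sp_simps(1))
  have inj: "inj_on g (carrier ?M)"
  proof (rule inj_onI)
    fix x y assume xy: "x \<in> carrier ?M" "y \<in> carrier ?M" "g x = g y"
    define z where "z = x \<oplus>\<^bsub>?M\<^esub> ((-1) \<odot>\<^bsub>?M\<^esub> y)"
    have zM: "z \<in> carrier ?M" unfolding z_def by (intro Mcl xy)
    have gV: "g x \<in> carrier V" "g y \<in> carrier V" using homD(1)[OF g] xy by auto
    have "g z = g x \<oplus>\<^bsub>V\<^esub> (-1) \<odot>\<^bsub>V\<^esub> g y"
      unfolding z_def by (simp only: homD(2)[OF g xy(1) Mcl(2)[OF xy(2)]] homD(3)[OF g xy(2)])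
    then have "g z = \<zero>\<^bsub>V\<^esub>" using gV xy(3) vs_facts(6)[OF V_vs] vrneg by simp
    then have "z l = 0" if "l < k" for l
      using independent_orbit[OF u ind xS[OF zM] _ that] by (simp add: g_def)
    then have e: "x l = y l" if "l < k" for l
      using that by (simp add: z_def fun_eq_iff)
    show "x = y"
      by (rule PiE_ext[of x "{..<k}" "\<lambda>_. carrier Sp" y]) (use xy e in \<open>simp_all del: Sp_simps\<close>)
  qed
  have zM: "(\<lambda>l\<in>{..<k}. 0) \<in> carrier ?M" using Sp_closed(3) by (simp del: Sp_simps)
  have "g (\<lambda>l\<in>{..<k}. 0) = (\<Oplus>\<^bsub>V\<^esub>l\<in>{..<k}. \<zero>\<^bsub>V\<^esub>)"
    unfolding g_def
  proof (rule finsum_cong'[OF refl])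
    fix l assume "l \<in> {..<k}"
    then show "ra ((\<lambda>l\<in>{..<k}. 0) l) (u l) = \<zero>\<^bsub>V\<^esub>"
      using hom_zero[OF Sp_vs V_vs ra_left_hom[OF uV]] by simp
  qed simp
  then have g0: "g (\<lambda>l\<in>{..<k}. 0) = \<zero>\<^bsub>V\<^esub>" by (simp add: finsum_zero)
  have sU: "sr U"
  proof (rule srI)
    show "U \<subseteq> carrier V" using homD(1)[OF g] by (auto simp: U_def)
    show "\<zero>\<^bsub>V\<^esub> \<in> U" unfolding U_def by (subst g0[symmetric], rule imageI[OF zM])
    show "v \<oplus>\<^bsub>V\<^esub> w \<in> U" if i1: "v \<in> U" and i2: "w \<in> U" for v w
    proof -
      obtain x where x: "x \<in> carrier ?M" "v = g x" using i1 unfolding U_def by blast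
      obtain y where y: "y \<in> carrier ?M" "w = g y" using i2 unfolding U_def by blast
      show ?thesis unfolding U_def
        by (rule image_eqI[OF _ Mcl(1)[OF x(1) y(1)]]) (simp only: x(2) y(2) homD(2)[OF g x(1) y(1)])
    qed
    show "q \<odot>\<^bsub>V\<^esub> v \<in> U" if i1: "v \<in> U" for q v
    proof -
      obtain x where x: "x \<in> carrier ?M" "v = g x" using i1 unfolding U_def by blast
      show ?thesis unfolding U_def
        by (rule image_eqI[OF _ Mcl(2)[OF x(1)]]) (simp only: x(2) homD(3)[OF g x(1)])
    qed
    show "\<rho> h v \<in> U" if i1: "h \<in> P" and i2: "v \<in> U" for h v
    proof -
      obtain x where x: "x \<in> carrier ?M" "v = g x" using i2 unfolding U_def by blast
      show ?thesis unfolding U_def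
        by (rule image_eqI[OF _ Mcl(3)[OF that(1) x(1)]]) (simp only: x(2) geq[OF that(1) x(1)])
    qed
  qed
  have "rep_iso (sym_group n) ?M (power_action k sa) (V\<lparr>carrier := U\<rparr>) \<rho>"
    unfolding rep_iso_def
  proof (intro bexI conjI ballI)
    show "g \<in> hom ?M (V\<lparr>carrier := U\<rparr>)"
      by (rule homI) (use homD[OF g] in \<open>auto simp: U_def simp del: power_simps Sp_simps\<close>)
    show "bij_betw g (carrier ?M) (carrier (V\<lparr>carrier := U\<rparr>))" using inj by (simp add: bij_betw_def U_def)
    show "g (power_action k sa h x) = \<rho> h (g x)" if "h \<in> carrier (sym_group n)" "x \<in> carrier ?M" for h x
      using geq that by simp
  qed
  then have iso: "rep_iso (sym_group n) (V\<lparr>carrier := U\<rparr>) \<rho> ?M (power_action k sa)"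
    by (rule rep_iso_sym) (rule Mcl, assumption+, rule Mcl, assumption, rule Mcl, simp, assumption)
  have "U \<subseteq> W" if W: "sr W" and uW: "\<forall>l<k. u l \<in> W" for W
    unfolding U_def g_def using uW sr_act[OF W] by (auto intro!: sr_finsum[OF W])
  then show ?thesis using sU iso by blast
qed

text \<open>The converse of \<open>orbit_iso\<close>: the vectors are the images of \<open>c\<close>
  placed in the \<open>k\<close> coordinates of the power, which are independent since the
  isomorphism is injective.\<close>

lemma iso_vectors:
  assumes W: "sr W" and i: "rep_iso (sym_group n) (V\<lparr>carrier := W\<rparr>) \<rho> (module_power Sp k) (power_action k sa)"
  shows "\<exists>u. (\<forall>l<k. u l \<in> W \<and> u l \<in> eig) \<and>
    (\<forall>\<alpha>. (\<Oplus>\<^bsub>V\<^esub>l\<in>{..<k}. \<alpha> l \<odot>\<^bsub>V\<^esub> u l) = \<zero>\<^bsub>V\<^esub> \<longrightarrow> (\<forall>l<k. \<alpha> l = 0))"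
proof -
  let ?M = "module_power Sp k" and ?W = "V\<lparr>carrier := W\<rparr>"
  have "rep_iso (sym_group n) ?M (power_action k sa) ?W \<rho>"
    by (rule rep_iso_sym[OF i]) (use srD[OF W] in auto)
  then obtain f where f: "f \<in> hom ?M ?W" "bij_betw f (carrier ?M) W"
    "\<And>h x. h \<in> P \<Longrightarrow> x \<in> carrier ?M \<Longrightarrow> f (power_action k sa h x) = \<rho> h (f x)"
    by (auto simp: rep_iso_def simp del: power_simps Sp_simps)
  have Wvs: "vectorspace rat_field ?W" by (rule subrep_vectorspace[OF W])
  have WV: "\<And>w. w \<in> W \<Longrightarrow> w \<in> carrier V" using srD(1)[OF W] by blast
  define e where "e = (\<lambda>l x. \<lambda>i\<in>{..<k}. if i = l then x else (0 :: (nat \<Rightarrow> nat) \<Rightarrow> rat))"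
  have eM: "e l x \<in> carrier ?M" if "x \<in> carrier Sp" for l x
    using that Sp_closed(3) by (auto simp: e_def simp del: Sp_simps)
  define F where "F = (\<lambda>l x. f (e l x))"
  have F: "F l \<in> hom Sp V" for l
  proof (rule homI)
    show "F l x \<in> carrier V" if "x \<in> carrier Sp" for x
      using homD(1)[OF f(1) eM[OF that]] WV by (simp add: F_def)
    show "F l (x \<oplus>\<^bsub>Sp\<^esub> y) = F l x \<oplus>\<^bsub>V\<^esub> F l y" if "x \<in> carrier Sp" "y \<in> carrier Sp" for x y
    proof -
      have "e l (x + y) = e l x \<oplus>\<^bsub>?M\<^esub> e l y" by (auto simp: e_def fun_eq_iff)
      then show ?thesis using homD(2)[OF f(1) eM[OF that(1)] eM[OF that(2)]] by (simp add: F_def)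
    qed
    show "F l (q \<odot>\<^bsub>Sp\<^esub> x) = q \<odot>\<^bsub>V\<^esub> F l x" if "x \<in> carrier Sp" for q x
    proof -
      have "e l (q *q x) = q \<odot>\<^bsub>?M\<^esub> e l x" by (auto simp: e_def fun_eq_iff)
      then show ?thesis using homD(3)[OF f(1) eM[OF that]] by (simp add: F_def)
    qed
  qed
  have Feq: "F l (sa g x) = \<rho> g (F l x)" if "g \<in> P" "x \<in> carrier Sp" for l g x
  proof -
    have z: "sa g 0 = 0"
      using sa_eq[OF that(1) Sp_closed(3)] lin_zero[OF perm_rep.lin_act[OF left_reg_rep[OF finite_atLeastAtMost]]] by simp
    have "e l (sa g x) = power_action k sa g (e l x)"
      by (rule ext) (simp add: e_def power_action_def z)
    then show ?thesis using f(3)[OF that(1) eM[OF that(2)]] by (simp add: F_def)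
  qed
  define u where "u = (\<lambda>l. F l c)"
  have uW: "u l \<in> W" for l using homD(1)[OF f(1) eM[OF c_Sp]] by (simp add: u_def F_def)
  have "ra c (u l) = kap \<odot>\<^bsub>V\<^esub> u l" for l
  proof -
    have "F l (conv T c c) = ra c (F l c)" by (rule Sp_hom[OF V_vs F _ c_Sp]) (rule Feq)
    moreover have "F l (kap *q c) = kap \<odot>\<^bsub>V\<^esub> F l c" using homD(3)[OF F c_Sp, of l kap] by (simp only: Sp_simps)
    ultimately show ?thesis by (simp only: u_def kap(2))
  qed
  then have ue: "u l \<in> eig" for l using uW WV by (simp add: eig_def)
  have "\<forall>l<k. \<alpha> l = 0" if s: "(\<Oplus>\<^bsub>V\<^esub>l\<in>{..<k}. \<alpha> l \<odot>\<^bsub>V\<^esub> u l) = \<zero>\<^bsub>V\<^esub>" for \<alpha>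
  proof -
    \<comment> \<open>\<open>y j\<close> keeps the first \<open>j\<close> terms of the relation. The
      value of \<open>f\<close> on the full sum is reached by letting \<open>j\<close> grow, using
      additivity for two summands only.\<close>
    define y where "y = (\<lambda>j l. if l < j \<and> l < k then \<alpha> l *q c else 0)"
    have yM: "restrict (y j) {..<k} \<in> carrier ?M" for j
      using Sp_closed(2)[OF c_Sp] Sp_closed(3) by (auto simp: y_def simp del: Sp_simps)
    have part_sum: "f (restrict (y j) {..<k}) = (\<Oplus>\<^bsub>V\<^esub>l\<in>{..<j}. \<alpha> l \<odot>\<^bsub>V\<^esub> u l)" if "j \<le> k" for j
      using that
    proof (induction j)
      case 0
      have "restrict (y 0) {..<k} = 0 \<odot>\<^bsub>?M\<^esub> restrict (y 0) {..<k}" by (auto simp: y_def fun_eq_iff)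
      then have "f (restrict (y 0) {..<k}) = 0 \<odot>\<^bsub>V\<^esub> f (restrict (y 0) {..<k})"
        using homD(3)[OF f(1) yM, of 0 0] by (simp del: power_simps)
      then have "f (restrict (y 0) {..<k}) = \<zero>\<^bsub>V\<^esub>"
        using vs_facts(1)[OF V_vs WV] homD(1)[OF f(1) yM[of 0]] by (simp del: power_simps restrict_apply)
      then show ?case by (simp only: lessThan_0 finsum_empty)
    next
      case (Suc j)
      have "restrict (y (Suc j)) {..<k} = (\<alpha> j \<odot>\<^bsub>?M\<^esub> e j c) \<oplus>\<^bsub>?M\<^esub> restrict (y j) {..<k}"
        using Suc.prems by (auto simp: y_def e_def fun_eq_iff less_Suc_eq)
      moreover have "\<alpha> j \<odot>\<^bsub>?M\<^esub> e j c \<in> carrier ?M"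
        using eM[OF Sp_closed(2)[OF c_Sp], of j "\<alpha> j"] by (rule back_subst[of "\<lambda>z. z \<in> carrier ?M"]) (auto simp: e_def fun_eq_iff)
      ultimately have "f (restrict (y (Suc j)) {..<k}) = \<alpha> j \<odot>\<^bsub>V\<^esub> u j \<oplus>\<^bsub>V\<^esub> (\<Oplus>\<^bsub>V\<^esub>l\<in>{..<j}. \<alpha> l \<odot>\<^bsub>V\<^esub> u l)"
      proof -
        assume a: "restrict (y (Suc j)) {..<k} = (\<alpha> j \<odot>\<^bsub>?M\<^esub> e j c) \<oplus>\<^bsub>?M\<^esub> restrict (y j) {..<k}"
          and b: "\<alpha> j \<odot>\<^bsub>?M\<^esub> e j c \<in> carrier ?M"
        have hf: "f (A \<oplus>\<^bsub>?M\<^esub> B) = f A \<oplus>\<^bsub>V\<^esub> f B" if "A \<in> carrier ?M" "B \<in> carrier ?M" for A B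
          using homD(2)[OF f(1) that] by simp
        have hs: "f (q \<odot>\<^bsub>?M\<^esub> A) = q \<odot>\<^bsub>V\<^esub> f A" if "A \<in> carrier ?M" for q A
          using homD(3)[OF f(1) that] by simp
        have "f (restrict (y j) {..<k}) = (\<Oplus>\<^bsub>V\<^esub>l\<in>{..<j}. \<alpha> l \<odot>\<^bsub>V\<^esub> u l)"
          by (rule Suc.IH) (use Suc.prems in simp)
        then show ?thesis by (simp only: a hf[OF b yM] hs[OF eM[OF c_Sp]] u_def F_def)
      qed
      also have "\<dots> = (\<Oplus>\<^bsub>V\<^esub>l\<in>{..<Suc j}. \<alpha> l \<odot>\<^bsub>V\<^esub> u l)"
        unfolding lessThan_Suc using uW WV vs_facts(3)[OF V_vs] by (subst finsum_insert) auto
      finally show ?case .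
    qed
    have "f (restrict (y 0) {..<k}) = (\<Oplus>\<^bsub>V\<^esub>l\<in>{..<0}. \<alpha> l \<odot>\<^bsub>V\<^esub> u l)" by (rule part_sum) simp
    also have "\<dots> = \<zero>\<^bsub>V\<^esub>" by simp
    finally have z0: "f (restrict (y 0) {..<k}) = \<zero>\<^bsub>V\<^esub>" .
    have "f (restrict (y k) {..<k}) = (\<Oplus>\<^bsub>V\<^esub>l\<in>{..<k}. \<alpha> l \<odot>\<^bsub>V\<^esub> u l)" by (rule part_sum) simp
    also have "\<dots> = \<zero>\<^bsub>V\<^esub>" by (rule s)
    finally have "f (restrict (y k) {..<k}) = \<zero>\<^bsub>V\<^esub>" .
    then have "restrict (y k) {..<k} = restrict (y 0) {..<k}"
      by (intro inj_onD[OF bij_betw_imp_inj_on[OF f(2)] _ yM yM]) (simp only: z0)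
    then have eq: "restrict (y k) {..<k} l = restrict (y 0) {..<k} l" for l by simp
    show ?thesis
    proof (intro allI impI)
      fix l assume "l < k"
      then have "\<alpha> l *q c = 0" using eq[of l] by (simp add: y_def)
      then show "\<alpha> l = 0" using c0 fv.scale_eq_0_iff by blast
    qed
  qed
  then show ?thesis using uW ue by blast
qed

text \<open>Schur's lemma seen through the symmetrizer. In a copy of the Specht module the image of
  \<open>c\<close> is a line. If some \<open>ra c w\<close> is nonzero, it generates a copy of the
  Specht module, which by irreducibility is all of \<open>W\<close>.\<close>

lemma irreducible_iso:
  assumes W: "irreducible_subrep (sym_group n) V \<rho> W"
  shows "rep_iso (sym_group n) (V\<lparr>carrier := W\<rparr>) \<rho> Sp sa \<Longrightarrow>
      \<exists>u\<in>W. u \<in> eig \<and> u \<noteq> \<zero>\<^bsub>V\<^esub> \<and> (\<forall>w\<in>W. \<exists>q. ra c w = q \<odot>\<^bsub>V\<^esub> u)"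
    and "\<not> rep_iso (sym_group n) (V\<lparr>carrier := W\<rparr>) \<rho> Sp sa \<Longrightarrow> w \<in> W \<Longrightarrow> ra c w = \<zero>\<^bsub>V\<^esub>"
proof -
  let ?W = "V\<lparr>carrier := W\<rparr>"
  have sW: "sr W" using W by (simp add: irreducible_subrep_def)
  have WV: "\<And>w. w \<in> W \<Longrightarrow> w \<in> carrier V" using srD(1)[OF sW] by blast
  show "\<exists>u\<in>W. u \<in> eig \<and> u \<noteq> \<zero>\<^bsub>V\<^esub> \<and> (\<forall>w\<in>W. \<exists>q. ra c w = q \<odot>\<^bsub>V\<^esub> u)"
    if i: "rep_iso (sym_group n) ?W \<rho> Sp sa"
  proof -
    have "rep_iso (sym_group n) Sp sa ?W \<rho>" by (rule rep_iso_sym[OF i]) (use srD[OF sW] in auto)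
    then obtain F where F: "F \<in> hom Sp ?W" "bij_betw F (carrier Sp) W"
      "\<And>h x. h \<in> P \<Longrightarrow> x \<in> carrier Sp \<Longrightarrow> F (sa h x) = \<rho> h (F x)"
      by (auto simp: rep_iso_def simp del: Sp_simps)
    have FV: "F \<in> hom Sp V" by (rule homI) (use homD[OF F(1)] WV in auto)
    have FF: "F (conv T a x) = ra a (F x)" if "x \<in> carrier Sp" for a x
      by (rule Sp_hom[OF V_vs FV _ that]) (rule F(3))
    have Fs: "F (q *q c) = q \<odot>\<^bsub>V\<^esub> F c" for q
      using homD(3)[OF FV c_Sp, of q] by (simp only: Sp_simps)
    have uW: "F c \<in> W" using homD(1)[OF F(1) c_Sp] by simp
    have "ra c (F c) = kap \<odot>\<^bsub>V\<^esub> F c"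
      by (simp only: FF[OF c_Sp, symmetric] kap(2) Fs)
    then have ue: "F c \<in> eig" using uW WV by (simp add: eig_def)
    have "F c \<noteq> \<zero>\<^bsub>V\<^esub>"
    proof
      assume "F c = \<zero>\<^bsub>V\<^esub>"
      then have "F c = F 0" using hom_zero[OF Sp_vs V_vs FV] by simp
      then have "c = 0" using F(2) c_Sp Sp_closed(3) by (meson bij_betw_def inj_onD)
      then show False using c0 by simp
    qed
    moreover have "\<exists>q. ra c w = q \<odot>\<^bsub>V\<^esub> F c" if w: "w \<in> W" for w
    proof -
      obtain x where x: "x \<in> carrier Sp" "w = F x" using F(2) w by (auto simp: bij_betw_def)
      obtain q where "conv T c (conv T (delta id) x) = q *q c" using Sp_sandwich[OF x(1)] by blast
      then have "conv T c x = q *q c" by (simp only: conv_delta_left[OF finite_atLeastAtMost])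
      then have "ra c w = q \<odot>\<^bsub>V\<^esub> F c" by (simp only: x(2) FF[OF x(1), symmetric] Fs)
      then show ?thesis by (rule exI)
    qed
    ultimately show ?thesis using uW ue by blast
  qed
  show "ra c w = \<zero>\<^bsub>V\<^esub>" if ni: "\<not> rep_iso (sym_group n) ?W \<rho> Sp sa" and w: "w \<in> W"
  proof (rule ccontr)
    assume nz: "ra c w \<noteq> \<zero>\<^bsub>V\<^esub>"
    define u where "u = ra c w"
    have uW: "u \<in> W" unfolding u_def by (rule sr_act[OF sW w])
    have uV: "u \<in> carrier V" by (rule WV[OF uW])
    have ue: "u \<in> eig" unfolding u_def by (rule eig_image[OF WV[OF w]])
    have one: "(\<Oplus>\<^bsub>V\<^esub>l\<in>{..<Suc 0}. h l) = h 0" if "h 0 \<in> carrier V" for h :: "nat \<Rightarrow> 'a"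
      using that by (simp add: lessThan_Suc)
    have inj0: "x = 0" if "x \<in> carrier Sp" "ra x u = \<zero>\<^bsub>V\<^esub>" for x
    proof (rule independent_orbit[where k = "Suc 0" and u = "\<lambda>_. u" and z = "\<lambda>_. x" and j = 0])
      show "\<forall>l<Suc 0. \<alpha> l = 0" if "(\<Oplus>\<^bsub>V\<^esub>l\<in>{..<Suc 0}. \<alpha> l \<odot>\<^bsub>V\<^esub> u) = \<zero>\<^bsub>V\<^esub>" for \<alpha>
        using that one[of "\<lambda>l. \<alpha> l \<odot>\<^bsub>V\<^esub> u"] vs_facts(3)[OF V_vs uV] vs_facts(12)[OF V_vs uV] nz by (auto simp: u_def)
      show "(\<Oplus>\<^bsub>V\<^esub>l\<in>{..<Suc 0}. ra x u) = \<zero>\<^bsub>V\<^esub>" using one[of "\<lambda>_. ra x u"] act_closed[OF uV] that(2) by simp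
    qed (use ue that in auto)
    let ?g = "\<lambda>x. ra x u"
    note g = ra_left_hom[OF uV]
    have geq: "?g (sa h x) = \<rho> h (?g x)" if "h \<in> P" "x \<in> carrier Sp" for h x
      by (simp only: sa_eq[OF that] ra_conv[OF uV] ra_delta[OF act_closed[OF uV] that(1)])
    have sI: "sr (?g ` carrier Sp)"
    proof (rule srI)
      show "?g ` carrier Sp \<subseteq> carrier V" using act_closed[OF uV] by blast
      have "?g 0 = \<zero>\<^bsub>V\<^esub>" using hom_zero[OF Sp_vs V_vs g] by simp
      then show "\<zero>\<^bsub>V\<^esub> \<in> ?g ` carrier Sp" using Sp_closed(3) by (rule image_eqI[OF sym])
      show "v \<oplus>\<^bsub>V\<^esub> w \<in> ?g ` carrier Sp" if i1: "v \<in> ?g ` carrier Sp" and i2: "w \<in> ?g ` carrier Sp" for v w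
      proof -
        obtain x where "v = ra x u" "x \<in> carrier Sp" using i1 by (rule imageE)
        then have x: "x \<in> carrier Sp" "v = ra x u" by (simp_all only:)
        obtain y where "w = ra y u" "y \<in> carrier Sp" using i2 by (rule imageE)
        then have y: "y \<in> carrier Sp" "w = ra y u" by (simp_all only:)
        show ?thesis by (rule image_eqI[OF _ Sp_closed(1)[OF x(1) y(1)]]) (simp only: x(2) y(2) act_left_add[OF uV])
      qed
      show "q \<odot>\<^bsub>V\<^esub> v \<in> ?g ` carrier Sp" if i1: "v \<in> ?g ` carrier Sp" for q v
      proof -
        obtain x where "v = ra x u" "x \<in> carrier Sp" using i1 by (rule imageE)
        then have x: "x \<in> carrier Sp" "v = ra x u" by (simp_all only:)
        show ?thesis by (rule image_eqI[OF _ Sp_closed(2)[OF x(1)]]) (simp only: x(2) act_left_scl[OF uV])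
      qed
      show "\<rho> h v \<in> ?g ` carrier Sp" if i1: "h \<in> P" and i2: "v \<in> ?g ` carrier Sp" for h v
      proof -
        obtain x where "v = ra x u" "x \<in> carrier Sp" using i2 by (rule imageE)
        then have x: "x \<in> carrier Sp" "v = ra x u" by (simp_all only:)
        show ?thesis by (rule image_eqI[OF _ sa_closed[OF that(1) x(1)]]) (simp only: x(2) geq[OF that(1) x(1)])
      qed
    qed
    have sub: "?g ` carrier Sp \<subseteq> W" using sr_act[OF sW uW] by blast
    have "?g c = kap \<odot>\<^bsub>V\<^esub> u" using ue by (simp add: eig_def)
    then have "?g c \<noteq> \<zero>\<^bsub>V\<^esub>" using vs_facts(12)[OF V_vs uV] kap(1) nz u_def by metis
    then have "?g ` carrier Sp \<noteq> {\<zero>\<^bsub>V\<^esub>}" using c_Sp by blast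
    then have im: "?g ` carrier Sp = W" using W sI sub unfolding irreducible_subrep_def by blast
    have inj: "inj_on ?g (carrier Sp)"
    proof (rule inj_onI)
      fix x y assume xy: "x \<in> carrier Sp" "y \<in> carrier Sp" "?g x = ?g y"
      have yn: "(-1) *q y \<in> carrier Sp" by (rule Sp_closed(2)[OF xy(2)])
      have "?g (x + (-1) *q y) = \<zero>\<^bsub>V\<^esub>"
        using act_left_add[OF uV, of x "(-1) *q y"] act_left_scl[OF uV, of "-1" y] xy(3)
          vs_facts(6)[OF V_vs act_closed[OF uV]] vrneg[OF act_closed[OF uV]] by simp
      then have "x + (-1) *q y = 0" using inj0 Sp_closed(1)[OF xy(1) yn] by blast
      then show "x = y" by (simp add: fun_eq_iff)
    qed
    have "rep_iso (sym_group n) Sp sa ?W \<rho>"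
      unfolding rep_iso_def
    proof (intro bexI conjI ballI)
      show "?g \<in> hom Sp ?W" by (rule homI) (use im homD[OF g] in \<open>auto simp del: Sp_simps(1)\<close>)
      show "bij_betw ?g (carrier Sp) (carrier ?W)" using inj im by (simp add: bij_betw_def del: Sp_simps)
    qed (use geq in simp)
    then have "rep_iso (sym_group n) ?W \<rho> Sp sa"
      by (rule rep_iso_sym) (use Sp_closed sa_closed in \<open>simp_all del: Sp_simps(1)\<close>)
    then show False using ni by simp
  qed
qed

text \<open>Each summand isomorphic to the Specht module contributes a line to the image of
  \<open>c\<close> and each other summand contributes nothing, so generators of these lines form a
  basis of the image.\<close>

lemma decomposition_multiplicity:
  assumes D: "irreducible_decomposition (sym_group n) V \<rho> r W"
  shows "card {i. i < r \<and> rep_iso (sym_group n) (V\<lparr>carrier := W i\<rparr>) \<rho> Sp sa} = fv.dim (crd ` eig)"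
proof -
  define I where "I = {i. i < r \<and> rep_iso (sym_group n) (V\<lparr>carrier := W i\<rparr>) \<rho> Sp sa}"
  have irr: "irreducible_subrep (sym_group n) V \<rho> (W i)" if "i < r" for i
    using D that by (simp add: irreducible_decomposition_def)
  have uni: "\<exists>!w. w \<in> (\<Pi>\<^sub>E i\<in>{..<r}. W i) \<and> v = (\<Oplus>\<^bsub>V\<^esub>i\<in>{..<r}. w i)" if "v \<in> carrier V" for v
    using D that by (simp add: irreducible_decomposition_def)
  have sW: "sr (W i)" if "i < r" for i using irr[OF that] by (simp add: irreducible_subrep_def)
  have WV: "w \<in> carrier V" if "i < r" "w \<in> W i" for i w using srD(1)[OF sW[OF that(1)]] that(2) by blast
  have fI: "finite I" by (simp add: I_def)
  have "\<forall>i. \<exists>u. i \<in> I \<longrightarrow> u \<in> W i \<and> u \<in> eig \<and> u \<noteq> \<zero>\<^bsub>V\<^esub> \<and> (\<forall>w\<in>W i. \<exists>q. ra c w = q \<odot>\<^bsub>V\<^esub> u)"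
    using irreducible_iso(1)[OF irr] unfolding I_def by blast
  then obtain u where u: "\<And>i. i \<in> I \<Longrightarrow> u i \<in> W i \<and> u i \<in> eig \<and> u i \<noteq> \<zero>\<^bsub>V\<^esub> \<and> (\<forall>w\<in>W i. \<exists>q. ra c w = q \<odot>\<^bsub>V\<^esub> u i)"
    by metis
  have uV: "u i \<in> carrier V" if "i \<in> I" for i using u[OF that] eig_carrier by blast
  have z: "\<forall>i\<in>I. \<alpha> i = 0" if s: "(\<Sum>i\<in>I. \<alpha> i *q crd (u i)) = 0" for \<alpha>
  proof -
    \<comment> \<open>The linear relation becomes a decomposition of zero along the
      \<open>W i\<close>, to be compared with the trivial decomposition \<open>w0\<close>.\<close>
    define w where "w = (\<lambda>i\<in>{..<r}. if i \<in> I then \<alpha> i \<odot>\<^bsub>V\<^esub> u i else \<zero>\<^bsub>V\<^esub>)"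
    define w0 where "w0 = (\<lambda>i\<in>{..<r}. \<zero>\<^bsub>V\<^esub>)"
    have wW: "w \<in> (\<Pi>\<^sub>E i\<in>{..<r}. W i)" "w0 \<in> (\<Pi>\<^sub>E i\<in>{..<r}. W i)"
      using u srD(2,4)[OF sW] by (auto simp: w_def w0_def)
    have wV: "w \<in> {..<r} \<rightarrow> carrier V" "w0 \<in> {..<r} \<rightarrow> carrier V" using wW WV by (auto simp: PiE_iff)
    have "crd (\<Oplus>\<^bsub>V\<^esub>i\<in>{..<r}. w i) = (\<Sum>i\<in>{..<r}. crd (w i))" by (rule crd_finsum[OF wV(1)])
    also have "\<dots> = (\<Sum>i\<in>I. crd (w i))"
      by (rule sum.mono_neutral_right) (auto simp: w_def crd_zero I_def)
    also have "\<dots> = (\<Sum>i\<in>I. \<alpha> i *q crd (u i))"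
      by (rule sum.cong) (auto simp: w_def I_def crd_scl[OF uV, unfolded I_def])
    finally have a: "crd (\<Oplus>\<^bsub>V\<^esub>i\<in>{..<r}. w i) = 0" using s by simp
    have b: "crd (\<Oplus>\<^bsub>V\<^esub>i\<in>{..<r}. w0 i) = 0"
      unfolding crd_finsum[OF wV(2)] by (rule sum.neutral) (simp add: w0_def crd_zero)
    have "(\<Oplus>\<^bsub>V\<^esub>i\<in>{..<r}. w i) = \<zero>\<^bsub>V\<^esub>" "(\<Oplus>\<^bsub>V\<^esub>i\<in>{..<r}. w0 i) = \<zero>\<^bsub>V\<^esub>"
      using a b finsum_closed[OF wV(1)] finsum_closed[OF wV(2)] crd_zero by (auto intro!: crd_inj)
    then have "w = w0" using uni[of "\<zero>\<^bsub>V\<^esub>"] wW by (metis zero_closed vs_facts(4)[OF V_vs])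
    then have "\<alpha> i \<odot>\<^bsub>V\<^esub> u i = \<zero>\<^bsub>V\<^esub>" if "i \<in> I" for i
    proof -
      have "w i = w0 i" by (simp only: \<open>w = w0\<close>)
      then show ?thesis using that by (simp add: w_def w0_def I_def)
    qed
    then show ?thesis using u vs_facts(12)[OF V_vs uV] by blast
  qed
  note fam = independent_family[OF fI z, where b = "\<lambda>i. crd (u i)"]
  have sub: "(\<lambda>i. crd (u i)) ` I \<subseteq> crd ` eig" using u by blast
  have "crd ` eig \<subseteq> fv.span ((\<lambda>i. crd (u i)) ` I)"
  proof
    fix x assume "x \<in> crd ` eig"
    then obtain v where v: "v \<in> carrier V" "x = crd (ra c v)" unfolding eig_eq by blast
    obtain w where w: "w \<in> (\<Pi>\<^sub>E i\<in>{..<r}. W i)" "v = (\<Oplus>\<^bsub>V\<^esub>i\<in>{..<r}. w i)" using uni[OF v(1)] by blast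
    have wW: "w i \<in> W i" if "i < r" for i using w(1) that by (auto simp: PiE_iff)
    have "ra c v = (\<Oplus>\<^bsub>V\<^esub>i\<in>{..<r}. ra c (w i))"
      unfolding w(2) by (rule hom_finsum[OF V_vs V_vs act_right_hom]) (use wW WV in auto)
    then have "x = (\<Sum>i\<in>{..<r}. crd (ra c (w i)))"
      unfolding v(2) using wW WV act_closed by (simp add: crd_finsum)
    also have "\<dots> \<in> fv.span ((\<lambda>i. crd (u i)) ` I)"
    proof (rule fv.span_sum)
      fix i assume "i \<in> {..<r}"
      then have i: "i < r" by simp
      show "crd (ra c (w i)) \<in> fv.span ((\<lambda>i. crd (u i)) ` I)"
      proof (cases "i \<in> I")
        case True
        then obtain q where "ra c (w i) = q \<odot>\<^bsub>V\<^esub> u i" using u[OF True] wW[OF i] by blast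
        then show ?thesis using True by (simp add: crd_scl[OF uV] fv.span_scale fv.span_base)
      next
        case False
        then have "ra c (w i) = \<zero>\<^bsub>V\<^esub>" using irreducible_iso(2)[OF irr[OF i] _ wW[OF i]] i by (simp add: I_def)
        then show ?thesis by (simp add: crd_zero fv.span_zero)
      qed
    qed
    finally show "x \<in> fv.span ((\<lambda>i. crd (u i)) ` I)" .
  qed
  then have "card ((\<lambda>i. crd (u i)) ` I) = fv.dim (crd ` eig)"
    by (rule fv.basis_card_eq_dim[OF sub _ fam(2)])
  then show ?thesis using card_image[OF fam(1)] by (simp add: I_def)
qed

text \<open>The count in any decomposition is a dimension that does not mention the decomposition,
  so the definite description is well defined.\<close>

lemma multiplicity_eq: "multiplicity_in (sym_group n) Sp sa V \<rho> = fv.dim (crd ` eig)"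
proof -
  from decomposition_exists[OF sr_carrier] obtain r :: nat and W where
    d: "(\<forall>i<r. irreducible_subrep (sym_group n) V \<rho> (W i) \<and> W i \<subseteq> carrier V) \<and>
      (\<forall>v\<in>carrier V. \<exists>!w. w \<in> (\<Pi>\<^sub>E i\<in>{..<r}. W i) \<and> v = (\<Oplus>\<^bsub>V\<^esub>i\<in>{..<r}. w i))"
    by (elim exE)
  have D: "irreducible_decomposition (sym_group n) V \<rho> r W"
    unfolding irreducible_decomposition_def using conjunct1[OF d] by (intro conjI[OF _ conjunct2[OF d]]) simp
  show ?thesis
    unfolding multiplicity_in_def
  proof (rule the_equality)
    show "\<exists>r W. irreducible_decomposition (sym_group n) V \<rho> r W \<and> fv.dim (crd ` eig)
        = card {i. i < r \<and> rep_iso (sym_group n) (V\<lparr>carrier := W i\<rparr>) \<rho> Sp sa}"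
      by (rule exI, rule exI, rule conjI, rule D, rule decomposition_multiplicity[OF D, symmetric])
    fix m assume "\<exists>r W. irreducible_decomposition (sym_group n) V \<rho> r W \<and> m
        = card {i. i < r \<and> rep_iso (sym_group n) (V\<lparr>carrier := W i\<rparr>) \<rho> Sp sa}"
    then show "m = fv.dim (crd ` eig)" by (elim exE conjE) (simp only: decomposition_multiplicity)
  qed
qed

end

section \<open>Stability in terms of Young symmetrizers\<close>

lemma dim_image_linear:
  assumes f: "lin f" and A: "fv.subspace A" and inj: "inj_on f A"
  shows "fv.dim (f ` A) = fv.dim A"
proof -
  interpret pr: vector_space_pair "scl :: rat \<Rightarrow> ('a \<Rightarrow> rat) \<Rightarrow> _" "scl :: rat \<Rightarrow> ('b \<Rightarrow> rat) \<Rightarrow> _" ..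
  obtain B where B: "B \<subseteq> A" "fv.independent B" "A \<subseteq> fv.span B"
    using fv.maximal_independent_subset by blast
  have sp: "fv.span B = A" using B fv.span_minimal[OF B(1) A] by blast
  have ind: "fv.independent (f ` B)"
    by (rule pr.linear_independent_injective_image[OF f B(2)]) (simp only: sp inj)
  have "f ` A \<subseteq> fv.span (f ` B)" using pr.linear_span_image[OF f, of B] sp by simp
  moreover have "f ` B \<subseteq> f ` A" using B(1) by blast
  ultimately have "card (f ` B) = fv.dim (f ` A)" using ind by (intro fv.basis_card_eq_dim)
  moreover have "card B = fv.dim A" by (rule fv.basis_card_eq_dim[OF B(1,3,2)])
  moreover have "card (f ` B) = card B" by (rule card_image) (rule inj_on_subset[OF inj B(1)])
  ultimately show ?thesis by simp
qed

lemma subspace_image_linear: "lin f \<Longrightarrow> fv.subspace A \<Longrightarrow> fv.subspace (f ` A)"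
proof -
  interpret pr: vector_space_pair "scl :: rat \<Rightarrow> ('a \<Rightarrow> rat) \<Rightarrow> _" "scl :: rat \<Rightarrow> ('b \<Rightarrow> rat) \<Rightarrow> _" ..
  show "lin f \<Longrightarrow> fv.subspace A \<Longrightarrow> fv.subspace (f ` A)" by (rule pr.linear_subspace_image)
qed

lemma inj_lin_surj:
  assumes f: "lin f" and A: "fv.subspace A" and B: "fv.subspace B" and AB: "f ` A \<subseteq> B"
    and inj: "inj_on f A" and d: "fv.dim A = fv.dim B" and F: "finite F" "B \<subseteq> fv.span F"
  shows "f ` A = B"
proof (rule ccontr)
  assume "f ` A \<noteq> B"
  then have "f ` A \<subset> B" using AB by blast
  then have "fv.dim (f ` A) < fv.dim B" by (rule dim_psubset[OF subspace_image_linear[OF f A] B _ F])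
  then show False using dim_image_linear[OF f A inj] d by simp
qed

text \<open>A suitable permutation exists by \<open>cy_theta\<close>. Fixing one choice makes the
  shift one definite operator, the same for \<open>V\<close> and for its cohomology.\<close>

definition theta :: "nat list \<Rightarrow> nat \<Rightarrow> (nat \<Rightarrow> nat) \<Rightarrow> rat" where
  "theta \<mu> n = conv {1..Suc n} (cy \<mu> (Suc n)) (delta (SOME \<sigma>. \<sigma> \<in> perms {1..Suc n} \<and> (\<forall>x. \<exists>q.
    conv {1..Suc n} (cy \<mu> (Suc n)) (conv {1..Suc n} x (cy \<mu> n))
      = q *q conv {1..Suc n} (cy \<mu> (Suc n)) (delta \<sigma>))))"

lemma theta_sandwich:
  assumes "is_partition \<mu>" "padding_exists \<mu> n" "n \<ge> 1"
  shows "\<exists>q. conv {1..Suc n} (cy \<mu> (Suc n)) (conv {1..Suc n} x (cy \<mu> n)) = q *q theta \<mu> n"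
proof -
  let ?Q = "\<lambda>\<sigma>. \<sigma> \<in> perms {1..Suc n} \<and> (\<forall>x. \<exists>q.
    conv {1..Suc n} (cy \<mu> (Suc n)) (conv {1..Suc n} x (cy \<mu> n))
      = q *q conv {1..Suc n} (cy \<mu> (Suc n)) (delta \<sigma>))"
  have "\<exists>\<sigma>. ?Q \<sigma>" using cy_theta[OF assms] by (simp only: Bex_def)
  then have "?Q (SOME \<sigma>. ?Q \<sigma>)" by (rule someI_ex)
  then show ?thesis unfolding theta_def by (elim conjE allE)
qed

text \<open>Unlike \<open>eig\<close>, this form is free of coordinates and so makes sense for
  cohomology before finite dimensionality is known; for the \<open>V n\<close> the two agree by
  \<open>eig_eq\<close>.\<close>

definition eigs :: "nat list \<Rightarrow> nat \<Rightarrow> (rat, 'v) module \<Rightarrow> ((nat \<Rightarrow> nat) \<Rightarrow> 'v \<Rightarrow> 'v) \<Rightarrow> 'v set" where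
  "eigs \<mu> n V \<rho> = rep_act n V \<rho> (cy \<mu> n) ` carrier V"

definition shift :: "nat list \<Rightarrow> nat \<Rightarrow> (rat, 'v) module \<Rightarrow> ((nat \<Rightarrow> nat) \<Rightarrow> 'v \<Rightarrow> 'v) \<Rightarrow> ('v \<Rightarrow> 'v) \<Rightarrow> 'v \<Rightarrow> 'v" where
  "shift \<mu> n W \<sigma> \<phi> v = rep_act (Suc n) W \<sigma> (theta \<mu> n) (\<phi> v)"

text \<open>For each \<open>\<lambda>\<close> the spaces \<open>c V\<^sub>n\<close>, with \<open>c\<close> the Young symmetrizer of \<open>\<lambda>[n]\<close>, have the
  multiplicity of \<open>V(\<lambda>)\<^sub>n\<close> as dimension; monotone stability means that they are carried
  isomorphically to each other by operators that are natural in the coefficients.\<close>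

definition good_sequence ::
  "nat \<Rightarrow> (nat \<Rightarrow> (rat, 'v) module) \<Rightarrow> (nat \<Rightarrow> (nat \<Rightarrow> nat) \<Rightarrow> 'v \<Rightarrow> 'v) \<Rightarrow> (nat \<Rightarrow> 'v \<Rightarrow> 'v) \<Rightarrow> bool" where
  "good_sequence N V \<rho> \<phi> \<longleftrightarrow> (\<forall>n\<ge>max 1 N. \<forall>\<mu>. is_partition \<mu> \<longrightarrow>
     (padding_exists \<mu> n \<longrightarrow> bij_betw (shift \<mu> n (V (Suc n)) (\<rho> (Suc n)) (\<phi> n))
        (eigs \<mu> n (V n) (\<rho> n)) (eigs \<mu> (Suc n) (V (Suc n)) (\<rho> (Suc n)))) \<and>
     (\<not> padding_exists \<mu> n \<longrightarrow> padding_exists \<mu> (Suc n) \<longrightarrow>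
        eigs \<mu> (Suc n) (V (Suc n)) (\<rho> (Suc n)) = {\<zero>\<^bsub>V (Suc n)\<^esub>}))"

lemma padding_Suc: "padding_exists \<mu> n \<Longrightarrow> padding_exists \<mu> (Suc n)"
  by (simp add: padding_exists_def)

locale rep_sequence =
  fixes V :: "nat \<Rightarrow> (rat, 'v) module" and \<rho> :: "nat \<Rightarrow> (nat \<Rightarrow> nat) \<Rightarrow> 'v \<Rightarrow> 'v" and \<phi> :: "nat \<Rightarrow> 'v \<Rightarrow> 'v"
  assumes cons: "consistent_sequence V \<rho> \<phi>" and fd: "\<forall>n\<ge>1. finite_dim (V n)"
begin

lemma rr: "n \<ge> 1 \<Longrightarrow> rat_rep (sym_group n) (V n) (\<rho> n)"
  and phi_hom: "n \<ge> 1 \<Longrightarrow> \<phi> n \<in> hom (V n) (V (Suc n))"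
  and phi_eq: "n \<ge> 1 \<Longrightarrow> s \<in> perms {1..n} \<Longrightarrow> v \<in> carrier (V n) \<Longrightarrow> \<phi> n (\<rho> n s v) = \<rho> (Suc n) s (\<phi> n v)"
  using cons by (auto simp: consistent_sequence_def)

definition "crd n = (SOME c. \<exists>vec d. coords (V n) c vec d)"
definition "vec n = (SOME v. \<exists>d. coords (V n) (crd n) v d)"
definition "dm n = (SOME d. coords (V n) (crd n) (vec n) d)"

lemma coords: "n \<ge> 1 \<Longrightarrow> coords (V n) (crd n) (vec n) (dm n)"
proof -
  assume n: "n \<ge> 1"
  have "\<exists>c. \<exists>vec d. coords (V n) c vec d" using coords_exist fd n by blast
  then have "\<exists>vec d. coords (V n) (crd n) vec d" unfolding crd_def by (rule someI_ex)
  then have "\<exists>d. coords (V n) (crd n) (vec n) d" unfolding vec_def by (rule someI_ex)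
  then show ?thesis unfolding dm_def by (rule someI_ex)
qed

lemma sym_rep: "n \<ge> 1 \<Longrightarrow> sym_rep (V n) (crd n) (vec n) (dm n) n (\<rho> n)"
  by (intro sym_rep.intro coords sym_rep_axioms.intro rr)

lemma stage: "n \<ge> 1 \<Longrightarrow> is_partition \<mu> \<Longrightarrow> padding_exists \<mu> n \<Longrightarrow>
    stage (V n) (crd n) (vec n) (dm n) n (\<rho> n) \<mu>"
  by (intro stage.intro sym_rep specht.intro)

text \<open>Equivariance of \<open>\<phi> n\<close> gives the sum over \<open>perms {1..n}\<close>;
  enlarging the sum to \<open>perms {1..Suc n}\<close> adds only zero coefficients.\<close>

lemma phi_act:
  assumes n: "n \<ge> 1" and a: "a \<in> alg {1..n}" and v: "v \<in> carrier (V n)"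
  shows "\<phi> n (rep_act n (V n) (\<rho> n) a v) = rep_act (Suc n) (V (Suc n)) (\<rho> (Suc n)) a (\<phi> n v)"
proof -
  interpret A: sym_rep "V n" "crd n" "vec n" "dm n" n "\<rho> n" by (rule sym_rep[OF n])
  interpret B: sym_rep "V (Suc n)" "crd (Suc n)" "vec (Suc n)" "dm (Suc n)" "Suc n" "\<rho> (Suc n)"
    by (rule sym_rep) simp
  have wV: "\<phi> n v \<in> carrier (V (Suc n))" by (rule homD(1)[OF phi_hom[OF n] v])
  have sub: "g \<in> perms {1..Suc n}" if "g \<in> perms {1..n}" for g
    by (rule perms_mono[OF _ that]) simp
  have "\<phi> n (rep_act n (V n) (\<rho> n) a v) = rep_act n (V (Suc n)) (\<rho> (Suc n)) a (\<phi> n v)"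
    by (rule hom_rep_act[OF A.V_vs B.V_vs phi_hom[OF n]]) (rule A.rho_closed[OF _ v], assumption, rule phi_eq[OF n _ v])
  also have "\<dots> = rep_act (Suc n) (V (Suc n)) (\<rho> (Suc n)) a (\<phi> n v)"
  proof (rule B.crd_inj)
    have t: "(\<lambda>g. a g \<odot>\<^bsub>V (Suc n)\<^esub> \<rho> (Suc n) g (\<phi> n v)) \<in> perms {1..n} \<rightarrow> carrier (V (Suc n))"
      using B.rho_closed[OF sub wV] vs_facts(3)[OF B.V_vs] by blast
    show "rep_act n (V (Suc n)) (\<rho> (Suc n)) a (\<phi> n v) \<in> carrier (V (Suc n))"
      unfolding rep_act_def by (rule B.finsum_closed[OF t])
    show "rep_act (Suc n) (V (Suc n)) (\<rho> (Suc n)) a (\<phi> n v) \<in> carrier (V (Suc n))"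
      by (rule B.act_closed[OF wV])
    have "crd (Suc n) (rep_act n (V (Suc n)) (\<rho> (Suc n)) a (\<phi> n v))
        = (\<Sum>g\<in>perms {1..n}. crd (Suc n) (a g \<odot>\<^bsub>V (Suc n)\<^esub> \<rho> (Suc n) g (\<phi> n v)))"
      unfolding rep_act_def by (rule B.crd_finsum[OF t])
    also have "\<dots> = act {1..n} B.mat a (crd (Suc n) (\<phi> n v))"
      unfolding act_def
    proof (rule sum.cong[OF refl])
      fix g assume g: "g \<in> perms {1..n}"
      show "crd (Suc n) (a g \<odot>\<^bsub>V (Suc n)\<^esub> \<rho> (Suc n) g (\<phi> n v)) = a g *q B.mat g (crd (Suc n) (\<phi> n v))"
        by (simp only: B.crd_scl[OF B.rho_closed[OF sub[OF g] wV]] B.crd_rho[OF sub[OF g] wV])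
    qed
    also have "\<dots> = act {1..Suc n} B.mat a (crd (Suc n) (\<phi> n v))"
      by (rule act_mono[symmetric, OF _ _ a]) auto
    also have "\<dots> = crd (Suc n) (rep_act (Suc n) (V (Suc n)) (\<rho> (Suc n)) a (\<phi> n v))"
      by (rule B.crd_act[symmetric, OF wV])
    finally show "crd (Suc n) (rep_act n (V (Suc n)) (\<rho> (Suc n)) a (\<phi> n v))
        = crd (Suc n) (rep_act (Suc n) (V (Suc n)) (\<rho> (Suc n)) a (\<phi> n v))" .
  qed
  finally show ?thesis .
qed

abbreviation Eg where "Eg \<mu> n \<equiv> eigs \<mu> n (V n) (\<rho> n)"
abbreviation Sh where "Sh \<mu> n \<equiv> shift \<mu> n (V (Suc n)) (\<rho> (Suc n)) (\<phi> n)"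

lemma Sh_hom: "n \<ge> 1 \<Longrightarrow> Sh \<mu> n \<in> hom (V n) (V (Suc n))"
proof -
  assume n: "n \<ge> 1"
  interpret B: sym_rep "V (Suc n)" "crd (Suc n)" "vec (Suc n)" "dm (Suc n)" "Suc n" "\<rho> (Suc n)"
    by (rule sym_rep) simp
  show ?thesis unfolding shift_def
    by (rule homI) (simp_all only: homD[OF phi_hom[OF n]] homD[OF B.act_right_hom] B.act_closed)
qed

lemma Sh_Eg: "n \<ge> 1 \<Longrightarrow> v \<in> carrier (V n) \<Longrightarrow> Sh \<mu> n v \<in> Eg \<mu> (Suc n)"
proof -
  assume n: "n \<ge> 1" and v: "v \<in> carrier (V n)"
  interpret B: sym_rep "V (Suc n)" "crd (Suc n)" "vec (Suc n)" "dm (Suc n)" "Suc n" "\<rho> (Suc n)"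
    by (rule sym_rep) simp
  have w: "\<phi> n v \<in> carrier (V (Suc n))" by (rule homD(1)[OF phi_hom[OF n] v])
  show ?thesis
    unfolding shift_def theta_def eigs_def B.ra_conv[OF w] by (rule imageI) (rule B.act_closed[OF w])
qed

definition "shm \<mu> n x = crd (Suc n) (Sh \<mu> n (vec n x))"

lemma lin_shm: "n \<ge> 1 \<Longrightarrow> lin (shm \<mu> n)"
proof -
  assume n: "n \<ge> 1"
  interpret A: coords "V n" "crd n" "vec n" "dm n" by (rule coords[OF n])
  interpret B: coords "V (Suc n)" "crd (Suc n)" "vec (Suc n)" "dm (Suc n)" by (rule coords) simp
  note h = homD[OF Sh_hom[OF n]]
  show ?thesis unfolding shm_def
    by (rule linI) (simp_all only: A.vec_add A.vec_scl h[OF A.vec_closed] h(2)[OF A.vec_closed A.vec_closed]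
       B.crd_add[OF h(1)[OF A.vec_closed] h(1)[OF A.vec_closed]] B.crd_scl[OF h(1)[OF A.vec_closed]])
qed

lemma shm_crd: "n \<ge> 1 \<Longrightarrow> v \<in> carrier (V n) \<Longrightarrow> shm \<mu> n (crd n v) = crd (Suc n) (Sh \<mu> n v)"
  by (simp only: shm_def coords.vec_crd[OF coords])

lemma shm_image: "n \<ge> 1 \<Longrightarrow> E \<subseteq> carrier (V n) \<Longrightarrow> shm \<mu> n ` crd n ` E = crd (Suc n) ` Sh \<mu> n ` E"
  unfolding image_image by (rule image_cong[OF refl], rule shm_crd) auto

lemma shm_inj:
  assumes n: "n \<ge> 1" and E: "E \<subseteq> carrier (V n)" and inj: "inj_on (Sh \<mu> n) E"
  shows "inj_on (shm \<mu> n) (crd n ` E)"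
proof (rule inj_onI)
  fix x y assume x: "x \<in> crd n ` E" and y: "y \<in> crd n ` E" and e: "shm \<mu> n x = shm \<mu> n y"
  obtain v where v: "x = crd n v" "v \<in> E" using x by (rule imageE)
  obtain w where w: "y = crd n w" "w \<in> E" using y by (rule imageE)
  have vw: "v \<in> carrier (V n)" "w \<in> carrier (V n)" using v w E by auto
  have "crd (Suc n) (Sh \<mu> n v) = crd (Suc n) (Sh \<mu> n w)"
    using e by (simp only: v(1) w(1) shm_crd[OF n vw(1)] shm_crd[OF n vw(2)])
  then have "Sh \<mu> n v = Sh \<mu> n w"
    using coords.crd_inj[OF coords[of "Suc n"]] homD(1)[OF Sh_hom[OF n]] vw by simp
  then have "v = w" by (rule inj_onD[OF inj _ v(2) w(2)])
  then show "x = y" by (simp only: v(1) w(1))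
qed

text \<open>Since \<open>v\<close> is the symmetrizer of stage \<open>n\<close> applied to some
  \<open>v0\<close>, that symmetrizer passes through \<open>\<phi> n\<close>, and the product with
  \<open>x\<close> and the next symmetrizer collapses to a multiple of \<open>theta\<close>. So the
  \<open>\<mu>\<close>-part of everything generated by \<open>\<phi> n v\<close> lies on the line of
  its shift.\<close>

lemma phi_eig:
  assumes n: "n \<ge> 1" and \<mu>: "is_partition \<mu>" "padding_exists \<mu> n" and v: "v \<in> Eg \<mu> n"
  shows "\<exists>q. rep_act (Suc n) (V (Suc n)) (\<rho> (Suc n)) (cy \<mu> (Suc n))
      (rep_act (Suc n) (V (Suc n)) (\<rho> (Suc n)) x (\<phi> n v)) = q \<odot>\<^bsub>V (Suc n)\<^esub> Sh \<mu> n v"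
proof -
  interpret A: stage "V n" "crd n" "vec n" "dm n" n "\<rho> n" \<mu> by (rule stage[OF n \<mu>])
  interpret B: sym_rep "V (Suc n)" "crd (Suc n)" "vec (Suc n)" "dm (Suc n)" "Suc n" "\<rho> (Suc n)"
    by (rule sym_rep) simp
  have ve: "v \<in> A.eig" using v by (simp only: eigs_def A.eig_eq)
  define v0 where "v0 = (1 / A.kap) \<odot>\<^bsub>V n\<^esub> v"
  have vV: "v \<in> carrier (V n)" by (rule A.eig_carrier[OF ve])
  have v0V: "v0 \<in> carrier (V n)" unfolding v0_def by (rule vs_facts(3)[OF A.V_vs vV])
  have pv0: "\<phi> n v0 = (1 / A.kap) \<odot>\<^bsub>V (Suc n)\<^esub> \<phi> n v" unfolding v0_def by (rule homD(3)[OF phi_hom[OF n] vV])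
  have pV: "\<phi> n v \<in> carrier (V (Suc n))" "\<phi> n v0 \<in> carrier (V (Suc n))"
    using homD(1)[OF phi_hom[OF n]] vV v0V by auto
  have pv: "\<phi> n v = B.ra (cy \<mu> n) (\<phi> n v0)"
    using phi_act[OF n cy_alg v0V, of \<mu>] A.eig_self[OF ve] by (simp only: v0_def)
  obtain q where q: "conv {1..Suc n} (cy \<mu> (Suc n)) (conv {1..Suc n} x (cy \<mu> n)) = q *q theta \<mu> n"
    using theta_sandwich[OF \<mu> n] by blast
  have "B.ra (cy \<mu> (Suc n)) (B.ra x (\<phi> n v)) = B.ra (q *q theta \<mu> n) (\<phi> n v0)"
    by (subst pv) (simp only: q[symmetric] B.ra_conv[OF pV(2)])
  also have "\<dots> = q \<odot>\<^bsub>V (Suc n)\<^esub> ((1 / A.kap) \<odot>\<^bsub>V (Suc n)\<^esub> Sh \<mu> n v)"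
    unfolding B.act_left_scl[OF pV(2)] by (simp only: pv0 homD(3)[OF B.act_right_hom pV(1)] shift_def)
  also have "\<dots> = (q * (1 / A.kap)) \<odot>\<^bsub>V (Suc n)\<^esub> Sh \<mu> n v"
    by (rule vs_facts(11)[OF B.V_vs, symmetric]) (rule homD(1)[OF Sh_hom[OF n] vV])
  finally show ?thesis by (rule exI)
qed

text \<open>Monotonicity for a single copy gives injectivity of the shift; constant multiplicities
  give equal dimensions and hence surjectivity. If the padding does not exist at \<open>n\<close>,
  the multiplicity there is zero by convention, and constancy forces it to vanish at
  \<open>Suc n\<close>.\<close>

lemma stable_monotone_good:
  assumes mono: "monotone_sequence N V \<rho> \<phi>" and st: "uniformly_stable N V \<rho> \<phi>"
  shows "good_sequence N V \<rho> \<phi>"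
  unfolding good_sequence_def
proof (intro allI impI conjI)
  fix n \<mu> assume nN: "max 1 N \<le> n" and part: "is_partition \<mu>"
  have n: "n \<ge> 1" using nN by simp
  have mult: "padded_multiplicity \<mu> n (V n) (\<rho> n) = padded_multiplicity \<mu> (Suc n) (V (Suc n)) (\<rho> (Suc n))"
  proof -
    have "\<forall>\<mu>. is_partition \<mu> \<longrightarrow> (\<forall>m\<ge>max 1 N. \<forall>n\<ge>max 1 N.
        padded_multiplicity \<mu> m (V m) (\<rho> m) = padded_multiplicity \<mu> n (V n) (\<rho> n))"
      using st unfolding uniformly_stable_def by (elim conjE)
    from this[rule_format, OF part nN, of "Suc n"] show ?thesis using nN by simp
  qed
  { assume pad: "padding_exists \<mu> n"
    note pad' = padding_Suc[OF pad]
    interpret A: stage "V n" "crd n" "vec n" "dm n" n "\<rho> n" \<mu> by (rule stage[OF n part pad])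
    interpret B: stage "V (Suc n)" "crd (Suc n)" "vec (Suc n)" "dm (Suc n)" "Suc n" "\<rho> (Suc n)" \<mu>
      by (rule stage[OF _ part pad']) simp
    have EA: "Eg \<mu> n = A.eig" and EB: "Eg \<mu> (Suc n) = B.eig" by (simp_all only: eigs_def A.eig_eq B.eig_eq)
    have EV: "Eg \<mu> n \<subseteq> carrier (V n)" unfolding EA using A.eig_carrier by blast
    \<comment> \<open>If the shift kills \<open>v\<close>, take the copy generated by
      \<open>v\<close>. Monotonicity provides a copy in the span of its image, with generator
      \<open>u 0\<close> of the form \<open>x\<close> applied to \<open>\<phi> n v\<close>. By
      \<open>phi_eig\<close> the symmetrizer kills \<open>u 0\<close>, although it acts on it as the
      nonzero scalar \<open>kap\<close>.\<close>
    have nonzero: "Sh \<mu> n v \<noteq> \<zero>\<^bsub>V (Suc n)\<^esub>" if ve: "v \<in> A.eig" and v0: "v \<noteq> \<zero>\<^bsub>V n\<^esub>" for v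
    proof
      assume sh0: "Sh \<mu> n v = \<zero>\<^bsub>V (Suc n)\<^esub>"
      have vV: "v \<in> carrier (V n)" by (rule A.eig_carrier[OF ve])
      have ind: "\<forall>l<Suc 0. \<alpha> l = 0" if "(\<Oplus>\<^bsub>V n\<^esub>l\<in>{..<Suc 0}. \<alpha> l \<odot>\<^bsub>V n\<^esub> v) = \<zero>\<^bsub>V n\<^esub>" for \<alpha>
        using that vs_facts(3)[OF A.V_vs vV] vs_facts(12)[OF A.V_vs vV] v0 by (simp add: lessThan_Suc)
      obtain U where U: "A.sr U" "rep_iso (sym_group n) ((V n)\<lparr>carrier := U\<rparr>) (\<rho> n)
          (module_power A.Sp (Suc 0)) (power_action (Suc 0) A.sa)"
        and Umin: "\<And>W. A.sr W \<Longrightarrow> v \<in> W \<Longrightarrow> U \<subseteq> W"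
        using A.orbit_iso[where u = "\<lambda>_. v" and k = "Suc 0", OF ve ind] by auto
      obtain U' where U': "B.sr U'" "U' \<subseteq> rep_span (sym_group (Suc n)) (V (Suc n)) (\<rho> (Suc n)) (\<phi> n ` U)"
        "rep_iso (sym_group (Suc n)) ((V (Suc n))\<lparr>carrier := U'\<rparr>) (\<rho> (Suc n))
          (module_power B.Sp (Suc 0)) (power_action (Suc 0) B.sa)"
        using mono part pad nN U unfolding monotone_sequence_def by blast
      obtain u where u: "u (0 :: nat) \<in> U'" "u 0 \<in> B.eig"
        "\<And>\<alpha>. (\<Oplus>\<^bsub>V (Suc n)\<^esub>l\<in>{..<Suc 0}. \<alpha> l \<odot>\<^bsub>V (Suc n)\<^esub> u l) = \<zero>\<^bsub>V (Suc n)\<^esub> \<Longrightarrow> \<alpha> 0 = (0 :: rat)"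
        using B.iso_vectors[OF U'(1,3)] by auto
      have uV: "u 0 \<in> carrier (V (Suc n))" by (rule B.eig_carrier[OF u(2)])
      have u0: "u 0 \<noteq> \<zero>\<^bsub>V (Suc n)\<^esub>"
      proof
        assume "u 0 = \<zero>\<^bsub>V (Suc n)\<^esub>"
        then have "(\<Oplus>\<^bsub>V (Suc n)\<^esub>l\<in>{..<Suc 0}. (\<lambda>_. 1) l \<odot>\<^bsub>V (Suc n)\<^esub> u l) = \<zero>\<^bsub>V (Suc n)\<^esub>"
          using vs_facts(4,5)[OF B.V_vs] by (simp add: lessThan_Suc)
        then have "(\<lambda>_ :: nat. 1 :: rat) 0 = 0" by (rule u(3))
        then show False by simp
      qed
      have wV: "\<phi> n v \<in> carrier (V (Suc n))" by (rule homD(1)[OF phi_hom[OF n] vV])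
      \<comment> \<open>The cyclic module generated by \<open>\<phi> n v\<close>. It contains the
        image of \<open>U\<close>, because its preimage \<open>D'\<close> is a subrepresentation
        containing \<open>v\<close> and \<open>U\<close> is the least one.\<close>
      define D where "D = (\<lambda>x. B.ra x (\<phi> n v)) ` UNIV"
      have DI: "B.ra x (\<phi> n v) \<in> D" for x unfolding D_def by (rule imageI) simp
      have sD: "B.sr D"
      proof (rule B.srI)
        show "D \<subseteq> carrier (V (Suc n))" using B.act_closed[OF wV] by (auto simp: D_def)
        have "B.ra 0 (\<phi> n v) = 0 \<odot>\<^bsub>V (Suc n)\<^esub> B.ra 0 (\<phi> n v)"
          using B.act_left_scl[OF wV, of 0 0] by simp
        then have "B.ra 0 (\<phi> n v) = \<zero>\<^bsub>V (Suc n)\<^esub>" using vs_facts(1)[OF B.V_vs B.act_closed[OF wV]] by simp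
        then show "\<zero>\<^bsub>V (Suc n)\<^esub> \<in> D" using DI[of 0] by simp
        show "a \<oplus>\<^bsub>V (Suc n)\<^esub> b \<in> D" if "a \<in> D" "b \<in> D" for a b
          using that DI by (auto simp: D_def simp flip: B.act_left_add[OF wV])
        show "q \<odot>\<^bsub>V (Suc n)\<^esub> a \<in> D" if "a \<in> D" for q a
          using that DI by (auto simp: D_def simp flip: B.act_left_scl[OF wV])
        show "\<rho> (Suc n) g a \<in> D" if "g \<in> perms {1..Suc n}" "a \<in> D" for g a
        proof -
          obtain x where "a = B.ra x (\<phi> n v)" using \<open>a \<in> D\<close> unfolding D_def by blast
          then have "\<rho> (Suc n) g a = B.ra (conv {1..Suc n} (delta g) x) (\<phi> n v)"
            by (simp only: B.ra_conv[OF wV] B.ra_delta[OF B.act_closed[OF wV] \<open>g \<in> perms {1..Suc n}\<close>])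
          then show ?thesis using DI by (simp only:)
        qed
      qed
      define D' where "D' = {w \<in> carrier (V n). \<phi> n w \<in> D}"
      have "A.sr D'"
      proof (rule A.srI)
        show "\<zero>\<^bsub>V n\<^esub> \<in> D'"
          using hom_zero[OF A.V_vs B.V_vs phi_hom[OF n]] B.srD(2)[OF sD] vs_facts(4)[OF A.V_vs] by (simp add: D'_def)
        show "\<rho> n g w \<in> D'" if "g \<in> perms {1..n}" "w \<in> D'" for g w
          using that A.rho_closed[OF that(1)] phi_eq[OF n that(1)] B.srD(5)[OF sD perms_mono[OF _ that(1)]]
          by (auto simp: D'_def)
      qed (use homD[OF phi_hom[OF n]] B.srD[OF sD] vs_facts(3,8)[OF A.V_vs] in \<open>auto simp: D'_def\<close>)
      moreover have "v \<in> D'"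
        using vV DI[of "delta id"] B.ra_delta[OF wV, of id] permutes_id[of "{1..Suc n}"] B.rho_one[OF wV] by (simp add: D'_def)
      ultimately have "U \<subseteq> D'" by (rule Umin)
      then have "\<phi> n ` U \<subseteq> D" by (auto simp: D'_def)
      then have "U' \<subseteq> D" using U'(2) sD unfolding rep_span_def by blast
      then obtain x where x: "u 0 = B.ra x (\<phi> n v)" using u(1) unfolding D_def by blast
      obtain q where "B.ra (cy \<mu> (Suc n)) (u 0) = q \<odot>\<^bsub>V (Suc n)\<^esub> Sh \<mu> n v"
        using phi_eig[OF n part pad, of v x] ve unfolding EA x by blast
      then have "B.kap \<odot>\<^bsub>V (Suc n)\<^esub> u 0 = \<zero>\<^bsub>V (Suc n)\<^esub>"
        using u(2) sh0 vs_facts(5)[OF B.V_vs] by (simp add: B.eig_def)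
      then show False using vs_facts(12)[OF B.V_vs uV] B.kap(1) u0 by blast
    qed
    have inj: "inj_on (Sh \<mu> n) (Eg \<mu> n)"
    proof (rule inj_onI)
      fix v w assume v: "v \<in> Eg \<mu> n" and w: "w \<in> Eg \<mu> n" and e: "Sh \<mu> n v = Sh \<mu> n w"
      have vV: "v \<in> carrier (V n)" "w \<in> carrier (V n)" using v w EV by auto
      have ev: "A.ra (cy \<mu> n) v = A.kap \<odot>\<^bsub>V n\<^esub> v" "A.ra (cy \<mu> n) w = A.kap \<odot>\<^bsub>V n\<^esub> w"
        using v w unfolding EA by (simp_all add: A.eig_def)
      define z where "z = v \<oplus>\<^bsub>V n\<^esub> (-1) \<odot>\<^bsub>V n\<^esub> w"
      have w1: "(-1) \<odot>\<^bsub>V n\<^esub> w \<in> carrier (V n)" by (rule vs_facts(3)[OF A.V_vs vV(2)])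
      have zV: "z \<in> carrier (V n)" unfolding z_def by (rule vs_facts(8)[OF A.V_vs vV(1) w1])
      have "A.ra (cy \<mu> n) z = A.kap \<odot>\<^bsub>V n\<^esub> v \<oplus>\<^bsub>V n\<^esub> (-1) \<odot>\<^bsub>V n\<^esub> (A.kap \<odot>\<^bsub>V n\<^esub> w)"
        unfolding z_def by (simp only: homD(2)[OF A.act_right_hom vV(1) w1] homD(3)[OF A.act_right_hom vV(2)] ev)
      also have "\<dots> = A.kap \<odot>\<^bsub>V n\<^esub> z"
        unfolding z_def vs_facts(9)[OF A.V_vs vV(1) w1]
        by (simp only: vs_facts(11)[OF A.V_vs vV(2), symmetric] mult.commute)
      finally have ze: "z \<in> A.eig" using zV by (simp add: A.eig_def)
      have "Sh \<mu> n z = Sh \<mu> n v \<oplus>\<^bsub>V (Suc n)\<^esub> (-1) \<odot>\<^bsub>V (Suc n)\<^esub> Sh \<mu> n w"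
        unfolding z_def by (simp only: homD(2)[OF Sh_hom[OF n] vV(1) w1] homD(3)[OF Sh_hom[OF n] vV(2)])
      also have "\<dots> = \<zero>\<^bsub>V (Suc n)\<^esub>"
        using e vs_facts(6)[OF B.V_vs] B.vrneg homD(1)[OF Sh_hom[OF n] vV(2)] by simp
      finally have "z = \<zero>\<^bsub>V n\<^esub>" using nonzero[OF ze] by blast
      then have "v \<oplus>\<^bsub>V n\<^esub> \<ominus>\<^bsub>V n\<^esub> w = \<zero>\<^bsub>V n\<^esub>" unfolding z_def vs_facts(6)[OF A.V_vs vV(2)] .
      then show "v = w" by (rule A.vneg_eq'[OF vV])
    qed
    have dims: "fv.dim (crd n ` Eg \<mu> n) = fv.dim (crd (Suc n) ` Eg \<mu> (Suc n))"
      using mult pad pad' by (simp add: padded_multiplicity_def EA EB A.multiplicity_eq B.multiplicity_eq)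
    have "shm \<mu> n ` crd n ` Eg \<mu> n = crd (Suc n) ` Eg \<mu> (Suc n)"
    proof (rule inj_lin_surj[OF lin_shm[OF n] _ _ _ shm_inj[OF n EV inj] dims _ B.crd_bounded])
      show "fv.subspace (crd n ` Eg \<mu> n)" "fv.subspace (crd (Suc n) ` Eg \<mu> (Suc n))"
        unfolding EA EB by (rule A.eig_subspace, rule B.eig_subspace)
      show "shm \<mu> n ` crd n ` Eg \<mu> n \<subseteq> crd (Suc n) ` Eg \<mu> (Suc n)"
        unfolding shm_image[OF n EV] using Sh_Eg[OF n] EV by blast
      show "Eg \<mu> (Suc n) \<subseteq> carrier (V (Suc n))" unfolding EB using B.eig_carrier by blast
    qed simp
    then have im: "crd (Suc n) ` Sh \<mu> n ` Eg \<mu> n = crd (Suc n) ` Eg \<mu> (Suc n)" by (simp only: shm_image[OF n EV])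
    have "Sh \<mu> n ` Eg \<mu> n = Eg \<mu> (Suc n)"
    proof (intro equalityI subsetI)
      fix w assume w: "w \<in> Eg \<mu> (Suc n)"
      then have "crd (Suc n) w \<in> crd (Suc n) ` Sh \<mu> n ` Eg \<mu> n" unfolding im by (rule imageI)
      then obtain w' where w': "crd (Suc n) w = crd (Suc n) w'" "w' \<in> Sh \<mu> n ` Eg \<mu> n" by (rule imageE)
      have "w \<in> carrier (V (Suc n))" using w unfolding EB by (rule B.eig_carrier)
      moreover have "w' \<in> carrier (V (Suc n))" using w'(2) homD(1)[OF Sh_hom[OF n]] EV by blast
      ultimately have "w = w'" using w'(1) by (rule B.crd_inj)
      then show "w \<in> Sh \<mu> n ` Eg \<mu> n" using w'(2) by simp
    qed (use Sh_Eg[OF n] EV in blast)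
    then show "bij_betw (Sh \<mu> n) (Eg \<mu> n) (Eg \<mu> (Suc n))" using inj by (simp add: bij_betw_def) }
  { assume npad: "\<not> padding_exists \<mu> n" and pad': "padding_exists \<mu> (Suc n)"
    interpret B: stage "V (Suc n)" "crd (Suc n)" "vec (Suc n)" "dm (Suc n)" "Suc n" "\<rho> (Suc n)" \<mu>
      by (rule stage[OF _ part pad']) simp
    have EB: "Eg \<mu> (Suc n) = B.eig" by (simp only: eigs_def B.eig_eq)
    have d: "fv.dim (crd (Suc n) ` B.eig) = 0"
      using mult npad pad' by (simp add: padded_multiplicity_def B.multiplicity_eq)
    have EV: "B.eig \<subseteq> carrier (V (Suc n))" using B.eig_carrier by blast
    have z: "\<zero>\<^bsub>V (Suc n)\<^esub> \<in> B.eig"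
      using B.act_zero_right vs_facts(4,5)[OF B.V_vs] by (simp add: B.eig_def)
    have "v = \<zero>\<^bsub>V (Suc n)\<^esub>" if v: "v \<in> B.eig" for v
    proof (rule ccontr)
      assume ne: "v \<noteq> \<zero>\<^bsub>V (Suc n)\<^esub>"
      have "crd (Suc n) v \<noteq> 0"
        using B.crd_inj[OF B.eig_carrier[OF v] vs_facts(4)[OF B.V_vs]] ne B.crd_zero by auto
      then have ps: "{0} \<subset> crd (Suc n) ` B.eig" using v z B.crd_zero by (metis empty_subsetI image_eqI insert_subset psubsetI singletonD)
      have "fv.dim {0 :: nat \<Rightarrow> rat} < fv.dim (crd (Suc n) ` B.eig)"
        by (rule dim_psubset[OF _ B.eig_subspace ps _ B.crd_bounded[OF EV]]) (auto intro: fv.subspace_single_0)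
      then show False using d by simp
    qed
    then show "Eg \<mu> (Suc n) = {\<zero>\<^bsub>V (Suc n)\<^esub>}" unfolding EB using z by blast }
qed

text \<open>Completeness of the Young symmetrizers enters here. A nonzero kernel of
  \<open>\<phi> n\<close> would contain a nonzero vector of some \<open>Eg \<mu> n\<close>, but the
  shift factors through \<open>\<phi> n\<close> and is injective there. A proper subrepresentation
  containing the image would have a complement with a nonzero vector of some
  \<open>Eg \<mu> (Suc n)\<close>, but that space consists of shifts or is zero. Multiplicities are
  the dimensions of the spaces that the shift identifies.\<close>

lemma good_stable_monotone:
  assumes good: "good_sequence N V \<rho> \<phi>"
  shows "monotone_sequence N V \<rho> \<phi> \<and> uniformly_stable N V \<rho> \<phi>"
proof -
  have bij: "bij_betw (Sh \<mu> n) (Eg \<mu> n) (Eg \<mu> (Suc n))" if "max 1 N \<le> n" "is_partition \<mu>" "padding_exists \<mu> n" for n \<mu>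
    using good that by (simp add: good_sequence_def)
  have none: "Eg \<mu> (Suc n) = {\<zero>\<^bsub>V (Suc n)\<^esub>}"
    if "max 1 N \<le> n" "is_partition \<mu>" "\<not> padding_exists \<mu> n" "padding_exists \<mu> (Suc n)" for n \<mu>
    using good that by (simp add: good_sequence_def)
  have inj: "inj_on (\<phi> n) (carrier (V n))" if nN: "max 1 N \<le> n" for n
  proof -
    have n: "n \<ge> 1" using nN by simp
    interpret A: sym_rep "V n" "crd n" "vec n" "dm n" n "\<rho> n" by (rule sym_rep[OF n])
    interpret B: sym_rep "V (Suc n)" "crd (Suc n)" "vec (Suc n)" "dm (Suc n)" "Suc n" "\<rho> (Suc n)"
      by (rule sym_rep) simp
    note ph = homD[OF phi_hom[OF n]]
    have p0: "\<phi> n \<zero>\<^bsub>V n\<^esub> = \<zero>\<^bsub>V (Suc n)\<^esub>" by (rule hom_zero[OF A.V_vs B.V_vs phi_hom[OF n]])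
    define K where "K = {v \<in> carrier (V n). \<phi> n v = \<zero>\<^bsub>V (Suc n)\<^esub>}"
    have sK: "A.sr K"
    proof (rule A.srI)
      show "\<rho> n g w \<in> K" if "g \<in> perms {1..n}" "w \<in> K" for g w
        using that A.rho_closed[OF that(1)] phi_eq[OF n that(1)]
          hom_zero[OF B.V_vs B.V_vs B.rho_hom[OF perms_mono[OF _ that(1)]]] by (auto simp: K_def)
    qed (use ph p0 vs_facts(3,4,5,8)[OF A.V_vs] vs_facts(4,5)[OF B.V_vs] B.vrzero in \<open>auto simp: K_def\<close>)
    have "K = {\<zero>\<^bsub>V n\<^esub>}"
    proof (rule ccontr)
      assume "K \<noteq> {\<zero>\<^bsub>V n\<^esub>}"
      then obtain \<mu> w where \<mu>: "is_partition \<mu>" "padding_exists \<mu> n" and w: "w \<in> K" "A.ra (cy \<mu> n) w \<noteq> \<zero>\<^bsub>V n\<^esub>"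
        using A.complete[OF sK _ n] by blast
      define y where "y = A.ra (cy \<mu> n) w"
      have wV: "w \<in> carrier (V n)" using w by (simp add: K_def)
      have yE: "y \<in> Eg \<mu> n" unfolding y_def eigs_def by (rule imageI[OF wV])
      have "\<zero>\<^bsub>V n\<^esub> = A.ra (cy \<mu> n) \<zero>\<^bsub>V n\<^esub>" by (rule A.act_zero_right[symmetric])
      then have zE: "\<zero>\<^bsub>V n\<^esub> \<in> Eg \<mu> n" unfolding eigs_def by (rule image_eqI) (rule vs_facts(4)[OF A.V_vs])
      have "y \<in> K" unfolding y_def by (rule A.sr_act[OF sK w(1)])
      then have "Sh \<mu> n y = Sh \<mu> n \<zero>\<^bsub>V n\<^esub>" by (simp add: shift_def K_def p0)
      then have "y = \<zero>\<^bsub>V n\<^esub>" by (rule inj_onD[OF bij_betw_imp_inj_on[OF bij[OF nN \<mu>]] _ yE zE])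
      then show False using w(2) by (simp add: y_def)
    qed
    then have K0: "v = \<zero>\<^bsub>V n\<^esub>" if "v \<in> carrier (V n)" "\<phi> n v = \<zero>\<^bsub>V (Suc n)\<^esub>" for v
      using that by (auto simp: K_def)
    show ?thesis
    proof (rule inj_onI)
      fix v w assume v: "v \<in> carrier (V n)" and w: "w \<in> carrier (V n)" and e: "\<phi> n v = \<phi> n w"
      have w1: "(-1) \<odot>\<^bsub>V n\<^esub> w \<in> carrier (V n)" by (rule vs_facts(3)[OF A.V_vs w])
      have "\<phi> n (v \<oplus>\<^bsub>V n\<^esub> (-1) \<odot>\<^bsub>V n\<^esub> w) = \<phi> n v \<oplus>\<^bsub>V (Suc n)\<^esub> (-1) \<odot>\<^bsub>V (Suc n)\<^esub> \<phi> n w"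
        by (simp only: ph(2)[OF v w1] ph(3)[OF w])
      also have "\<dots> = \<zero>\<^bsub>V (Suc n)\<^esub>" using e vs_facts(6)[OF B.V_vs] B.vrneg ph(1)[OF w] by simp
      finally have "v \<oplus>\<^bsub>V n\<^esub> (-1) \<odot>\<^bsub>V n\<^esub> w = \<zero>\<^bsub>V n\<^esub>" by (rule K0[OF vs_facts(8)[OF A.V_vs v w1]])
      then show "v = w" unfolding vs_facts(6)[OF A.V_vs w] by (rule A.vneg_eq'[OF v w])
    qed
  qed
  have span: "rep_span (sym_group (Suc n)) (V (Suc n)) (\<rho> (Suc n)) (\<phi> n ` carrier (V n)) = carrier (V (Suc n))"
    if nN: "max 1 N \<le> n" for n
  proof -
    have n: "n \<ge> 1" using nN by simp
    interpret B: sym_rep "V (Suc n)" "crd (Suc n)" "vec (Suc n)" "dm (Suc n)" "Suc n" "\<rho> (Suc n)"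
      by (rule sym_rep) simp
    have all: "W = carrier (V (Suc n))" if W: "B.sr W" and sub: "\<phi> n ` carrier (V n) \<subseteq> W" for W
    proof (rule ccontr)
      assume ne: "W \<noteq> carrier (V (Suc n))"
      obtain C where C: "B.sr C" "W \<inter> C = {\<zero>\<^bsub>V (Suc n)\<^esub>}" "\<forall>v\<in>carrier (V (Suc n)). \<exists>w\<in>W. \<exists>c\<in>C. v = w \<oplus>\<^bsub>V (Suc n)\<^esub> c"
        using B.maschke[OF W] by blast
      have "C \<noteq> {\<zero>\<^bsub>V (Suc n)\<^esub>}"
      proof
        assume C0: "C = {\<zero>\<^bsub>V (Suc n)\<^esub>}"
        have "v \<in> W" if v: "v \<in> carrier (V (Suc n))" for v
        proof -
          obtain w where "w \<in> W" "v = w \<oplus>\<^bsub>V (Suc n)\<^esub> \<zero>\<^bsub>V (Suc n)\<^esub>" using C(3) v C0 by blast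
          then show ?thesis using B.srD(3)[OF W _ B.srD(2)[OF W]] by simp
        qed
        then show False using ne B.srD(1)[OF W] by blast
      qed
      then obtain \<mu> w where \<mu>: "is_partition \<mu>" "padding_exists \<mu> (Suc n)" and w: "w \<in> C" "B.ra (cy \<mu> (Suc n)) w \<noteq> \<zero>\<^bsub>V (Suc n)\<^esub>"
        using B.complete[OF C(1)] by auto
      define y where "y = B.ra (cy \<mu> (Suc n)) w"
      have yE: "y \<in> Eg \<mu> (Suc n)" unfolding y_def eigs_def by (rule imageI) (use w(1) B.srD(1)[OF C(1)] in blast)
      have yC: "y \<in> C" unfolding y_def by (rule B.sr_act[OF C(1) w(1)])
      show False
      proof (cases "padding_exists \<mu> n")
        case True
        then obtain v where v: "v \<in> Eg \<mu> n" "y = Sh \<mu> n v"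
          using yE bij[OF nN \<mu>(1)] by (auto simp: bij_betw_def)
        interpret A: sym_rep "V n" "crd n" "vec n" "dm n" n "\<rho> n" by (rule sym_rep[OF n])
        have "v \<in> carrier (V n)" using v(1) A.act_closed by (auto simp: eigs_def)
        then have "y \<in> W" unfolding v(2) shift_def using sub by (intro B.sr_act[OF W]) blast
        then have "y = \<zero>\<^bsub>V (Suc n)\<^esub>" using yC C(2) by blast
        then show ?thesis using w(2) by (simp add: y_def)
      next
        case False
        then have "y = \<zero>\<^bsub>V (Suc n)\<^esub>" using yE none[OF nN \<mu>(1) _ \<mu>(2)] by simp
        then show ?thesis using w(2) by (simp add: y_def)
      qed
    qed
    have "{W. B.sr W \<and> \<phi> n ` carrier (V n) \<subseteq> W} = {carrier (V (Suc n))}"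
      using all B.sr_carrier homD(1)[OF phi_hom[OF n]] by blast
    then show ?thesis unfolding rep_span_def by simp
  qed
  have step: "padded_multiplicity \<mu> (Suc n) (V (Suc n)) (\<rho> (Suc n)) = padded_multiplicity \<mu> n (V n) (\<rho> n)"
    if nN: "max 1 N \<le> n" and part: "is_partition \<mu>" for n \<mu>
  proof -
    have n: "n \<ge> 1" using nN by simp
    show ?thesis
    proof (cases "padding_exists \<mu> n")
      case True
      note pad' = padding_Suc[OF True]
      interpret A: stage "V n" "crd n" "vec n" "dm n" n "\<rho> n" \<mu> by (rule stage[OF n part True])
      interpret B: stage "V (Suc n)" "crd (Suc n)" "vec (Suc n)" "dm (Suc n)" "Suc n" "\<rho> (Suc n)" \<mu>
        by (rule stage[OF _ part pad']) simp
      have EA: "Eg \<mu> n = A.eig" and EB: "Eg \<mu> (Suc n) = B.eig" by (simp_all only: eigs_def A.eig_eq B.eig_eq)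
      have EV: "A.eig \<subseteq> carrier (V n)" using A.eig_carrier by blast
      note b = bij[OF nN part True, unfolded EA EB]
      have "fv.dim (shm \<mu> n ` crd n ` A.eig) = fv.dim (crd n ` A.eig)"
        by (rule dim_image_linear[OF lin_shm[OF n] A.eig_subspace shm_inj[OF n EV bij_betw_imp_inj_on[OF b]]])
      then have "fv.dim (crd (Suc n) ` B.eig) = fv.dim (crd n ` A.eig)"
        by (simp only: shm_image[OF n EV] bij_betw_imp_surj_on[OF b])
      then show ?thesis using True pad' by (simp add: padded_multiplicity_def A.multiplicity_eq B.multiplicity_eq)
    next
      case False
      show ?thesis
      proof (cases "padding_exists \<mu> (Suc n)")
        case pad': True
        interpret B: stage "V (Suc n)" "crd (Suc n)" "vec (Suc n)" "dm (Suc n)" "Suc n" "\<rho> (Suc n)" \<mu>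
          by (rule stage[OF _ part pad']) simp
        have "B.eig = {\<zero>\<^bsub>V (Suc n)\<^esub>}" using none[OF nN part False pad'] by (simp only: eigs_def B.eig_eq)
        then have "crd (Suc n) ` B.eig = {0}" by (simp add: B.crd_zero)
        moreover have "fv.dim {0 :: nat \<Rightarrow> rat} = 0"
          using fv.dim_span[of "{} :: (nat \<Rightarrow> rat) set"] fv.dim_eq_card_independent[OF fv.independent_empty] by simp
        ultimately show ?thesis using False pad' by (simp add: padded_multiplicity_def B.multiplicity_eq)
      qed (use False in \<open>simp add: padded_multiplicity_def\<close>)
    qed
  qed
  have mult: "padded_multiplicity \<mu> m (V m) (\<rho> m) = padded_multiplicity \<mu> (max 1 N) (V (max 1 N)) (\<rho> (max 1 N))"
    if m: "max 1 N \<le> m" and part: "is_partition \<mu>" for m \<mu>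
    using m by (induction m rule: dec_induct) (simp_all only: step[OF _ part])
  \<comment> \<open>The generators of the \<open>k\<close> copies are shifted. They stay independent
    since the shift is injective, they lie in the span since the shift is \<open>theta\<close>
    applied after \<open>\<phi> n\<close>, and \<open>orbit_iso\<close> rebuilds \<open>k\<close>
    copies from them.\<close>
  have mono: "\<exists>U. subrep (sym_group (Suc n)) (V (Suc n)) (\<rho> (Suc n)) U \<and>
      U \<subseteq> rep_span (sym_group (Suc n)) (V (Suc n)) (\<rho> (Suc n)) (\<phi> n ` W) \<and>
      rep_iso (sym_group (Suc n)) ((V (Suc n))\<lparr>carrier := U\<rparr>) (\<rho> (Suc n))
        (module_power (specht_module (padded \<mu> (Suc n))) k) (power_action k (specht_action (padded \<mu> (Suc n))))"
    if nN: "max 1 N \<le> n" and part: "is_partition \<mu>" and pad: "padding_exists \<mu> n"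
      and W: "subrep (sym_group n) (V n) (\<rho> n) W"
      and iso: "rep_iso (sym_group n) ((V n)\<lparr>carrier := W\<rparr>) (\<rho> n)
        (module_power (specht_module (padded \<mu> n)) k) (power_action k (specht_action (padded \<mu> n)))" for n \<mu> k W
  proof -
    have n: "n \<ge> 1" using nN by simp
    note pad' = padding_Suc[OF pad]
    interpret A: stage "V n" "crd n" "vec n" "dm n" n "\<rho> n" \<mu> by (rule stage[OF n part pad])
    interpret B: stage "V (Suc n)" "crd (Suc n)" "vec (Suc n)" "dm (Suc n)" "Suc n" "\<rho> (Suc n)" \<mu>
      by (rule stage[OF _ part pad']) simp
    have EA: "Eg \<mu> n = A.eig" and EB: "Eg \<mu> (Suc n) = B.eig" by (simp_all only: eigs_def A.eig_eq B.eig_eq)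
    note b = bij[OF nN part pad, unfolded EA EB]
    obtain u where u: "\<forall>l<k. u l \<in> W \<and> u l \<in> A.eig"
      and ind: "\<forall>\<alpha>. (\<Oplus>\<^bsub>V n\<^esub>l\<in>{..<k}. \<alpha> l \<odot>\<^bsub>V n\<^esub> u l) = \<zero>\<^bsub>V n\<^esub> \<longrightarrow> (\<forall>l<k. \<alpha> l = 0)"
      using A.iso_vectors[OF W iso] by blast
    have uV: "u l \<in> carrier (V n)" if "l < k" for l using u that A.eig_carrier by blast
    define u' where "u' = (\<lambda>l. Sh \<mu> n (u l))"
    have u'e: "u' l \<in> B.eig" if "l < k" for l
      unfolding u'_def EB[symmetric] by (rule Sh_Eg[OF n uV[OF that]])
    have ind': "\<forall>l<k. \<alpha> l = 0" if s: "(\<Oplus>\<^bsub>V (Suc n)\<^esub>l\<in>{..<k}. \<alpha> l \<odot>\<^bsub>V (Suc n)\<^esub> u' l) = \<zero>\<^bsub>V (Suc n)\<^esub>" for \<alpha>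
    proof -
      have t: "(\<lambda>l. \<alpha> l \<odot>\<^bsub>V n\<^esub> u l) \<in> {..<k} \<rightarrow> carrier (V n)" using uV vs_facts(3)[OF A.V_vs] by auto
      \<comment> \<open>Injectivity of the shift is known on \<open>A.eig\<close> only, so the
        combination \<open>z\<close> has to be placed there first.\<close>
      define z where "z = (\<Oplus>\<^bsub>V n\<^esub>l\<in>{..<k}. \<alpha> l \<odot>\<^bsub>V n\<^esub> u l)"
      have zV: "z \<in> carrier (V n)" unfolding z_def by (rule A.finsum_closed[OF t])
      have "A.ra (cy \<mu> n) z = (\<Oplus>\<^bsub>V n\<^esub>l\<in>{..<k}. A.ra (cy \<mu> n) (\<alpha> l \<odot>\<^bsub>V n\<^esub> u l))"
        unfolding z_def by (rule hom_finsum[OF A.V_vs A.V_vs A.act_right_hom t])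
      also have "\<dots> = (\<Oplus>\<^bsub>V n\<^esub>l\<in>{..<k}. A.kap \<odot>\<^bsub>V n\<^esub> (\<alpha> l \<odot>\<^bsub>V n\<^esub> u l))"
      proof (rule A.finsum_cong'[OF refl])
        show "(\<lambda>l. A.kap \<odot>\<^bsub>V n\<^esub> (\<alpha> l \<odot>\<^bsub>V n\<^esub> u l)) \<in> {..<k} \<rightarrow> carrier (V n)"
          using t vs_facts(3)[OF A.V_vs] by blast
        fix l assume "l \<in> {..<k}"
        then have l: "l < k" by simp
        have "A.ra (cy \<mu> n) (u l) = A.kap \<odot>\<^bsub>V n\<^esub> u l" using u l by (simp add: A.eig_def)
        then show "A.ra (cy \<mu> n) (\<alpha> l \<odot>\<^bsub>V n\<^esub> u l) = A.kap \<odot>\<^bsub>V n\<^esub> (\<alpha> l \<odot>\<^bsub>V n\<^esub> u l)"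
          by (simp only: homD(3)[OF A.act_right_hom uV[OF l]] vs_facts(11)[OF A.V_vs uV[OF l], symmetric] mult.commute)
      qed
      also have "\<dots> = A.kap \<odot>\<^bsub>V n\<^esub> z"
        unfolding z_def by (rule A.finsum_smult_ldistr[symmetric]) (use t in auto)
      finally have ze: "z \<in> A.eig" using zV by (simp add: A.eig_def)
      have zero: "\<zero>\<^bsub>V n\<^esub> \<in> A.eig" using A.act_zero_right vs_facts(4,5)[OF A.V_vs] by (simp add: A.eig_def)
      have sz: "Sh \<mu> n \<zero>\<^bsub>V n\<^esub> = \<zero>\<^bsub>V (Suc n)\<^esub>" by (rule hom_zero[OF A.V_vs B.V_vs Sh_hom[OF n]])
      have "Sh \<mu> n z = (\<Oplus>\<^bsub>V (Suc n)\<^esub>l\<in>{..<k}. Sh \<mu> n (\<alpha> l \<odot>\<^bsub>V n\<^esub> u l))"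
        unfolding z_def by (rule hom_finsum[OF A.V_vs B.V_vs Sh_hom[OF n] t])
      also have "\<dots> = (\<Oplus>\<^bsub>V (Suc n)\<^esub>l\<in>{..<k}. \<alpha> l \<odot>\<^bsub>V (Suc n)\<^esub> u' l)"
        by (rule B.finsum_cong'[OF refl])
           (use uV homD[OF Sh_hom[OF n]] vs_facts(3)[OF B.V_vs] in \<open>auto simp: u'_def\<close>)
      finally have "Sh \<mu> n z = Sh \<mu> n \<zero>\<^bsub>V n\<^esub>" by (simp only: s sz)
      then have zz: "z = \<zero>\<^bsub>V n\<^esub>" by (rule inj_onD[OF bij_betw_imp_inj_on[OF b] _ ze zero])
      show ?thesis by (rule spec[OF ind, THEN mp, OF zz[unfolded z_def]])
    qed
    obtain U where U: "B.sr U" "rep_iso (sym_group (Suc n)) ((V (Suc n))\<lparr>carrier := U\<rparr>) (\<rho> (Suc n))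
        (module_power B.Sp k) (power_action k B.sa)" "\<forall>Y. B.sr Y \<longrightarrow> (\<forall>l<k. u' l \<in> Y) \<longrightarrow> U \<subseteq> Y"
      using B.orbit_iso[where u = u' and k = k, OF u'e ind'] by blast
    have "U \<subseteq> Y" if Y: "B.sr Y" "\<phi> n ` W \<subseteq> Y" for Y
    proof -
      have "u' l \<in> Y" if "l < k" for l
        unfolding u'_def shift_def by (rule B.sr_act[OF Y(1)]) (use u that Y(2) in blast)
      then show ?thesis using U(3) Y(1) by blast
    qed
    then have "U \<subseteq> rep_span (sym_group (Suc n)) (V (Suc n)) (\<rho> (Suc n)) (\<phi> n ` W)"
      unfolding rep_span_def by blast
    then show ?thesis using U by blast
  qed
  have "monotone_sequence N V \<rho> \<phi>"
    unfolding monotone_sequence_def using cons inj mono by blast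
  moreover have "uniformly_stable N V \<rho> \<phi>"
    unfolding uniformly_stable_def using cons fd inj span mult by metis
  ultimately show ?thesis ..
qed

end

section \<open>Cochains and induced maps\<close>

definition omit :: "nat \<Rightarrow> 'a list \<Rightarrow> 'a list" where
  "omit i t = take i t @ drop (Suc i) t"

lemma length_omit: "i < length t \<Longrightarrow> length (omit i t) = length t - 1"
  by (simp add: omit_def)

lemma nth_omit: "i < length t \<Longrightarrow> k < length t - 1 \<Longrightarrow> omit i t ! k = (if k < i then t ! k else t ! Suc k)"
  by (auto simp: omit_def nth_append min_def)

lemma set_omit: "set (omit i t) \<subseteq> set t"
  using set_take_subset set_drop_subset by (fastforce simp: omit_def)

lemma omit_map: "omit i (map h t) = map h (omit i t)"
  by (simp add: omit_def take_map drop_map)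

lemma omit_omit:
  assumes "j < i" "i < length t"
  shows "omit j (omit i t) = omit (i - 1) (omit j t)"
proof (rule nth_equalityI)
  show l: "length (omit j (omit i t)) = length (omit (i - 1) (omit j t))"
    using assms by (simp add: length_omit)
  fix k assume "k < length (omit j (omit i t))"
  then have "k < length t - 2" using assms by (simp add: length_omit)
  then show "omit j (omit i t) ! k = omit (i - 1) (omit j t) ! k"
    using assms by (simp add: nth_omit length_omit) auto
qed

text \<open>The simplicial boundary, a list of length \<open>m\<close> being a simplex of dimension
  \<open>m - 1\<close>. The empty list is included, so that on lists of length one the boundary is
  the augmentation.\<close>

definition bd :: "'a list \<Rightarrow> 'a list \<Rightarrow>\<^sub>0 int" where
  "bd t = (\<Sum>i<length t. frag_cmul ((-1) ^ i) (frag_of (omit i t)))"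

text \<open>Two entries can be omitted in either order, with opposite signs. \<open>S1\<close> and
  \<open>S2\<close> are the two orders, exchanged by means of \<open>omit_omit\<close>.\<close>

lemma bd_bd: "frag_extend bd (bd t) = 0"
proof -
  define L where "L = length t"
  define F where "F = (\<lambda>(i, j). frag_cmul ((-1) ^ (i + j)) (frag_of (omit j (omit i t))))"
  define S1 where "S1 = {(i, j). i < L \<and> j < i}"
  define S2 where "S2 = {(i, j). i \<le> j \<and> j < L - 1}"
  have fin: "finite S1" "finite S2"
    by (rule finite_subset[of _ "{..<L} \<times> {..<L}"]; auto simp: S1_def S2_def)+
  have "frag_extend bd (bd t) = (\<Sum>i<L. frag_cmul ((-1) ^ i) (bd (omit i t)))"
    by (simp add: bd_def[of t] frag_extend_sum frag_extend_cmul comp_def L_def)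
  also have "\<dots> = (\<Sum>i<L. \<Sum>j<L - 1. F (i, j))"
  proof (rule sum.cong[OF refl])
    fix i assume "i \<in> {..<L}"
    then have "length (omit i t) = L - 1" by (simp add: length_omit L_def)
    then show "frag_cmul ((-1) ^ i) (bd (omit i t)) = (\<Sum>j<L - 1. F (i, j))"
      by (simp add: bd_def frag_cmul_sum F_def power_add)
  qed
  also have "\<dots> = (\<Sum>x\<in>{..<L} \<times> {..<L - 1}. F x)"
    by (simp add: sum.cartesian_product)
  also have "{..<L} \<times> {..<L - 1} = S1 \<union> S2"
    by (auto simp: S1_def S2_def)
  also have "(\<Sum>x\<in>S1 \<union> S2. F x) = (\<Sum>x\<in>S1. F x) + (\<Sum>x\<in>S2. F x)"
    by (rule sum.union_disjoint[OF fin]) (auto simp: S1_def S2_def)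
  also have "(\<Sum>x\<in>S1. F x) = (\<Sum>x\<in>S2. - F x)"
  proof (rule sum.reindex_bij_witness[of _ "\<lambda>(a, b). (Suc b, a)" "\<lambda>(i, j). (j, i - 1)"])
    fix x assume "x \<in> S1"
    then obtain i j where x: "x = (i, j)" "i < L" "j < i" by (auto simp: S1_def)
    then obtain k where k: "i = Suc k" by (cases i) auto
    show "- F (case x of (i, j) \<Rightarrow> (j, i - 1)) = F x"
      using omit_omit[of j i t] x k by (simp add: F_def L_def add.commute)
  qed (auto simp: S1_def S2_def)
  finally show ?thesis by (simp add: sum_negf)
qed

lemma bd_keys: "s \<in> Poly_Mapping.keys (bd t) \<Longrightarrow> \<exists>i<length t. s = omit i t"
proof -
  have "Poly_Mapping.keys (bd t) \<subseteq> (\<Union>i<length t. Poly_Mapping.keys (frag_cmul ((-1) ^ i) (frag_of (omit i t))))"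
    unfolding bd_def by (rule keys_sum)
  moreover assume "s \<in> Poly_Mapping.keys (bd t)"
  ultimately obtain i where i: "i < length t" "s \<in> Poly_Mapping.keys (frag_cmul ((-1) ^ i) (frag_of (omit i t)))"
    by blast
  have "s = omit i t" using subsetD[OF keys_cmul i(2)] by (simp add: keys_frag_of)
  then show "\<exists>i<length t. s = omit i t" using i(1) by blast
qed

text \<open>Linear extension from basis elements; with \<open>f\<close> a cochain in coordinates it
  evaluates the cochain on a chain.\<close>

definition ext :: "('a \<Rightarrow> 'i \<Rightarrow> rat) \<Rightarrow> ('a \<Rightarrow>\<^sub>0 int) \<Rightarrow> 'i \<Rightarrow> rat" where
  "ext f x = (\<Sum>t\<in>Poly_Mapping.keys x. of_int (Poly_Mapping.lookup x t) *q f t)"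

lemma ext_superset:
  "finite S \<Longrightarrow> Poly_Mapping.keys x \<subseteq> S \<Longrightarrow> ext f x = (\<Sum>t\<in>S. of_int (Poly_Mapping.lookup x t) *q f t)"
  unfolding ext_def by (rule sum.mono_neutral_left) (auto simp: in_keys_iff)

lemma ext_diff: "ext f (x - y) = ext f x - ext f y"
proof -
  let ?S = "Poly_Mapping.keys x \<union> Poly_Mapping.keys y"
  have S: "finite ?S" "Poly_Mapping.keys (x - y) \<subseteq> ?S" using keys_diff[of x y] by auto
  have "ext f (x - y) = (\<Sum>t\<in>?S. of_int (Poly_Mapping.lookup x t) *q f t - of_int (Poly_Mapping.lookup y t) *q f t)"
    unfolding ext_superset[OF S] by (rule sum.cong[OF refl]) (simp only: lookup_minus of_int_diff fv.scale_left_diff_distrib)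
  also have "\<dots> = ext f x - ext f y"
    by (simp only: sum_subtractf ext_superset[OF S(1) Un_upper1] ext_superset[OF S(1) Un_upper2])
  finally show ?thesis .
qed

lemma ext_zero: "ext f 0 = 0"
  by (simp add: ext_def)

lemma ext_add: "ext f (x + y) = ext f x + ext f y"
  using ext_diff[of f "x + y" y] by (simp only: add_diff_cancel_right' diff_eq_eq) simp

lemma ext_of: "ext f (frag_of t) = f t"
  by (simp add: ext_def keys_frag_of)

lemma ext_cmul: "ext f (frag_cmul k x) = of_int k *q ext f x"
proof -
  have "ext f (frag_cmul k x) = (\<Sum>t\<in>Poly_Mapping.keys x. of_int (Poly_Mapping.lookup (frag_cmul k x) t) *q f t)"
    by (rule ext_superset) (auto intro: subsetD[OF keys_cmul])
  also have "\<dots> = of_int k *q ext f x"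
    unfolding ext_def fv.scale_sum_right by (rule sum.cong[OF refl]) (simp only: lookup_frag_cmul of_int_mult fv.scale_scale)
  finally show ?thesis .
qed

lemma ext_sum: "ext f (\<Sum>i\<in>I. g i) = (\<Sum>i\<in>I. ext f (g i))"
proof (induction I rule: infinite_finite_induct)
  case (insert i I)
  then show ?case by (simp only: sum.insert ext_add not_False_eq_True)
qed (simp_all only: sum.infinite sum.empty ext_zero not_False_eq_True)

lemma ext_frag_extend: "ext f (frag_extend g x) = ext (\<lambda>t. ext f (g t)) x"
proof -
  have "Poly_Mapping.keys x \<subseteq> UNIV" by simp
  then show ?thesis
    by (induction x rule: frag_induction) (simp_all only: frag_extend_0 ext_zero frag_extend_of ext_of frag_extend_diff ext_diff)
qed

lemma ext_cong: "(\<And>t. t \<in> Poly_Mapping.keys x \<Longrightarrow> f t = g t) \<Longrightarrow> ext f x = ext g x"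
  unfolding ext_def by (rule sum.cong) auto

lemma ext_bd: "ext f (bd t) = (\<Sum>i<length t. (-1) ^ i *q f (omit i t))"
  unfolding bd_def ext_sum by (rule sum.cong[OF refl]) (simp only: ext_cmul ext_of of_int_power of_int_minus of_int_1)

lemma coset_facts:
  assumes C: "vectorspace rat_field C" and B: "B \<subseteq> carrier C" "\<zero>\<^bsub>C\<^esub> \<in> B"
    "\<forall>a\<in>B. \<forall>b\<in>B. a \<oplus>\<^bsub>C\<^esub> b \<in> B" "\<forall>q. \<forall>a\<in>B. q \<odot>\<^bsub>C\<^esub> a \<in> B"
    and f: "f \<in> carrier C" and g: "g \<in> carrier C"
  shows "B +>\<^bsub>C\<^esub> f = B +>\<^bsub>C\<^esub> g \<longleftrightarrow> f \<oplus>\<^bsub>C\<^esub> (-1) \<odot>\<^bsub>C\<^esub> g \<in> B"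
    and "(B +>\<^bsub>C\<^esub> f) <+>\<^bsub>C\<^esub> (B +>\<^bsub>C\<^esub> g) = B +>\<^bsub>C\<^esub> (f \<oplus>\<^bsub>C\<^esub> g)"
    and "B +>\<^bsub>C\<^esub> \<zero>\<^bsub>C\<^esub> = B"
    and "b \<in> B \<Longrightarrow> B +>\<^bsub>C\<^esub> (b \<oplus>\<^bsub>C\<^esub> f) = B +>\<^bsub>C\<^esub> f"
proof -
  interpret A: abelian_group C by (rule vs_facts(7)[OF C])
  note neg = vs_facts(6)[OF C] and sc = vs_facts(3)[OF C]
  have BC: "\<And>b. b \<in> B \<Longrightarrow> b \<in> carrier C" using B(1) by blast
  have nB: "\<ominus>\<^bsub>C\<^esub> b \<in> B" if "b \<in> B" for b using B(4)[rule_format, OF that, of "-1"] neg[OF BC[OF that]] by simp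
  have mem: "h \<in> B +>\<^bsub>C\<^esub> k \<longleftrightarrow> (\<exists>b\<in>B. h = b \<oplus>\<^bsub>C\<^esub> k)" for h k by (auto simp: a_r_coset_def')
  have absorb: "B +>\<^bsub>C\<^esub> (b \<oplus>\<^bsub>C\<^esub> k) = B +>\<^bsub>C\<^esub> k" if b: "b \<in> B" and k: "k \<in> carrier C" for b k
  proof (intro equalityI subsetI)
    fix h assume "h \<in> B +>\<^bsub>C\<^esub> (b \<oplus>\<^bsub>C\<^esub> k)"
    then obtain a where a: "a \<in> B" "h = a \<oplus>\<^bsub>C\<^esub> (b \<oplus>\<^bsub>C\<^esub> k)" unfolding mem by blast
    then have "h = (a \<oplus>\<^bsub>C\<^esub> b) \<oplus>\<^bsub>C\<^esub> k" using b k BC by (simp add: A.a_assoc)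
    then show "h \<in> B +>\<^bsub>C\<^esub> k" unfolding mem using B(3)[rule_format, OF a(1) b] by blast
  next
    fix h assume "h \<in> B +>\<^bsub>C\<^esub> k"
    then obtain a where a: "a \<in> B" "h = a \<oplus>\<^bsub>C\<^esub> k" unfolding mem by blast
    have "h = (a \<oplus>\<^bsub>C\<^esub> \<ominus>\<^bsub>C\<^esub> b) \<oplus>\<^bsub>C\<^esub> (b \<oplus>\<^bsub>C\<^esub> k)"
      unfolding a(2) using a(1) b k BC by (simp add: A.a_assoc vs_group_facts(1)[OF C])
    then show "h \<in> B +>\<^bsub>C\<^esub> (b \<oplus>\<^bsub>C\<^esub> k)" unfolding mem using B(3)[rule_format, OF a(1) nB[OF b]] by blast
  qed
  show "b \<in> B \<Longrightarrow> B +>\<^bsub>C\<^esub> (b \<oplus>\<^bsub>C\<^esub> f) = B +>\<^bsub>C\<^esub> f" by (rule absorb[OF _ f])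
  show "B +>\<^bsub>C\<^esub> f = B +>\<^bsub>C\<^esub> g \<longleftrightarrow> f \<oplus>\<^bsub>C\<^esub> (-1) \<odot>\<^bsub>C\<^esub> g \<in> B"
    unfolding neg[OF g]
  proof
    assume e: "B +>\<^bsub>C\<^esub> f = B +>\<^bsub>C\<^esub> g"
    have "f \<in> B +>\<^bsub>C\<^esub> f" unfolding mem using B(2) f by (intro bexI[of _ "\<zero>\<^bsub>C\<^esub>"]) auto
    then obtain b where b: "b \<in> B" "f = b \<oplus>\<^bsub>C\<^esub> g" unfolding e mem by blast
    then have "f \<oplus>\<^bsub>C\<^esub> \<ominus>\<^bsub>C\<^esub> g = b" using g BC by (simp add: A.a_assoc A.r_neg)
    then show "f \<oplus>\<^bsub>C\<^esub> \<ominus>\<^bsub>C\<^esub> g \<in> B" using b by simp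
  next
    assume b: "f \<oplus>\<^bsub>C\<^esub> \<ominus>\<^bsub>C\<^esub> g \<in> B"
    have "f = (f \<oplus>\<^bsub>C\<^esub> \<ominus>\<^bsub>C\<^esub> g) \<oplus>\<^bsub>C\<^esub> g" using f g by (simp add: A.a_assoc A.l_neg)
    then show "B +>\<^bsub>C\<^esub> f = B +>\<^bsub>C\<^esub> g" using absorb[OF b g] by simp
  qed
  show "(B +>\<^bsub>C\<^esub> f) <+>\<^bsub>C\<^esub> (B +>\<^bsub>C\<^esub> g) = B +>\<^bsub>C\<^esub> (f \<oplus>\<^bsub>C\<^esub> g)"
  proof (intro equalityI subsetI)
    fix h assume "h \<in> (B +>\<^bsub>C\<^esub> f) <+>\<^bsub>C\<^esub> (B +>\<^bsub>C\<^esub> g)"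
    then obtain a b where ab: "a \<in> B" "b \<in> B" "h = (a \<oplus>\<^bsub>C\<^esub> f) \<oplus>\<^bsub>C\<^esub> (b \<oplus>\<^bsub>C\<^esub> g)"
      by (auto simp: set_add_def' mem)
    have "h = (a \<oplus>\<^bsub>C\<^esub> b) \<oplus>\<^bsub>C\<^esub> (f \<oplus>\<^bsub>C\<^esub> g)"
      unfolding ab(3) using f g BC[OF ab(1)] BC[OF ab(2)] by (simp add: A.a_ac)
    then show "h \<in> B +>\<^bsub>C\<^esub> (f \<oplus>\<^bsub>C\<^esub> g)" unfolding mem using B(3)[rule_format, OF ab(1,2)] by blast
  next
    fix h assume "h \<in> B +>\<^bsub>C\<^esub> (f \<oplus>\<^bsub>C\<^esub> g)"
    then obtain a where a: "a \<in> B" "h = a \<oplus>\<^bsub>C\<^esub> (f \<oplus>\<^bsub>C\<^esub> g)" unfolding mem by blast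
    have "h = (a \<oplus>\<^bsub>C\<^esub> f) \<oplus>\<^bsub>C\<^esub> (\<zero>\<^bsub>C\<^esub> \<oplus>\<^bsub>C\<^esub> g)" unfolding a(2) using f g BC[OF a(1)] by (simp add: A.a_assoc)
    moreover have "a \<oplus>\<^bsub>C\<^esub> f \<in> B +>\<^bsub>C\<^esub> f" "\<zero>\<^bsub>C\<^esub> \<oplus>\<^bsub>C\<^esub> g \<in> B +>\<^bsub>C\<^esub> g" unfolding mem using a B(2) by blast+
    ultimately show "h \<in> (B +>\<^bsub>C\<^esub> f) <+>\<^bsub>C\<^esub> (B +>\<^bsub>C\<^esub> g)" unfolding set_add_def' by blast
  qed
  show "B +>\<^bsub>C\<^esub> \<zero>\<^bsub>C\<^esub> = B"
  proof (intro equalityI subsetI)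
    fix h assume "h \<in> B +>\<^bsub>C\<^esub> \<zero>\<^bsub>C\<^esub>"
    then obtain b where "b \<in> B" "h = b \<oplus>\<^bsub>C\<^esub> \<zero>\<^bsub>C\<^esub>" unfolding mem by blast
    then show "h \<in> B" using BC by simp
  next
    fix h assume h: "h \<in> B"
    then have "h = h \<oplus>\<^bsub>C\<^esub> \<zero>\<^bsub>C\<^esub>" using BC by simp
    then show "h \<in> B +>\<^bsub>C\<^esub> \<zero>\<^bsub>C\<^esub>" unfolding mem using h by blast
  qed
qed

text \<open>All representatives of a coset give the same coset in the target, so the unions that
  define scalar multiplication and \<open>cohomology_map\<close> have a single distinct
  member.\<close>

lemma coset_map:
  assumes C: "vectorspace rat_field C" and B: "B \<subseteq> carrier C" "\<zero>\<^bsub>C\<^esub> \<in> B"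
    and D: "vectorspace rat_field D" and B': "B' \<subseteq> carrier D" "\<zero>\<^bsub>D\<^esub> \<in> B'"
    "\<forall>a\<in>B'. \<forall>b\<in>B'. a \<oplus>\<^bsub>D\<^esub> b \<in> B'" "\<forall>q. \<forall>a\<in>B'. q \<odot>\<^bsub>D\<^esub> a \<in> B'"
    and m: "m \<in> hom C D" "m ` B \<subseteq> B'" and f: "f \<in> carrier C"
  shows "(\<Union>h\<in>B +>\<^bsub>C\<^esub> f. B' +>\<^bsub>D\<^esub> m h) = B' +>\<^bsub>D\<^esub> m f"
proof -
  interpret A: abelian_group C by (rule vs_facts(7)[OF C])
  have e: "B' +>\<^bsub>D\<^esub> m h = B' +>\<^bsub>D\<^esub> m f" if h: "h \<in> B +>\<^bsub>C\<^esub> f" for h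
  proof -
    obtain b where b: "b \<in> B" "h = b \<oplus>\<^bsub>C\<^esub> f" using h by (auto simp: a_r_coset_def')
    have "m h = m b \<oplus>\<^bsub>D\<^esub> m f" unfolding b(2) using b(1) B(1) f homD(2)[OF m(1)] by blast
    then show ?thesis
      using coset_facts(4)[OF D B' homD(1)[OF m(1) f] homD(1)[OF m(1) f], of "m b"] b(1) m(2) by auto
  qed
  have "\<zero>\<^bsub>C\<^esub> \<oplus>\<^bsub>C\<^esub> f \<in> B +>\<^bsub>C\<^esub> f" using B(2) by (auto simp: a_r_coset_def')
  then have "B +>\<^bsub>C\<^esub> f \<noteq> {}" by blast
  then show ?thesis using e by auto
qed

lemma vectorspace_image:
  assumes Z: "vectorspace rat_field Z" and im: "carrier H = h ` carrier Z"
    and add: "\<And>f g. f \<in> carrier Z \<Longrightarrow> g \<in> carrier Z \<Longrightarrow> h (f \<oplus>\<^bsub>Z\<^esub> g) = h f \<oplus>\<^bsub>H\<^esub> h g"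
    and scl: "\<And>q f. f \<in> carrier Z \<Longrightarrow> h (q \<odot>\<^bsub>Z\<^esub> f) = q \<odot>\<^bsub>H\<^esub> h f" and zero: "h \<zero>\<^bsub>Z\<^esub> = \<zero>\<^bsub>H\<^esub>"
  shows "vectorspace rat_field H"
proof -
  interpret A: abelian_group Z by (rule vs_facts(7)[OF Z])
  note v = vs_facts[OF Z]
  show ?thesis
  proof (rule vectorspaceI)
    show "\<exists>w\<in>carrier H. w \<oplus>\<^bsub>H\<^esub> x = \<zero>\<^bsub>H\<^esub>" if "x \<in> carrier H" for x
    proof -
      obtain f where f: "f \<in> carrier Z" "x = h f" using \<open>x \<in> carrier H\<close> im by blast
      have "h (\<ominus>\<^bsub>Z\<^esub> f) \<oplus>\<^bsub>H\<^esub> x = \<zero>\<^bsub>H\<^esub>" using add[of "\<ominus>\<^bsub>Z\<^esub> f" f] f zero by (simp add: A.l_neg)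
      then show ?thesis using im f by blast
    qed
  qed (use im v in \<open>auto simp flip: add scl zero simp: A.a_ac\<close>)
qed

section \<open>Cocycles, coboundaries and cohomology as vector spaces\<close>

locale coh = coords V crd vec d for V :: "(rat, 'v) module" and crd vec d +
  fixes G :: "('g, 'm) monoid_scheme" and \<gamma> :: "'g \<Rightarrow> 'v \<Rightarrow> 'v"
  assumes grp: "group G" and rg: "rat_rep G V \<gamma>"
begin

abbreviation C where "C \<equiv> cochains G V \<gamma>"
abbreviation cobd where "cobd \<equiv> coboundary G V"
abbreviation Z where "Z \<equiv> cocycles G V \<gamma>"
abbreviation B where "B \<equiv> coboundaries G V \<gamma>"
abbreviation H where "H \<equiv> cohomology G V \<gamma>"
abbreviation tup where "tup \<equiv> tuples G"

definition tr_left :: "'g \<Rightarrow> 'g list \<Rightarrow> 'g list" where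
  "tr_left g = map (\<lambda>x. g \<otimes>\<^bsub>G\<^esub> x)"

lemma C_zero: "\<zero>\<^bsub>C p\<^esub> = (\<lambda>t\<in>tup p. \<zero>\<^bsub>V\<^esub>)"
  and C_add: "f \<oplus>\<^bsub>C p\<^esub> f' = (\<lambda>t\<in>tup p. f t \<oplus>\<^bsub>V\<^esub> f' t)"
  and C_scl: "q \<odot>\<^bsub>C p\<^esub> f = (\<lambda>t\<in>tup p. q \<odot>\<^bsub>V\<^esub> f t)"
  by (simp_all add: cochains_def)

lemma C_carrier: "f \<in> carrier (C p) \<longleftrightarrow> f \<in> tup p \<rightarrow>\<^sub>E carrier V \<and>
    (\<forall>g\<in>carrier G. \<forall>t\<in>tup p. f (tr_left g t) = \<gamma> g (f t))"
  by (simp add: cochains_def tr_left_def)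

lemma CD: "f \<in> carrier (C p) \<Longrightarrow> t \<in> tup p \<Longrightarrow> f t \<in> carrier V"
  "f \<in> carrier (C p) \<Longrightarrow> g \<in> carrier G \<Longrightarrow> t \<in> tup p \<Longrightarrow> f (tr_left g t) = \<gamma> g (f t)"
  by (auto simp: C_carrier)

lemma CF: "f \<in> carrier (C p) \<Longrightarrow> f \<in> tup p \<rightarrow> carrier V"
  by (auto simp: C_carrier)

lemma C_eqI:
  assumes "f \<in> extensional (tup p)" "f' \<in> extensional (tup p)" "\<And>t. t \<in> tup p \<Longrightarrow> f t = f' t"
  shows "f = f'"
  by (rule extensionalityI[OF assms])

lemma C_ext: "f \<in> carrier (C p) \<Longrightarrow> f \<in> extensional (tup p)"
  by (auto simp: C_carrier PiE_def)

lemma tr_tup: "g \<in> carrier G \<Longrightarrow> t \<in> tup p \<Longrightarrow> tr_left g t \<in> tup p"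
  using monoid.m_closed[OF group.is_monoid[OF grp]] by (auto simp: tuples_def tr_left_def)

lemma gam_hom: "g \<in> carrier G \<Longrightarrow> \<gamma> g \<in> hom V V"
  by (rule rat_repD(2)[OF rg])

lemma CI:
  assumes "\<And>t. t \<in> tup p \<Longrightarrow> f t \<in> carrier V" "\<And>g t. g \<in> carrier G \<Longrightarrow> t \<in> tup p \<Longrightarrow> f (tr_left g t) = \<gamma> g (f t)"
  shows "(\<lambda>t\<in>tup p. f t) \<in> carrier (C p)"
  using assms tr_tup by (auto simp: C_carrier)

lemma C_vs: "vectorspace rat_field (C p)"
proof (rule vectorspaceI)
  note v = vs_facts[OF V_vs]
  show ad: "f \<oplus>\<^bsub>C p\<^esub> f' \<in> carrier (C p)" if "f \<in> carrier (C p)" "f' \<in> carrier (C p)" for f f'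
    unfolding C_add by (rule CI) (use that v(8) CD homD(2)[OF gam_hom] in auto)
  show "\<zero>\<^bsub>C p\<^esub> \<in> carrier (C p)"
    unfolding C_zero by (rule CI) (use v(4) hom_zero[OF V_vs V_vs gam_hom] in auto)
  show sc: "q \<odot>\<^bsub>C p\<^esub> f \<in> carrier (C p)" if "f \<in> carrier (C p)" for q f
    unfolding C_scl by (rule CI) (use that v(3) CD homD(3)[OF gam_hom] in auto)
  interpret A: abelian_group V by (rule v(7))
  show "\<exists>f'\<in>carrier (C p). f' \<oplus>\<^bsub>C p\<^esub> f = \<zero>\<^bsub>C p\<^esub>" if f: "f \<in> carrier (C p)" for f
  proof (rule bexI[OF _ sc[OF f, of "-1"]])
    show "(-1) \<odot>\<^bsub>C p\<^esub> f \<oplus>\<^bsub>C p\<^esub> f = \<zero>\<^bsub>C p\<^esub>"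
    proof (rule C_eqI[of _ p])
      fix t assume t: "t \<in> tup p"
      show "((-1) \<odot>\<^bsub>C p\<^esub> f \<oplus>\<^bsub>C p\<^esub> f) t = \<zero>\<^bsub>C p\<^esub> t"
        using t v(6)[OF CD(1)[OF f t]] abelian_group.l_neg[OF v(7) CD(1)[OF f t]]
        by (simp only: C_add C_scl C_zero restrict_apply')
    qed (simp_all add: C_add C_zero)
  qed
  show "\<zero>\<^bsub>C p\<^esub> \<oplus>\<^bsub>C p\<^esub> f = f" "1 \<odot>\<^bsub>C p\<^esub> f = f" if "f \<in> carrier (C p)" for f
    by (rule C_eqI[of _ p]; use that C_ext CD(1) v(2,4) in \<open>simp add: C_add C_zero C_scl\<close>)+
qed (use CD(1) vs_facts(3,8-11)[OF V_vs] vs_group_facts(5)[OF V_vs]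
     abelian_monoid.a_comm[OF abelian_group.axioms(1)[OF vs_facts(7)[OF V_vs]]]
     in \<open>auto simp: C_add C_scl intro!: restrict_ext\<close>)

lemma omit_tup: "t \<in> tup (Suc p) \<Longrightarrow> i \<le> Suc p \<Longrightarrow> omit i t \<in> tup p"
  using set_omit[of i t] by (auto simp: tuples_def length_omit)

lemma cobd_eq:
  assumes f: "f \<in> tup p \<rightarrow> carrier V" and t: "t \<in> tup (Suc p)"
  shows "cobd p f t = (\<Oplus>\<^bsub>V\<^esub>i\<in>{..Suc p}. (-1) ^ i \<odot>\<^bsub>V\<^esub> f (omit i t))"
proof -
  have fo: "f (omit i t) \<in> carrier V" if i1: "i \<le> Suc p" for i using f omit_tup[OF t i1] by blast
  have "(let v = f (take i t @ drop (Suc i) t) in if even i then v else \<ominus>\<^bsub>V\<^esub> v) = (-1) ^ i \<odot>\<^bsub>V\<^esub> f (omit i t)"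
    if i2: "i \<le> Suc p" for i
    using vs_facts(2,6)[OF V_vs fo[OF i2]] by (simp add: omit_def Let_def)
  then have "(\<Oplus>\<^bsub>V\<^esub>i\<in>{..Suc p}. let v = f (take i t @ drop (Suc i) t) in if even i then v else \<ominus>\<^bsub>V\<^esub> v)
      = (\<Oplus>\<^bsub>V\<^esub>i\<in>{..Suc p}. (-1) ^ i \<odot>\<^bsub>V\<^esub> f (omit i t))"
    by (intro abelian_monoid.finsum_cong'[OF abelian_group.axioms(1)[OF vs_facts(7)[OF V_vs]] refl])
       (use fo vs_facts(3)[OF V_vs] in auto)
  then show ?thesis unfolding coboundary_def using t by (simp only: restrict_apply')
qed

text \<open>The coboundary is the transpose of \<open>bd\<close>. In coordinates the sums of the
  module record become sums of functions, so identities between chains can be evaluated on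
  cochains.\<close>

lemma crd_cobd:
  assumes f: "f \<in> tup p \<rightarrow> carrier V" and t: "t \<in> tup (Suc p)"
  shows "crd (cobd p f t) = ext (\<lambda>s. crd (f s)) (bd t)"
proof -
  have fo: "f (omit i t) \<in> carrier V" if i1: "i \<le> Suc p" for i using f omit_tup[OF t i1] by blast
  have l: "{..<length t} = {..Suc p}" using t by (auto simp: tuples_def)
  have "crd (cobd p f t) = (\<Sum>i\<le>Suc p. crd ((-1) ^ i \<odot>\<^bsub>V\<^esub> f (omit i t)))"
    unfolding cobd_eq[OF f t] by (rule crd_finsum) (use fo vs_facts(3)[OF V_vs] in auto)
  also have "\<dots> = (\<Sum>i\<le>Suc p. (-1) ^ i *q crd (f (omit i t)))"
    by (rule sum.cong[OF refl]) (use crd_scl[OF fo] in simp)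
  finally show ?thesis unfolding ext_bd l .
qed

lemma cobd_value:
  assumes f: "f \<in> tup p \<rightarrow> carrier V" and t: "t \<in> tup (Suc p)"
  shows "cobd p f t \<in> carrier V"
  unfolding cobd_eq[OF f t]
  by (intro abelian_monoid.finsum_closed[OF abelian_group.axioms(1)[OF vs_facts(7)[OF V_vs]]])
     (use funcset_mem[OF f omit_tup[OF t]] vs_facts(3)[OF V_vs] in auto)

lemma cobd_ext: "cobd p f \<in> extensional (tup (Suc p))"
  by (simp add: coboundary_def)

lemma cobd_natural:
  assumes W: "vectorspace rat_field W" and e: "\<eta> \<in> hom V W" and f: "f \<in> tup p \<rightarrow> carrier V"
    and g: "\<And>s. s \<in> tup p \<Longrightarrow> g s = \<eta> (f s)" and t: "t \<in> tup (Suc p)"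
  shows "coboundary G W p g t = \<eta> (cobd p f t)"
proof -
  interpret W: abelian_group W by (rule vs_facts(7)[OF W])
  have fo: "f (omit i t) \<in> carrier V" if i1: "i \<le> Suc p" for i using f omit_tup[OF t i1] by blast
  have "\<eta> (cobd p f t) = (\<Oplus>\<^bsub>W\<^esub>i\<in>{..Suc p}. \<eta> ((-1) ^ i \<odot>\<^bsub>V\<^esub> f (omit i t)))"
    unfolding cobd_eq[OF f t] by (rule hom_finsum[OF V_vs W e]) (use fo vs_facts(3)[OF V_vs] in auto)
  also have "\<dots> = (\<Oplus>\<^bsub>W\<^esub>i\<in>{..Suc p}. let v = g (take i t @ drop (Suc i) t) in if even i then v else \<ominus>\<^bsub>W\<^esub> v)"
  proof (rule W.finsum_cong'[OF refl])
    fix i assume "i \<in> {..Suc p}"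
    then have i: "i \<le> Suc p" by simp
    have gw: "g (omit i t) = \<eta> (f (omit i t))" "\<eta> (f (omit i t)) \<in> carrier W"
      using g[OF omit_tup[OF t i]] homD(1)[OF e fo[OF i]] by auto
    show "\<eta> ((-1) ^ i \<odot>\<^bsub>V\<^esub> f (omit i t)) = (let v = g (take i t @ drop (Suc i) t) in if even i then v else \<ominus>\<^bsub>W\<^esub> v)"
      unfolding omit_def[symmetric] homD(3)[OF e fo[OF i]]
      using vs_facts(2,6)[OF W gw(2)] by (simp add: Let_def gw(1))
  next
    show "(\<lambda>i. let v = g (take i t @ drop (Suc i) t) in if even i then v else \<ominus>\<^bsub>W\<^esub> v) \<in> {..Suc p} \<rightarrow> carrier W"
    proof
      fix i assume "i \<in> {..Suc p}"
      then have i: "i \<le> Suc p" by simp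
      have "g (omit i t) \<in> carrier W" using g[OF omit_tup[OF t i]] homD(1)[OF e fo[OF i]] by simp
      then show "(let v = g (take i t @ drop (Suc i) t) in if even i then v else \<ominus>\<^bsub>W\<^esub> v) \<in> carrier W"
        by (simp add: Let_def omit_def)
    qed
  qed
  finally show ?thesis unfolding coboundary_def using t by (simp only: restrict_apply')
qed

lemma cobd_hom: "cobd p \<in> hom (C p) (C (Suc p))"
proof (rule homI)
  note v = vs_facts[OF V_vs]
  show "cobd p f \<in> carrier (C (Suc p))" if f: "f \<in> carrier (C p)" for f
  proof -
    have "cobd p f (tr_left g t) = \<gamma> g (cobd p f t)" if g: "g \<in> carrier G" and t: "t \<in> tup (Suc p)" for g t
    proof -
      have "cobd p f (tr_left g t) = cobd p (\<lambda>s. f (tr_left g s)) t"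
        unfolding cobd_eq[OF CF[OF f] tr_tup[OF g t]]
        by (subst cobd_eq[OF _ t]) (use CD(1)[OF f] tr_tup[OF g] in \<open>auto simp: tr_left_def omit_map simp del: finsum_Suc\<close>)
      also have "\<dots> = \<gamma> g (cobd p f t)"
        by (rule cobd_natural[OF V_vs gam_hom[OF g] CF[OF f] _ t]) (rule CD(2)[OF f g])
      finally show ?thesis .
    qed
    then show ?thesis
      using cobd_value[OF CF[OF f]] cobd_ext by (auto simp: C_carrier PiE_def)
  qed
  show "cobd p (f \<oplus>\<^bsub>C p\<^esub> f') = cobd p f \<oplus>\<^bsub>C (Suc p)\<^esub> cobd p f'" if f: "f \<in> carrier (C p)" and f': "f' \<in> carrier (C p)" for f f'
  proof (rule C_eqI[OF cobd_ext])
    fix t assume t: "t \<in> tup (Suc p)"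
    have cl: "(f \<oplus>\<^bsub>C p\<^esub> f') \<in> tup p \<rightarrow> carrier V" using CD(1)[OF f] CD(1)[OF f'] v(8) by (simp add: C_add)
    have "crd (cobd p (f \<oplus>\<^bsub>C p\<^esub> f') t) = crd (cobd p f t \<oplus>\<^bsub>V\<^esub> cobd p f' t)"
      unfolding crd_cobd[OF cl t] crd_add[OF cobd_value[OF CF[OF f] t] cobd_value[OF CF[OF f'] t]]
        crd_cobd[OF CF[OF f] t] crd_cobd[OF CF[OF f'] t] ext_bd sum.distrib[symmetric]
    proof (rule sum.cong[OF refl])
      fix i assume "i \<in> {..<length t}"
      then have i: "omit i t \<in> tup p" using t omit_tup[OF t, of i] by (simp add: tuples_def)
      show "(-1) ^ i *q crd ((f \<oplus>\<^bsub>C p\<^esub> f') (omit i t)) = (-1) ^ i *q crd (f (omit i t)) + (-1) ^ i *q crd (f' (omit i t))"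
        using i by (simp only: C_add restrict_apply' crd_add[OF CD(1)[OF f i] CD(1)[OF f' i]] fv.scale_right_distrib)
    qed
    then show "cobd p (f \<oplus>\<^bsub>C p\<^esub> f') t = (cobd p f \<oplus>\<^bsub>C (Suc p)\<^esub> cobd p f') t"
      using crd_inj[OF cobd_value[OF cl t] v(8)[OF cobd_value[OF CF[OF f] t] cobd_value[OF CF[OF f'] t]]] t
      by (simp add: C_add)
  qed (simp add: C_add)
  show "cobd p (q \<odot>\<^bsub>C p\<^esub> f) = q \<odot>\<^bsub>C (Suc p)\<^esub> cobd p f" if f: "f \<in> carrier (C p)" for q f
  proof (rule C_eqI[OF cobd_ext])
    fix t assume t: "t \<in> tup (Suc p)"
    have h: "(\<lambda>v. q \<odot>\<^bsub>V\<^esub> v) \<in> hom V V"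
      by (rule homI) (use v(3,9) v(11) in \<open>auto simp flip: v(11) simp: mult.commute\<close>)
    have "cobd p (q \<odot>\<^bsub>C p\<^esub> f) t = q \<odot>\<^bsub>V\<^esub> cobd p f t"
      by (rule cobd_natural[OF V_vs h CF[OF f] _ t]) (simp_all add: C_scl)
    then show "cobd p (q \<odot>\<^bsub>C p\<^esub> f) t = (q \<odot>\<^bsub>C (Suc p)\<^esub> cobd p f) t" using t by (simp add: C_scl)
  qed (simp add: C_scl)
qed

text \<open>The transpose of \<open>bd_bd\<close>.\<close>

lemma cobd_cobd: assumes f: "f \<in> carrier (C p)" shows "cobd (Suc p) (cobd p f) = \<zero>\<^bsub>C (Suc (Suc p))\<^esub>"
proof (rule C_eqI[OF cobd_ext])
  note cv = cobd_value[OF CF[OF f]]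
  fix t assume t: "t \<in> tup (Suc (Suc p))"
  have cv': "cobd p f \<in> tup (Suc p) \<rightarrow> carrier V" using cv by blast
  have "crd (cobd (Suc p) (cobd p f) t) = ext (\<lambda>s. crd (cobd p f s)) (bd t)" by (rule crd_cobd[OF cv' t])
  also have "\<dots> = ext (\<lambda>s. ext (\<lambda>r. crd (f r)) (bd s)) (bd t)"
  proof (rule ext_cong)
    fix s assume "s \<in> Poly_Mapping.keys (bd t)"
    then obtain i where "i < length t" "s = omit i t" using bd_keys by blast
    then have "s \<in> tup (Suc p)" using omit_tup[OF t, of i] t by (simp add: tuples_def)
    then show "crd (cobd p f s) = ext (\<lambda>r. crd (f r)) (bd s)" by (rule crd_cobd[OF CF[OF f]])
  qed
  also have "\<dots> = 0" unfolding ext_frag_extend[symmetric] bd_bd by (rule ext_zero)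
  finally have "cobd (Suc p) (cobd p f) t = \<zero>\<^bsub>V\<^esub>"
    using crd_inj[OF cobd_value[OF cv' t] vs_facts(4)[OF V_vs]] crd_zero by simp
  then show "cobd (Suc p) (cobd p f) t = \<zero>\<^bsub>C (Suc (Suc p))\<^esub> t" using t by (simp add: C_zero)
qed (simp add: C_zero)

lemma Z_sub: "Z p \<subseteq> carrier (C p)" by (auto simp: cocycles_def)

lemma Z_closed: "\<zero>\<^bsub>C p\<^esub> \<in> Z p" "f \<in> Z p \<Longrightarrow> f' \<in> Z p \<Longrightarrow> f \<oplus>\<^bsub>C p\<^esub> f' \<in> Z p" "f \<in> Z p \<Longrightarrow> q \<odot>\<^bsub>C p\<^esub> f \<in> Z p"
  using hom_zero[OF C_vs C_vs cobd_hom] homD[OF cobd_hom] vs_facts(3,4,5,8)[OF C_vs] vs_group_facts(7)[OF C_vs]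
  by (auto simp: cocycles_def)

lemma B_sub: "B p \<subseteq> Z p"
proof (cases p)
  case 0 then show ?thesis using Z_closed(1) by simp
next
  case (Suc q)
  then show ?thesis using homD(1)[OF cobd_hom] cobd_cobd by (auto simp: cocycles_def)
qed

lemma B_closed: "\<zero>\<^bsub>C p\<^esub> \<in> B p" "f \<in> B p \<Longrightarrow> f' \<in> B p \<Longrightarrow> f \<oplus>\<^bsub>C p\<^esub> f' \<in> B p" "f \<in> B p \<Longrightarrow> q \<odot>\<^bsub>C p\<^esub> f \<in> B p"
proof -
  show "\<zero>\<^bsub>C p\<^esub> \<in> B p"
  proof (cases p)
    case (Suc q)
    show ?thesis unfolding Suc coboundaries.simps
      by (rule image_eqI[OF _ vs_facts(4)[OF C_vs]]) (rule hom_zero[OF C_vs C_vs cobd_hom, symmetric])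
  qed simp
  show "f \<oplus>\<^bsub>C p\<^esub> f' \<in> B p" if f: "f \<in> B p" and f': "f' \<in> B p"
  proof (cases p)
    case 0
    then show ?thesis using f f' vs_group_facts(7)[OF C_vs vs_facts(4)[OF C_vs]] by simp
  next
    case (Suc q)
    obtain h where h: "f = cobd q h" "h \<in> carrier (C q)" using f unfolding Suc coboundaries.simps by (rule imageE)
    obtain h' where h': "f' = cobd q h'" "h' \<in> carrier (C q)" using f' unfolding Suc coboundaries.simps by (rule imageE)
    show ?thesis unfolding Suc coboundaries.simps h(1) h'(1)
      by (rule image_eqI[OF _ vs_facts(8)[OF C_vs h(2) h'(2)]]) (rule homD(2)[OF cobd_hom h(2) h'(2), symmetric])
  qed
  show "q \<odot>\<^bsub>C p\<^esub> f \<in> B p" if f: "f \<in> B p"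
  proof (cases p)
    case 0
    then show ?thesis using f vs_facts(5)[OF C_vs] by simp
  next
    case (Suc r)
    obtain h where h: "f = cobd r h" "h \<in> carrier (C r)" using f unfolding Suc coboundaries.simps by (rule imageE)
    show ?thesis unfolding Suc coboundaries.simps h(1)
      by (rule image_eqI[OF _ vs_facts(3)[OF C_vs h(2)]]) (rule homD(3)[OF cobd_hom h(2), symmetric])
  qed
qed

lemma B_all: "\<forall>a\<in>B p. \<forall>b\<in>B p. a \<oplus>\<^bsub>C p\<^esub> b \<in> B p" "\<forall>q. \<forall>a\<in>B p. q \<odot>\<^bsub>C p\<^esub> a \<in> B p"
  using B_closed(2,3) by blast+

lemma B_sub': "B p \<subseteq> carrier (C p)" using B_sub Z_sub by blast

definition cls :: "nat \<Rightarrow> ('g list \<Rightarrow> 'v) \<Rightarrow> ('g list \<Rightarrow> 'v) set" where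
  "cls p f = B p +>\<^bsub>C p\<^esub> f"

lemmas cls_facts = coset_facts[OF C_vs B_sub' B_closed(1) B_all, folded cls_def]

lemma H_carrier: "carrier (H p) = cls p ` Z p"
  and H_zero: "\<zero>\<^bsub>H p\<^esub> = B p"
  by (simp_all add: cohomology_def Let_def cls_def)

lemma cls_add: "f \<in> carrier (C p) \<Longrightarrow> f' \<in> carrier (C p) \<Longrightarrow> cls p (f \<oplus>\<^bsub>C p\<^esub> f') = cls p f \<oplus>\<^bsub>H p\<^esub> cls p f'"
  using cls_facts(2) by (simp add: cohomology_def Let_def)

lemma cls_zero: "cls p \<zero>\<^bsub>C p\<^esub> = \<zero>\<^bsub>H p\<^esub>"
  using cls_facts(3)[OF vs_facts(4)[OF C_vs] vs_facts(4)[OF C_vs]] by (simp add: H_zero)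

lemma C_scl_hom: "(\<lambda>f. q \<odot>\<^bsub>C p\<^esub> f) \<in> hom (C p) (C p)"
  by (rule homI) (use vs_facts(3,9,11)[OF C_vs] in \<open>auto simp flip: vs_facts(11)[OF C_vs] simp: mult.commute\<close>)

lemma cls_scl: "f \<in> carrier (C p) \<Longrightarrow> cls p (q \<odot>\<^bsub>C p\<^esub> f) = q \<odot>\<^bsub>H p\<^esub> cls p f"
proof -
  assume f: "f \<in> carrier (C p)"
  have "(\<Union>h\<in>B p +>\<^bsub>C p\<^esub> f. B p +>\<^bsub>C p\<^esub> (q \<odot>\<^bsub>C p\<^esub> h)) = B p +>\<^bsub>C p\<^esub> (q \<odot>\<^bsub>C p\<^esub> f)"
    by (rule coset_map[OF C_vs B_sub' B_closed(1) C_vs B_sub' B_closed(1) B_all C_scl_hom _ f]) (use B_closed(3) in auto)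
  then show ?thesis by (simp add: cohomology_def Let_def cls_def)
qed

abbreviation Zr where "Zr p \<equiv> (C p)\<lparr>carrier := Z p\<rparr>"

lemma Z_vs: "vectorspace rat_field (Zr p)"
proof (rule vectorspace.subspace_is_vs[OF C_vs])
  show "subspace rat_field (Z p) (C p)"
    using C_vs Z_sub Z_closed by (auto simp: subspace_def submodule_def vectorspace_def)
qed

lemma cls_hom: "cls p \<in> hom (Zr p) (H p)"
  by (rule homI) (simp_all add: H_carrier cls_add cls_scl subsetD[OF Z_sub])

lemma H_vs: "vectorspace rat_field (H p)"
proof (rule vectorspace_image[OF Z_vs])
  show "carrier (H p) = cls p ` carrier (Zr p)" by (simp add: H_carrier)
  show "cls p \<zero>\<^bsub>Zr p\<^esub> = \<zero>\<^bsub>H p\<^esub>" using cls_zero by simp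
  show "cls p (f \<oplus>\<^bsub>Zr p\<^esub> g) = cls p f \<oplus>\<^bsub>H p\<^esub> cls p g" if "f \<in> carrier (Zr p)" "g \<in> carrier (Zr p)" for f g
    using that cls_add[of f p g] Z_sub[of p] by (simp add: subset_iff)
  show "cls p (q \<odot>\<^bsub>Zr p\<^esub> f) = q \<odot>\<^bsub>H p\<^esub> cls p f" if "f \<in> carrier (Zr p)" for q f
    using that cls_scl[of f p q] Z_sub[of p] by (simp add: subset_iff)
qed

end

section \<open>Maps induced by equivariant coefficient maps\<close>

definition equivar :: "('g, 'm) monoid_scheme \<Rightarrow> (rat, 'v) module \<Rightarrow> ('g \<Rightarrow> 'v \<Rightarrow> 'v) \<Rightarrow>
    (rat, 'w) module \<Rightarrow> ('g \<Rightarrow> 'w \<Rightarrow> 'w) \<Rightarrow> ('v \<Rightarrow> 'w) \<Rightarrow> bool" where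
  "equivar G V \<gamma> W \<gamma>' \<eta> \<longleftrightarrow> \<eta> \<in> hom V W \<and> (\<forall>g\<in>carrier G. \<forall>v\<in>carrier V. \<eta> (\<gamma> g v) = \<gamma>' g (\<eta> v))"

definition push :: "('g, 'm) monoid_scheme \<Rightarrow> nat \<Rightarrow> ('v \<Rightarrow> 'w) \<Rightarrow> ('g list \<Rightarrow> 'v) \<Rightarrow> 'g list \<Rightarrow> 'w" where
  "push G p \<eta> f = (\<lambda>t\<in>tuples G p. \<eta> (f t))"

lemma push_facts:
  assumes V: "coh V crd vec d G \<gamma>" and W: "coh W crd' vec' d' G \<gamma>'" and e: "equivar G V \<gamma> W \<gamma>' \<eta>"
  shows "push G p \<eta> \<in> hom (cochains G V \<gamma> p) (cochains G W \<gamma>' p)"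
    and "f \<in> cocycles G V \<gamma> p \<Longrightarrow> push G p \<eta> f \<in> cocycles G W \<gamma>' p"
    and "f \<in> coboundaries G V \<gamma> p \<Longrightarrow> push G p \<eta> f \<in> coboundaries G W \<gamma>' p"
    and "f \<in> cocycles G V \<gamma> p \<Longrightarrow>
      cohomology_map G W \<gamma>' p \<eta> (coh.cls V G \<gamma> p f) = coh.cls W G \<gamma>' p (push G p \<eta> f)"
proof -
  interpret V: coh V crd vec d G \<gamma> by (rule V)
  interpret W: coh W crd' vec' d' G \<gamma>' by (rule W)
  have eh: "\<eta> \<in> hom V W" and eq: "\<And>g v. g \<in> carrier G \<Longrightarrow> v \<in> carrier V \<Longrightarrow> \<eta> (\<gamma> g v) = \<gamma>' g (\<eta> v)"
    using e by (auto simp: equivar_def)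
  show ph: "push G p \<eta> \<in> hom (V.C p) (W.C p)" for p
  proof (rule homI)
    show "push G p \<eta> f \<in> carrier (W.C p)" if f: "f \<in> carrier (V.C p)" for f
      unfolding push_def by (rule W.CI) (simp_all only: homD(1)[OF eh] V.CD[OF f] eq)
    show "push G p \<eta> (f \<oplus>\<^bsub>V.C p\<^esub> f') = push G p \<eta> f \<oplus>\<^bsub>W.C p\<^esub> push G p \<eta> f'"
      if f: "f \<in> carrier (V.C p)" and f': "f' \<in> carrier (V.C p)" for f f'
      unfolding push_def V.C_add W.C_add
      by (rule restrict_ext) (simp only: restrict_apply' homD(2)[OF eh V.CD(1)[OF f] V.CD(1)[OF f']])
    show "push G p \<eta> (q \<odot>\<^bsub>V.C p\<^esub> f) = q \<odot>\<^bsub>W.C p\<^esub> push G p \<eta> f" if f: "f \<in> carrier (V.C p)" for q f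
      unfolding push_def V.C_scl W.C_scl
      by (rule restrict_ext) (simp only: restrict_apply' homD(3)[OF eh V.CD(1)[OF f]])
  qed
  have nat: "push G (Suc p) \<eta> (V.cobd p f) = W.cobd p (push G p \<eta> f)" if f: "f \<in> carrier (V.C p)" for p f
  proof (rule W.C_eqI[OF _ W.cobd_ext])
    fix t assume t: "t \<in> tuples G (Suc p)"
    have "W.cobd p (push G p \<eta> f) t = \<eta> (V.cobd p f t)"
      by (rule V.cobd_natural[OF W.V_vs eh V.CF[OF f] _ t]) (simp_all add: push_def)
    then show "push G (Suc p) \<eta> (V.cobd p f) t = W.cobd p (push G p \<eta> f) t" using t by (simp add: push_def)
  qed (simp add: push_def)
  have pz: "push G p \<eta> \<zero>\<^bsub>V.C p\<^esub> = \<zero>\<^bsub>W.C p\<^esub>" for p by (rule hom_zero[OF V.C_vs W.C_vs ph])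
  show "push G p \<eta> f \<in> W.Z p" if f: "f \<in> V.Z p" for f
    using f nat[of f p] pz[of "Suc p"] homD(1)[OF ph, of f p] by (auto simp: cocycles_def)
  show pB: "push G p \<eta> f \<in> W.B p" if f: "f \<in> V.B p" for f
  proof (cases p)
    case 0
    then show ?thesis using f pz[of 0] by simp
  next
    case (Suc q)
    obtain h where h: "f = V.cobd q h" "h \<in> carrier (V.C q)" using f unfolding Suc coboundaries.simps by (rule imageE)
    show ?thesis unfolding Suc coboundaries.simps h(1)
      by (rule image_eqI[where x = "push G q \<eta> h"]) (rule nat[OF h(2)], rule homD(1)[OF ph h(2)])
  qed
  show "cohomology_map G W \<gamma>' p \<eta> (V.cls p f) = W.cls p (push G p \<eta> f)" if f: "f \<in> V.Z p" for f
    unfolding cohomology_map_def V.cls_def W.cls_def push_def[symmetric]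
    by (rule coset_map[OF V.C_vs V.B_sub' V.B_closed(1) W.C_vs W.B_sub' W.B_closed(1) W.B_all ph])
       (use pB f V.Z_sub in auto)
qed

lemma cohomology_map_hom:
  assumes V: "coh V crd vec d G \<gamma>" and W: "coh W crd' vec' d' G \<gamma>'" and e: "equivar G V \<gamma> W \<gamma>' \<eta>"
  shows "cohomology_map G W \<gamma>' p \<eta> \<in> hom (cohomology G V \<gamma> p) (cohomology G W \<gamma>' p)"
proof -
  interpret V: coh V crd vec d G \<gamma> by (rule V)
  interpret W: coh W crd' vec' d' G \<gamma>' by (rule W)
  note pf = push_facts[OF V W e]
  show ?thesis
  proof (rule homI)
    fix x assume "x \<in> carrier (V.H p)"
    then obtain f where f: "f \<in> V.Z p" "x = V.cls p f" unfolding V.H_carrier by blast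
    have fC: "f \<in> carrier (V.C p)" using f V.Z_sub by blast
    show "cohomology_map G W \<gamma>' p \<eta> x \<in> carrier (W.H p)"
      unfolding f(2) pf(4)[OF f(1)] W.H_carrier by (rule imageI[OF pf(2)[OF f(1)]])
    show "cohomology_map G W \<gamma>' p \<eta> (q \<odot>\<^bsub>V.H p\<^esub> x) = q \<odot>\<^bsub>W.H p\<^esub> cohomology_map G W \<gamma>' p \<eta> x" for q
      unfolding f(2) V.cls_scl[OF fC, symmetric] pf(4)[OF f(1)] pf(4)[OF V.Z_closed(3)[OF f(1)]] homD(3)[OF pf(1) fC]
      by (rule W.cls_scl[OF homD(1)[OF pf(1) fC]])
    fix y assume "y \<in> carrier (V.H p)"
    then obtain f' where f': "f' \<in> V.Z p" "y = V.cls p f'" unfolding V.H_carrier by blast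
    have fC': "f' \<in> carrier (V.C p)" using f' V.Z_sub by blast
    show "cohomology_map G W \<gamma>' p \<eta> (x \<oplus>\<^bsub>V.H p\<^esub> y) = cohomology_map G W \<gamma>' p \<eta> x \<oplus>\<^bsub>W.H p\<^esub> cohomology_map G W \<gamma>' p \<eta> y"
      unfolding f(2) f'(2) V.cls_add[OF fC fC', symmetric] pf(4)[OF f(1)] pf(4)[OF f'(1)] pf(4)[OF V.Z_closed(2)[OF f(1) f'(1)]]
        homD(2)[OF pf(1) fC fC']
      by (rule W.cls_add[OF homD(1)[OF pf(1) fC] homD(1)[OF pf(1) fC']])
  qed
qed

lemma equivarD:
  assumes "equivar G V \<gamma> W \<gamma>' \<eta>"
  shows "\<eta> \<in> hom V W" "g \<in> carrier G \<Longrightarrow> v \<in> carrier V \<Longrightarrow> \<eta> (\<gamma> g v) = \<gamma>' g (\<eta> v)"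
  using assms by (auto simp: equivar_def)

lemma equivar_comp:
  assumes a: "equivar G U \<gamma> V \<gamma>' \<eta>" and b: "equivar G V \<gamma>' W \<gamma>'' \<zeta>"
  shows "equivar G U \<gamma> W \<gamma>'' (\<lambda>v. \<zeta> (\<eta> v))"
  unfolding equivar_def
proof (intro conjI ballI homI)
  note h = homD[OF equivarD(1)[OF a]] homD[OF equivarD(1)[OF b]]
  show "\<zeta> (\<eta> v) \<in> carrier W" if v: "v \<in> carrier U" for v by (rule h(4)[OF h(1)[OF v]])
  show "\<zeta> (\<eta> (v \<oplus>\<^bsub>U\<^esub> w)) = \<zeta> (\<eta> v) \<oplus>\<^bsub>W\<^esub> \<zeta> (\<eta> w)" if v: "v \<in> carrier U" and w: "w \<in> carrier U" for v w
    by (simp only: h(2)[OF v w] h(5)[OF h(1)[OF v] h(1)[OF w]])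
  show "\<zeta> (\<eta> (c \<odot>\<^bsub>U\<^esub> v)) = c \<odot>\<^bsub>W\<^esub> \<zeta> (\<eta> v)" if v: "v \<in> carrier U" for c v
    by (simp only: h(3)[OF v] h(6)[OF h(1)[OF v]])
  show "\<zeta> (\<eta> (\<gamma> g v)) = \<gamma>'' g (\<zeta> (\<eta> v))" if g: "g \<in> carrier G" and v: "v \<in> carrier U" for g v
    by (simp only: equivarD(2)[OF a g v] equivarD(2)[OF b g h(1)[OF v]])
qed

lemma push_comp: "push G p \<zeta> (push G p \<eta> f) = push G p (\<lambda>v. \<zeta> (\<eta> v)) f"
  unfolding push_def by (rule restrict_ext) simp

lemma push_cong: "(\<And>t. t \<in> tuples G p \<Longrightarrow> \<eta> (f t) = \<eta>' (f t)) \<Longrightarrow> push G p \<eta> f = push G p \<eta>' f"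
  unfolding push_def by (rule restrict_ext)

lemma (in coh) push_id:
  assumes f: "f \<in> carrier (C p)" and e: "\<And>t. t \<in> tup p \<Longrightarrow> \<eta> (f t) = f t"
  shows "push G p \<eta> f = f"
  by (rule C_eqI[OF _ C_ext[OF f]]) (simp_all add: push_def e)

lemma (in coh) scale_equivar: "equivar G V \<gamma> V \<gamma> (\<lambda>v. q \<odot>\<^bsub>V\<^esub> v)"
  unfolding equivar_def
proof (intro conjI ballI homI)
  note v = vs_facts[OF V_vs]
  show "q \<odot>\<^bsub>V\<^esub> (c \<odot>\<^bsub>V\<^esub> x) = c \<odot>\<^bsub>V\<^esub> (q \<odot>\<^bsub>V\<^esub> x)" if x: "x \<in> carrier V" for c x
    by (simp only: v(11)[OF x, symmetric] mult.commute)
  show "q \<odot>\<^bsub>V\<^esub> \<gamma> g x = \<gamma> g (q \<odot>\<^bsub>V\<^esub> x)" if g: "g \<in> carrier G" and x: "x \<in> carrier V" for g x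
    by (rule homD(3)[OF gam_hom[OF g] x, symmetric])
qed (simp_all add: vs_facts[OF V_vs])

text \<open>The inverse of \<open>S\<close> is given on \<open>E'\<close> only. It is extended to
  \<open>W\<close> by composing with \<open>\<alpha>'\<close>, a \<open>G\<close>-map into
  \<open>E'\<close> that fixes \<open>E'\<close>. Linearity and equivariance hold because both sides
  lie in the image of \<open>\<alpha>\<close> and agree under \<open>S\<close>, which is injective
  there.\<close>

lemma equivar_inverse:
  assumes V: "vectorspace rat_field V" and W: "vectorspace rat_field W"
    and rg: "rat_rep G V \<gamma>" and rg': "rat_rep G W \<gamma>'"
    and a: "equivar G V \<gamma> V \<gamma> \<alpha>" and a': "equivar G W \<gamma>' W \<gamma>' \<alpha>'" and S: "equivar G V \<gamma> W \<gamma>' S"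
    and bij: "bij_betw S (\<alpha> ` carrier V) E'" and im: "\<And>w. w \<in> carrier W \<Longrightarrow> \<alpha>' w \<in> E'"
    and pr: "\<And>w. w \<in> E' \<Longrightarrow> w \<in> carrier W \<and> \<alpha>' w = w"
  shows "\<exists>Q. equivar G W \<gamma>' V \<gamma> Q \<and> (\<forall>v\<in>\<alpha> ` carrier V. Q (S v) = v) \<and> (\<forall>w\<in>E'. S (Q w) = w \<and> Q w \<in> \<alpha> ` carrier V)"
proof -
  let ?E = "\<alpha> ` carrier V"
  define R where "R = the_inv_into ?E S"
  have inj: "inj_on S ?E" and sur: "S ` ?E = E'" using bij by (auto simp: bij_betw_def)
  have RS: "R (S v) = v" if v: "v \<in> ?E" for v unfolding R_def by (rule the_inv_into_f_f[OF inj v])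
  have SR: "S (R w) = w" if w: "w \<in> E'" for w unfolding R_def by (rule f_the_inv_into_f[OF inj]) (simp only: sur w)
  have RE: "R w \<in> ?E" if w: "w \<in> E'" for w unfolding R_def by (rule the_inv_into_into[OF inj _ order_refl]) (simp only: sur w)
  have EV: "v \<in> carrier V" if v: "v \<in> ?E" for v using v homD(1)[OF equivarD(1)[OF a]] by blast
  have u: "R w = v" if w: "S v = w" and v: "v \<in> ?E" for v w using RS[OF v] w by simp
  note hS = homD[OF equivarD(1)[OF S]] and ha = homD[OF equivarD(1)[OF a]] and ha' = homD[OF equivarD(1)[OF a']]
  have Ea: "v \<oplus>\<^bsub>V\<^esub> w \<in> ?E" if v: "v \<in> ?E" and w: "w \<in> ?E" for v w
  proof -
    obtain x where x: "v = \<alpha> x" "x \<in> carrier V" using v by (rule imageE)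
    obtain y where y: "w = \<alpha> y" "y \<in> carrier V" using w by (rule imageE)
    show ?thesis unfolding x(1) y(1) ha(2)[OF x(2) y(2), symmetric] by (rule imageI[OF vs_facts(8)[OF V x(2) y(2)]])
  qed
  have Es: "q \<odot>\<^bsub>V\<^esub> v \<in> ?E" if v: "v \<in> ?E" for q v
  proof -
    obtain x where x: "v = \<alpha> x" "x \<in> carrier V" using v by (rule imageE)
    show ?thesis unfolding x(1) ha(3)[OF x(2), symmetric] by (rule imageI[OF vs_facts(3)[OF V x(2)]])
  qed
  have Eg: "\<gamma> g v \<in> ?E" if g: "g \<in> carrier G" and v: "v \<in> ?E" for g v
  proof -
    obtain x where x: "v = \<alpha> x" "x \<in> carrier V" using v by (rule imageE)
    show ?thesis unfolding x(1) equivarD(2)[OF a g x(2), symmetric] by (rule imageI[OF rat_repD(3)[OF rg g x(2)]])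
  qed
  define Q where "Q w = R (\<alpha>' w)" for w
  have Qim: "Q w \<in> ?E" if w: "w \<in> carrier W" for w unfolding Q_def by (rule RE[OF im[OF w]])
  have SQ: "S (Q w) = \<alpha>' w" if w: "w \<in> carrier W" for w unfolding Q_def by (rule SR[OF im[OF w]])
  have "equivar G W \<gamma>' V \<gamma> Q"
    unfolding equivar_def
  proof (intro conjI ballI homI)
    show "Q w \<in> carrier V" if w: "w \<in> carrier W" for w by (rule EV[OF Qim[OF w]])
    show "Q (w \<oplus>\<^bsub>W\<^esub> x) = Q w \<oplus>\<^bsub>V\<^esub> Q x" if w: "w \<in> carrier W" and x: "x \<in> carrier W" for w x
      unfolding Q_def[of "w \<oplus>\<^bsub>W\<^esub> x"]
      by (rule u[OF _ Ea[OF Qim[OF w] Qim[OF x]]]) (simp only: hS(2)[OF EV[OF Qim[OF w]] EV[OF Qim[OF x]]] SQ[OF w] SQ[OF x] ha'(2)[OF w x])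
    show "Q (q \<odot>\<^bsub>W\<^esub> w) = q \<odot>\<^bsub>V\<^esub> Q w" if w: "w \<in> carrier W" for w q
      unfolding Q_def[of "q \<odot>\<^bsub>W\<^esub> w"]
      by (rule u[OF _ Es[OF Qim[OF w]]]) (simp only: hS(3)[OF EV[OF Qim[OF w]]] SQ[OF w] ha'(3)[OF w])
    show "Q (\<gamma>' g w) = \<gamma> g (Q w)" if g: "g \<in> carrier G" and w: "w \<in> carrier W" for g w
      unfolding Q_def[of "\<gamma>' g w"]
      by (rule u[OF _ Eg[OF g Qim[OF w]]]) (simp only: equivarD(2)[OF S g EV[OF Qim[OF w]]] SQ[OF w] equivarD(2)[OF a' g w])
  qed
  moreover have "Q (S v) = v" if v: "v \<in> ?E" for v
  proof -
    have "S v \<in> E'" using v sur by blast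
    then show ?thesis unfolding Q_def using pr[of "S v"] RS[OF v] by simp
  qed
  moreover have "S (Q w) = w \<and> Q w \<in> ?E" if w: "w \<in> E'" for w
    using SQ[of w] Qim[of w] pr[OF w] by simp
  ultimately have "equivar G W \<gamma>' V \<gamma> Q \<and> (\<forall>v\<in>?E. Q (S v) = v) \<and> (\<forall>w\<in>E'. S (Q w) = w \<and> Q w \<in> ?E)" by blast
  then show ?thesis by (intro exI[where x = Q])
qed

locale coh_sequence = rep_sequence V \<rho> \<phi> for V :: "nat \<Rightarrow> (rat, 'v) module" and \<rho> \<phi> +
  fixes G :: "('g, 'm) monoid_scheme" and \<gamma> :: "nat \<Rightarrow> 'g \<Rightarrow> 'v \<Rightarrow> 'v" and p :: nat
  assumes grp: "group G" and comp: "compatible_action G V \<rho> \<phi> \<gamma>"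
begin

lemma gam: "n \<ge> 1 \<Longrightarrow> rat_rep G (V n) (\<gamma> n)"
  and gam_phi: "n \<ge> 1 \<Longrightarrow> g \<in> carrier G \<Longrightarrow> v \<in> carrier (V n) \<Longrightarrow> \<phi> n (\<gamma> n g v) = \<gamma> (Suc n) g (\<phi> n v)"
  and gam_rho: "n \<ge> 1 \<Longrightarrow> g \<in> carrier G \<Longrightarrow> s \<in> perms {1..n} \<Longrightarrow> v \<in> carrier (V n) \<Longrightarrow>
    \<gamma> n g (\<rho> n s v) = \<rho> n s (\<gamma> n g v)"
  using comp by (auto simp: compatible_action_def)

lemma coh: "n \<ge> 1 \<Longrightarrow> coh (V n) (crd n) (vec n) (dm n) G (\<gamma> n)"
  by (intro coh.intro coords coh_axioms.intro grp gam)

abbreviation HV where "HV n \<equiv> cohomology G (V n) (\<gamma> n) p"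
abbreviation hr where "hr n s \<equiv> cohomology_map G (V n) (\<gamma> n) p (\<rho> n s)"
abbreviation hp where "hp n \<equiv> cohomology_map G (V (Suc n)) (\<gamma> (Suc n)) p (\<phi> n)"
abbreviation Zn where "Zn n \<equiv> cocycles G (V n) (\<gamma> n) p"
abbreviation Cn where "Cn n \<equiv> cochains G (V n) (\<gamma> n) p"
abbreviation cl where "cl n \<equiv> coh.cls (V n) G (\<gamma> n) p"
abbreviation eqv where "eqv m n \<equiv> equivar G (V m) (\<gamma> m) (V n) (\<gamma> n)"

lemma eqv_rho: "n \<ge> 1 \<Longrightarrow> s \<in> perms {1..n} \<Longrightarrow> eqv n n (\<rho> n s)"
  using rat_repD(2)[OF rr, of n s] gam_rho[of n] by (simp add: equivar_def)

lemma eqv_phi: "n \<ge> 1 \<Longrightarrow> eqv n (Suc n) (\<phi> n)"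
  using phi_hom gam_phi by (simp add: equivar_def)

lemma eqv_ra: assumes n: "n \<ge> 1" shows "eqv n n (rep_act n (V n) (\<rho> n) a)"
proof -
  interpret A: sym_rep "V n" "crd n" "vec n" "dm n" n "\<rho> n" by (rule sym_rep[OF n])
  have "rep_act n (V n) (\<rho> n) a (\<gamma> n g v) = \<gamma> n g (rep_act n (V n) (\<rho> n) a v)"
    if g: "g \<in> carrier G" and v: "v \<in> carrier (V n)" for g v
    by (rule hom_rep_act[OF A.V_vs A.V_vs rat_repD(2)[OF gam[OF n] g], symmetric])
       (rule A.rho_closed[OF _ v], assumption, rule gam_rho[OF n g _ v])
  then show ?thesis unfolding equivar_def using A.act_right_hom by blast
qed

lemma eqv_Sh: "n \<ge> 1 \<Longrightarrow> eqv n (Suc n) (Sh \<mu> n)"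
  unfolding shift_def by (rule equivar_comp[OF eqv_phi eqv_ra]) simp_all

lemma cmap: "m \<ge> 1 \<Longrightarrow> n \<ge> 1 \<Longrightarrow> eqv m n \<eta> \<Longrightarrow> f \<in> Zn m \<Longrightarrow>
    cohomology_map G (V n) (\<gamma> n) p \<eta> (cl m f) = cl n (push G p \<eta> f)"
  by (rule push_facts(4)[OF coh coh])

lemma push_Z: "m \<ge> 1 \<Longrightarrow> n \<ge> 1 \<Longrightarrow> eqv m n \<eta> \<Longrightarrow> f \<in> Zn m \<Longrightarrow> push G p \<eta> f \<in> Zn n"
  by (rule push_facts(2)[OF coh coh])

lemma Zn_C: "n \<ge> 1 \<Longrightarrow> f \<in> Zn n \<Longrightarrow> f \<in> carrier (Cn n)"
  by (simp add: cocycles_def)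

lemma Zn_value: "n \<ge> 1 \<Longrightarrow> f \<in> Zn n \<Longrightarrow> t \<in> tuples G p \<Longrightarrow> f t \<in> carrier (V n)"
  by (rule coh.CD(1)[OF coh Zn_C])

lemma HV_carrier: "n \<ge> 1 \<Longrightarrow> carrier (HV n) = cl n ` Zn n"
  by (rule coh.H_carrier[OF coh])

lemma HV_consistent: "consistent_sequence HV hr hp"
  unfolding consistent_sequence_def
proof (intro allI impI conjI ballI)
  fix n :: nat assume n: "n \<ge> 1"
  have n': "Suc n \<ge> 1" by simp
  note r = rat_repD[OF rr[OF n]]
  show "hp n \<in> hom (HV n) (HV (Suc n))" by (rule cohomology_map_hom[OF coh[OF n] coh[OF n'] eqv_phi[OF n]])
  show "rat_rep (sym_group n) (HV n) (hr n)"
    unfolding rat_rep_def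
  proof (intro conjI ballI)
    show "group (sym_group n)" using rr[OF n] by (simp add: rat_rep_def)
    show "vectorspace rat_field (HV n)" by (rule coh.H_vs[OF coh[OF n]])
    show "hr n s \<in> hom (HV n) (HV n)" if s: "s \<in> carrier (sym_group n)" for s
      by (rule cohomology_map_hom[OF coh[OF n] coh[OF n] eqv_rho[OF n]]) (use s in simp)
    fix x assume "x \<in> carrier (HV n)"
    then obtain f where f: "x = cl n f" "f \<in> Zn n" unfolding HV_carrier[OF n] by (rule imageE)
    have id1: "id \<in> perms {1..n}" using r(4) group.is_monoid[of "sym_group n"] monoid.one_closed[of "sym_group n"] rr[OF n] by (simp add: rat_rep_def)
    have "push G p (\<rho> n id) f = f"
      by (rule coh.push_id[OF coh[OF n] Zn_C[OF n f(2)]]) (use r(4)[OF Zn_value[OF n f(2)]] in simp)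
    then show "hr n \<one>\<^bsub>sym_group n\<^esub> x = x"
      unfolding f(1) sym_group_simps cmap[OF n n eqv_rho[OF n id1] f(2)] by simp
    fix s s' assume s: "s \<in> carrier (sym_group n)" and s': "s' \<in> carrier (sym_group n)"
    then have s1: "s \<in> perms {1..n}" "s' \<in> perms {1..n}" and s2: "s \<circ> s' \<in> perms {1..n}"
      using monoid.m_closed[OF group.is_monoid[of "sym_group n"], of s s'] rr[OF n] by (auto simp: rat_rep_def)
    show "hr n (s \<otimes>\<^bsub>sym_group n\<^esub> s') x = hr n s (hr n s' x)"
      unfolding f(1) sym_group_simps cmap[OF n n eqv_rho[OF n s2] f(2)] cmap[OF n n eqv_rho[OF n s1(2)] f(2)]
        cmap[OF n n eqv_rho[OF n s1(1)] push_Z[OF n n eqv_rho[OF n s1(2)] f(2)]] push_comp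
      by (rule arg_cong[where f = "cl n"], rule push_cong) (use r(5)[OF s s' Zn_value[OF n f(2)]] in simp)
  qed
  fix s x assume s: "s \<in> carrier (sym_group n)" and "x \<in> carrier (HV n)"
  then obtain f where f: "x = cl n f" "f \<in> Zn n" unfolding HV_carrier[OF n] by blast
  have s1: "s \<in> perms {1..n}" using s by simp
  have s2: "s \<in> perms {1..Suc n}" by (rule perms_mono[OF _ s1]) simp
  show "hp n (hr n s x) = hr (Suc n) s (hp n x)"
    unfolding f(1) cmap[OF n n' eqv_phi[OF n] f(2)] cmap[OF n n eqv_rho[OF n s1] f(2)]
      cmap[OF n n' eqv_phi[OF n] push_Z[OF n n eqv_rho[OF n s1] f(2)]]
      cmap[OF n' n' eqv_rho[OF n' s2] push_Z[OF n n' eqv_phi[OF n] f(2)]] push_comp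
    by (rule arg_cong[where f = "cl (Suc n)"], rule push_cong) (rule phi_eq[OF n s1 Zn_value[OF n f(2)]])
qed

text \<open>The sum over the group is formed among cocycles and then passed through the linear map
  to classes.\<close>

lemma HV_rep_act:
  assumes n: "n \<ge> 1" and f: "f \<in> Zn n"
  shows "rep_act n (HV n) (hr n) a (cl n f) = cl n (push G p (rep_act n (V n) (\<rho> n) a) f)"
proof -
  interpret A: sym_rep "V n" "crd n" "vec n" "dm n" n "\<rho> n" by (rule sym_rep[OF n])
  interpret C: coh "V n" "crd n" "vec n" "dm n" G "\<gamma> n" by (rule coh[OF n])
  define x where "x s = a s \<odot>\<^bsub>C.C p\<^esub> push G p (\<rho> n s) f" for s
  have pZ: "push G p (\<rho> n s) f \<in> C.Z p" if s: "s \<in> A.P" for s by (rule push_Z[OF n n eqv_rho[OF n s] f])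
  have xZ: "x s \<in> C.Z p" if s: "s \<in> A.P" for s unfolding x_def by (rule C.Z_closed(3)[OF pZ[OF s]])
  have xP: "x \<in> A.P \<rightarrow> carrier (C.Zr p)" using xZ by simp
  have cx: "cl n (x s) = a s \<odot>\<^bsub>HV n\<^esub> hr n s (cl n f)" if s: "s \<in> A.P" for s
    unfolding x_def C.cls_scl[OF Zn_C[OF n pZ[OF s]]] cmap[OF n n eqv_rho[OF n s] f] by (rule refl)
  have sumZ: "finsum (C.Zr p) x A.P \<in> C.Z p"
    using abelian_monoid.finsum_closed[OF abelian_group.axioms(1)[OF vs_facts(7)[OF C.Z_vs]] xP] by simp
  \<comment> \<open>Evaluation at a tuple is linear, so the sum in the space of cocycles may be
    computed pointwise in \<open>V n\<close>.\<close>
  have ev: "(\<lambda>f. f t) \<in> hom (C.Zr p) (V n)" if t: "t \<in> tuples G p" for t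
    by (rule homI) (use t C.CD(1)[OF subsetD[OF C.Z_sub]] in \<open>simp_all add: C.C_add C.C_scl\<close>)
  have "finsum (C.Zr p) x A.P = push G p (A.ra a) f"
  proof (rule C.C_eqI[OF C.C_ext[OF subsetD[OF C.Z_sub sumZ]]])
    fix t assume t: "t \<in> tuples G p"
    have "finsum (C.Zr p) x A.P t = finsum (V n) (\<lambda>s. x s t) A.P"
      by (rule hom_finsum[OF C.Z_vs A.V_vs ev[OF t] xP])
    also have "\<dots> = A.ra a (f t)"
      unfolding rep_act_def
    proof (rule abelian_monoid.finsum_cong'[OF abelian_group.axioms(1)[OF vs_facts(7)[OF A.V_vs]] refl])
      show "(\<lambda>s. a s \<odot>\<^bsub>V n\<^esub> \<rho> n s (f t)) \<in> A.P \<rightarrow> carrier (V n)"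
        using vs_facts(3)[OF A.V_vs A.rho_closed[OF _ Zn_value[OF n f t]]] by blast
      show "x s t = a s \<odot>\<^bsub>V n\<^esub> \<rho> n s (f t)" for s
        unfolding x_def C.C_scl push_def using t by simp
    qed
    finally show "finsum (C.Zr p) x A.P t = push G p (A.ra a) f t" using t by (simp add: push_def)
  qed (simp add: push_def)
  moreover have "rep_act n (HV n) (hr n) a (cl n f) = cl n (finsum (C.Zr p) x A.P)"
    unfolding rep_act_def hom_finsum[OF C.Z_vs C.H_vs C.cls_hom xP]
  proof (rule abelian_monoid.finsum_cong'[OF abelian_group.axioms(1)[OF vs_facts(7)[OF C.H_vs]] refl])
    show "(\<lambda>s. cl n (x s)) \<in> A.P \<rightarrow> carrier (HV n)" using xZ unfolding C.H_carrier by blast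
    show "a s \<odot>\<^bsub>HV n\<^esub> hr n s (cl n f) = cl n (x s)" if "s \<in> A.P" for s by (rule cx[OF that, symmetric])
  qed
  ultimately show ?thesis by (simp only:)
qed

text \<open>Up to the scalar \<open>kap\<close> the symmetrizer is a \<open>G\<close>-equivariant
  idempotent on the coefficients, so taking its image commutes with cohomology. A class in the image
  is represented by a pushed cocycle, and a cocycle with values in the image is the push of itself
  divided by \<open>kap\<close>.\<close>

lemma HV_eigs:
  assumes n: "n \<ge> 1" and part: "is_partition \<mu>" and pad: "padding_exists \<mu> n"
  shows "x \<in> eigs \<mu> n (HV n) (hr n) \<longleftrightarrow> (\<exists>f\<in>Zn n. (\<forall>t\<in>tuples G p. f t \<in> Eg \<mu> n) \<and> x = cl n f)"
proof
  interpret A: stage "V n" "crd n" "vec n" "dm n" n "\<rho> n" \<mu> by (rule stage[OF n part pad])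
  interpret C: coh "V n" "crd n" "vec n" "dm n" G "\<gamma> n" by (rule coh[OF n])
  {
    assume "x \<in> eigs \<mu> n (HV n) (hr n)"
    then obtain y where y: "y \<in> carrier (HV n)" "x = rep_act n (HV n) (hr n) (cy \<mu> n) y" unfolding eigs_def by blast
    then obtain f where f: "y = cl n f" "f \<in> Zn n" unfolding HV_carrier[OF n] by blast
    let ?f = "push G p (A.ra A.c) f"
    have "?f \<in> Zn n" by (rule push_Z[OF n n eqv_ra[OF n] f(2)])
    moreover have "?f t \<in> Eg \<mu> n" if t: "t \<in> tuples G p" for t
      using t Zn_value[OF n f(2) t] by (simp add: push_def eigs_def)
    moreover have "x = cl n ?f" unfolding y(2) f(1) by (rule HV_rep_act[OF n f(2)])
    ultimately show "\<exists>f\<in>Zn n. (\<forall>t\<in>tuples G p. f t \<in> Eg \<mu> n) \<and> x = cl n f" by (intro bexI[of _ ?f]) simp_all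
  }
  assume "\<exists>f\<in>Zn n. (\<forall>t\<in>tuples G p. f t \<in> Eg \<mu> n) \<and> x = cl n f"
  then obtain f where f: "f \<in> Zn n" "\<And>t. t \<in> tuples G p \<Longrightarrow> f t \<in> Eg \<mu> n" "x = cl n f" by blast
  define h where "h = push G p (\<lambda>v. (1 / A.kap) \<odot>\<^bsub>V n\<^esub> v) f"
  have h: "h \<in> Zn n" unfolding h_def by (rule push_Z[OF n n C.scale_equivar f(1)])
  have "push G p (A.ra A.c) h = f"
    unfolding h_def push_comp
  proof (rule C.push_id[OF Zn_C[OF n f(1)]])
    fix t assume "t \<in> tuples G p"
    then have "f t \<in> A.eig" using f(2) unfolding A.eig_eq eigs_def by blast
    then show "A.ra A.c ((1 / A.kap) \<odot>\<^bsub>V n\<^esub> f t) = f t" by (rule A.eig_self)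
  qed
  then have "x = rep_act n (HV n) (hr n) (cy \<mu> n) (cl n h)" unfolding HV_rep_act[OF n h] f(3) by simp
  then show "x \<in> eigs \<mu> n (HV n) (hr n)" unfolding eigs_def HV_carrier[OF n] using h by blast
qed

lemma HV_shift:
  assumes n: "n \<ge> 1" and f: "f \<in> Zn n"
  shows "shift \<mu> n (HV (Suc n)) (hr (Suc n)) (hp n) (cl n f) = cl (Suc n) (push G p (Sh \<mu> n) f)"
proof -
  have n': "Suc n \<ge> 1" by simp
  show ?thesis
    unfolding shift_def cmap[OF n n' eqv_phi[OF n] f] HV_rep_act[OF n' push_Z[OF n n' eqv_phi[OF n] f]] push_comp
    by (rule refl)
qed

text \<open>The inverse of the shift is the restriction of a \<open>G\<close>-map defined on all of \<open>V (Suc n)\<close>, so it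
  induces an inverse on cohomology.\<close>

lemma HV_good:
  assumes "good_sequence N V \<rho> \<phi>"
  shows "good_sequence N HV hr hp"
  unfolding good_sequence_def
proof (intro allI impI conjI)
  fix n \<mu> assume nN: "max 1 N \<le> n" and part: "is_partition \<mu>"
  then have n: "n \<ge> 1" by simp
  have n': "Suc n \<ge> 1" by simp
  let ?E = "Eg \<mu> n" and ?E' = "Eg \<mu> (Suc n)"
  have g: "padding_exists \<mu> n \<Longrightarrow> bij_betw (Sh \<mu> n) ?E ?E'"
    "\<not> padding_exists \<mu> n \<Longrightarrow> padding_exists \<mu> (Suc n) \<Longrightarrow> ?E' = {\<zero>\<^bsub>V (Suc n)\<^esub>}"
    using assms nN part unfolding good_sequence_def by blast+
  {
    assume pad: "padding_exists \<mu> n"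
    have pad': "padding_exists \<mu> (Suc n)" by (rule padding_Suc[OF pad])
    interpret A: stage "V n" "crd n" "vec n" "dm n" n "\<rho> n" \<mu> by (rule stage[OF n part pad])
    interpret B: stage "V (Suc n)" "crd (Suc n)" "vec (Suc n)" "dm (Suc n)" "Suc n" "\<rho> (Suc n)" \<mu>
      by (rule stage[OF n' part pad'])
    have EB: "?E' = B.eig" unfolding B.eig_eq eigs_def by (rule refl)
    \<comment> \<open>The idempotent belonging to the symmetrizer of stage \<open>n + 1\<close>: it
      maps everything into \<open>?E'\<close> and fixes \<open>?E'\<close>, as
      \<open>equivar_inverse\<close> requires.\<close>
    define \<alpha>' where "\<alpha>' = B.ra ((1 / B.kap) *q B.c)"
    have sc: "\<alpha>' w = B.ra B.c ((1 / B.kap) \<odot>\<^bsub>V (Suc n)\<^esub> w)" if w: "w \<in> carrier (V (Suc n))" for w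
      unfolding \<alpha>'_def B.act_left_scl[OF w] by (rule homD(3)[OF B.act_right_hom w, symmetric])
    have "\<exists>Q. eqv (Suc n) n Q \<and> (\<forall>v\<in>A.ra A.c ` carrier (V n). Q (Sh \<mu> n v) = v) \<and>
        (\<forall>w\<in>?E'. Sh \<mu> n (Q w) = w \<and> Q w \<in> A.ra A.c ` carrier (V n))"
    proof (rule equivar_inverse[OF A.V_vs B.V_vs gam[OF n] gam[OF n'] eqv_ra[OF n] eqv_ra[OF n'] eqv_Sh[OF n]])
      show "bij_betw (Sh \<mu> n) (A.ra A.c ` carrier (V n)) ?E'" using g(1)[OF pad] by (simp only: eigs_def)
      show "B.ra ((1 / B.kap) *q B.c) w \<in> ?E'" if w: "w \<in> carrier (V (Suc n))" for w
        unfolding \<alpha>'_def[symmetric] sc[OF w] eigs_def by (rule imageI[OF vs_facts(3)[OF B.V_vs w]])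
      show "w \<in> carrier (V (Suc n)) \<and> B.ra ((1 / B.kap) *q B.c) w = w" if w: "w \<in> ?E'" for w
      proof -
        have e: "w \<in> B.eig" using w by (simp only: EB)
        show ?thesis unfolding \<alpha>'_def[symmetric] sc[OF B.eig_carrier[OF e]]
          by (rule conjI[OF B.eig_carrier[OF e] B.eig_self[OF e]])
      qed
    qed
    then obtain Q where Q: "eqv (Suc n) n Q" and QS: "\<And>v. v \<in> ?E \<Longrightarrow> Q (Sh \<mu> n v) = v"
      and SQ: "\<And>w. w \<in> ?E' \<Longrightarrow> Sh \<mu> n (Q w) = w" and QE: "\<And>w. w \<in> ?E' \<Longrightarrow> Q w \<in> ?E"
      unfolding eigs_def[symmetric] by blast
    have SE: "Sh \<mu> n v \<in> ?E'" if v: "v \<in> ?E" for v using g(1)[OF pad] v by (auto simp: bij_betw_def)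
    let ?S = "shift \<mu> n (HV (Suc n)) (hr (Suc n)) (hp n)" and ?Q = "cohomology_map G (V n) (\<gamma> n) p Q"
    have pS: "push G p (Sh \<mu> n) f \<in> Zn (Suc n)" if f: "f \<in> Zn n" for f by (rule push_Z[OF n n' eqv_Sh[OF n] f])
    have pQ: "push G p Q f \<in> Zn n" if f: "f \<in> Zn (Suc n)" for f by (rule push_Z[OF n' n Q f])
    note eA = HV_eigs[OF n part pad] and eB = HV_eigs[OF n' part pad']
    show "bij_betw ?S (eigs \<mu> n (HV n) (hr n)) (eigs \<mu> (Suc n) (HV (Suc n)) (hr (Suc n)))"
    proof (rule bij_betw_byWitness[where f' = ?Q]; (intro ballI subsetI)?)
      fix x assume "x \<in> eigs \<mu> n (HV n) (hr n)"
      then obtain f where f: "f \<in> Zn n" "\<And>t. t \<in> tuples G p \<Longrightarrow> f t \<in> ?E" "x = cl n f" unfolding eA by blast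
      have "push G p (\<lambda>v. Q (Sh \<mu> n v)) f = f"
        by (rule coh.push_id[OF coh[OF n] Zn_C[OF n f(1)]]) (rule QS[OF f(2)])
      then show "?Q (?S x) = x"
        unfolding f(3) HV_shift[OF n f(1)] cmap[OF n' n Q pS[OF f(1)]] push_comp by simp
    next
      fix x assume "x \<in> eigs \<mu> (Suc n) (HV (Suc n)) (hr (Suc n))"
      then obtain f where f: "f \<in> Zn (Suc n)" "\<And>t. t \<in> tuples G p \<Longrightarrow> f t \<in> ?E'" "x = cl (Suc n) f" unfolding eB by blast
      have "push G p (\<lambda>v. Sh \<mu> n (Q v)) f = f"
        by (rule coh.push_id[OF coh[OF n'] Zn_C[OF n' f(1)]]) (rule SQ[OF f(2)])
      then show "?S (?Q x) = x"
        unfolding f(3) cmap[OF n' n Q f(1)] HV_shift[OF n pQ[OF f(1)]] push_comp by simp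
    next
      fix y assume "y \<in> ?S ` eigs \<mu> n (HV n) (hr n)"
      then obtain x where x: "y = ?S x" "x \<in> eigs \<mu> n (HV n) (hr n)" by (rule imageE)
      then obtain f where f: "f \<in> Zn n" "\<And>t. t \<in> tuples G p \<Longrightarrow> f t \<in> ?E" "x = cl n f" unfolding eA by blast
      show "y \<in> eigs \<mu> (Suc n) (HV (Suc n)) (hr (Suc n))"
        unfolding eB x(1) f(3) HV_shift[OF n f(1)]
        by (intro bexI[OF _ pS[OF f(1)]] conjI ballI refl) (simp add: push_def SE f(2))
    next
      fix y assume "y \<in> ?Q ` eigs \<mu> (Suc n) (HV (Suc n)) (hr (Suc n))"
      then obtain x where x: "y = ?Q x" "x \<in> eigs \<mu> (Suc n) (HV (Suc n)) (hr (Suc n))" by (rule imageE)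
      then obtain f where f: "f \<in> Zn (Suc n)" "\<And>t. t \<in> tuples G p \<Longrightarrow> f t \<in> ?E'" "x = cl (Suc n) f" unfolding eB by blast
      show "y \<in> eigs \<mu> n (HV n) (hr n)"
        unfolding eA x(1) f(3) cmap[OF n' n Q f(1)]
        by (intro bexI[OF _ pQ[OF f(1)]] conjI ballI refl) (simp add: push_def QE f(2))
    qed
  }
  assume np: "\<not> padding_exists \<mu> n" and pad': "padding_exists \<mu> (Suc n)"
  interpret C: coh "V (Suc n)" "crd (Suc n)" "vec (Suc n)" "dm (Suc n)" G "\<gamma> (Suc n)" by (rule coh[OF n'])
  have e0: "?E' = {\<zero>\<^bsub>V (Suc n)\<^esub>}" by (rule g(2)[OF np pad'])
  show "eigs \<mu> (Suc n) (HV (Suc n)) (hr (Suc n)) = {\<zero>\<^bsub>HV (Suc n)\<^esub>}"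
  proof (rule Set.set_eqI)
    fix x
    have "x = cl (Suc n) \<zero>\<^bsub>C.C p\<^esub>" if f: "f \<in> Zn (Suc n)" "\<forall>t\<in>tuples G p. f t \<in> ?E'" "x = cl (Suc n) f" for f
    proof -
      have "f = \<zero>\<^bsub>C.C p\<^esub>"
        by (rule C.C_eqI[OF C.C_ext[OF Zn_C[OF n' f(1)]]]) (use f(2) e0 in \<open>simp_all add: C.C_zero\<close>)
      then show ?thesis using f(3) by simp
    qed
    moreover have "\<forall>t\<in>tuples G p. \<zero>\<^bsub>C.C p\<^esub> t \<in> ?E'" unfolding e0 C.C_zero by simp
    ultimately show "x \<in> eigs \<mu> (Suc n) (HV (Suc n)) (hr (Suc n)) \<longleftrightarrow> x \<in> {\<zero>\<^bsub>HV (Suc n)\<^esub>}"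
      unfolding HV_eigs[OF n' part pad'] C.cls_zero[symmetric] using C.Z_closed(1)[of p] by blast
  qed
qed

end

section \<open>Finitely generated projective resolutions\<close>

lemma bd_map: "bd (map h t) = frag_extend (\<lambda>s. frag_of (map h s)) (bd t)"
  by (simp add: bd_def omit_map frag_extend_sum frag_extend_cmul comp_def)

definition cone :: "'a \<Rightarrow> ('a list \<Rightarrow>\<^sub>0 int) \<Rightarrow> 'a list \<Rightarrow>\<^sub>0 int" where
  "cone a = frag_extend (\<lambda>s. frag_of (a # s))"

text \<open>Omitting the new first entry gives back \<open>t\<close>; a later omission takes place
  inside \<open>t\<close>, with its index and hence its sign shifted by one.\<close>

lemma bd_Cons: "bd (a # t) = frag_of t - cone a (bd t)"
proof -
  have "bd (a # t) = frag_of t + (\<Sum>i<length t. frag_cmul (- ((-1) ^ i)) (frag_of (a # omit i t)))"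
    unfolding bd_def by (simp add: sum.lessThan_Suc_shift omit_def del: sum.lessThan_Suc)
  also have "(\<Sum>i<length t. frag_cmul (- ((-1) ^ i)) (frag_of (a # omit i t))) = - cone a (bd t)"
  proof -
    have m: "frag_cmul (- c) x = - frag_cmul c x" for c and x :: "'a list \<Rightarrow>\<^sub>0 int"
      by (rule poly_mapping_eqI) simp
    show ?thesis
      unfolding cone_def bd_def m sum_negf by (simp add: frag_extend_sum frag_extend_cmul comp_def)
  qed
  finally show ?thesis by simp
qed

text \<open>Coning is a contracting homotopy of the standard resolution: a cycle is the boundary of
  its cone.\<close>

lemma bd_cone: "frag_extend bd (cone a c) = c - cone a (frag_extend bd c)"
proof -
  have "Poly_Mapping.keys c \<subseteq> UNIV" by simp
  then show ?thesis
    by (induction c rule: frag_induction) (simp_all add: cone_def bd_Cons frag_extend_diff)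
qed

text \<open>Elements outside the carrier are fixed, so that the group acts on the whole type.\<close>

definition left_mul :: "('g, 'm) monoid_scheme \<Rightarrow> 'g \<Rightarrow> 'g \<Rightarrow> 'g" where
  "left_mul G g x = (if x \<in> carrier G then g \<otimes>\<^bsub>G\<^esub> x else x)"

lemma left_mul:
  assumes "group G"
  shows "g \<in> carrier G \<Longrightarrow> h \<in> carrier G \<Longrightarrow> left_mul G (g \<otimes>\<^bsub>G\<^esub> h) x = left_mul G g (left_mul G h x)"
    and "left_mul G \<one>\<^bsub>G\<^esub> x = x"
    and "g \<in> carrier G \<Longrightarrow> left_mul G g x = y \<longleftrightarrow> x = left_mul G (inv\<^bsub>G\<^esub> g) y"
    and "g \<in> carrier G \<Longrightarrow> left_mul G g x \<in> carrier G \<longleftrightarrow> x \<in> carrier G"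
proof -
  interpret group G by fact
  show "g \<in> carrier G \<Longrightarrow> h \<in> carrier G \<Longrightarrow> left_mul G (g \<otimes>\<^bsub>G\<^esub> h) x = left_mul G g (left_mul G h x)"
    "left_mul G \<one>\<^bsub>G\<^esub> x = x" "g \<in> carrier G \<Longrightarrow> left_mul G g x \<in> carrier G \<longleftrightarrow> x \<in> carrier G"
    by (auto simp: left_mul_def m_assoc)
  show "g \<in> carrier G \<Longrightarrow> left_mul G g x = y \<longleftrightarrow> x = left_mul G (inv\<^bsub>G\<^esub> g) y"
    by (auto simp: left_mul_def inv_solve_left m_assoc[symmetric])
qed

text \<open>The pair \<open>(l, h)\<close> stands for the translate by \<open>h\<close> of the free
  generator number \<open>l\<close>.\<close>

definition act1 :: "('g, 'm) monoid_scheme \<Rightarrow> 'g \<Rightarrow> (nat \<times> 'g \<Rightarrow>\<^sub>0 int) \<Rightarrow> nat \<times> 'g \<Rightarrow>\<^sub>0 int" where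
  "act1 G g = frag_extend (\<lambda>(l, h). frag_of (l, left_mul G g h))"

text \<open>Level 0 is the trivial module; giving it an action of its own lets the augmentation be
  treated as one more differential.\<close>

definition lact :: "('g, 'm) monoid_scheme \<Rightarrow> nat \<Rightarrow> 'g \<Rightarrow> (nat \<times> 'g \<Rightarrow>\<^sub>0 int) \<Rightarrow> nat \<times> 'g \<Rightarrow>\<^sub>0 int" where
  "lact G m g y = (if m = 0 then y else act1 G g y)"

lemma lookup_act1:
  assumes G: "group G" and g: "g \<in> carrier G"
  shows "Poly_Mapping.lookup (act1 G g y) (l, x) = Poly_Mapping.lookup y (l, left_mul G (inv\<^bsub>G\<^esub> g) x)"
proof -
  have "Poly_Mapping.keys y \<subseteq> UNIV" by simp
  then show ?thesis
  proof (induction y rule: frag_induction)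
    case (one z)
    obtain l' h where z: "z = (l', h)" by (cases z)
    show ?case using left_mul(3)[OF G g, of h x] by (auto simp: z act1_def lookup_frag_of)
  qed (simp_all add: act1_def frag_extend_diff lookup_minus)
qed

lemma lact:
  assumes G: "group G"
  shows "lact G m g (x - y) = lact G m g x - lact G m g y"
    and "g \<in> carrier G \<Longrightarrow> h \<in> carrier G \<Longrightarrow> lact G m (g \<otimes>\<^bsub>G\<^esub> h) x = lact G m g (lact G m h x)"
    and "lact G m \<one>\<^bsub>G\<^esub> x = x"
proof -
  show "lact G m g (x - y) = lact G m g x - lact G m g y" by (simp add: lact_def act1_def frag_extend_diff)
  have k: "Poly_Mapping.keys x \<subseteq> UNIV" by simp
  show "lact G m (g \<otimes>\<^bsub>G\<^esub> h) x = lact G m g (lact G m h x)" if "g \<in> carrier G" "h \<in> carrier G"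
    using k by (induction x rule: frag_induction)
      (auto simp: lact_def act1_def frag_extend_diff left_mul(1)[OF G that])
  show "lact G m \<one>\<^bsub>G\<^esub> x = x"
    using k by (induction x rule: frag_induction)
      (auto simp: lact_def act1_def frag_extend_diff left_mul(2)[OF G])
qed

text \<open>The augmented resolution in free abelian groups: level \<open>0\<close> is \<open>\<int>\<close>, spanned by \<open>(0, \<one>)\<close> with the
  trivial action, and level \<open>m + 1\<close> is \<open>P\<^sub>m\<close>, cut out of the free module on \<open>k (m + 1)\<close> generators by
  the idempotent \<open>e (m + 1)\<close>; \<open>D m\<close> lowers the level from \<open>m + 1\<close> to \<open>m\<close>.\<close>

locale frag_complex =
  fixes G :: "('g, 'm) monoid_scheme" and k :: "nat \<Rightarrow> nat"
    and e D :: "nat \<Rightarrow> (nat \<times> 'g \<Rightarrow>\<^sub>0 int) \<Rightarrow> nat \<times> 'g \<Rightarrow>\<^sub>0 int"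
  assumes grp: "group G"
    and e_add: "e m (x + y) = e m x + e m y" and D_add: "D m (x + y) = D m x + D m y"
    and e_eq: "g \<in> carrier G \<Longrightarrow> e m (lact G m g x) = lact G m g (e m x)"
    and D_eq: "g \<in> carrier G \<Longrightarrow> D m (lact G (Suc m) g x) = lact G m g (D m x)"
    and e_e: "e m (e m x) = e m x" and D_e: "D m (e (Suc m) x) = D m x"
    and D_D: "D m (D (Suc m) x) = 0"
    and surj: "e 0 z = z \<Longrightarrow> \<exists>y. e 1 y = y \<and> D 0 y = z"
    and exact: "e (Suc m) z = z \<Longrightarrow> D m z = 0 \<Longrightarrow> \<exists>y. e (Suc (Suc m)) y = y \<and> D (Suc m) y = z"
    and keys: "Poly_Mapping.keys (e m x) \<subseteq> {..<k m} \<times> carrier G"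
    and e_0: "e 0 x = frag_cmul (Poly_Mapping.lookup x (0, \<one>\<^bsub>G\<^esub>)) (frag_of (0, \<one>\<^bsub>G\<^esub>))"

text \<open>The aim is to describe \<open>P\<close> by an idempotent on the free abelian group with
  basis the pairs \<open>(l, g)\<close>, where additive maps are determined by their values on basis
  elements.\<close>

locale fp_module =
  fixes G :: "('g, 'm) monoid_scheme" and P :: "('g \<Rightarrow> int, nat \<Rightarrow> 'g \<Rightarrow> int) module" and k :: nat and j q
  assumes G: "group G" and lm: "left_module (group_ring G) P"
    and j: "j \<in> LinearCombinations.module_hom (group_ring G) P (module_power (regular_module (group_ring G)) k)"
    and q: "q \<in> LinearCombinations.module_hom (group_ring G) (module_power (regular_module (group_ring G)) k) P"
    and qj: "x \<in> carrier P \<Longrightarrow> q (j x) = x"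
begin

abbreviation R :: "('g \<Rightarrow> int) ring" where "R \<equiv> group_ring G"
abbreviation F where "F \<equiv> module_power (regular_module R) k"

text \<open>Group elements inside the group ring. Of the module structure only their action and
  addition are retained, which is all that the comparison of resolutions works with.\<close>

definition dl :: "'g \<Rightarrow> 'g \<Rightarrow> int" where "dl g = (\<lambda>x. if x = g then 1 else 0)"

lemma dl: "g \<in> carrier G \<Longrightarrow> dl g \<in> carrier R"
  by (auto simp: group_ring_def dl_def)

lemma F_simps:
  "u \<in> carrier F \<longleftrightarrow> u \<in> {..<k} \<rightarrow>\<^sub>E carrier R"
  "u \<oplus>\<^bsub>F\<^esub> v = (\<lambda>l\<in>{..<k}. (\<lambda>x. u l x + v l x))"
  "a \<odot>\<^bsub>F\<^esub> u = (\<lambda>l\<in>{..<k}. a \<otimes>\<^bsub>R\<^esub> u l)"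
  by (simp_all add: module_power_def regular_module_def group_ring_def)

lemma dl_mult:
  assumes g: "g \<in> carrier G" and b: "b \<in> carrier R"
  shows "dl g \<otimes>\<^bsub>R\<^esub> b = (\<lambda>x. if x \<in> carrier G then b (left_mul G (inv\<^bsub>G\<^esub> g) x) else 0)"
proof
  interpret group G by (rule G)
  fix x
  have bc: "b h \<noteq> 0 \<Longrightarrow> h \<in> carrier G" for h using b by (auto simp: group_ring_def)
  let ?S = "{(g', h). dl g g' \<noteq> 0 \<and> b h \<noteq> 0 \<and> g' \<otimes>\<^bsub>G\<^esub> h = x}"
  have "?S = (if x \<in> carrier G \<and> b (inv\<^bsub>G\<^esub> g \<otimes>\<^bsub>G\<^esub> x) \<noteq> 0 then {(g, inv\<^bsub>G\<^esub> g \<otimes>\<^bsub>G\<^esub> x)} else {})"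
    using g bc by (auto simp: dl_def m_assoc[symmetric] split: if_splits)
  then have "(\<Sum>(g', h)\<in>?S. dl g g' * b h) = (if x \<in> carrier G then b (left_mul G (inv\<^bsub>G\<^esub> g) x) else 0)"
    by (auto simp: dl_def left_mul_def)
  then show "(dl g \<otimes>\<^bsub>R\<^esub> b) x = (if x \<in> carrier G then b (left_mul G (inv\<^bsub>G\<^esub> g) x) else 0)"
    by (simp add: group_ring_def)
qed

lemma F_value: "u \<in> carrier F \<Longrightarrow> l < k \<Longrightarrow> finite {g. u l g \<noteq> 0} \<and> (\<forall>g. u l g \<noteq> 0 \<longrightarrow> g \<in> carrier G)"
proof -
  assume "u \<in> carrier F" "l < k"
  then have "u l \<in> carrier R" unfolding F_simps by blast
  then show ?thesis by (auto simp: group_ring_def)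
qed

text \<open>\<open>el\<close> and \<open>fr\<close> translate between finitely supported functions
  on pairs and families of group ring elements. Pairs with \<open>l \<ge> k\<close> or with second
  component outside the group are forgotten by \<open>el\<close>, so in general only
  \<open>el (fr u) = u\<close> holds.\<close>

definition el :: "(nat \<times> 'g \<Rightarrow>\<^sub>0 int) \<Rightarrow> nat \<Rightarrow> 'g \<Rightarrow> int" where
  "el y = (\<lambda>l\<in>{..<k}. \<lambda>g. if g \<in> carrier G then Poly_Mapping.lookup y (l, g) else 0)"

definition fr :: "(nat \<Rightarrow> 'g \<Rightarrow> int) \<Rightarrow> nat \<times> 'g \<Rightarrow>\<^sub>0 int" where
  "fr u = Abs_poly_mapping (\<lambda>(l, g). if l < k \<and> g \<in> carrier G then u l g else 0)"

lemma el_F: "el y \<in> carrier F"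
proof -
  have "finite {g. (if g \<in> carrier G then Poly_Mapping.lookup y (l, g) else 0) \<noteq> 0}" for l
    by (rule finite_subset[of _ "snd ` Poly_Mapping.keys y"]) (force simp: in_keys_iff split: if_splits)+
  then show ?thesis unfolding F_simps by (auto simp: el_def group_ring_def split: if_splits)
qed

lemma lookup_fr:
  assumes u: "u \<in> carrier F"
  shows "Poly_Mapping.lookup (fr u) (l, g) = (if l < k \<and> g \<in> carrier G then u l g else 0)"
proof -
  have "finite {g. u l g \<noteq> 0}" if "l < k" for l using F_value[OF u that] by simp
  then have "finite (SIGMA l:{..<k}. {g. u l g \<noteq> 0})" by auto
  moreover have "{x. (case x of (l, g) \<Rightarrow> if l < k \<and> g \<in> carrier G then u l g else 0) \<noteq> 0} \<subseteq> (SIGMA l:{..<k}. {g. u l g \<noteq> 0})"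
    by (auto split: if_splits)
  ultimately have "finite {x. (case x of (l, g) \<Rightarrow> if l < k \<and> g \<in> carrier G then u l g else 0) \<noteq> 0}"
    by (rule finite_subset[rotated])
  then show ?thesis unfolding fr_def by (simp add: Abs_poly_mapping_inverse)
qed

lemma el_fr: assumes u: "u \<in> carrier F" shows "el (fr u) = u"
proof
  fix l
  have "u l g = 0" if "l < k" "g \<notin> carrier G" for g using F_value[OF u that(1)] that(2) by blast
  moreover have "u l = undefined" if "\<not> l < k" using u[unfolded F_simps] that by (auto simp: PiE_def extensional_def)
  ultimately show "el (fr u) l = u l" by (auto simp: el_def lookup_fr[OF u] fun_eq_iff)
qed

lemma el_add: "el (x + y) = el x \<oplus>\<^bsub>F\<^esub> el y"
  by (auto simp: F_simps el_def lookup_add fun_eq_iff)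

lemma el_act: "g \<in> carrier G \<Longrightarrow> el (act1 G g y) = dl g \<odot>\<^bsub>F\<^esub> el y"
proof -
  assume g: "g \<in> carrier G"
  have "el y l \<in> carrier R" if "l < k" for l using el_F[of y] that by (auto simp: F_simps)
  then have m: "dl g \<otimes>\<^bsub>R\<^esub> el y l = (\<lambda>x. if x \<in> carrier G then el y l (left_mul G (inv\<^bsub>G\<^esub> g) x) else 0)" if "l < k" for l
    using dl_mult[OF g] that by blast
  show ?thesis
    unfolding F_simps
  proof (subst el_def, rule restrict_ext)
    fix l assume "l \<in> {..<k}"
    then have l: "l < k" by simp
    show "(\<lambda>x. if x \<in> carrier G then Poly_Mapping.lookup (act1 G g y) (l, x) else 0) = dl g \<otimes>\<^bsub>R\<^esub> el y l"
      unfolding m[OF l] using l left_mul(4)[OF G group.inv_closed[OF G g]] by (auto simp: el_def lookup_act1[OF G g] fun_eq_iff)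
  qed
qed

lemma fr_add: assumes u: "u \<in> carrier F" and v: "v \<in> carrier F" shows "fr (u \<oplus>\<^bsub>F\<^esub> v) = fr u + fr v"
proof -
  have "u \<oplus>\<^bsub>F\<^esub> v \<in> carrier F" using el_F[of "fr u + fr v"] by (simp only: el_add el_fr[OF u] el_fr[OF v])
  then show ?thesis
    by (intro poly_mapping_eqI) (auto simp: lookup_add lookup_fr u v F_simps(2))
qed

lemma keys_fr: "u \<in> carrier F \<Longrightarrow> Poly_Mapping.keys (fr u) \<subseteq> {..<k} \<times> carrier G"
  by (auto simp: in_keys_iff lookup_fr split: if_splits)

lemma fr_act: assumes g: "g \<in> carrier G" and u: "u \<in> carrier F" shows "fr (dl g \<odot>\<^bsub>F\<^esub> u) = act1 G g (fr u)"
proof (rule poly_mapping_eqI)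
  fix z :: "nat \<times> 'g"
  obtain l x where z: "z = (l, x)" by (cases z)
  have c: "dl g \<odot>\<^bsub>F\<^esub> u \<in> carrier F" using el_F[of "act1 G g (fr u)"] by (simp only: el_act[OF g] el_fr[OF u])
  have "el (act1 G g (fr u)) l x = (dl g \<odot>\<^bsub>F\<^esub> u) l x" by (simp only: el_act[OF g] el_fr[OF u])
  then show "Poly_Mapping.lookup (fr (dl g \<odot>\<^bsub>F\<^esub> u)) z = Poly_Mapping.lookup (act1 G g (fr u)) z"
    unfolding z lookup_fr[OF c] using left_mul(4)[OF G group.inv_closed[OF G g], of x]
    by (cases "l < k") (auto simp: el_def lookup_act1[OF G g] lookup_fr[OF u] split: if_splits)
qed

lemma jD: "x \<in> carrier P \<Longrightarrow> j x \<in> carrier F"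
    "x \<in> carrier P \<Longrightarrow> y \<in> carrier P \<Longrightarrow> j (x \<oplus>\<^bsub>P\<^esub> y) = j x \<oplus>\<^bsub>F\<^esub> j y"
    "a \<in> carrier R \<Longrightarrow> x \<in> carrier P \<Longrightarrow> j (a \<odot>\<^bsub>P\<^esub> x) = a \<odot>\<^bsub>F\<^esub> j x"
  using j by (auto simp: LinearCombinations.module_hom_def)

lemma qD: "x \<in> carrier F \<Longrightarrow> q x \<in> carrier P"
    "x \<in> carrier F \<Longrightarrow> y \<in> carrier F \<Longrightarrow> q (x \<oplus>\<^bsub>F\<^esub> y) = q x \<oplus>\<^bsub>P\<^esub> q y"
    "a \<in> carrier R \<Longrightarrow> x \<in> carrier F \<Longrightarrow> q (a \<odot>\<^bsub>F\<^esub> x) = a \<odot>\<^bsub>P\<^esub> q x"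
  using q by (auto simp: LinearCombinations.module_hom_def)

text \<open>\<open>pr\<close> is defined on the whole free abelian group, and \<open>sc\<close> is a
  section of it over \<open>P\<close>; the map sending \<open>y\<close> to \<open>sc (pr y)\<close>
  is the idempotent that cuts out \<open>P\<close>.\<close>

definition pr :: "(nat \<times> 'g \<Rightarrow>\<^sub>0 int) \<Rightarrow> nat \<Rightarrow> 'g \<Rightarrow> int" where "pr y = q (el y)"
definition sc :: "(nat \<Rightarrow> 'g \<Rightarrow> int) \<Rightarrow> nat \<times> 'g \<Rightarrow>\<^sub>0 int" where "sc x = fr (j x)"

lemma pr_closed: "pr y \<in> carrier P" by (simp add: pr_def qD(1) el_F)
lemma pr_add: "pr (x + y) = pr x \<oplus>\<^bsub>P\<^esub> pr y" by (simp only: pr_def el_add qD(2)[OF el_F el_F])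
lemma pr_act: "g \<in> carrier G \<Longrightarrow> pr (act1 G g y) = dl g \<odot>\<^bsub>P\<^esub> pr y"
  by (simp only: pr_def el_act qD(3)[OF dl el_F])
lemma pr_sc: "x \<in> carrier P \<Longrightarrow> pr (sc x) = x" by (simp only: pr_def sc_def el_fr jD(1) qj)
lemma sc_add: "x \<in> carrier P \<Longrightarrow> y \<in> carrier P \<Longrightarrow> sc (x \<oplus>\<^bsub>P\<^esub> y) = sc x + sc y"
  by (simp only: sc_def jD fr_add)
lemma sc_act: "g \<in> carrier G \<Longrightarrow> x \<in> carrier P \<Longrightarrow> sc (dl g \<odot>\<^bsub>P\<^esub> x) = act1 G g (sc x)"
  by (simp only: sc_def jD dl fr_act)
lemma keys_sc: "x \<in> carrier P \<Longrightarrow> Poly_Mapping.keys (sc x) \<subseteq> {..<k} \<times> carrier G"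
  unfolding sc_def by (rule keys_fr[OF jD(1)])

lemma P_group: "abelian_group P" using lm by (simp add: left_module_def)

lemma zero_closed: "\<zero>\<^bsub>P\<^esub> \<in> carrier P"
  by (rule abelian_monoid.zero_closed[OF abelian_group.axioms(1)[OF P_group]])

lemma sc_zero: "sc \<zero>\<^bsub>P\<^esub> = 0"
proof -
  have "sc (\<zero>\<^bsub>P\<^esub> \<oplus>\<^bsub>P\<^esub> \<zero>\<^bsub>P\<^esub>) = sc \<zero>\<^bsub>P\<^esub> + sc \<zero>\<^bsub>P\<^esub>" by (rule sc_add[OF zero_closed zero_closed])
  then show ?thesis using abelian_monoid.l_zero[OF abelian_group.axioms(1)[OF P_group] zero_closed] by simp
qed

lemma sc_zero_iff: "x \<in> carrier P \<Longrightarrow> sc x = 0 \<Longrightarrow> x = \<zero>\<^bsub>P\<^esub>"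
  using pr_sc[of x] pr_sc[OF zero_closed] sc_zero by simp

end

text \<open>Each \<open>P i\<close> is replaced by its copy under \<open>sc i\<close>, and the
  differentials are transported by \<open>pr\<close> and \<open>sc\<close>. Exactness survives
  because \<open>pr i\<close> undoes \<open>sc i\<close> and \<open>sc i\<close> vanishes only at
  zero.\<close>

theorem frag_complex_exists:
  fixes G :: "('g, 'm) monoid_scheme"
  assumes G: "group G" and fp: "type_FP_infinity G"
  shows "\<exists>k e D. frag_complex G k e D"
proof -
  obtain P :: "nat \<Rightarrow> ('g \<Rightarrow> int, nat \<Rightarrow> 'g \<Rightarrow> int) module" and d \<epsilon> where
    proj: "\<And>i. fg_projective (group_ring G) (P i)"
    and d: "\<And>i. d i \<in> LinearCombinations.module_hom (group_ring G) (P (Suc i)) (P i)"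
    and eps: "\<epsilon> \<in> LinearCombinations.module_hom (group_ring G) (P 0) trivial_module"
    and onto: "\<epsilon> ` carrier (P 0) = UNIV" and ker0: "{x \<in> carrier (P 0). \<epsilon> x = 0} = d 0 ` carrier (P 1)"
    and ker: "\<And>i. {x \<in> carrier (P (Suc i)). d i x = \<zero>\<^bsub>P i\<^esub>} = d (Suc i) ` carrier (P (Suc (Suc i)))"
    using fp unfolding type_FP_infinity_def by (elim exE conjE) blast
  have "\<exists>K. fp_module G (P i) (fst K) (fst (snd K)) (snd (snd K))" for i
  proof -
    obtain k j q where "fp_module G (P i) k j q"
      using proj[of i] G unfolding fg_projective_def fp_module_def by blast
    then show ?thesis by (intro exI[of _ "(k, j, q)"]) simp
  qed
  then have "\<forall>i. \<exists>K. fp_module G (P i) (fst K) (fst (snd K)) (snd (snd K))" by simp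
  then obtain K where K: "\<forall>i. fp_module G (P i) (fst (K i)) (fst (snd (K i))) (snd (snd (K i)))"
    by (elim choice[THEN exE])
  define k where "k i = fst (K i)" for i
  define j where "j i = fst (snd (K i))" for i
  define q where "q i = snd (snd (K i))" for i
  have M: "fp_module G (P i) (k i) (j i) (q i)" for i
    unfolding k_def j_def q_def by (rule K[rule_format])
  define pr where "pr i = fp_module.pr G (k i) (q i)" for i
  define sc where "sc i = fp_module.sc G (k i) (j i)" for i
  define dl where "dl = (fp_module.dl :: 'g \<Rightarrow> 'g \<Rightarrow> int)"
  note pc = fp_module.pr_closed[OF M, folded pr_def] and pa = fp_module.pr_add[OF M, folded pr_def]
    and pact = fp_module.pr_act[OF M, folded pr_def dl_def] and ps = fp_module.pr_sc[OF M, folded pr_def sc_def]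
    and sa = fp_module.sc_add[OF M, folded sc_def] and sact = fp_module.sc_act[OF M, folded sc_def dl_def]
    and sz = fp_module.sc_zero[OF M, folded sc_def] and szi = fp_module.sc_zero_iff[OF M, folded sc_def]
    and sk = fp_module.keys_sc[OF M, folded sc_def] and dlR = fp_module.dl[OF M, folded dl_def]
  have dD: "x \<in> carrier (P (Suc i)) \<Longrightarrow> d i x \<in> carrier (P i)"
    "x \<in> carrier (P (Suc i)) \<Longrightarrow> y \<in> carrier (P (Suc i)) \<Longrightarrow> d i (x \<oplus>\<^bsub>P (Suc i)\<^esub> y) = d i x \<oplus>\<^bsub>P i\<^esub> d i y"
    "a \<in> carrier (group_ring G) \<Longrightarrow> x \<in> carrier (P (Suc i)) \<Longrightarrow> d i (a \<odot>\<^bsub>P (Suc i)\<^esub> x) = a \<odot>\<^bsub>P i\<^esub> d i x" for i x y a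
    using d[of i] by (auto simp: LinearCombinations.module_hom_def)
  have eD: "x \<in> carrier (P 0) \<Longrightarrow> y \<in> carrier (P 0) \<Longrightarrow> \<epsilon> (x \<oplus>\<^bsub>P 0\<^esub> y) = \<epsilon> x + \<epsilon> y" for x y
    using eps by (auto simp: LinearCombinations.module_hom_def trivial_module_def)
  have eG: "\<epsilon> (dl g \<odot>\<^bsub>P 0\<^esub> x) = \<epsilon> x" if g: "g \<in> carrier G" and x: "x \<in> carrier (P 0)" for g x
  proof -
    have "\<epsilon> (dl g \<odot>\<^bsub>P 0\<^esub> x) = (\<Sum>h | dl g h \<noteq> 0. dl g h) * \<epsilon> x"
      using eps dlR[OF g] x by (auto simp: LinearCombinations.module_hom_def trivial_module_def)
    also have "{h. dl g h \<noteq> 0} = {g}" by (auto simp: dl_def fp_module.dl_def[OF M])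
    finally show ?thesis by (simp add: dl_def fp_module.dl_def[OF M])
  qed
  let ?u = "frag_of (0, \<one>\<^bsub>G\<^esub>) :: nat \<times> 'g \<Rightarrow>\<^sub>0 int"
  define e where "e m y = (case m of 0 \<Rightarrow> frag_cmul (Poly_Mapping.lookup y (0, \<one>\<^bsub>G\<^esub>)) ?u | Suc i \<Rightarrow> sc i (pr i y))" for m y
  define D where "D m y = (case m of 0 \<Rightarrow> frag_cmul (\<epsilon> (pr 0 y)) ?u | Suc i \<Rightarrow> sc i (d i (pr (Suc i) y)))" for m y
  define kk where "kk m = (case m of 0 \<Rightarrow> 1 | Suc i \<Rightarrow> k i)" for m
  have cz: "frag_cmul c ?u = 0 \<Longrightarrow> c = 0" for c by simp
  have "frag_complex G kk e D"
  proof (rule frag_complex.intro[OF G])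
    fix m x y
    show "e m (x + y) = e m x + e m y"
      by (cases m) (simp_all add: e_def lookup_add frag_cmul_distrib pa sa pc)
    show "D m (x + y) = D m x + D m y"
      by (cases m) (simp_all add: D_def frag_cmul_distrib pa eD pc sa dD)
    show "e m (e m x) = e m x"
      by (cases m) (simp_all add: e_def ps pc)
    show "D m (e (Suc m) x) = D m x"
      by (cases m) (simp_all add: e_def D_def ps pc)
    have "d i (d (Suc i) (pr (Suc (Suc i)) x)) = \<zero>\<^bsub>P i\<^esub>" for i using ker[of i] pc by blast
    moreover have "\<epsilon> (d 0 (pr (Suc 0) x)) = 0" using ker0 pc by (auto simp del: One_nat_def simp: One_nat_def[symmetric])
    ultimately show "D m (D (Suc m) x) = 0"
      by (cases m) (simp_all add: D_def ps dD pc sz)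
    show "Poly_Mapping.keys (e m x) \<subseteq> {..<kk m} \<times> carrier G"
    proof (cases m)
      case 0
      have "\<one>\<^bsub>G\<^esub> \<in> carrier G" using group.is_monoid[OF G] by (rule monoid.one_closed)
      then show ?thesis using keys_cmul[of "Poly_Mapping.lookup x (0, \<one>\<^bsub>G\<^esub>)" ?u]
        by (auto simp: e_def kk_def 0 keys_frag_of)
    qed (use sk[OF pc] in \<open>simp add: e_def kk_def\<close>)
    show "e 0 x = frag_cmul (Poly_Mapping.lookup x (0, \<one>\<^bsub>G\<^esub>)) ?u" by (simp add: e_def)
  next
    fix m x g assume g: "g \<in> carrier G"
    show "e m (lact G m g x) = lact G m g (e m x)"
      by (cases m) (simp_all add: e_def lact_def pact[OF g] sact[OF g] pc)
    show "D m (lact G (Suc m) g x) = lact G m g (D m x)"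
      by (cases m) (simp_all add: D_def lact_def pact[OF g] eG[OF g] sact[OF g] pc dD dlR[OF g])
  next
    fix z assume z: "e 0 z = z"
    obtain x where x: "x \<in> carrier (P 0)" "\<epsilon> x = Poly_Mapping.lookup z (0, \<one>\<^bsub>G\<^esub>)" using onto by (metis UNIV_I imageE)
    have "e 1 (sc 0 x) = sc 0 x \<and> D 0 (sc 0 x) = z" using z by (simp add: e_def D_def ps x)
    then show "\<exists>y. e 1 y = y \<and> D 0 y = z" by (rule exI)
  next
    fix m z assume z: "e (Suc m) z = z" and Dz: "D m z = 0"
    have "\<exists>x\<in>carrier (P (Suc m)). d m x = pr m z"
    proof (cases m)
      case 0
      have "\<epsilon> (pr 0 z) = 0" using Dz cz by (simp add: D_def 0)
      then have "pr 0 z \<in> d 0 ` carrier (P 1)" using ker0 pc by blast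
      then show ?thesis unfolding 0 by (auto simp: One_nat_def)
    next
      case (Suc i)
      have "d i (pr (Suc i) z) = \<zero>\<^bsub>P i\<^esub>" using Dz szi[OF dD(1)[OF pc]] by (simp add: D_def Suc)
      then have "pr (Suc i) z \<in> d (Suc i) ` carrier (P (Suc (Suc i)))" using ker[of i] pc by blast
      then show ?thesis unfolding Suc by auto
    qed
    then obtain x where x: "x \<in> carrier (P (Suc m))" "d m x = pr m z" by blast
    have "e (Suc (Suc m)) (sc (Suc m) x) = sc (Suc m) x \<and> D (Suc m) (sc (Suc m) x) = z"
      using z by (simp add: e_def D_def ps x)
    then show "\<exists>y. e (Suc (Suc m)) y = y \<and> D (Suc m) y = z" by (rule exI)
  qed
  then show ?thesis by blast
qed

section \<open>Comparison with the standard resolution\<close>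

text \<open>Additivity is stated through differences to match \<open>frag_induction\<close>, which
  builds the free abelian group from basis elements by subtraction.\<close>

lemma frag_agree:
  fixes f g :: "('a \<Rightarrow>\<^sub>0 int) \<Rightarrow> 'b::ab_group_add"
  assumes c: "Poly_Mapping.keys c \<subseteq> S" and f: "\<And>x y. f (x - y) = f x - f y" and g: "\<And>x y. g (x - y) = g x - g y"
    and eq: "\<And>t. t \<in> S \<Longrightarrow> f (frag_of t) = g (frag_of t)"
  shows "f c = g c"
  using c
proof (induction c rule: frag_induction)
  case zero
  have "f 0 = 0" "g 0 = 0" using f[of 0 0] g[of 0 0] by simp_all
  then show ?case by simp
qed (simp_all add: f g eq)

lemma additive_diff:
  fixes f :: "'a::ab_group_add \<Rightarrow> 'b::ab_group_add"
  assumes "\<And>x y. f (x + y) = f x + f y"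
  shows "f (x - y) = f x - f y" "f 0 = 0"
  using assms[of "x - y" y] assms[of 0 0] by (simp_all add: algebra_simps)

lemma keys_frag_extend_sub:
  "(\<And>x. x \<in> Poly_Mapping.keys c \<Longrightarrow> Poly_Mapping.keys (f x) \<subseteq> S) \<Longrightarrow> Poly_Mapping.keys (frag_extend f c) \<subseteq> S"
  using keys_frag_extend[of f c] by blast

section \<open>Comparison maps in both directions and the homotopy\<close>

context frag_complex
begin

abbreviation act where "act \<equiv> lact G"
text \<open>Lists of length \<open>m\<close> belong to level \<open>m\<close>, so simplices of
  dimension \<open>p\<close> are at level \<open>p + 1\<close> and the empty list spans level
  0.\<close>

abbreviation L where "L m \<equiv> {t. length t = m \<and> set t \<subseteq> carrier G}"
abbreviation one where "one \<equiv> \<one>\<^bsub>G\<^esub>"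

definition mv :: "'g \<Rightarrow> 'g list \<Rightarrow> 'g list" where "mv g = map (left_mul G g)"
definition T where "T g = frag_extend (\<lambda>t. frag_of (mv g t))"
text \<open>The member of the orbit of \<open>t\<close> whose first entry is \<open>one\<close>. The
  group permutes nonempty tuples freely, so an equivariant map may be prescribed on these
  representatives and transported by \<open>hd t\<close>.\<close>

definition nt where "nt t = mv (inv\<^bsub>G\<^esub> (hd t)) t"
abbreviation del where "del \<equiv> frag_extend bd"

lemmas e_diff = additive_diff[of "e m" for m, OF e_add] and D_diff = additive_diff[of "D m" for m, OF D_add]

lemma one_closed: "one \<in> carrier G"
  by (rule monoid.one_closed[OF group.is_monoid[OF grp]])

lemma T_diff: "T g (x - y) = T g x - T g y" and T_zero: "T g 0 = 0" and T_of: "T g (frag_of t) = frag_of (mv g t)"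
  by (simp_all add: T_def frag_extend_diff)

lemma mv_mult: "g \<in> carrier G \<Longrightarrow> h \<in> carrier G \<Longrightarrow> mv (g \<otimes>\<^bsub>G\<^esub> h) t = mv g (mv h t)"
  by (simp add: mv_def left_mul(1)[OF grp])

lemma mv_one: "mv one t = t"
  by (simp add: mv_def left_mul(2)[OF grp] map_idI)

lemma T_mult: "g \<in> carrier G \<Longrightarrow> h \<in> carrier G \<Longrightarrow> T (g \<otimes>\<^bsub>G\<^esub> h) x = T g (T h x)"
  by (rule frag_agree[of x UNIV]) (simp_all add: T_diff T_of mv_mult)

lemma T_del: "del (T g x) = T g (del x)"
  by (rule frag_agree[of x UNIV]) (simp_all add: T_diff frag_extend_diff T_of, simp add: T_def mv_def bd_map)

lemma mv_L: "g \<in> carrier G \<Longrightarrow> mv g t \<in> L m \<longleftrightarrow> t \<in> L m"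
  using left_mul(4)[OF grp, of g] by (auto simp: mv_def)

lemma hd_L: "t \<in> L (Suc m) \<Longrightarrow> hd t \<in> carrier G"
  by (cases t) auto

lemma nt_L: assumes t: "t \<in> L (Suc m)" shows "nt t \<in> L (Suc m)"
  unfolding nt_def mv_L[OF group.inv_closed[OF grp hd_L[OF t]]] by (rule t)

lemma mv_nt: assumes t: "t \<in> L (Suc m)" shows "mv (hd t) (nt t) = t"
  unfolding nt_def mv_mult[OF hd_L[OF t] group.inv_closed[OF grp hd_L[OF t]], symmetric]
    group.r_inv[OF grp hd_L[OF t]] by (rule mv_one)

lemma mv_move:
  assumes t: "t \<in> L (Suc m)" and g: "g \<in> carrier G"
  shows "hd (mv g t) = g \<otimes>\<^bsub>G\<^esub> hd t" "nt (mv g t) = nt t"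
proof -
  interpret group G by (rule grp)
  have "t \<noteq> []" using t by auto
  then show hd: "hd (mv g t) = g \<otimes>\<^bsub>G\<^esub> hd t"
    using hd_L[OF t] by (simp add: mv_def hd_map left_mul_def)
  have "inv\<^bsub>G\<^esub> (g \<otimes>\<^bsub>G\<^esub> hd t) \<otimes>\<^bsub>G\<^esub> g = inv\<^bsub>G\<^esub> (hd t)"
    using g hd_L[OF t] by (simp add: inv_mult_group m_assoc)
  then show "nt (mv g t) = nt t"
    unfolding nt_def hd using mv_mult[of "inv\<^bsub>G\<^esub> (g \<otimes>\<^bsub>G\<^esub> hd t)" g t] g hd_L[OF t] by simp
qed

lemma bd_L: assumes t: "t \<in> L (Suc m)" shows "Poly_Mapping.keys (bd t) \<subseteq> L m"
proof
  fix s assume "s \<in> Poly_Mapping.keys (bd t)"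
  then obtain i where i: "i < length t" "s = omit i t" using bd_keys by blast
  then show "s \<in> L m" using t set_omit[of i t] by (auto simp: length_omit)
qed

lemma del_L: "Poly_Mapping.keys c \<subseteq> L (Suc m) \<Longrightarrow> Poly_Mapping.keys (del c) \<subseteq> L m"
  by (rule keys_frag_extend_sub) (use bd_L in blast)

lemma T_L: "g \<in> carrier G \<Longrightarrow> Poly_Mapping.keys c \<subseteq> L m \<Longrightarrow> Poly_Mapping.keys (T g c) \<subseteq> L m"
  unfolding T_def by (rule keys_frag_extend_sub) (use mv_L in \<open>force simp: keys_frag_of\<close>)

lemma cone_L: "Poly_Mapping.keys c \<subseteq> L m \<Longrightarrow> Poly_Mapping.keys (cone one c) \<subseteq> L (Suc m)"
  unfolding cone_def by (rule keys_frag_extend_sub) (use one_closed in \<open>force simp: keys_frag_of\<close>)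

abbreviation u0 where "u0 \<equiv> frag_of (0, one)"

definition lift where "lift m z = (SOME y. e (Suc m) y = y \<and> D m y = z)"

text \<open>The comparison map from the standard resolution to the projective one, over the identity
  of the integers. On the representative \<open>nt t\<close> it is a lift provided by exactness;
  translation by \<open>hd t\<close> makes it equivariant.\<close>

primrec beta :: "nat \<Rightarrow> 'g list \<Rightarrow> nat \<times> 'g \<Rightarrow>\<^sub>0 int" where
  "beta 0 = (\<lambda>t. u0)"
| "beta (Suc m) = (\<lambda>t. act (Suc m) (hd t) (lift m (frag_extend (beta m) (bd (nt t)))))"

abbreviation bet where "bet m \<equiv> frag_extend (beta m)"

definition beta_ok where
  "beta_ok m \<longleftrightarrow> (\<forall>t\<in>L m. e m (beta m t) = beta m t) \<and>
     (\<forall>t\<in>L m. \<forall>g\<in>carrier G. beta m (mv g t) = act m g (beta m t))"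

lemma bet_e: "beta_ok m \<Longrightarrow> Poly_Mapping.keys c \<subseteq> L m \<Longrightarrow> e m (bet m c) = bet m c"
  by (rule frag_agree[of c "L m"]) (simp_all add: e_diff frag_extend_diff beta_ok_def)

lemma bet_T: "beta_ok m \<Longrightarrow> g \<in> carrier G \<Longrightarrow> Poly_Mapping.keys c \<subseteq> L m \<Longrightarrow> bet m (T g c) = act m g (bet m c)"
  by (rule frag_agree[of c "L m"]) (simp_all add: T_diff frag_extend_diff lact(1)[OF grp] T_of beta_ok_def)

lemma bet_D:
  assumes "\<And>t. t \<in> L (Suc m) \<Longrightarrow> D m (beta (Suc m) t) = bet m (bd t)" and "Poly_Mapping.keys c \<subseteq> L (Suc m)"
  shows "D m (bet (Suc m) c) = bet m (del c)"
  by (rule frag_agree[OF assms(2)]) (simp_all only: D_diff frag_extend_diff frag_extend_of assms(1))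

text \<open>A lift exists because \<open>bet m (bd t)\<close> is fixed by \<open>e m\<close> and, by
  the chain map property one level lower, is killed by the differential. At level 0 surjectivity of
  the augmentation takes the place of exactness.\<close>

lemma beta_step:
  assumes ok: "beta_ok m"
    and D: "\<And>n t. m = Suc n \<Longrightarrow> t \<in> L m \<Longrightarrow> D n (beta m t) = bet n (bd t)"
  shows "beta_ok (Suc m)" and "t \<in> L (Suc m) \<Longrightarrow> D m (beta (Suc m) t) = bet m (bd t)"
proof -
  have lift: "e (Suc m) (lift m (bet m (bd t))) = lift m (bet m (bd t)) \<and> D m (lift m (bet m (bd t))) = bet m (bd t)"
    if t: "t \<in> L (Suc m)" for t
  proof -
    have ez: "e m (bet m (bd t)) = bet m (bd t)" by (rule bet_e[OF ok bd_L[OF t]])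
    have "\<exists>y. e (Suc m) y = y \<and> D m y = bet m (bd t)"
    proof (cases m)
      case 0
      then show ?thesis using surj[of "bet m (bd t)"] ez by simp
    next
      case (Suc n)
      have "D n (bet (Suc n) (bd t)) = bet n (del (bd t))"
        by (rule bet_D[OF _ bd_L[OF t[unfolded Suc]]]) (rule D[OF Suc, unfolded Suc])
      then have "D n (bet (Suc n) (bd t)) = 0" by (simp add: bd_bd)
      then show ?thesis using exact[of n "bet m (bd t)"] ez unfolding Suc by blast
    qed
    then show ?thesis unfolding lift_def by (rule someI_ex)
  qed
  show "D m (beta (Suc m) t) = bet m (bd t)" if t: "t \<in> L (Suc m)" for t
  proof -
    have "D m (beta (Suc m) t) = act m (hd t) (bet m (bd (nt t)))"
      using lift[OF nt_L[OF t]] by (simp add: D_eq[OF hd_L[OF t]])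
    also have "\<dots> = bet m (T (hd t) (bd (nt t)))"
      by (rule bet_T[OF ok hd_L[OF t] bd_L[OF nt_L[OF t]], symmetric])
    also have "T (hd t) (bd (nt t)) = bd (mv (hd t) (nt t))"
      using T_del[of "hd t" "frag_of (nt t)"] by (simp add: T_of)
    finally show ?thesis by (simp only: mv_nt[OF t])
  qed
  show "beta_ok (Suc m)"
    unfolding beta_ok_def
  proof (intro conjI ballI)
    fix t assume t: "t \<in> L (Suc m)"
    show "e (Suc m) (beta (Suc m) t) = beta (Suc m) t"
      using lift[OF nt_L[OF t]] by (simp add: e_eq[OF hd_L[OF t]])
    show "beta (Suc m) (mv g t) = act (Suc m) g (beta (Suc m) t)" if g: "g \<in> carrier G" for g
      by (simp add: mv_move[OF t g] lact(2)[OF grp g hd_L[OF t]])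
  qed
qed

lemma beta_facts: "beta_ok m" and beta_D: "t \<in> L (Suc m) \<Longrightarrow> D m (beta (Suc m) t) = bet m (bd t)"
proof -
  have 0: "beta_ok 0" by (auto simp: beta_ok_def e_0 mv_def lact_def lookup_frag_of)
  have C: "beta_ok m \<and> (\<forall>n t. m = Suc n \<longrightarrow> t \<in> L m \<longrightarrow> D n (beta m t) = bet n (bd t))" for m
  proof (induction m)
    case 0
    show ?case using \<open>beta_ok 0\<close> by simp
  next
    case (Suc m)
    have IH: "D n (beta m t) = bet n (bd t)" if "m = Suc n" "t \<in> L m" for n t using Suc.IH that by blast
    have "beta_ok (Suc m)" by (rule beta_step(1)[OF conjunct1[OF Suc.IH] IH])
    moreover have "D m (beta (Suc m) t) = bet m (bd t)" if t: "t \<in> L (Suc m)" for t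
      by (rule beta_step(2)[OF conjunct1[OF Suc.IH] IH t])
    ultimately show ?case by blast
  qed
  show "beta_ok m" using C by blast
  show "t \<in> L (Suc m) \<Longrightarrow> D m (beta (Suc m) t) = bet m (bd t)" using C[of "Suc m"] by blast
qed

text \<open>The comparison map in the other direction. A generator goes to the cone over the value
  already fixed for its boundary, translates follow by equivariance, and \<open>e\<close> restricts
  the result to the projective module.\<close>

primrec alpha :: "nat \<Rightarrow> (nat \<times> 'g \<Rightarrow>\<^sub>0 int) \<Rightarrow> 'g list \<Rightarrow>\<^sub>0 int" where
  "alpha 0 = (\<lambda>y. frag_extend (\<lambda>_. frag_of []) (e 0 y))"
| "alpha (Suc m) = (\<lambda>y. frag_extend (\<lambda>(l, h). if h \<in> carrier G
     then T h (cone one (alpha m (D m (frag_of (l, one))))) else 0) (e (Suc m) y))"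

text \<open>The chain assigned to the generator number \<open>l\<close>. Each level has finitely
  many generators, and the values of \<open>alpha\<close> at the next level are combinations of
  translates of these chains: here finite generation becomes effective.\<close>

definition gen where "gen m l = cone one (alpha m (D m (frag_of (l, one))))"
definition av where "av m = (\<lambda>(l, h). if h \<in> carrier G then T h (gen m l) else 0)"

lemma alpha_Suc: "alpha (Suc m) y = frag_extend (av m) (e (Suc m) y)"
  unfolding alpha.simps av_def gen_def by (rule refl)

lemma alpha_diff: "alpha m (x - y) = alpha m x - alpha m y"
  by (cases m) (simp_all only: alpha_Suc alpha.simps(1) e_diff frag_extend_diff)

lemma alpha_zero: "alpha m 0 = 0"
  using alpha_diff[of m 0 0] by simp

lemma av_act:
  assumes g: "g \<in> carrier G" shows "frag_extend (av m) (act1 G g y) = T g (frag_extend (av m) y)"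
proof (rule frag_agree[of y UNIV])
  fix z :: "nat \<times> 'g"
  obtain l h where z: "z = (l, h)" by (cases z)
  show "frag_extend (av m) (act1 G g (frag_of z)) = T g (frag_extend (av m) (frag_of z))"
    using left_mul(4)[OF grp g, of h] by (auto simp: z act1_def av_def T_zero left_mul_def T_mult[OF g])
qed (simp_all add: act1_def frag_extend_diff T_diff)

lemma alpha_act: assumes g: "g \<in> carrier G" shows "alpha m (act m g y) = T g (alpha m y)"
proof (cases m)
  case 0
  have "frag_extend (\<lambda>_. frag_of []) (e 0 y) = T g (frag_extend (\<lambda>_. frag_of []) (e 0 y))"
    by (rule frag_agree[of "e 0 y" UNIV]) (simp_all add: frag_extend_diff T_diff T_of mv_def)
  then show ?thesis by (simp add: 0 lact_def)
next
  case (Suc n)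
  show ?thesis unfolding Suc alpha_Suc e_eq[OF g] av_act[OF g, symmetric] by (simp add: lact_def)
qed

lemma alpha_L: "Poly_Mapping.keys (alpha m y) \<subseteq> L m"
proof (induction m arbitrary: y)
  case 0
  show ?case unfolding alpha.simps(1) by (rule keys_frag_extend_sub) (simp add: keys_frag_of)
next
  case (Suc m)
  have "Poly_Mapping.keys (av m x) \<subseteq> L (Suc m)" for x
    by (cases x) (use T_L[OF _ cone_L[OF Suc.IH]] in \<open>simp add: av_def gen_def\<close>)
  then show ?case unfolding alpha_Suc by (rule keys_frag_extend_sub)
qed

lemma gen_L: "Poly_Mapping.keys (gen m l) \<subseteq> L (Suc m)"
  unfolding gen_def by (rule cone_L[OF alpha_L])

lemma cone_zero: "cone a 0 = 0" by (simp add: cone_def)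

text \<open>By \<open>bd_cone\<close> the boundary of \<open>gen m l\<close> is the chain that was
  coned off, minus the cone over the boundary of that chain. The latter is zero by the formula one
  level lower and \<open>D_D\<close>; equivariance covers the translates.\<close>

lemma alpha_del: "del (alpha (Suc m) y) = alpha m (D m y)"
proof (induction m arbitrary: y)
  have step: "del (alpha (Suc m) y) = alpha m (D m y)" if c: "\<And>x. del (alpha m (D m x)) = 0" for m y
  proof -
    have "del (frag_extend (av m) (e (Suc m) y)) = alpha m (D m (e (Suc m) y))"
    proof (rule frag_agree[of "e (Suc m) y" "{..<k (Suc m)} \<times> carrier G"])
      fix z assume "z \<in> {..<k (Suc m)} \<times> carrier G"
      then obtain l h where z: "z = (l, h)" and h: "h \<in> carrier G" by auto
      have "act (Suc m) h (frag_of (l, one)) = frag_of z"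
        using group.is_monoid[OF grp] h by (simp add: z lact_def act1_def left_mul_def one_closed monoid.r_one)
      then have "alpha m (D m (frag_of z)) = T h (alpha m (D m (frag_of (l, one))))"
        using D_eq[OF h, of m "frag_of (l, one)"] alpha_act[OF h] by simp
      then show "del (frag_extend (av m) (frag_of z)) = alpha m (D m (frag_of z))"
        using h by (simp add: z av_def gen_def T_del bd_cone c cone_zero)
    qed (simp_all only: frag_extend_diff D_diff alpha_diff keys)
    then show ?thesis unfolding alpha_Suc D_e .
  qed
  {
    case 0
    have "del (frag_extend (\<lambda>_. frag_of []) x) = 0" for x :: "nat \<times> 'g \<Rightarrow>\<^sub>0 int"
      by (rule frag_agree[of x UNIV]) (simp_all add: frag_extend_diff bd_def)
    then show ?case by (intro step) simp
  next
    case (Suc m)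
    show ?case by (rule step) (simp only: Suc.IH D_D alpha_zero)
  }
qed

text \<open>The round trip through the projective resolution, an endomorphism of the standard
  resolution that the homotopy below compares with the identity.\<close>

definition gam where "gam m c = alpha m (bet m c)"

lemma gam_diff: "gam m (x - y) = gam m x - gam m y"
  by (simp add: gam_def frag_extend_diff alpha_diff)

lemma gam_T: "g \<in> carrier G \<Longrightarrow> Poly_Mapping.keys c \<subseteq> L m \<Longrightarrow> gam m (T g c) = T g (gam m c)"
  by (simp only: gam_def bet_T[OF beta_facts] alpha_act)

lemma gam_del: "Poly_Mapping.keys c \<subseteq> L (Suc m) \<Longrightarrow> del (gam (Suc m) c) = gam m (del c)"
  by (simp only: gam_def alpha_del bet_D[OF beta_D])

text \<open>On tuples starting with \<open>\<one>\<close>, coning off with \<open>\<one>\<close> contracts the standard resolution; equivariance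
  forces the values on all other tuples.\<close>

primrec hh :: "nat \<Rightarrow> 'g list \<Rightarrow> 'g list \<Rightarrow>\<^sub>0 int" where
  "hh 0 = (\<lambda>t. 0)"
| "hh (Suc m) = (\<lambda>t. T (hd t) (cone one (frag_of (nt t) - gam (Suc m) (frag_of (nt t)) - frag_extend (hh m) (bd (nt t)))))"

abbreviation HH where "HH m \<equiv> frag_extend (hh m)"

text \<open>What the homotopy at the next level has to bound; on a tuple it is a cycle by the
  homotopy formula one level lower.\<close>

definition ww where "ww m c = c - gam (Suc m) c - HH m (del c)"

lemma hh_Suc: "hh (Suc m) t = T (hd t) (cone one (ww m (frag_of (nt t))))"
  by (simp add: ww_def)

lemma hh_mv: "t \<in> L m \<Longrightarrow> g \<in> carrier G \<Longrightarrow> hh m (mv g t) = T g (hh m t)"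
proof (cases m)
  case (Suc n)
  assume t: "t \<in> L m" and g: "g \<in> carrier G"
  note t' = t[unfolded Suc]
  show ?thesis unfolding Suc hh_Suc mv_move[OF t' g] by (rule T_mult[OF g hd_L[OF t']])
qed (simp add: T_zero)

lemma HH_T: "g \<in> carrier G \<Longrightarrow> Poly_Mapping.keys c \<subseteq> L m \<Longrightarrow> HH m (T g c) = T g (HH m c)"
  by (rule frag_agree[of c "L m"]) (simp_all only: T_diff frag_extend_diff T_of frag_extend_of hh_mv)

lemma ww_T: assumes g: "g \<in> carrier G" and c: "Poly_Mapping.keys c \<subseteq> L (Suc m)" shows "ww m (T g c) = T g (ww m c)"
  by (simp only: ww_def T_diff gam_T[OF g c] T_del HH_T[OF g del_L[OF c]])

lemma hh_L: "t \<in> L m \<Longrightarrow> Poly_Mapping.keys (hh m t) \<subseteq> L (Suc m)"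
proof (induction m arbitrary: t)
  case (Suc m)
  let ?u = "nt t"
  have u: "?u \<in> L (Suc m)" by (rule nt_L[OF Suc.prems])
  have 1: "Poly_Mapping.keys (frag_of ?u) \<subseteq> L (Suc m)" using u by (simp add: keys_frag_of)
  have 2: "Poly_Mapping.keys (gam (Suc m) (frag_of ?u)) \<subseteq> L (Suc m)" unfolding gam_def by (rule alpha_L)
  have 3: "Poly_Mapping.keys (HH m (del (frag_of ?u))) \<subseteq> L (Suc m)"
    by (rule keys_frag_extend_sub[OF Suc.IH]) (use del_L[OF 1] in blast)
  have "Poly_Mapping.keys (ww m (frag_of ?u)) \<subseteq> L (Suc m)"
    unfolding ww_def using keys_diff[of "frag_of ?u - gam (Suc m) (frag_of ?u)" "HH m (del (frag_of ?u))"]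
      keys_diff[of "frag_of ?u" "gam (Suc m) (frag_of ?u)"] 1 2 3 by blast
  then show ?case unfolding hh_Suc by (intro T_L[OF hd_L[OF Suc.prems]] cone_L)
qed simp

text \<open>On \<open>nt t\<close> the chain \<open>ww m\<close> is a cycle, so it is the boundary
  of its cone, and equivariance carries this to \<open>t\<close>. At the bottom \<open>hh 0\<close>
  is zero and \<open>gam 0\<close> fixes the empty list.\<close>

lemma homotopy: "t \<in> L (Suc m) \<Longrightarrow> del (hh (Suc m) t) = frag_of t - gam (Suc m) (frag_of t) - HH m (bd t)"
proof (induction m arbitrary: t)
  have step: "del (hh (Suc m) t) = frag_of t - gam (Suc m) (frag_of t) - HH m (bd t)"
    if t: "t \<in> L (Suc m)" and h: "\<And>u. u \<in> L (Suc m) \<Longrightarrow> del (HH m (bd u)) = bd u - gam m (bd u)" for m t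
  proof -
    let ?u = "nt t"
    have u: "?u \<in> L (Suc m)" by (rule nt_L[OF t])
    have k: "Poly_Mapping.keys (frag_of ?u) \<subseteq> L (Suc m)" using u by (simp add: keys_frag_of)
    have "del (ww m (frag_of ?u)) = bd ?u - gam m (bd ?u) - del (HH m (bd ?u))"
      by (simp only: ww_def frag_extend_diff gam_del[OF k] frag_extend_of)
    also have "\<dots> = 0" unfolding h[OF u] by simp
    finally have "del (hh (Suc m) t) = T (hd t) (ww m (frag_of ?u))"
      by (simp only: hh_Suc T_del bd_cone cone_zero diff_zero)
    also have "\<dots> = ww m (frag_of t)"
      by (simp only: ww_T[OF hd_L[OF t] k, symmetric] T_of mv_nt[OF t])
    finally show ?thesis by (simp only: ww_def frag_extend_of)
  qed
  {
    case 0
    have "del (HH 0 (bd u)) = bd u - gam 0 (bd u)" if u: "u \<in> L (Suc 0)" for u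
    proof -
      obtain x where "u = [x]" using u by (cases u) auto
      then have "bd u = frag_of []" by (simp add: bd_def omit_def)
      then show ?thesis by (simp add: gam_def e_0 frag_extend_eq_0)
    qed
    then show ?case by (rule step[OF 0])
  next
    case (Suc m)
    have "del (HH (Suc m) (bd u)) = bd u - gam (Suc m) (bd u)" if u: "u \<in> L (Suc (Suc m))" for u
    proof -
      have "del (HH (Suc m) (bd u)) = bd u - gam (Suc m) (bd u) - HH m (del (bd u))"
        by (rule frag_agree[OF bd_L[OF u]]) (simp_all only: frag_extend_diff gam_diff frag_extend_of Suc.IH, simp_all add: algebra_simps)
      then show ?thesis by (simp add: bd_bd)
    qed
    then show ?case by (rule step[OF Suc.prems])
  }
qed

end

section \<open>Finite dimensionality of the cohomology\<close>

lemma ext_fun_add: "ext (\<lambda>t. f t + g t) x = ext f x + ext g x"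
  by (simp only: ext_def fv.scale_right_distrib sum.distrib)

lemma ext_fun_scl: "ext (\<lambda>t. q *q f t) x = q *q ext f x"
  by (simp only: ext_def fv.scale_sum_right fv.scale_scale mult.commute)

text \<open>A basis of the image of \<open>\<psi>\<close> lifts to finitely many elements of
  \<open>Z\<close>. Every \<open>f\<close> differs from a combination of the lifts by an element
  killed by \<open>\<psi>\<close>, hence by \<open>h\<close>, so the images of the lifts span
  \<open>H\<close>.\<close>

lemma finite_dim_quotient:
  fixes \<psi> :: "'z \<Rightarrow> 'i \<Rightarrow> rat"
  assumes Z: "vectorspace rat_field Z" and H: "vectorspace rat_field H" and h: "h \<in> hom Z H"
    and onto: "carrier H = h ` carrier Z" and psi: "\<psi> \<in> hom Z funs"
    and F: "finite F" and psiF: "\<psi> ` carrier Z \<subseteq> fv.span F"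
    and ker: "\<And>f. f \<in> carrier Z \<Longrightarrow> \<psi> f = 0 \<Longrightarrow> h f = \<zero>\<^bsub>H\<^esub>"
  shows "finite_dim H"
proof -
  interpret H: vectorspace rat_field H by (rule H)
  note zf = vs_facts[OF Z]
  obtain B where B: "B \<subseteq> \<psi> ` carrier Z" "fv.independent B" "\<psi> ` carrier Z \<subseteq> fv.span B"
    using fv.maximal_independent_subset by blast
  have fB: "finite B" using fv.independent_span_bound[OF F B(2)] B(1) psiF by blast
  define g where "g = inv_into (carrier Z) \<psi>"
  have g: "g b \<in> carrier Z" "\<psi> (g b) = b" if "b \<in> B" for b
    using B(1) that inv_into_into[of b \<psi> "carrier Z"] f_inv_into_f[of b \<psi> "carrier Z"] by (auto simp: g_def)
  let ?S = "h ` g ` B"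
  have SH: "?S \<subseteq> carrier H" using g(1) onto by blast
  note sub = H.span_is_submodule[OF SH]
  have "x \<in> H.span ?S" if x: "x \<in> carrier H" for x
  proof -
    obtain f where f: "x = h f" "f \<in> carrier Z" using x unfolding onto by (rule imageE)
    have "\<psi> f \<in> fv.span B" using B(3) f(2) by blast
    then obtain q where q: "\<psi> f = (\<Sum>b\<in>B. q b *q b)" using fv.span_finite[OF fB] by auto
    let ?m = "\<lambda>b. q b \<odot>\<^bsub>Z\<^esub> g b"
    have m: "?m \<in> B \<rightarrow> carrier Z" using g(1) zf(3) by blast
    define f' where "f' = finsum Z ?m B"
    have f': "f' \<in> carrier Z" unfolding f'_def
      by (rule abelian_monoid.finsum_closed[OF abelian_group.axioms(1)[OF zf(7)] m])
    have "\<psi> f' = (\<Sum>b\<in>B. \<psi> (?m b))"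
      unfolding f'_def hom_finsum[OF Z funs_vs psi m] by (rule finsum_funs)
    also have "\<dots> = \<psi> f" unfolding q
      by (rule sum.cong[OF refl]) (simp only: homD(3)[OF psi g(1)] g(2) funs_simps)
    finally have eq: "\<psi> f' = \<psi> f" .
    have n: "(-1) \<odot>\<^bsub>Z\<^esub> f' \<in> carrier Z" by (rule zf(3)[OF f'])
    have "\<psi> (f \<oplus>\<^bsub>Z\<^esub> (-1) \<odot>\<^bsub>Z\<^esub> f') = 0"
      unfolding homD(2)[OF psi f(2) n] homD(3)[OF psi f'] eq by (simp add: fun_eq_iff)
    then have "h (f \<oplus>\<^bsub>Z\<^esub> (-1) \<odot>\<^bsub>Z\<^esub> f') = \<zero>\<^bsub>H\<^esub>" by (rule ker[OF zf(8)[OF f(2) n]])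
    then have "h f \<oplus>\<^bsub>H\<^esub> \<ominus>\<^bsub>H\<^esub> h f' = \<zero>\<^bsub>H\<^esub>"
      by (simp only: homD(2)[OF h f(2) n] homD(3)[OF h f'] vs_facts(6)[OF H homD(1)[OF h f']])
    then have "x = h f'" unfolding f(1)
      using H.minus_equality[of "h f" "\<ominus>\<^bsub>H\<^esub> h f'"] homD(1)[OF h] f(2) f' by simp
    also have "\<dots> = finsum H (\<lambda>b. h (?m b)) B" unfolding f'_def by (rule hom_finsum[OF Z H h m])
    also have "\<dots> \<in> H.span ?S"
    proof -
      have "finsum H (\<lambda>b. h (?m b)) B' \<in> H.span ?S" if "finite B'" "B' \<subseteq> B" for B'
        using that
      proof (induction B' rule: finite_induct)
        case empty
        show ?case using submodule.zero_closed[OF sub] by (simp add: submodule_def subgroup.one_closed)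
      next
        case (insert b B')
        have hb: "h (?m b) \<in> H.span ?S"
        proof -
          have "h (g b) \<in> H.span ?S" using H.in_own_span[OF SH] insert.prems by blast
          then show ?thesis using submodule.smult_closed[OF sub, of "q b" "h (g b)"] insert.prems
            by (simp add: homD(3)[OF h g(1)])
        qed
        have c: "(\<lambda>b. h (?m b)) \<in> insert b B' \<rightarrow> carrier H" using m homD(1)[OF h] insert.prems by blast
        have "finsum H (\<lambda>b. h (?m b)) (insert b B') = h (?m b) \<oplus>\<^bsub>H\<^esub> finsum H (\<lambda>b. h (?m b)) B'"
          using insert.hyps c by (intro H.finsum_insert) auto
        then show ?case using submodule.m_closed[OF sub hb] insert by simp
      qed
      then show ?thesis using fB by blast
    qed
    finally show ?thesis .
  qed
  moreover have "H.span ?S \<subseteq> carrier H" using SH by (auto simp: H.span_def)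
  ultimately have eq: "H.span ?S = carrier H" by blast
  have "finite ?S" using fB by simp
  then show ?thesis unfolding finite_dim_def H.fin_dim_def by (intro conjI H exI[of _ ?S] SH eq)
qed

text \<open>The values of a cocycle on the generators of \<open>P\<^sub>p\<close> form a vector \<open>\<psi> f\<close> of bounded length, and the
  homotopy shows that a cocycle with \<open>\<psi> f = 0\<close> is a coboundary.\<close>

theorem finite_dim_cohomology:
  fixes V :: "(rat, 'v) module" and G :: "('g, 'm) monoid_scheme"
  assumes coh: "coh V crd vec d G \<gamma>" and fc: "frag_complex G k e D"
  shows "finite_dim (cohomology G V \<gamma> p)"
proof -
  interpret coh V crd vec d G \<gamma> by (rule coh)
  interpret P: frag_complex G k e D by (rule fc)
  have tupL: "tup q = P.L (Suc q)" for q by (auto simp: tuples_def)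
  have tr: "P.mv g t = tr_left g t" if "t \<in> tup q" for g t q
    using that by (auto simp: P.mv_def tr_left_def left_mul_def tuples_def)
  define E where "E f = ext (\<lambda>t. crd (f t))" for f :: "'g list \<Rightarrow> 'v"
  \<comment> \<open>The value of a cochain on a chain is computed in coordinates. It is the
    coordinate vector of an actual element of \<open>V\<close>, on which the group acts as it does
    on the chain.\<close>
  have ev: "\<exists>v\<in>carrier V. crd v = E f c \<and> (\<forall>g\<in>carrier G. crd (\<gamma> g v) = E f (P.T g c))"
    if f: "f \<in> carrier (C q)" and c: "Poly_Mapping.keys c \<subseteq> tup q" for f q c
    using c
  proof (induction c rule: frag_induction)
    case zero
    show ?case
    proof (intro bexI[of _ "\<zero>\<^bsub>V\<^esub>"] conjI ballI vs_facts(4)[OF V_vs])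
      fix g assume g: "g \<in> carrier G"
      show "crd (\<gamma> g \<zero>\<^bsub>V\<^esub>) = E f (P.T g 0)"
        unfolding hom_zero[OF V_vs V_vs gam_hom[OF g]] crd_zero P.T_zero E_def ext_zero by (rule refl)
    qed (simp only: crd_zero E_def ext_zero)
  next
    case (one t)
    show ?case
    proof (intro bexI[of _ "f t"] conjI ballI CD(1)[OF f one])
      fix g assume g: "g \<in> carrier G"
      show "crd (\<gamma> g (f t)) = E f (P.T g (frag_of t))"
        unfolding P.T_of E_def ext_of tr[OF one] CD(2)[OF f g one] by (rule refl)
    qed (simp only: E_def ext_of)
  next
    case (diff a b)
    then obtain v w where v: "v \<in> carrier V" "crd v = E f a" "\<And>g. g \<in> carrier G \<Longrightarrow> crd (\<gamma> g v) = E f (P.T g a)"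
      and w: "w \<in> carrier V" "crd w = E f b" "\<And>g. g \<in> carrier G \<Longrightarrow> crd (\<gamma> g w) = E f (P.T g b)" by blast
    have n: "(-1) \<odot>\<^bsub>V\<^esub> x \<in> carrier V" if "x \<in> carrier V" for x by (rule vs_facts(3)[OF V_vs that])
    have cd: "crd (x \<oplus>\<^bsub>V\<^esub> (-1) \<odot>\<^bsub>V\<^esub> y) = crd x - crd y" if "x \<in> carrier V" "y \<in> carrier V" for x y
      unfolding crd_add[OF that(1) n[OF that(2)]] crd_scl[OF that(2)] by (simp add: fun_eq_iff)
    show ?case
    proof (intro bexI[of _ "v \<oplus>\<^bsub>V\<^esub> (-1) \<odot>\<^bsub>V\<^esub> w"] conjI ballI vs_facts(8)[OF V_vs v(1) n[OF w(1)]])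
      show "crd (v \<oplus>\<^bsub>V\<^esub> (-1) \<odot>\<^bsub>V\<^esub> w) = E f (a - b)"
        unfolding cd[OF v(1) w(1)] v(2) w(2) E_def ext_diff by (rule refl)
      fix g assume g: "g \<in> carrier G"
      note gh = homD[OF gam_hom[OF g]]
      show "crd (\<gamma> g (v \<oplus>\<^bsub>V\<^esub> (-1) \<odot>\<^bsub>V\<^esub> w)) = E f (P.T g (a - b))"
        unfolding gh(2)[OF v(1) n[OF w(1)]] gh(3)[OF w(1)] cd[OF gh(1)[OF v(1)] gh(1)[OF w(1)]]
          v(3)[OF g] w(3)[OF g] P.T_diff E_def ext_diff by (rule refl)
    qed
  qed
  let ?kk = "k (Suc p)"
  define \<psi> where "\<psi> f = (\<lambda>(l, i). if l < ?kk then E f (P.gen p l) i else 0)" for f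
  have genL: "Poly_Mapping.keys (P.gen p l) \<subseteq> tup p" for l unfolding tupL by (rule P.gen_L)
  have ZC: "f \<in> carrier (C p)" if "f \<in> Z p" for f using that Z_sub by blast
  have psi: "\<psi> \<in> hom (Zr p) funs"
  proof (rule homI)
    fix f f' assume "f \<in> carrier (Zr p)" "f' \<in> carrier (Zr p)"
    then have f: "f \<in> carrier (C p)" and f': "f' \<in> carrier (C p)" using ZC by simp_all
    have "E (f \<oplus>\<^bsub>C p\<^esub> f') (P.gen p l) = E f (P.gen p l) + E f' (P.gen p l)" for l
      unfolding E_def ext_fun_add[symmetric]
    proof (rule ext_cong)
      fix t assume "t \<in> Poly_Mapping.keys (P.gen p l)"
      then have t: "t \<in> tup p" using genL by blast
      show "crd ((f \<oplus>\<^bsub>C p\<^esub> f') t) = crd (f t) + crd (f' t)"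
        using t by (simp only: C_add restrict_apply' crd_add[OF CD(1)[OF f t] CD(1)[OF f' t]])
    qed
    then show "\<psi> (f \<oplus>\<^bsub>Zr p\<^esub> f') = \<psi> f \<oplus>\<^bsub>funs\<^esub> \<psi> f'" by (auto simp: \<psi>_def)
  next
    fix c f assume "f \<in> carrier (Zr p)"
    then have f: "f \<in> carrier (C p)" using ZC by simp
    have "E (c \<odot>\<^bsub>C p\<^esub> f) (P.gen p l) = c *q E f (P.gen p l)" for l
      unfolding E_def ext_fun_scl[symmetric]
    proof (rule ext_cong)
      fix t assume "t \<in> Poly_Mapping.keys (P.gen p l)"
      then have t: "t \<in> tup p" using genL by blast
      show "crd ((c \<odot>\<^bsub>C p\<^esub> f) t) = c *q crd (f t)"
        using t by (simp only: C_scl restrict_apply' crd_scl[OF CD(1)[OF f t]])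
    qed
    then show "\<psi> (c \<odot>\<^bsub>Zr p\<^esub> f) = c \<odot>\<^bsub>funs\<^esub> \<psi> f" by (auto simp: \<psi>_def)
  qed simp
  let ?F = "delta ` ({..<?kk} \<times> {..<d})"
  have span: "\<psi> ` carrier (Zr p) \<subseteq> fv.span ?F"
  proof
    fix x assume "x \<in> \<psi> ` carrier (Zr p)"
    then obtain f where f: "x = \<psi> f" "f \<in> carrier (C p)" using ZC by auto
    have b: "E f (P.gen p l) i = 0" if "i \<ge> d" for l i
      using ev[OF f(2) genL[of l]] bound[OF _ that] by metis
    have "x = (\<Sum>y\<in>{..<?kk} \<times> {..<d}. x y *q delta y)"
    proof
      fix y
      have "(\<Sum>y\<in>{..<?kk} \<times> {..<d}. x y *q delta y) y = (\<Sum>z\<in>{..<?kk} \<times> {..<d}. if z = y then x z else 0)"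
        unfolding sum_fun_apply by (rule sum.cong) (auto simp: delta_def)
      also have "\<dots> = x y" using b by (cases y) (auto simp: f(1) \<psi>_def not_less)
      finally show "x y = (\<Sum>y\<in>{..<?kk} \<times> {..<d}. x y *q delta y) y" by (rule sym)
    qed
    also have "\<dots> \<in> fv.span ?F" by (intro fv.span_sum fv.span_scale fv.span_base) simp
    finally show "x \<in> fv.span ?F" .
  qed
  have ker: "f \<in> B p" if f: "f \<in> Z p" and p0: "\<psi> f = 0" for f
  proof -
    have fC: "f \<in> carrier (C p)" by (rule ZC[OF f])
    have gen0: "E f (P.gen p l) = 0" if l: "l < ?kk" for l
    proof
      fix i show "E f (P.gen p l) i = 0 i" using fun_cong[OF p0, of "(l, i)"] l by (simp add: \<psi>_def)
    qed
    \<comment> \<open>\<open>\<psi>\<close> records the values on the generators only; equivariance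
      of \<open>f\<close> carries the vanishing to all their translates.\<close>
    have T0: "E f (P.T g (P.gen p l)) = 0" if l: "l < ?kk" and g: "g \<in> carrier G" for l g
    proof -
      obtain v where v: "v \<in> carrier V" "crd v = E f (P.gen p l)" "crd (\<gamma> g v) = E f (P.T g (P.gen p l))"
        using ev[OF fC genL] g by blast
      have "v = \<zero>\<^bsub>V\<^esub>"
        by (rule crd_inj[OF v(1) vs_facts(4)[OF V_vs]]) (simp only: v(2) gen0[OF l] crd_zero)
      then show ?thesis using v(3) hom_zero[OF V_vs V_vs gam_hom[OF g]] crd_zero by simp
    qed
    \<comment> \<open>The round trip passes through the projective module, so its values are
      combinations of translates of the chains on which \<open>f\<close> vanishes.\<close>
    have gam0: "E f (P.gam (Suc p) (frag_of t)) = 0" if t: "t \<in> tup p" for t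
    proof -
      let ?y = "P.beta (Suc p) t"
      have y: "e (Suc p) ?y = ?y" using P.beta_facts[of "Suc p"] t unfolding P.beta_ok_def tupL by blast
      have "P.gam (Suc p) (frag_of t) = frag_extend (P.av p) ?y"
        by (simp only: P.gam_def frag_extend_of P.alpha_Suc y)
      then have "E f (P.gam (Suc p) (frag_of t)) = ext (\<lambda>x. E f (P.av p x)) ?y"
        by (simp only: E_def ext_frag_extend)
      also have "\<dots> = ext (\<lambda>x. 0) ?y"
      proof (rule ext_cong)
        fix x assume "x \<in> Poly_Mapping.keys ?y"
        then have "x \<in> {..<?kk} \<times> carrier G" using P.keys[of "Suc p" ?y] unfolding y by blast
        then show "E f (P.av p x) = 0" using T0 by (auto simp: P.av_def)
      qed
      also have "\<dots> = 0" by (simp add: ext_def)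
      finally show ?thesis .
    qed
    have del0: "E f (P.del c) = 0" if c: "Poly_Mapping.keys c \<subseteq> tup (Suc p)" for c
    proof -
      have "E f (P.del c) = ext (\<lambda>s. E f (bd s)) c" by (simp only: E_def ext_frag_extend)
      also have "\<dots> = ext (\<lambda>s. 0) c"
      proof (rule ext_cong)
        fix s assume "s \<in> Poly_Mapping.keys c"
        then have s: "s \<in> tup (Suc p)" using c by blast
        have "E f (bd s) = crd (cobd p f s)" unfolding E_def by (rule crd_cobd[OF CF[OF fC] s, symmetric])
        also have "cobd p f s = \<zero>\<^bsub>V\<^esub>" using f s by (simp add: cocycles_def C_zero)
        finally show "E f (bd s) = 0" by (simp only: crd_zero)
      qed
      also have "\<dots> = 0" by (simp add: ext_def)
      finally show ?thesis .
    qed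
    \<comment> \<open>The homotopy formula evaluated on \<open>f\<close>: the boundary term is zero
      since \<open>f\<close> is a cocycle, and the \<open>P.gam\<close> term is zero since
      \<open>\<psi> f = 0\<close>.\<close>
    have main: "crd (f t) = E f (P.HH p (bd t))" if t: "t \<in> tup p" for t
    proof -
      have t': "t \<in> P.L (Suc p)" using t by (simp only: tupL)
      have k: "Poly_Mapping.keys (P.hh (Suc p) t) \<subseteq> tup (Suc p)" unfolding tupL by (rule P.hh_L[OF t'])
      have "E f (P.del (P.hh (Suc p) t)) = E f (frag_of t) - E f (P.gam (Suc p) (frag_of t)) - E f (P.HH p (bd t))"
        by (simp only: P.homotopy[OF t'] E_def ext_diff)
      then show ?thesis unfolding del0[OF k] gam0[OF t] by (simp add: E_def ext_of)
    qed
    show "f \<in> B p"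
    proof (cases p)
      \<comment> \<open>In degree 0 the homotopy term is zero, so \<open>main\<close> makes
        \<open>f\<close> the zero cochain, the only coboundary of that degree.\<close>
      case 0
      have "f = \<zero>\<^bsub>C p\<^esub>"
      proof (rule C_eqI[OF C_ext[OF fC]])
        fix t assume t: "t \<in> tup p"
        have "crd (f t) = 0" unfolding main[OF t] by (simp add: 0 frag_extend_eq_0 E_def ext_zero)
        then have "f t = \<zero>\<^bsub>V\<^esub>" by (intro crd_inj[OF CD(1)[OF fC t] vs_facts(4)[OF V_vs]]) (simp only: crd_zero)
        then show "f t = \<zero>\<^bsub>C p\<^esub> t" using t by (simp add: C_zero)
      qed (simp add: C_zero)
      then show ?thesis by (simp add: 0)
    next
      case (Suc q)
      \<comment> \<open>\<open>f\<close> composed with the homotopy; by \<open>main\<close> its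
        coboundary is \<open>f\<close>. The degrees fit because \<open>P.hh p\<close> takes lists of
        length \<open>p = Suc q\<close>, which are the tuples of degree \<open>q\<close>.\<close>
      define b where "b = (\<lambda>s\<in>tup q. vec (E f (P.hh p s)))"
      have hL: "Poly_Mapping.keys (P.hh p s) \<subseteq> tup p" if s: "s \<in> tup q" for s
        using P.hh_L[of s p] s by (simp only: tupL Suc)
      have vb: "crd (vec (E f (P.hh p s))) = E f (P.hh p s)" if s: "s \<in> tup q" for s
        using ev[OF fC hL[OF s]] vec_crd by metis
      have bC: "b \<in> carrier (C q)"
        unfolding b_def
      proof (rule CI)
        show "vec (E f (P.hh p s)) \<in> carrier V" for s by (rule vec_closed)
        fix g s assume g: "g \<in> carrier G" and s: "s \<in> tup q"
        obtain v where v: "v \<in> carrier V" "crd v = E f (P.hh p s)" "crd (\<gamma> g v) = E f (P.T g (P.hh p s))"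
          using ev[OF fC hL[OF s]] g by blast
        have "P.hh p (tr_left g s) = P.T g (P.hh p s)"
          unfolding tr[OF s, symmetric] by (rule P.hh_mv[OF _ g]) (use s in \<open>simp only: tupL Suc\<close>)
        then show "vec (E f (P.hh p (tr_left g s))) = \<gamma> g (vec (E f (P.hh p s)))"
          by (simp only: v(2)[symmetric] v(3)[symmetric] vec_crd[OF v(1)] vec_crd[OF homD(1)[OF gam_hom[OF g] v(1)]])
      qed
      have "f = cobd q b"
      proof (rule C_eqI[OF C_ext[OF fC]])
        fix t assume t: "t \<in> tup p"
        have t': "t \<in> tup (Suc q)" using t by (simp only: Suc)
        have "crd (cobd q b t) = ext (\<lambda>s. crd (b s)) (bd t)" by (rule crd_cobd[OF CF[OF bC] t'])
        also have "\<dots> = ext (\<lambda>s. E f (P.hh p s)) (bd t)"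
        proof (rule ext_cong)
          fix s assume "s \<in> Poly_Mapping.keys (bd t)"
          then have s: "s \<in> tup q" using P.bd_L[of t p] t by (auto simp: tupL Suc)
          show "crd (b s) = E f (P.hh p s)" using s vb[OF s] by (simp add: b_def)
        qed
        also have "\<dots> = crd (f t)" unfolding main[OF t] by (simp only: E_def ext_frag_extend)
        finally show "f t = cobd q b t"
          by (intro crd_inj[OF CD(1)[OF fC t] cobd_value[OF CF[OF bC] t']]) (rule sym)
      qed (use cobd_ext in \<open>simp add: Suc\<close>)
      then show ?thesis unfolding Suc coboundaries.simps by (rule image_eqI[OF _ bC])
    qed
  qed
  show ?thesis
  proof (rule finite_dim_quotient[OF Z_vs H_vs cls_hom _ psi _ span])
    fix f assume f: "f \<in> carrier (Zr p)" and p0: "\<psi> f = 0"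
    then have fB: "f \<in> B p" using ker by simp
    have "cls p (f \<oplus>\<^bsub>C p\<^esub> \<zero>\<^bsub>C p\<^esub>) = cls p \<zero>\<^bsub>C p\<^esub>"
      by (rule cls_facts(4)[OF vs_facts(4)[OF C_vs] vs_facts(4)[OF C_vs] fB])
    then show "cls p f = \<zero>\<^bsub>H p\<^esub>"
      using vs_group_facts(7)[OF C_vs, of f p] ZC[of f] f cls_zero by simp
  qed (simp_all add: H_carrier)
qed

theorem theorem1p7:
  fixes G :: "('g, 'm) monoid_scheme"
    and V :: "nat \<Rightarrow> (rat, 'v) module"
    and \<rho> :: "nat \<Rightarrow> (nat \<Rightarrow> nat) \<Rightarrow> 'v \<Rightarrow> 'v"
    and \<phi> :: "nat \<Rightarrow> 'v \<Rightarrow> 'v"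
    and \<gamma> :: "nat \<Rightarrow> 'g \<Rightarrow> 'v \<Rightarrow> 'v"
    and N p :: nat
  assumes "group G"
    and "type_FP_infinity G"
    and "consistent_sequence V \<rho> \<phi>"
    and "\<forall>n\<ge>1. finite_dim (V n)"
    and "compatible_action G V \<rho> \<phi> \<gamma>"
    and "monotone_sequence N V \<rho> \<phi>"
    and "uniformly_stable N V \<rho> \<phi>"
  shows "monotone_sequence N
           (\<lambda>n. cohomology G (V n) (\<gamma> n) p)
           (\<lambda>n s. cohomology_map G (V n) (\<gamma> n) p (\<rho> n s))
           (\<lambda>n. cohomology_map G (V (Suc n)) (\<gamma> (Suc n)) p (\<phi> n)) \<and>
         uniformly_stable N
           (\<lambda>n. cohomology G (V n) (\<gamma> n) p)
           (\<lambda>n s. cohomology_map G (V n) (\<gamma> n) p (\<rho> n s))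
           (\<lambda>n. cohomology_map G (V (Suc n)) (\<gamma> (Suc n)) p (\<phi> n))"
proof -
  interpret S: coh_sequence V \<rho> \<phi> G \<gamma> p
    by (intro coh_sequence.intro rep_sequence.intro coh_sequence_axioms.intro assms)
  obtain k e D where fc: "frag_complex G k e D" using frag_complex_exists[OF assms(1,2)] by blast
  \<comment> \<open>Finite dimensionality comes first because \<open>good_stable_monotone\<close>
    works in coordinates of the cohomology spaces.\<close>
  have fd: "\<forall>n\<ge>1. finite_dim (S.HV n)" using finite_dim_cohomology[OF S.coh fc] by blast
  interpret H: rep_sequence S.HV S.hr S.hp by (rule rep_sequence.intro[OF S.HV_consistent fd])
  have "good_sequence N S.HV S.hr S.hp"
    by (rule S.HV_good[OF S.stable_monotone_good[OF assms(6,7)]])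
  from H.good_stable_monotone[OF this] show ?thesis by blast
qed

end
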